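(* Let $\eta=+1$ for the $+$ families and $\eta=-1$ for the $-$ families (with $n$ in the range where $DC_i^{\pm}(n,q)$ is defined), write $A_i=A_i^{\pm}(n,q)$, $B_i=B_i^{\pm}(n,q)$, $N_i=A_iB_i$, and let $C_{i,j}$ be the number of codewords of Hamming weight $j$ in $C(DC_i^{\pm}(n,q))$. In each formula below the sum runs over all families of nonnegative integers $\{\nu_\beta\}_{\beta\in\mathbb F_q},\{\mu_\beta\}_{\beta\in\mathbb F_q}$ with $\sum_\beta\nu_\beta+\sum_\beta\mu_\beta=j$ and $\sum_\beta\nu_\beta\beta=\sum_\beta\mu_\beta\beta$ in $\mathbb F_q$. Then for $0\le j\le N_i$: (1) for $i=1,3$: $$C_{i,j}=\sum\binom{q^{-1}A_i(B_i+\eta)}{\nu_1,\mu_1}\binom{q^{-1}A_i(B_i+\eta)}{\nu_{-1},\mu_{-1}}\prod_{\beta:\ \beta^2-1\ne0\text{ square}}\binom{q^{-1}A_i(B_i+\eta(q+1))}{\nu_\beta,\mu_\beta}\prod_{\beta:\ \beta^2-1\text{ nonsquare}}\binom{q^{-1}A_i(B_i+\eta(1-q))}{\nu_\beta,\mu_\beta};$$ (2) $C_{2,j}=\sum\prod_{\beta\in\mathbb F_q}\binom{q^{-1}A_2(B_2+\eta((q-1)^2-q\delta(2,q;\beta)))}{\nu_\beta,\mu_\beta}$; (3) $C_{4,j}=\sum\binom{q^{-1}A_4(B_4-\eta(q\delta(2,q;0)+(q-1)^3))}{\nu_0,\mu_0}\prod_{\beta\ne0}\binom{q^{-1}A_4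(B_4-\eta(q\delta(2,q;\beta)-2q^2+3q-1))}{\nu_\beta,\mu_\beta}$.
   Context: $q=3^s$. For nonnegative integers $a,b,c$: $\binom{c}{a,b}=\frac{c!}{a!\,b!\,(c-a-b)!}$ if $a+b\le c$ and $0$ otherwise. $\delta(2,q;\beta)=|\{(\alpha_1,\alpha_2)\in(\mathbb F_q^* )^2:\alpha_1+\alpha_1^{-1}+\alpha_2+\alpha_2^{-1}=\beta\}|$. Fix a nonsquare $\epsilon\in\mathbb F_q^*$, $\delta_\epsilon=\mathrm{diag}(1,-\epsilon)$, $J=\begin{bmatrix}0&1_{n-1}&0\\1_{n-1}&0&0\\0&0&\delta_\epsilon\end{bmatrix}$, $O^-(2n,q)=\{w\in GL(2n,q):{}^twJw=J\}$, $SO^-$ its determinant-one subgroup. $Q=Q(2n,q)$: products $\begin{bmatrix}A&0&0\\0&{}^tA^{-1}&0\\0&0&i\end{bmatrix}\begin{bmatrix}1_{n-1}&B&-{}^th\delta_\epsilon\\0&1_{n-1}&0\\0&h&1_2\end{bmatrix}$, $A\in GL(n-1,q)$, $i\in SO^-(2,q)$, ${}^tB+B+{}^th\delta_\epsilon h=0$. $\rho=\mathrm{diag}(1_{n-1},1_{n-1},1,-1)$, $\sigma_r=\begin{bmatrix}0&0&1_r&0&0\\0&1_{n-1-r}&0&0&0\\1_r&0&0&0&0\\0&0&0&1_{n-1-r}&0\\0&0&0&0&1_2\end{bmatrix}$. $DC_1^+=Q\sigma_{n-1}Q$, $DC_2^+=Q\sigma_{n-2}Q$, $DC_3^+=\rho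 Q\sigma_{n-2}Q$ ($n\ge2$ even), $DC_4^+=\rho Q\sigma_{n-3}Q$ ($n\ge4$ even), $DC_1^-=Q\sigma_{n-1}Q$ ($n\ge1$ odd), $DC_2^-=Q\sigma_{n-2}Q$, $DC_3^-=\rho Q\sigma_{n-2}Q$, $DC_4^-=\rho Q\sigma_{n-3}Q$ ($n\ge3$ odd). For $D=DC_i^{\pm}(n,q)$, $N=|D|$, ordering $g_1,\dots,g_N$: $C(D)=\{u\in\mathbb F_3^N:\sum_ju_j\mathrm{Tr}(g_j)=0\text{ in }\mathbb F_q\}$. Constants (empty products $=1$, $\left[{m\atop r}\right]_q=\prod_{j=0}^{r-1}\frac{q^{m-j}-1}{q^{r-j}-1}$): $A_1^+=q^{(5n^2-2n-4)/4}(q^{n-1}-1)\prod_{j=1}^{(n-2)/2}(q^{2j-1}-1)$, $B_1^+=(q+1)q^{n^2/4}\prod_{j=1}^{(n-2)/2}(q^{2j}-1)$; $A_2^+=q^{(5n^2-2n-8)/4}\left[{n-1\atop1}\right]_q\prod_{j=1}^{(n-2)/2}(q^{2j-1}-1)$, $B_2^+=(q+1)q^{(n-2)^2/4}(q^{n-1}-1)\prod_{j=1}^{(n-2)/2}(q^{2j}-1)$; $A_3^+=(q+1)A_2^+$, $B_3^+=q^{(n-2)^2/4}(q^{n-1}-1)\prod_{j=1}^{(n-2)/2}(q^{2j}-1)$; $A_4^+=(q+1)q^{(5n^2-6n-4)/4}\left[{n-1\atop2}\right]_q\prod_{j=1}^{(n-2)/2}(q^{2j-1}-1)$, $B_4^+=B_3^+$;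 $A_1^-=q^{5(n^2-1)/4}\prod_{j=1}^{(n-1)/2}(q^{2j-1}-1)$, $B_1^-=(q+1)q^{(n-1)^2/4}\prod_{j=1}^{(n-1)/2}(q^{2j}-1)$; $A_2^-=q^{(5n^2-4n-5)/4}\left[{n-1\atop1}\right]_q\prod_{j=1}^{(n-1)/2}(q^{2j-1}-1)$, $B_2^-=B_1^-$; $A_3^-=(q+1)A_2^-$, $B_3^-=q^{(n-1)^2/4}\prod_{j=1}^{(n-1)/2}(q^{2j}-1)$; $A_4^-=(q+1)q^{(5n^2-4n-9)/4}\left[{n-1\atop2}\right]_q\prod_{j=1}^{(n-3)/2}(q^{2j-1}-1)$, $B_4^-=q^{(n-3)^2/4}(q^{n-2}-1)(q^{n-1}-1)\prod_{j=1}^{(n-3)/2}(q^{2j}-1)$. *)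

theory Defs
  imports "Jordan_Normal_Form.Matrix" "Jordan_Normal_Form.Determinant" "HOL-Library.Cardinality"
begin

definition mat_tr :: "'a::comm_ring_1 mat \<Rightarrow> 'a" where
  "mat_tr A = (\<Sum>i<dim_row A. A $$ (i,i))"

(* block index for the block decomposition (n-1) + (n-1) + 2 with m = n-1 *)
definition blk_dim :: "nat \<Rightarrow> nat \<Rightarrow> nat" where
  "blk_dim m a = (if a < 2 then m else 2)"

definition blk_idx :: "nat \<Rightarrow> nat \<Rightarrow> nat \<times> nat" where
  "blk_idx m i = (if i < m then (0, i) else if i < 2*m then (1, i - m) else (2, i - 2*m))"

definition block3 :: "nat \<Rightarrow> (nat \<Rightarrow> nat \<Rightarrow> 'a mat) \<Rightarrow> 'a mat" where
  "block3 m F = mat (2*m+2) (2*m+2)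
     (\<lambda>(i,j). case blk_idx m i of (a,i') \<Rightarrow> case blk_idx m j of (b,j') \<Rightarrow> F a b $$ (i',j'))"

definition delta_eps :: "'a::field \<Rightarrow> 'a mat" where
  "delta_eps e = mat 2 2 (\<lambda>(i,j). if i = j then (if i = 0 then 1 else - e) else 0)"

definition Jmat :: "nat \<Rightarrow> 'a::field \<Rightarrow> 'a mat" where
  "Jmat n e = block3 (n-1) (\<lambda>a b.
      if (a,b) = (0,1) \<or> (a,b) = (1,0) then 1\<^sub>m (n-1)
      else if (a,b) = (2,2) then delta_eps e
      else 0\<^sub>m (blk_dim (n-1) a) (blk_dim (n-1) b))"

definition GL :: "nat \<Rightarrow> 'a::field mat set" where
  "GL m = {A \<in> carrier_mat m m. invertible_mat A}"

definition Ominus :: "nat \<Rightarrow> 'a::field \<Rightarrow> 'a mat set" where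
  "Ominus n e = {w \<in> GL (2*n). transpose_mat w * Jmat n e * w = Jmat n e}"

definition SOminus :: "nat \<Rightarrow> 'a::field \<Rightarrow> 'a mat set" where
  "SOminus n e = {w \<in> Ominus n e. det w = 1}"

definition Qpar :: "nat \<Rightarrow> 'a::field \<Rightarrow> 'a mat set" where
  "Qpar n e = {block3 (n-1) (\<lambda>a b.
                  if (a,b) = (0,0) then A
                  else if (a,b) = (1,1) then transpose_mat A'
                  else if (a,b) = (2,2) then i
                  else 0\<^sub>m (blk_dim (n-1) a) (blk_dim (n-1) b))
             * block3 (n-1) (\<lambda>a b.
                  if a = b then 1\<^sub>m (blk_dim (n-1) a)
                  else if (a,b) = (0,1) then B
                  else if (a,b) = (0,2) then - (transpose_mat h * delta_eps e)
                  else if (a,b) = (2,1) then h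
                  else 0\<^sub>m (blk_dim (n-1) a) (blk_dim (n-1) b))
        | A A' i B h.
            A \<in> GL (n-1) \<and> A' \<in> carrier_mat (n-1) (n-1) \<and>
            A * A' = 1\<^sub>m (n-1) \<and> A' * A = 1\<^sub>m (n-1) \<and>
            i \<in> SOminus 1 e \<and>
            B \<in> carrier_mat (n-1) (n-1) \<and> h \<in> carrier_mat 2 (n-1) \<and>
            transpose_mat B + B + transpose_mat h * delta_eps e * h = 0\<^sub>m (n-1) (n-1)}"

definition rho_mat :: "nat \<Rightarrow> 'a::field mat" where
  "rho_mat n = mat (2*n) (2*n) (\<lambda>(i,j). if i = j then (if i = 2*n - 1 then -1 else 1) else 0)"

definition sigma_perm :: "nat \<Rightarrow> nat \<Rightarrow> nat \<Rightarrow> nat" where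
  "sigma_perm n r i = (if i < r then i + (n-1) else if n-1 \<le> i \<and> i < n-1+r then i - (n-1) else i)"

definition sigma_mat :: "nat \<Rightarrow> nat \<Rightarrow> 'a::field mat" where
  "sigma_mat n r = mat (2*n) (2*n) (\<lambda>(i,j). if j = sigma_perm n r i then 1 else 0)"

definition dcoset :: "'a::field mat set \<Rightarrow> 'a mat \<Rightarrow> 'a mat set" where
  "dcoset Q s = {q1 * s * q2 | q1 q2. q1 \<in> Q \<and> q2 \<in> Q}"

(* pm = True: the + families (n even); pm = False: the - families (n odd) *)
definition DC :: "bool \<Rightarrow> nat \<Rightarrow> nat \<Rightarrow> 'a::field \<Rightarrow> 'a mat set" where
  "DC pm i n e =
     (if i = 1 then dcoset (Qpar n e) (sigma_mat n (n-1))
      else if i = 2 then dcoset (Qpar n e) (sigma_mat n (n-2))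
      else if i = 3 then (\<lambda>g. rho_mat n * g) ` dcoset (Qpar n e) (sigma_mat n (n-2))
      else (\<lambda>g. rho_mat n * g) ` dcoset (Qpar n e) (sigma_mat n (n-3)))"

definition DC_valid :: "bool \<Rightarrow> nat \<Rightarrow> nat \<Rightarrow> bool" where
  "DC_valid pm i n = (i \<in> {1,2,3,4} \<and>
     (if pm then even n \<and> n \<ge> (if i = 4 then 4 else 2)
      else odd n \<and> n \<ge> (if i = 1 then 1 else 3)))"

(* F_3 is the prime subfield of F_q (characteristic 3) *)
definition prime_subfield :: "'a::field set" where
  "prime_subfield = range of_int"

(* codewords indexed by the elements of D (any ordering g_1..g_N gives the same weights) *)
definition trace_code :: "'a::field mat set \<Rightarrow> ('a mat \<Rightarrow> 'a) set" where
  "trace_code D = {u. (\<forall>g\<in>D. u g \<in> prime_subfield) \<and> (\<forall>g. g \<notin> D \<longrightarrow> u g = 0)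
                      \<and> (\<Sum>g\<in>D. u g * mat_tr g) = 0}"

definition hweight :: "'a::field mat set \<Rightarrow> ('a mat \<Rightarrow> 'a) \<Rightarrow> nat" where
  "hweight D u = card {g \<in> D. u g \<noteq> 0}"

definition weight_count :: "'a::field mat set \<Rightarrow> nat \<Rightarrow> nat" where
  "weight_count D j = card {u \<in> trace_code D. hweight D u = j}"

(* binom{c}{a,b}; for a nonnegative integer c this equals c!/(a! b! (c-a-b)!) if a+b <= c, else 0 *)
definition multinom :: "rat \<Rightarrow> nat \<Rightarrow> nat \<Rightarrow> rat" where
  "multinom c a b = (c gchoose a) * ((c - of_nat a) gchoose b)"

definition delta2 :: "'a::{field,finite} \<Rightarrow> nat" where
  "delta2 \<beta> = card {(a1,a2). a1 \<noteq> 0 \<and> a2 \<noteq> 0 \<and> a1 + inverse a1 + a2 + inverse a2 = \<beta>}"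

definition is_sq :: "'a::field \<Rightarrow> bool" where
  "is_sq x = (\<exists>y. x = y * y)"

definition fams :: "nat \<Rightarrow> (('a::{field,finite} \<Rightarrow> nat) \<times> ('a \<Rightarrow> nat)) set" where
  "fams j = {(\<nu>,\<mu>). (\<Sum>\<beta>\<in>UNIV. \<nu> \<beta>) + (\<Sum>\<beta>\<in>UNIV. \<mu> \<beta>) = j
                    \<and> (\<Sum>\<beta>\<in>UNIV. of_nat (\<nu> \<beta>) * \<beta>) = (\<Sum>\<beta>\<in>UNIV. of_nat (\<mu> \<beta>) * \<beta>)}"

definition qbin :: "nat \<Rightarrow> nat \<Rightarrow> rat \<Rightarrow> rat" where
  "qbin m r q = (\<Prod>j<r. (q^(m-j) - 1) / (q^(r-j) - 1))"

definition Aconst :: "bool \<Rightarrow> nat \<Rightarrow> nat \<Rightarrow> rat \<Rightarrow> rat" where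
  "Aconst pm i n q =
    (if pm then
       (if i = 1 then q^((5*n^2 - 2*n - 4) div 4) * (q^(n-1) - 1) * (\<Prod>j\<in>{1..(n-2) div 2}. q^(2*j-1) - 1)
        else if i = 2 then q^((5*n^2 - 2*n - 8) div 4) * qbin (n-1) 1 q * (\<Prod>j\<in>{1..(n-2) div 2}. q^(2*j-1) - 1)
        else if i = 3 then (q+1) * (q^((5*n^2 - 2*n - 8) div 4) * qbin (n-1) 1 q * (\<Prod>j\<in>{1..(n-2) div 2}. q^(2*j-1) - 1))
        else (q+1) * q^((5*n^2 - 6*n - 4) div 4) * qbin (n-1) 2 q * (\<Prod>j\<in>{1..(n-2) div 2}. q^(2*j-1) - 1))
     else
       (if i = 1 then q^((5*(n^2 - 1)) div 4) * (\<Prod>j\<in>{1..(n-1) div 2}. q^(2*j-1) - 1)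
        else if i = 2 then q^((5*n^2 - 4*n - 5) div 4) * qbin (n-1) 1 q * (\<Prod>j\<in>{1..(n-1) div 2}. q^(2*j-1) - 1)
        else if i = 3 then (q+1) * (q^((5*n^2 - 4*n - 5) div 4) * qbin (n-1) 1 q * (\<Prod>j\<in>{1..(n-1) div 2}. q^(2*j-1) - 1))
        else (q+1) * q^((5*n^2 - 4*n - 9) div 4) * qbin (n-1) 2 q * (\<Prod>j\<in>{1..(n-3) div 2}. q^(2*j-1) - 1)))"

definition Bconst :: "bool \<Rightarrow> nat \<Rightarrow> nat \<Rightarrow> rat \<Rightarrow> rat" where
  "Bconst pm i n q =
    (if pm then
       (if i = 1 then (q+1) * q^(n^2 div 4) * (\<Prod>j\<in>{1..(n-2) div 2}. q^(2*j) - 1)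
        else if i = 2 then (q+1) * q^((n-2)^2 div 4) * (q^(n-1) - 1) * (\<Prod>j\<in>{1..(n-2) div 2}. q^(2*j) - 1)
        else q^((n-2)^2 div 4) * (q^(n-1) - 1) * (\<Prod>j\<in>{1..(n-2) div 2}. q^(2*j) - 1))
     else
       (if i = 1 \<or> i = 2 then (q+1) * q^((n-1)^2 div 4) * (\<Prod>j\<in>{1..(n-1) div 2}. q^(2*j) - 1)
        else if i = 3 then q^((n-1)^2 div 4) * (\<Prod>j\<in>{1..(n-1) div 2}. q^(2*j) - 1)
        else q^((n-3)^2 div 4) * (q^(n-2) - 1) * (q^(n-1) - 1) * (\<Prod>j\<in>{1..(n-3) div 2}. q^(2*j) - 1)))"

end

theory Submission
  imports Defs
begin

text \<open>
  A codeword of weight \<open>j\<close> is determined by its sets of entries \<open>1\<close> and \<open>-1\<close>; recording how many elements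
  of each trace fibre they contain expresses the weight distribution through the fibre cardinalities
  \<open>N \<beta> = |{g \<in> D. Tr g = \<beta>}|\<close>, so everything reduces to computing \<open>N \<beta>\<close>.

  For \<open>f\<close> of mean zero, cyclicity of the trace turns the sum of \<open>f (Tr g)\<close> over \<open>Q \<sigma>\<^sub>r Q\<close> into a multiple of
  the sum over \<open>Q \<sigma>\<^sub>r\<close>. There the alternating part of \<open>B\<close> enters linearly through the upper left
  \<open>r \<times> n - 1\<close> corner of \<open>A\<close>, so only block lower triangular \<open>A\<close> with symmetric \<open>r \<times> r\<close> block survive.
  Summing over \<open>h\<close> then gives \<open>r\<close> copies of the anisotropic norm form, that is \<open>(- q)\<^sup>r\<close>, times the number of invertible
  symmetric matrices; what remains is a sum over \<open>GL(t)\<close> with \<open>t \<le> 2\<close> and over \<open>SO\<^sup>-(2)\<close>, which are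
  Kloosterman sums. The substitution \<open>\<alpha> \<mapsto> \<alpha> + 1 / \<alpha>\<close> counts their fibres through the square roots of
  \<open>\<beta>\<^sup>2 - 4 = \<beta>\<^sup>2 - 1\<close>, and the fibres of \<open>SO\<^sup>-(2)\<close> are complementary to these.\<close>

section \<open>Quadratic and Kloosterman-type sums over finite fields\<close>

text \<open>Only rational counts are wanted, so rational functions of mean zero replace complex
  characters. The condition \<open>transpose_mat B + B + gram e h = 0\<close> would tie B to h;
  since -1/2 = 1 in characteristic 3, writing B = \<open>gram e h\<close> + S with S alternating
  makes A, the rotation, h and S independent coordinates on Q. The sum over h has to follow the one
  over S: only after S has made the corner of A symmetric do the two rows of h see a Hermitian form
  over the quadratic extension. The signs arise as follows. Each of the r anisotropic planes gives
  -q, and the family together with the parity of n fixes the parity of r = n - 1 - t, so + and -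
  differ only by \<eta>. The reflection \<rho> changes the trace of a rotation from 2 a to a - a =
  0; hence for i = 3, 4 the rotation group contributes merely its order q + 1, for i = 1, 2 a
  Kloosterman sum with negative sign. The size of the double coset comes from the same identity
  applied to the constant function 1; the given constants are then recognised by comparing powers of
  q.\<close>

lemma three_eq_0:
  assumes "CARD('a::{field,finite}) = 3 ^ s"
  shows "(3::'a) = 0"
proof -
  \<comment> \<open>Translation by 1 permutes the field, so the \<open>CARD('a)\<close> extra
    summands 1 must add up to 0.\<close>
  have "(\<Sum>x\<in>UNIV. x + 1) = (\<Sum>x\<in>UNIV. x::'a)"
    by (rule sum.reindex_bij_betw) (auto intro!: bij_betwI[where g = "\<lambda>x. x - 1"])
  then have "of_nat CARD('a) = (0::'a)" by (simp add: sum.distrib)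
  then have "(3::'a) ^ s = 0" using assms by simp
  then show ?thesis by simp
qed

lemma two_neq_0:
  assumes three: "(3::'a::field) = 0"
  shows "(2::'a) \<noteq> 0"
proof
  assume "(2::'a) = 0"
  moreover have "(3::'a) = 2 + 1" by simp
  ultimately show False using three by simp
qed

text \<open>
  Functions of mean zero take the part of the nontrivial additive characters: a sum of \<open>f\<close> over values
  that are equidistributed in the field vanishes, and the indicator of a point becomes such a function
  after subtracting \<open>1 / q\<close>.\<close>

definition mean_zero :: "('a::finite \<Rightarrow> rat) \<Rightarrow> bool" where
  "mean_zero f \<longleftrightarrow> (\<Sum>x\<in>UNIV. f x) = 0"

lemma sum_affine:
  fixes f :: "'a::{field,finite} \<Rightarrow> rat"
  assumes "a \<noteq> 0"
  shows "(\<Sum>x\<in>UNIV. f (c + a * x)) = (\<Sum>x\<in>UNIV. f x)"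
  by (rule sum.reindex_bij_betw)
     (use assms in \<open>auto intro!: bij_betwI[where g = "\<lambda>x. (x - c) / a"]\<close>)

lemma mean_zero_affine:
  fixes f :: "'a::{field,finite} \<Rightarrow> rat"
  assumes "mean_zero f" "a \<noteq> 0"
  shows "mean_zero (\<lambda>x. f (c + a * x))"
  using assms by (simp add: mean_zero_def sum_affine)

lemma sum_fibres:
  fixes h :: "'b \<Rightarrow> 'a::finite" and g :: "'a \<Rightarrow> rat"
  assumes "finite X"
  shows "(\<Sum>y\<in>X. g (h y)) = (\<Sum>u\<in>UNIV. of_nat (card {y\<in>X. h y = u}) * g u)"
proof -
  have "(\<Sum>y\<in>X. g (h y)) = (\<Sum>u\<in>UNIV. \<Sum>y\<in>{y\<in>X. h y = u}. g (h y))"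
    by (rule sum.group[symmetric]) (use assms in auto)
  also have "\<dots> = (\<Sum>u\<in>UNIV. of_nat (card {y\<in>X. h y = u}) * g u)"
    by (intro sum.cong) auto
  finally show ?thesis .
qed

lemma card_sq_roots:
  fixes u :: "'a::{field,finite}"
  assumes two: "(2::'a) \<noteq> 0"
  shows "card {y. y * y = u} = (if u = 0 then 1 else if is_sq u then 2 else 0)"
proof -
  consider "u = 0" | "u \<noteq> 0" "is_sq u" | "u \<noteq> 0" "\<not> is_sq u" by auto
  then show ?thesis
  proof cases
    case 1
    then have "{y. y * y = u} = {0}" by auto
    with 1 show ?thesis by simp
  next
    case 2
    then obtain z where z: "u = z * z" by (auto simp: is_sq_def)
    have "{y. y * y = u} = {z, - z}"
      using z by (auto simp: square_eq_iff)
    moreover have "z \<noteq> - z"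
    proof
      assume "z = - z"
      then have "2 * z = 0" by (metis add.right_inverse mult_2)
      with two z 2 show False by auto
    qed
    ultimately show ?thesis using 2 by simp
  next
    case 3
    then have "{y. y * y = u} = {}" by (auto simp: is_sq_def)
    then show ?thesis using 3 by simp
  qed
qed

text \<open>Squaring is two-to-one on nonzero elements, so squares and nonsquares are equally many
  there; multiplication by e maps the former injectively into the latter, hence onto them.\<close>

lemma nonsquare_times:
  fixes e u :: "'a::{field,finite}"
  assumes two: "(2::'a) \<noteq> 0" and e: "\<not> is_sq e" and u: "\<not> is_sq u"
  shows "\<exists>y. u = e * (y * y)"
proof -
  have e0: "e \<noteq> 0" using e by (auto simp: is_sq_def)
  define S where "S = {x::'a. x \<noteq> 0 \<and> is_sq x}"
  define T where "T = {x::'a. \<not> is_sq x}"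
  have un: "S \<union> T = UNIV - {0}" "S \<inter> T = {}" by (auto simp: S_def T_def is_sq_def)
  have "card (UNIV - {0::'a}) = (\<Sum>u\<in>UNIV - {0}. card {y\<in>UNIV - {0::'a}. y * y = u})"
    using sum.group[of "UNIV - {0::'a}" "UNIV - {0::'a}" "\<lambda>y. y * y" "\<lambda>_. 1::nat"]
    by (simp add: image_subset_iff)
  also have "\<dots> = (\<Sum>u\<in>UNIV - {0::'a}. if u \<in> S then 2 else 0)"
  proof (rule sum.cong[OF refl])
    fix u :: 'a assume u: "u \<in> UNIV - {0}"
    then have "{y\<in>UNIV - {0::'a}. y * y = u} = {y. y * y = u}" by auto
    then show "card {y\<in>UNIV - {0::'a}. y * y = u} = (if u \<in> S then 2 else 0)"
      using u by (simp add: card_sq_roots[OF two] S_def)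
  qed
  also have "\<dots> = 2 * card S"
  proof -
    have "(UNIV - {0}) \<inter> S = S" using un by auto
    then show ?thesis by (subst sum.If_cases) auto
  qed
  finally have c1: "card (UNIV - {0::'a}) = 2 * card S" .
  moreover have "card (UNIV - {0::'a}) = card S + card T"
    unfolding un(1)[symmetric] by (rule card_Un_disjoint) (use un in auto)
  ultimately have cT: "card T = card S" by simp
  have sub: "(\<lambda>x. e * x) ` S \<subseteq> T"
  proof
    fix v assume "v \<in> (\<lambda>x. e * x) ` S"
    then obtain z where z: "z \<noteq> 0" "v = e * (z * z)" by (auto simp: S_def is_sq_def)
    show "v \<in> T"
    proof (rule ccontr)
      assume "v \<notin> T"
      then obtain w where "v = w * w" by (auto simp: T_def is_sq_def)
      with z have "e = (w * w) / (z * z)" by (simp add: field_simps)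
      then have "e = (w / z) * (w / z)" by simp
      with e show False unfolding is_sq_def by blast
    qed
  qed
  have "card ((\<lambda>x. e * x) ` S) = card S"
    by (rule card_image) (use e0 in \<open>auto simp: inj_on_def\<close>)
  with cT sub have "(\<lambda>x. e * x) ` S = T" by (intro card_subset_eq) auto
  then show ?thesis using u by (force simp: T_def S_def is_sq_def)
qed

text \<open>For u nonzero exactly one of u and u / e is a square, giving 2 + 0 or 0 + 2 solutions;
  for u = 0 each equation has one. This constancy makes the fibres of the rotation trace
  complementary to the Kloosterman fibres.\<close>

lemma card_sq_roots_twist:
  fixes e u :: "'a::{field,finite}"
  assumes two: "(2::'a) \<noteq> 0" and e: "\<not> is_sq e"
  shows "card {y. y * y = u} + card {y. e * (y * y) = u} = 2"
proof -
  have e0: "e \<noteq> 0" using e by (auto simp: is_sq_def)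
  have eq: "{y. e * (y * y) = u} = {y. y * y = u / e}" using e0 by (auto simp: field_simps)
  have "u \<noteq> 0 \<Longrightarrow> is_sq (u / e) \<longleftrightarrow> \<not> is_sq u"
  proof -
    assume u: "u \<noteq> 0"
    show ?thesis
    proof
      assume "is_sq (u / e)"
      then obtain y where y: "u = e * (y * y)" using e0 by (auto simp: is_sq_def field_simps)
      show "\<not> is_sq u"
      proof
        assume "is_sq u"
        then obtain z where "u = z * z" by (auto simp: is_sq_def)
        with y u have "e = (z * z) / (y * y)" by (auto simp: divide_simps)
        then have "e = (z / y) * (z / y)" by simp
        with e show False unfolding is_sq_def by blast
      qed
    next
      assume "\<not> is_sq u"
      from nonsquare_times[OF two e this] obtain y where "u = e * (y * y)" by auto
      then show "is_sq (u / e)" using e0 by (auto simp: is_sq_def)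
    qed
  qed
  then show ?thesis unfolding eq card_sq_roots[OF two] using e0 by auto
qed

text \<open>Together y^2 and e y^2 take every value exactly twice, so the two sums add up to twice
  the sum of g, which is 0.\<close>

lemma sum_nonsquare_twist:
  fixes g :: "'a::{field,finite} \<Rightarrow> rat"
  assumes two: "(2::'a) \<noteq> 0" and e: "\<not> is_sq e" and g: "mean_zero g"
  shows "(\<Sum>y\<in>UNIV. g (e * (y * y))) = - (\<Sum>y\<in>UNIV. g (y * y))"
proof -
  have "(\<Sum>y\<in>UNIV. g (y * y)) + (\<Sum>y\<in>UNIV. g (e * (y * y)))
      = (\<Sum>u\<in>UNIV. of_nat (card {y. y * y = u} + card {y. e * (y * y) = u}) * g u)"
    by (simp add: sum_fibres[where g = g] sum.distrib[symmetric] algebra_simps)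
  also have "\<dots> = (\<Sum>u\<in>UNIV. 2 * g u)"
    by (simp only: card_sq_roots_twist[OF two e]) simp
  also have "\<dots> = 0" using g by (simp add: mean_zero_def sum_distrib_left[symmetric])
  finally show ?thesis by simp
qed

text \<open>Source of the factor -q: twisting the y-sum replaces the anisotropic form by minus the
  sum for the split form x^2 - y^2, and that sum is q times the value at the centre.\<close>

lemma sum_norm_form:
  fixes f :: "'a::{field,finite} \<Rightarrow> rat"
  assumes two: "(2::'a) \<noteq> 0" and e: "\<not> is_sq e" and f: "mean_zero f" and a: "a \<noteq> 0"
  shows "(\<Sum>x\<in>UNIV. \<Sum>y\<in>UNIV. f (c + a * (x * x - e * (y * y)))) = - of_nat CARD('a) * f c"
proof -
  have "(\<Sum>x\<in>UNIV. \<Sum>y\<in>UNIV. f (c + a * (x * x - e * (y * y))))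
      = (\<Sum>x\<in>UNIV. - (\<Sum>y\<in>UNIV. f (c + a * (x * x - y * y))))"
  proof (rule sum.cong[OF refl])
    fix x
    have "mean_zero (\<lambda>u. f ((c + a * (x * x)) + (- a) * u))"
      by (rule mean_zero_affine[OF f]) (use a in simp)
    from sum_nonsquare_twist[OF two e this]
    show "(\<Sum>y\<in>UNIV. f (c + a * (x * x - e * (y * y)))) = - (\<Sum>y\<in>UNIV. f (c + a * (x * x - y * y)))"
      by (simp add: algebra_simps)
  qed
  also have "\<dots> = - (\<Sum>y\<in>UNIV. \<Sum>x\<in>UNIV. f (c + a * (x * x - y * y)))"
    by (subst sum.swap) (simp add: sum_negf)
  \<comment> \<open>With x = y + u the square of y cancels, and for fixed u the argument is affine
    in y with slope 2 a u; only u = 0 escapes equidistribution.\<close>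
  also have "(\<Sum>y\<in>UNIV. \<Sum>x\<in>UNIV. f (c + a * (x * x - y * y)))
      = (\<Sum>y\<in>UNIV. \<Sum>u\<in>UNIV. f (c + a * ((y + u) * (y + u) - y * y)))"
    by (intro sum.cong refl sum.reindex_bij_betw[symmetric])
       (auto intro!: bij_betwI[where g = "\<lambda>x. x - _"])
  also have "\<dots> = (\<Sum>u\<in>UNIV. \<Sum>y\<in>UNIV. f ((c + a * (u * u)) + (2 * a * u) * y))"
    by (subst sum.swap) (simp add: algebra_simps mult_2)
  also have "\<dots> = (\<Sum>u\<in>(UNIV :: 'a set). if u = 0 then of_nat CARD('a) * f c else 0)"
  proof (rule sum.cong[OF refl])
    fix u :: 'a
    show "(\<Sum>y\<in>UNIV. f ((c + a * (u * u)) + (2 * a * u) * y))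
        = (if u = 0 then of_nat CARD('a) * f c else 0)"
      using f a two sum_affine[of "2 * a * u" f "c + a * (u * u)"]
      by (cases "u = 0") (auto simp: mean_zero_def)
  qed
  also have "\<dots> = of_nat CARD('a) * f c" by simp
  finally show ?thesis by simp
qed

text \<open>Elements a + b sqrt e of norm 1 in the quadratic extension; through \<open>rot\<close>
  they are coordinates on the rotation group of minus type.\<close>

definition norm_one :: "'a::{field,finite} \<Rightarrow> ('a \<times> 'a) set" where
  "norm_one e = {(a, b). a * a - e * (b * b) = 1}"

text \<open>\<open>sum_norm_form\<close> at c = 0, a = 1 with the centred indicator of 1: the right
  side is 1 because 0 differs from 1, while the correction 1 / q over q^2 pairs subtracts q from the
  count.\<close>

lemma card_norm_one:
  fixes e :: "'a::{field,finite}"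
  assumes two: "(2::'a) \<noteq> 0" and e: "\<not> is_sq e"
  shows "card (norm_one e) = CARD('a) + 1"
proof -
  define q where "q = (of_nat CARD('a) :: rat)"
  have q: "q > 0" by (simp add: q_def)
  define f where "f = (\<lambda>x::'a. (if x = 1 then 1 else 0) - 1 / q)"
  have f: "mean_zero f"
    using q by (simp add: mean_zero_def f_def sum_subtractf q_def)
  have "(\<Sum>x\<in>UNIV. \<Sum>y\<in>UNIV. f (0 + 1 * (x * x - e * (y * y)))) = - q * f 0"
    unfolding q_def by (rule sum_norm_form[OF two e f]) simp
  moreover have "(\<Sum>x\<in>UNIV. \<Sum>y\<in>UNIV. f (0 + 1 * (x * x - e * (y * y))))
      = of_nat (card (norm_one e)) - q"
  proof -
    have "(\<Sum>x\<in>UNIV. \<Sum>y\<in>UNIV. f (0 + 1 * (x * x - e * (y * y))))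
      = (\<Sum>z\<in>UNIV. (if z \<in> norm_one e then 1 else 0) - 1 / q)"
      by (simp add: sum.cartesian_product f_def norm_one_def case_prod_beta)
    also have "\<dots> = of_nat (card (norm_one e)) - of_nat CARD('a \<times> 'a) / q"
      by (simp add: sum_subtractf sum.If_cases)
    also have "of_nat CARD('a \<times> 'a) / q = q"
      using q by (simp add: q_def UNIV_Times_UNIV[symmetric] card_cartesian_product del: UNIV_Times_UNIV)
    finally show ?thesis .
  qed
  ultimately have "of_nat (card (norm_one e)) = q + 1"
    using q by (simp add: f_def)
  then have "(of_nat (card (norm_one e)) :: rat) = of_nat (CARD('a) + 1)" by (simp add: q_def)
  then show ?thesis by (simp only: of_nat_eq_iff)
qed

text \<open>Completing the square: the equation is \<alpha>^2 - t \<alpha> + 1 = 0, and -t = 2 t in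
  characteristic 3, so the shift by t needs no division. The constant term excludes \<alpha> = 0
  automatically.\<close>

lemma card_kloosterman_fibre:
  fixes t :: "'a::{field,finite}"
  assumes three: "(3::'a) = 0"
  shows "card {\<alpha>\<in>UNIV - {0}. \<alpha> + inverse \<alpha> = t} = card {y. y * y = t * t - 1}"
proof -
  have eq: "\<alpha> \<noteq> 0 \<and> \<alpha> + inverse \<alpha> = t \<longleftrightarrow> (\<alpha> + t) * (\<alpha> + t) = t * t - 1" for \<alpha> :: 'a
  proof -
    have "(\<alpha> + t) * (\<alpha> + t) - (t * t - 1) = \<alpha> * \<alpha> - \<alpha> * t + 1 + 3 * (\<alpha> * t)"
      by (simp add: algebra_simps)
    also have "\<dots> = \<alpha> * \<alpha> - \<alpha> * t + 1" using three by simp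
    finally have *: "(\<alpha> + t) * (\<alpha> + t) = t * t - 1 \<longleftrightarrow> \<alpha> * \<alpha> - \<alpha> * t + 1 = 0"
      by (metis eq_iff_diff_eq_0)
    show ?thesis unfolding *
    proof (cases "\<alpha> = 0")
      case False
      then have "\<alpha> + inverse \<alpha> = t \<longleftrightarrow> \<alpha> * (\<alpha> + inverse \<alpha>) = \<alpha> * t" by simp
      also have "\<dots> \<longleftrightarrow> \<alpha> * \<alpha> + 1 = \<alpha> * t" using False by (simp add: algebra_simps)
      finally show "\<alpha> \<noteq> 0 \<and> \<alpha> + inverse \<alpha> = t \<longleftrightarrow> \<alpha> * \<alpha> - \<alpha> * t + 1 = 0"
        using False by (auto simp: algebra_simps)
    qed simp
  qed
  show ?thesis
    by (rule bij_betw_same_card[where f = "\<lambda>\<alpha>. \<alpha> + t"], rule bij_betwI[where g = "\<lambda>y. y - t"])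
       (use eq in auto)
qed

text \<open>For given a the number of admissible b is 2 minus the number of square roots of a^2 - 1,
  that is, 2 minus the size of a Kloosterman fibre; the constant 2 drops out by mean zero.\<close>

lemma sum_norm_one:
  fixes f :: "'a::{field,finite} \<Rightarrow> rat"
  assumes three: "(3::'a) = 0" and e: "\<not> is_sq e" and f: "mean_zero f"
  shows "(\<Sum>(a, b)\<in>norm_one e. f (c + 2 * a))
       = - (\<Sum>\<alpha>\<in>UNIV - {0}. f (c + (\<alpha> + inverse \<alpha>)))"
proof -
  have m2: "(2::'a) = - 1"
    using three by (metis add_eq_0_iff one_plus_numeral semiring_norm(4) add.commute numeral_One one_add_one numeral_plus_one semiring_norm(5))
  then have two: "(2::'a) \<noteq> 0" by (metis neg_equal_0_iff_equal zero_neq_one)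
  \<comment> \<open>2 = -1 turns the rotation trace 2 a into -a.\<close>
  have "(\<Sum>(a, b)\<in>norm_one e. f (c + 2 * a))
      = (\<Sum>(a, b)\<in>Sigma UNIV (\<lambda>a. {b. e * (b * b) = a * a - 1}). f (c - a))"
    by (rule sum.cong) (auto simp: norm_one_def m2 algebra_simps)
  also have "\<dots> = (\<Sum>a\<in>UNIV. of_nat (card {b. e * (b * b) = a * a - 1}) * f (c - a))"
    by (subst sum.Sigma[symmetric]) auto
  also have "\<dots> = (\<Sum>a\<in>UNIV. (2 - of_nat (card {y. y * y = a * a - 1})) * f (c - a))"
  proof (rule sum.cong[OF refl])
    fix a :: 'a
    have "(of_nat (card {b. e * (b * b) = a * a - 1}) :: rat) = 2 - of_nat (card {y. y * y = a * a - 1})"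
      using card_sq_roots_twist[OF two e, of "a * a - 1"]
      by (simp add: eq_diff_eq flip: of_nat_add)
    then show "of_nat (card {b. e * (b * b) = a * a - 1}) * f (c - a)
        = (2 - of_nat (card {y. y * y = a * a - 1})) * f (c - a)" by simp
  qed
  also have "\<dots> = 2 * (\<Sum>a\<in>UNIV. f (c + (- 1) * a)) - (\<Sum>a\<in>UNIV. of_nat (card {y. y * y = a * a - 1}) * f (c - a))"
    by (simp add: left_diff_distrib sum_subtractf sum_distrib_left)
  also have "(\<Sum>a\<in>UNIV. f (c + (- 1) * a)) = 0"
    using f by (subst sum_affine) (auto simp: mean_zero_def)
  \<comment> \<open>The number of roots is even as a function of a, so the sign of a can be
    reversed.\<close>
  also have "(\<Sum>a\<in>UNIV. of_nat (card {y. y * y = a * a - 1}) * f (c - a))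
      = (\<Sum>t\<in>UNIV. of_nat (card {y. y * y = t * t - 1}) * f (c + t))"
    by (rule sum.reindex_bij_witness[where i = uminus and j = uminus]) auto
  also have "\<dots> = (\<Sum>\<alpha>\<in>UNIV - {0}. f (c + (\<alpha> + inverse \<alpha>)))"
    by (simp only: sum_fibres[where g = "\<lambda>u. f (c + u)" and X = "UNIV - {0}", OF finite]
        card_kloosterman_fibre[OF three])
  finally show ?thesis by simp
qed

section \<open>Ternary codewords with prescribed weight\<close>

text \<open>For a > N the difference is negative on the left and truncated on the right, but the
  first binomial is then 0 on both sides.\<close>

lemma multinom_of_nat:
  "multinom (of_nat N) a b = of_nat ((N choose a) * ((N - a) choose b))"
proof (cases "a \<le> N")
  case True
  then show ?thesis
    by (simp add: multinom_def binomial_gbinomial flip: of_nat_diff)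
next
  case False
  then show ?thesis
    by (simp add: multinom_def binomial_eq_0 flip: binomial_gbinomial)
qed

lemma card_disjoint_pairs:
  fixes D :: "'b set"
  assumes "finite D"
  shows "card {(P, M). P \<subseteq> D \<and> M \<subseteq> D \<and> P \<inter> M = {} \<and> card P = a \<and> card M = b}
       = (card D choose a) * ((card D - a) choose b)"
proof -
  have "{(P, M). P \<subseteq> D \<and> M \<subseteq> D \<and> P \<inter> M = {} \<and> card P = a \<and> card M = b}
      = Sigma {P. P \<subseteq> D \<and> card P = a} (\<lambda>P. {M. M \<subseteq> D - P \<and> card M = b})"
    by auto
  also have "card \<dots> = (\<Sum>P\<in>{P. P \<subseteq> D \<and> card P = a}. card {M. M \<subseteq> D - P \<and> card M = b})"
    using assms by (intro card_SigmaI) auto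
  also have "\<dots> = (\<Sum>P\<in>{P. P \<subseteq> D \<and> card P = a}. (card D - a) choose b)"
  proof (rule sum.cong[OF refl])
    fix P assume "P \<in> {P. P \<subseteq> D \<and> card P = a}"
    then have "card (D - P) = card D - a" using assms by (auto simp: card_Diff_subset finite_subset)
    then show "card {M. M \<subseteq> D - P \<and> card M = b} = (card D - a) choose b"
      using assms by (subst n_subsets) auto
  qed
  also have "\<dots> = (card D choose a) * ((card D - a) choose b)"
    using assms by (simp add: n_subsets)
  finally show ?thesis .
qed

definition fibre :: "'b set \<Rightarrow> ('b \<Rightarrow> 'a) \<Rightarrow> 'a \<Rightarrow> 'b set" where
  "fibre D t \<beta> = {g \<in> D. t g = \<beta>}"

definition signed_pairs :: "'b set \<Rightarrow> ('b set \<times> 'b set) set" where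
  "signed_pairs D = {(P, M). P \<subseteq> D \<and> M \<subseteq> D \<and> P \<inter> M = {}}"

text \<open>The fibres of t partition D, so cutting P and M along them is reversible and
  disjointness can be tested fibre by fibre. The pieces are chosen independently, whence the
  product.\<close>

lemma card_signed_pairs_profile:
  fixes D :: "'b set" and t :: "'b \<Rightarrow> 'a::finite"
  assumes "finite D"
  shows "card {(P, M) \<in> signed_pairs D. (\<forall>\<beta>. card (fibre P t \<beta>) = \<nu> \<beta>) \<and> (\<forall>\<beta>. card (fibre M t \<beta>) = \<mu> \<beta>)}
       = (\<Prod>\<beta>\<in>UNIV. (card (fibre D t \<beta>) choose \<nu> \<beta>) * ((card (fibre D t \<beta>) - \<nu> \<beta>) choose \<mu> \<beta>))"
    (is "card ?L = _")
proof -
  define R where "R = (\<lambda>\<beta>. {(P, M). P \<subseteq> fibre D t \<beta> \<and> M \<subseteq> fibre D t \<beta> \<and> P \<inter> M = {}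
      \<and> card P = \<nu> \<beta> \<and> card M = \<mu> \<beta>})"
  have "bij_betw (\<lambda>(P, M) \<beta>. (fibre P t \<beta>, fibre M t \<beta>)) ?L (Pi\<^sub>E UNIV R)"
  proof (rule bij_betwI[where g = "\<lambda>F. (\<Union>\<beta>. fst (F \<beta>), \<Union>\<beta>. snd (F \<beta>))"])
    show "(\<lambda>(P, M) \<beta>. (fibre P t \<beta>, fibre M t \<beta>)) \<in> ?L \<rightarrow> Pi\<^sub>E UNIV R"
      by (auto simp: R_def fibre_def signed_pairs_def)
    have un: "fibre (\<Union>\<beta>. G \<beta>) t \<beta> = G \<beta>" if "\<And>\<beta>. G \<beta> \<subseteq> fibre D t \<beta>" for G \<beta>
      using that unfolding fibre_def by blast
    have R: "fst (F \<beta>) \<subseteq> fibre D t \<beta>" "snd (F \<beta>) \<subseteq> fibre D t \<beta>" "fst (F \<beta>) \<inter> snd (F \<beta>) = {}"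
        "card (fst (F \<beta>)) = \<nu> \<beta>" "card (snd (F \<beta>)) = \<mu> \<beta>"
      if "F \<in> Pi\<^sub>E UNIV R" for F \<beta>
      using that PiE_mem[OF that, of \<beta>] by (auto simp: R_def case_prod_beta)
    show "(\<lambda>F. (\<Union>\<beta>. fst (F \<beta>), \<Union>\<beta>. snd (F \<beta>))) \<in> Pi\<^sub>E UNIV R \<rightarrow> ?L"
    proof
      fix F assume F: "F \<in> Pi\<^sub>E UNIV R"
      have sub: "(\<Union>\<beta>. fst (F \<beta>)) \<subseteq> D" "(\<Union>\<beta>. snd (F \<beta>)) \<subseteq> D"
        using R(1,2)[OF F] unfolding fibre_def by blast+
      have "(\<Union>\<beta>. fst (F \<beta>)) \<inter> (\<Union>\<beta>. snd (F \<beta>)) = {}"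
      proof -
        \<comment> \<open>A common element x would force both fibres to be the one over t x, where
          the two pieces are disjoint.\<close>
        have False if "x \<in> fst (F \<beta>)" "x \<in> snd (F \<gamma>)" for x \<beta> \<gamma>
        proof -
          have "t x = \<beta>" "t x = \<gamma>" using R(1,2)[OF F] that unfolding fibre_def by blast+
          then show False using R(3)[OF F, of \<beta>] that by blast
        qed
        then show ?thesis by blast
      qed
      then show "((\<Union>\<beta>. fst (F \<beta>)), (\<Union>\<beta>. snd (F \<beta>))) \<in> ?L"
        using sub R(4,5)[OF F]
        by (simp add: un[OF R(1)[OF F]] un[OF R(2)[OF F]] signed_pairs_def)
    qed
    show "(\<lambda>F. (\<Union>\<beta>. fst (F \<beta>), \<Union>\<beta>. snd (F \<beta>))) ((\<lambda>(P, M) \<beta>. (fibre P t \<beta>, fibre M t \<beta>)) x) = x"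
      if "x \<in> ?L" for x by (auto simp: fibre_def case_prod_beta prod_eq_iff)
    show "(\<lambda>(P, M) \<beta>. (fibre P t \<beta>, fibre M t \<beta>)) ((\<lambda>F. (\<Union>\<beta>. fst (F \<beta>), \<Union>\<beta>. snd (F \<beta>))) F) = F"
      if F: "F \<in> Pi\<^sub>E UNIV R" for F
      by (simp add: un[OF R(1)[OF F]] un[OF R(2)[OF F]])
  qed
  then have "card ?L = (\<Prod>\<beta>\<in>UNIV. card (R \<beta>))"
    by (simp add: bij_betw_same_card card_PiE)
  also have "\<dots> = (\<Prod>\<beta>\<in>UNIV. (card (fibre D t \<beta>) choose \<nu> \<beta>) * ((card (fibre D t \<beta>) - \<nu> \<beta>) choose \<mu> \<beta>))"
    unfolding R_def using assms by (intro prod.cong refl card_disjoint_pairs) (simp add: fibre_def)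
  finally show ?thesis .
qed

lemma prime_subfield_char_3:
  assumes three: "(3::'a::field) = 0"
  shows "(prime_subfield :: 'a set) = {0, 1, - 1}"
proof
  have m2: "(2::'a) = - 1" using three by (simp add: eq_neg_iff_add_eq_0)
  show "(prime_subfield :: 'a set) \<subseteq> {0, 1, - 1}"
  proof
    fix x :: 'a assume "x \<in> prime_subfield"
    then obtain k where k: "x = of_int k" by (auto simp: prime_subfield_def)
    have "of_int k = (of_int (3 * (k div 3) + k mod 3) :: 'a)" by simp
    also have "\<dots> = of_int (k mod 3)" using three by (simp only: of_int_add of_int_mult of_int_numeral) simp
    finally have "x = of_int (k mod 3)" using k by simp
    moreover have "k mod 3 \<in> {0, 1, 2}" by auto
    ultimately show "x \<in> {0, 1, - 1}" using m2 by auto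
  qed
  show "{0, 1, - 1} \<subseteq> (prime_subfield :: 'a set)"
    unfolding prime_subfield_def
    by (auto intro: image_eqI[of _ _ 0] image_eqI[of _ _ 1] image_eqI[of _ _ "- 1"])
qed

text \<open>Keeps the outer sum genuine: over an infinite index set it would be 0 by convention.
  Each value of a family is bounded by j.\<close>

lemma finite_fams: "finite (fams j :: (('a::{field,finite} \<Rightarrow> nat) \<times> ('a \<Rightarrow> nat)) set)"
proof -
  have *: "g \<beta> \<le> j" if "(\<Sum>\<beta>\<in>UNIV. g \<beta>) \<le> j" for g :: "'a \<Rightarrow> nat" and \<beta>
    using that member_le_sum[of \<beta> UNIV g] by auto
  have "fams j \<subseteq> ((UNIV :: 'a set) \<rightarrow>\<^sub>E {..j}) \<times> ((UNIV :: 'a set) \<rightarrow>\<^sub>E {..j})"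
  proof
    fix x :: "('a \<Rightarrow> nat) \<times> ('a \<Rightarrow> nat)" assume "x \<in> fams j"
    then have "(\<Sum>\<beta>\<in>UNIV. fst x \<beta>) \<le> j" "(\<Sum>\<beta>\<in>UNIV. snd x \<beta>) \<le> j"
      by (auto simp: fams_def)
    then have "fst x \<beta> \<le> j" "snd x \<beta> \<le> j" for \<beta> by (auto intro: *)
    then show "x \<in> ((UNIV :: 'a set) \<rightarrow>\<^sub>E {..j}) \<times> ((UNIV :: 'a set) \<rightarrow>\<^sub>E {..j})"
      by (simp add: mem_Times_iff PiE_UNIV_domain)
  qed
  then show ?thesis by (rule finite_subset) (auto intro!: finite_PiE)
qed

text \<open>Weight and check equation depend only on how many elements of each trace fibre lie in
  the supports P of 1 and M of -1. The admissible count functions are exactly \<open>fams j\<close>,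
  and \<open>card_signed_pairs_profile\<close> tells how often each is realised.\<close>

lemma weight_count_eq:
  fixes D :: "'a::{field,finite} mat set"
  assumes three: "(3::'a) = 0" and D: "finite D"
  shows "(of_nat (weight_count D j) :: rat)
       = (\<Sum>(\<nu>,\<mu>)\<in>fams j. \<Prod>\<beta>\<in>UNIV. multinom (of_nat (card {g\<in>D. mat_tr g = \<beta>})) (\<nu> \<beta>) (\<mu> \<beta>))"
proof -
  have m2: "(2::'a) = - 1" using three by (simp add: eq_neg_iff_add_eq_0)
  \<comment> \<open>Otherwise the supports of 1 and -1 would coincide and the decoding below would
    fail.\<close>
  have ne: "(1::'a) \<noteq> - 1"
  proof
    assume "(1::'a) = - 1"
    then have "(1::'a) = 2" using m2 by simp
    then have "(2::'a) - 1 = 0" by simp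
    then show False by simp
  qed
  define W where "W = {u \<in> trace_code D. hweight D u = j}"
  define Z where "Z = {(P, M) \<in> signed_pairs D. card P + card M = j \<and> sum mat_tr P = sum mat_tr M}"
  define dec where "dec = (\<lambda>(P, M) (g :: 'a mat). if g \<in> P then 1 else if g \<in> M then - 1 else (0::'a))"
  have decsum: "(\<Sum>g\<in>D. dec (P, M) g * mat_tr g) = sum mat_tr P - sum mat_tr M"
    if "(P, M) \<in> signed_pairs D" for P M
  proof -
    have PM: "P \<subseteq> D" "M \<subseteq> D" "P \<inter> M = {}" using that by (auto simp: signed_pairs_def)
    have "(\<Sum>g\<in>D. dec (P, M) g * mat_tr g)
        = (\<Sum>g\<in>D. (if g \<in> P then mat_tr g else 0) - (if g \<in> M then mat_tr g else 0))"
      using PM by (intro sum.cong refl) (auto simp: dec_def)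
    also have "\<dots> = sum mat_tr P - sum mat_tr M"
      using D PM by (simp add: sum_subtractf sum.inter_restrict[symmetric] Int_absorb1)
    finally show ?thesis .
  qed
  have decwt: "{g \<in> D. dec (P, M) g \<noteq> 0} = P \<union> M" if "(P, M) \<in> signed_pairs D" for P M
    using that by (auto simp: signed_pairs_def dec_def)
  have "bij_betw dec Z W"
  proof (rule bij_betwI[where g = "\<lambda>u. ({g\<in>D. u g = 1}, {g\<in>D. u g = - 1})"])
    show "dec \<in> Z \<rightarrow> W"
    proof
      fix x assume x: "x \<in> Z"
      obtain P M where [simp]: "x = (P, M)" by (cases x)
      have PM: "(P, M) \<in> signed_pairs D" "card P + card M = j" "sum mat_tr P = sum mat_tr M"
        using x by (auto simp: Z_def)
      have "card (P \<union> M) = card P + card M"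
        using PM(1) D by (intro card_Un_disjoint) (auto simp: signed_pairs_def finite_subset)
      then have "hweight D (dec x) = j"
        using PM(2) decwt[OF PM(1)] by (simp add: hweight_def)
      moreover have "dec x \<in> trace_code D"
        using decsum[OF PM(1)] PM(1,3)
        by (auto simp: trace_code_def prime_subfield_char_3[OF three] dec_def signed_pairs_def)
      ultimately show "dec x \<in> W" by (simp add: W_def)
    qed
    have WD: "dec ({g\<in>D. u g = 1}, {g\<in>D. u g = - 1}) = u" if "u \<in> W" for u
    proof
      fix g
      show "dec ({g\<in>D. u g = 1}, {g\<in>D. u g = - 1}) g = u g"
        using that by (cases "g \<in> D")
          (auto simp: W_def trace_code_def prime_subfield_char_3[OF three] dec_def)
    qed
    show "(\<lambda>u. ({g\<in>D. u g = 1}, {g\<in>D. u g = - 1})) \<in> W \<rightarrow> Z"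
    proof
      fix u assume u: "u \<in> W"
      have s: "({g\<in>D. u g = 1}, {g\<in>D. u g = - 1}) \<in> signed_pairs D"
        using ne by (auto simp: signed_pairs_def)
      have "sum mat_tr {g\<in>D. u g = 1} = sum mat_tr {g\<in>D. u g = - 1}"
        using decsum[OF s] u unfolding WD[OF u] by (simp add: W_def trace_code_def)
      moreover have "card {g\<in>D. u g = 1} + card {g\<in>D. u g = - 1} = j"
      proof -
        have "card {g\<in>D. u g = 1} + card {g\<in>D. u g = - 1} = card ({g\<in>D. u g = 1} \<union> {g\<in>D. u g = - 1})"
          using s D by (intro card_Un_disjoint[symmetric]) (auto simp: signed_pairs_def)
        also have "\<dots> = hweight D u" using decwt[OF s] unfolding WD[OF u] by (simp add: hweight_def)
        finally show ?thesis using u by (simp add: W_def)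
      qed
      ultimately show "({g\<in>D. u g = 1}, {g\<in>D. u g = - 1}) \<in> Z" using s by (simp add: Z_def)
    qed
    show "({g\<in>D. dec x g = 1}, {g\<in>D. dec x g = - 1}) = x" if x: "x \<in> Z" for x
    proof -
      obtain P M where [simp]: "x = (P, M)" by (cases x)
      show ?thesis using x ne ne[symmetric] by (auto simp: Z_def signed_pairs_def dec_def split: if_splits)
    qed
    show "dec ({g\<in>D. u g = 1}, {g\<in>D. u g = - 1}) = u" if "u \<in> W" for u by (rule WD[OF that])
  qed
  then have "card W = card Z" by (metis bij_betw_same_card)
  define prof where "prof = (\<lambda>(P, M). (\<lambda>\<beta>::'a. card (fibre P mat_tr \<beta>), \<lambda>\<beta>::'a. card (fibre M mat_tr \<beta>)))"
  have cs: "card P = (\<Sum>\<beta>\<in>UNIV. card (fibre P mat_tr \<beta>))" if "P \<subseteq> D" for P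
    using sum.group[of P "UNIV :: 'a set" mat_tr "\<lambda>_. 1::nat"] finite_subset[OF that D]
    by (simp add: fibre_def)
  have ts: "sum mat_tr P = (\<Sum>\<beta>\<in>UNIV. of_nat (card (fibre P mat_tr \<beta>)) * \<beta>)" if "P \<subseteq> D" for P
  proof -
    have "sum mat_tr P = (\<Sum>\<beta>\<in>UNIV. \<Sum>g\<in>{g\<in>P. mat_tr g = \<beta>}. mat_tr g)"
      using finite_subset[OF that D] by (intro sum.group[symmetric]) auto
    also have "\<dots> = (\<Sum>\<beta>\<in>UNIV. of_nat (card (fibre P mat_tr \<beta>)) * \<beta>)"
      by (intro sum.cong refl) (simp add: fibre_def)
    finally show ?thesis .
  qed
  \<comment> \<open>Both conditions defining Z are read off the profile: the weight through
    \<open>cs\<close>, the trace equation through \<open>ts\<close>.\<close>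
  have Zeq: "x \<in> Z \<longleftrightarrow> x \<in> signed_pairs D \<and> prof x \<in> fams j" for x
  proof (cases x)
    case (Pair P M)
    show ?thesis
    proof (cases "x \<in> signed_pairs D")
      case True
      then have "P \<subseteq> D" "M \<subseteq> D" using Pair by (auto simp: signed_pairs_def)
      then show ?thesis using True
        by (simp add: Z_def Pair prof_def fams_def cs[of P] cs[of M] ts[of P] ts[of M])
    qed (simp add: Z_def Pair)
  qed
  have fsp: "finite (signed_pairs D)"
    by (rule finite_subset[of _ "Pow D \<times> Pow D"]) (use D in \<open>auto simp: signed_pairs_def\<close>)
  then have fZ: "finite Z" by (rule rev_finite_subset) (auto simp: Zeq)
  have "card Z = (\<Sum>y\<in>fams j. card {x\<in>Z. prof x = y})"
    using sum.group[of Z "fams j" prof "\<lambda>_. 1::nat"] fZ by (simp add: Zeq image_subset_iff finite_fams)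
  also have "\<dots> = (\<Sum>(\<nu>,\<mu>)\<in>fams j. \<Prod>\<beta>\<in>UNIV. (card (fibre D mat_tr \<beta>) choose \<nu> \<beta>)
      * ((card (fibre D mat_tr \<beta>) - \<nu> \<beta>) choose \<mu> \<beta>))"
  proof (rule sum.cong[OF refl])
    fix y :: "('a \<Rightarrow> nat) \<times> ('a \<Rightarrow> nat)" assume y: "y \<in> fams j"
    obtain \<nu> \<mu> where [simp]: "y = (\<nu>, \<mu>)" by (cases y)
    have "{x\<in>Z. prof x = y} = {(P, M) \<in> signed_pairs D.
        (\<forall>\<beta>. card (fibre P mat_tr \<beta>) = \<nu> \<beta>) \<and> (\<forall>\<beta>. card (fibre M mat_tr \<beta>) = \<mu> \<beta>)}"
      using y by (auto simp: Zeq prof_def)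
    then show "card {x\<in>Z. prof x = y} = (case y of (\<nu>, \<mu>) \<Rightarrow> \<Prod>\<beta>\<in>UNIV. (card (fibre D mat_tr \<beta>) choose \<nu> \<beta>)
      * ((card (fibre D mat_tr \<beta>) - \<nu> \<beta>) choose \<mu> \<beta>))"
      by (simp add: card_signed_pairs_profile[OF D])
  qed
  finally have "card Z = \<dots>" .
  moreover have "weight_count D j = card Z"
    using \<open>card W = card Z\<close> by (simp add: weight_count_def W_def)
  ultimately show ?thesis
    by (simp add: multinom_of_nat fibre_def case_prod_beta)
qed

section \<open>Invertible matrices\<close>

declare One_nat_def [simp del] plus_1_eq_Suc [simp]

lemma bij_betw_mat:
  "bij_betw (\<lambda>A. restrict (\<lambda>ij. A $$ ij) ({..<nr} \<times> {..<nc}))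
     (carrier_mat nr nc) (({..<nr} \<times> {..<nc}) \<rightarrow>\<^sub>E (UNIV :: 'a set))"
proof (rule bij_betwI[where g = "mat nr nc"])
  show "mat nr nc (restrict (\<lambda>ij. A $$ ij) ({..<nr} \<times> {..<nc})) = A" if "A \<in> carrier_mat nr nc" for A :: "'a mat"
    using that by (intro eq_matI) auto
  show "restrict (\<lambda>ij. mat nr nc x $$ ij) ({..<nr} \<times> {..<nc}) = x"
    if "x \<in> ({..<nr} \<times> {..<nc}) \<rightarrow>\<^sub>E (UNIV :: 'a set)" for x
    using that by (intro ext) (fastforce simp: restrict_def PiE_def extensional_def)
qed auto

lemma finite_carrier_mat [simp]: "finite (carrier_mat nr nc :: 'a::finite mat set)"
  using bij_betw_finite[OF bij_betw_mat[of nr nc, where 'a = 'a]]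
  by (simp add: finite_PiE)

lemma card_carrier_mat: "card (carrier_mat nr nc :: 'a::finite mat set) = CARD('a) ^ (nr * nc)"
  using bij_betw_same_card[OF bij_betw_mat[of nr nc, where 'a = 'a]]
  by (simp add: card_PiE card_cartesian_product)

lemma bij_betw_four_block:
  "bij_betw (\<lambda>(A, B, C, D). four_block_mat A B C D)
     (carrier_mat r1 c1 \<times> carrier_mat r1 c2 \<times> carrier_mat r2 c1 \<times> carrier_mat r2 c2)
     (carrier_mat (r1 + r2) (c1 + c2))"
proof (rule bij_betwI[where g = "\<lambda>M. split_block M r1 c1"])
  show "(\<lambda>M. split_block M r1 c1) \<in> carrier_mat (r1 + r2) (c1 + c2)
      \<rightarrow> carrier_mat r1 c1 \<times> carrier_mat r1 c2 \<times> carrier_mat r2 c1 \<times> carrier_mat r2 c2"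
    by (auto simp: split_block_def Let_def)
  show "(\<lambda>(A, B, C, D). four_block_mat A B C D) (split_block M r1 c1) = M"
    if "M \<in> carrier_mat (r1 + r2) (c1 + c2)" for M
    using that by (intro eq_matI) (auto simp: split_block_def Let_def)
  show "split_block ((\<lambda>(A, B, C, D). four_block_mat A B C D) x) r1 c1 = x"
    if "x \<in> carrier_mat r1 c1 \<times> carrier_mat r1 c2 \<times> carrier_mat r2 c1 \<times> carrier_mat r2 c2" for x
    using that by (auto simp: split_block_def Let_def intro!: eq_matI)
qed auto

lemma four_block_cases:
  assumes "M \<in> carrier_mat (r1 + r2) (c1 + c2)"
  obtains A B C D where "A \<in> carrier_mat r1 c1" "B \<in> carrier_mat r1 c2"
    "C \<in> carrier_mat r2 c1" "D \<in> carrier_mat r2 c2" "M = four_block_mat A B C D"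
proof -
  obtain A B C D where "split_block M r1 c1 = (A, B, C, D)" by (metis prod_cases4)
  from split_block[OF this, of r2 c2] assms that show ?thesis by auto
qed

lemma four_block_eq_iff:
  assumes "A \<in> carrier_mat r1 c1" "B \<in> carrier_mat r1 c2" "C \<in> carrier_mat r2 c1" "D \<in> carrier_mat r2 c2"
    and "A' \<in> carrier_mat r1 c1" "B' \<in> carrier_mat r1 c2" "C' \<in> carrier_mat r2 c1" "D' \<in> carrier_mat r2 c2"
  shows "four_block_mat A B C D = four_block_mat A' B' C' D' \<longleftrightarrow> A = A' \<and> B = B' \<and> C = C' \<and> D = D'"
  using bij_betw_imp_inj_on[OF bij_betw_four_block[of r1 c1 c2 r2]] assms
  by (auto simp: inj_on_def)

definition mat_sc :: "'a \<Rightarrow> 'a mat" where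
  "mat_sc a = mat 1 1 (\<lambda>_. a)"

lemma mat_sc_carrier [simp]: "mat_sc a \<in> carrier_mat 1 1"
  and mat_sc_index [simp]: "mat_sc a $$ (0, 0) = a"
  and mat_sc_dims [simp]: "dim_row (mat_sc a) = 1" "dim_col (mat_sc a) = 1"
  by (auto simp: mat_sc_def)

lemma carrier_mat_1_1E: assumes "A \<in> carrier_mat 1 1" shows "A = mat_sc (A $$ (0, 0))"
  using assms by (intro eq_matI) auto

lemma det_mat_sc [simp]: "det (mat_sc a) = a"
  by (simp add: det_single[OF mat_sc_carrier])

text \<open>Determinant form of \<open>GL\<close>, convenient because block triangular matrices are
  tested on their diagonal blocks; \<open>GL_eq_GLd\<close> identifies the two.\<close>

definition GLd :: "nat \<Rightarrow> 'a::field mat set" where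
  "GLd k = {A \<in> carrier_mat k k. det A \<noteq> 0}"

text \<open>A total choice function, meaningful on \<open>GLd\<close>, where
  \<open>minv_unique\<close> pins it down.\<close>

definition minv :: "'a::field mat \<Rightarrow> 'a mat" where
  "minv A = (SOME B. B \<in> carrier_mat (dim_row A) (dim_row A)
      \<and> A * B = 1\<^sub>m (dim_row A) \<and> B * A = 1\<^sub>m (dim_row A))"

lemma GLd_carrier: "A \<in> GLd k \<Longrightarrow> A \<in> carrier_mat k k"
  by (simp add: GLd_def)

lemma finite_GLd [simp]: "finite (GLd k :: 'a::{field,finite} mat set)"
  by (simp add: GLd_def)

lemma minv:
  assumes "A \<in> GLd k"
  shows "minv A \<in> carrier_mat k k" "A * minv A = 1\<^sub>m k" "minv A * A = 1\<^sub>m k"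
proof -
  have A: "A \<in> carrier_mat k k" "det A \<noteq> 0" using assms by (auto simp: GLd_def)
  then have "A \<in> Units (ring_mat TYPE('a) k ())" by (rule det_non_zero_imp_unit)
  then obtain B where "B \<in> carrier_mat k k" "A * B = 1\<^sub>m k" "B * A = 1\<^sub>m k"
    by (auto simp: Units_def ring_mat_simps)
  then have "\<exists>B. B \<in> carrier_mat (dim_row A) (dim_row A)
      \<and> A * B = 1\<^sub>m (dim_row A) \<and> B * A = 1\<^sub>m (dim_row A)"
    using A by auto
  from someI_ex[OF this] A
  show "minv A \<in> carrier_mat k k" "A * minv A = 1\<^sub>m k" "minv A * A = 1\<^sub>m k"
    by (auto simp: minv_def)
qed

lemma GLdI:
  assumes "A \<in> carrier_mat k k" "B \<in> carrier_mat k k" "A * B = 1\<^sub>m k"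
  shows "A \<in> GLd k"
proof -
  have "det A * det B = 1" using det_mult[OF assms(1,2)] assms(3) by simp
  then show ?thesis using assms by (auto simp: GLd_def)
qed

lemma minv_unique:
  assumes "A \<in> carrier_mat k k" "B \<in> carrier_mat k k" "A * B = 1\<^sub>m k"
  shows "minv A = B"
proof -
  have A: "A \<in> GLd k" by (rule GLdI[OF assms])
  have "minv A = minv A * (A * B)" using assms minv[OF A] by simp
  also have "\<dots> = minv A * A * B" using assms minv(1)[OF A] by simp
  also have "\<dots> = B" using assms minv[OF A] by simp
  finally show ?thesis .
qed

lemma minv_GLd: assumes "A \<in> GLd k" shows "minv A \<in> GLd k"
  using minv[OF assms] GLd_carrier[OF assms] by (auto intro: GLdI)

lemma GLd_mult: "A \<in> GLd k \<Longrightarrow> B \<in> GLd k \<Longrightarrow> A * B \<in> GLd k"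
  by (auto simp: GLd_def det_mult)

lemma GLd_transpose: "A \<in> GLd k \<Longrightarrow> transpose_mat A \<in> GLd k"
  by (auto simp: GLd_def det_transpose)

lemma GLd_left_cancel:
  assumes "A \<in> GLd k" "B \<in> carrier_mat k c"
  shows "minv A * (A * B) = B" "A * (minv A * B) = B"
  using assms minv[OF assms(1)] GLd_carrier[OF assms(1)]
  by (simp_all flip: assoc_mult_mat[of _ k k _ k _ c])

lemma GLd_right_cancel:
  assumes "A \<in> GLd k" "B \<in> carrier_mat c k"
  shows "(B * A) * minv A = B" "(B * minv A) * A = B"
  using assms minv[OF assms(1)] GLd_carrier[OF assms(1)] by simp_all

lemma bij_betw_GLd_left:
  assumes "A \<in> GLd k"
  shows "bij_betw ((*) A) (carrier_mat k c) (carrier_mat k c)"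
  by (rule bij_betwI[where g = "(*) (minv A)"])
     (use minv(1)[OF assms] GLd_carrier[OF assms] GLd_left_cancel[OF assms] in auto)

definition col_e1 :: "nat \<Rightarrow> 'a::field mat" where
  "col_e1 k = mat k 1 (\<lambda>(i, j). if i = 0 then 1 else 0)"

lemma col_e1_carrier [simp]: "col_e1 k \<in> carrier_mat k 1"
  and dim_col_e1 [simp]: "dim_row (col_e1 k) = k" "dim_col (col_e1 k) = 1"
  by (simp_all add: col_e1_def)

lemma mult_col_e1:
  assumes "A \<in> carrier_mat r (Suc k)"
  shows "A * col_e1 (Suc k) = mat r 1 (\<lambda>(i, j). A $$ (i, 0))"
proof (rule eq_matI)
  fix i j assume ij: "i < dim_row (mat r 1 (\<lambda>(i, j). A $$ (i, 0)))" "j < dim_col (mat r 1 (\<lambda>(i, j). A $$ (i, 0)))"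
  then show "(A * col_e1 (Suc k)) $$ (i, j) = mat r 1 (\<lambda>(i, j). A $$ (i, 0)) $$ (i, j)"
    using assms by (simp add: scalar_prod_def col_e1_def if_distrib[of "\<lambda>x. _ * x"] sum.If_cases Int_def cong: if_cong)
qed (use assms in auto)

text \<open>Transitivity on nonzero columns. A column with nonzero first entry is completed by the
  identity; otherwise adding a row with a nonzero entry to the first row reduces to that
  case.\<close>

lemma ex_GLd_col:
  fixes v :: "'a::field mat"
  assumes v: "v \<in> carrier_mat (Suc k) 1" "v \<noteq> 0\<^sub>m (Suc k) 1"
  shows "\<exists>P\<in>GLd (Suc k). P * col_e1 (Suc k) = v"
proof -
  have first: "\<exists>P\<in>GLd (Suc k). P * col_e1 (Suc k) = v"
    if v: "v \<in> carrier_mat (Suc k) 1" "v $$ (0, 0) \<noteq> 0" for v :: "'a mat"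
  proof -
    define P where "P = four_block_mat (mat_sc (v $$ (0, 0))) (0\<^sub>m 1 k) (mat k 1 (\<lambda>(i, j). v $$ (Suc i, 0))) (1\<^sub>m k)"
    have P: "P \<in> carrier_mat (Suc k) (Suc k)" by (auto simp: P_def)
    have "det P = v $$ (0, 0)"
      unfolding P_def by (subst det_four_block_mat_upper_right_zero[where n = 1 and m = k]) auto
    then have "P \<in> GLd (Suc k)" using P v by (simp add: GLd_def)
    moreover have "P * col_e1 (Suc k) = v"
      unfolding mult_col_e1[OF P] using v by (intro eq_matI) (auto simp: P_def)
    ultimately show ?thesis by blast
  qed
  show ?thesis
  proof (cases "v $$ (0, 0) = 0")
    case False
    with first v show ?thesis by blast
  next
    case True
    obtain i where i: "i < Suc k" "v $$ (i, 0) \<noteq> 0"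
    proof (rule ccontr)
      assume "\<not> thesis"
      then have "\<And>i. i < Suc k \<Longrightarrow> v $$ (i, 0) = 0" using that by blast
      then have "v = 0\<^sub>m (Suc k) 1" using v(1) by (intro eq_matI) auto
      with v show False by simp
    qed
    with True have i0: "i \<noteq> 0" by metis
    define E where "E = (addrow_mat (Suc k) 1 0 i :: 'a mat)"
    have E: "E \<in> GLd (Suc k)" using i0 by (auto simp: GLd_def E_def det_addrow_mat)
    note Ec = GLd_carrier[OF E]
    have Ev: "E * v \<in> carrier_mat (Suc k) 1" using Ec v by simp
    have "E * v = addrow 1 0 i v" unfolding E_def by (rule addrow_mat[symmetric, OF v(1) i(1)])
    then have "(E * v) $$ (0, 0) \<noteq> 0" using i v(1) True by simp
    from first[OF Ev this] obtain P where P: "P \<in> GLd (Suc k)" "P * col_e1 (Suc k) = E * v" by auto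
    have "(minv E * P) * col_e1 (Suc k) = minv E * (P * col_e1 (Suc k))"
      using P minv(1)[OF E] GLd_carrier[OF P(1)] by (intro assoc_mult_mat) auto
    also have "\<dots> = v" using GLd_left_cancel[OF E v(1)] P by simp
    finally show ?thesis using GLd_mult[OF minv_GLd[OF E] P(1)] by blast
  qed
qed

text \<open>The stabiliser of the first basis vector has first column (1, 0): there remain a free
  row of length k and an invertible k x k block.\<close>

lemma card_GLd_col_e1:
  "card {A \<in> GLd (Suc k) :: 'a::{field,finite} mat set. A * col_e1 (Suc k) = col_e1 (Suc k)}
   = CARD('a) ^ k * card (GLd k :: 'a mat set)"
proof -
  let ?S = "(carrier_mat 1 k :: 'a mat set) \<times> (GLd k :: 'a mat set)"
  let ?F = "\<lambda>(b, D). four_block_mat (mat_sc 1) b (0\<^sub>m k 1) (D :: 'a mat)"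
  let ?T = "{A \<in> GLd (Suc k) :: 'a mat set. A * col_e1 (Suc k) = col_e1 (Suc k)}"
  have "bij_betw ?F ?S ?T"
  proof (rule bij_betwI')
    fix x y assume "x \<in> ?S" "y \<in> ?S"
    then show "(?F x = ?F y) = (x = y)"
      by (auto simp: GLd_def four_block_eq_iff[of _ 1 1 _ k _ k])
  next
    fix x assume x: "x \<in> ?S"
    obtain b D where [simp]: "x = (b, D)" by (cases x)
    have bD: "b \<in> carrier_mat 1 k" "D \<in> carrier_mat k k" "det D \<noteq> 0" using x by (auto simp: GLd_def)
    have c: "?F x \<in> carrier_mat (Suc k) (Suc k)" using bD by auto
    have "det (?F x) = det D" using bD
      by (simp add: det_four_block_mat_lower_left_zero[where n = 1 and m = k])
    moreover have "?F x * col_e1 (Suc k) = col_e1 (Suc k)"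
      unfolding mult_col_e1[OF c] using bD by (intro eq_matI) (auto simp: col_e1_def)
    ultimately show "?F x \<in> ?T" using c bD by (simp add: GLd_def)
  next
    fix M assume "M \<in> ?T"
    then have M: "M \<in> carrier_mat (Suc k) (Suc k)" "det M \<noteq> 0" "M * col_e1 (Suc k) = col_e1 (Suc k)"
      by (auto simp: GLd_def)
    then have "M \<in> carrier_mat (1 + k) (1 + k)" by simp
    then obtain A B C D where blk: "A \<in> carrier_mat 1 1" "B \<in> carrier_mat 1 k"
      "C \<in> carrier_mat k 1" "D \<in> carrier_mat k k" "M = four_block_mat A B C D"
      by (rule four_block_cases)
    have e: "M $$ (i, 0) = (if i = 0 then 1 else 0)" if "i < Suc k" for i
      using arg_cong[OF M(3), of "\<lambda>X. X $$ (i, 0)"] that unfolding mult_col_e1[OF M(1)]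
      by (simp add: col_e1_def)
    have "A = mat_sc 1" using e[of 0] blk by (intro eq_matI) auto
    moreover have "C = 0\<^sub>m k 1" using e[of "Suc _"] blk by (intro eq_matI) auto
    moreover have "det M = det A * det D" using blk \<open>C = _\<close>
      by (simp add: det_four_block_mat_lower_left_zero[where n = 1 and m = k])
    ultimately show "\<exists>x\<in>?S. M = ?F x" using blk M(2)
      by (intro bexI[of _ "(B, D)"]) (auto simp: GLd_def)
  qed
  then have "card ?T = card ?S" by (simp add: bij_betw_same_card)
  then show ?thesis by (simp add: card_cartesian_product card_carrier_mat)
qed

text \<open>Orbit counting: matrices with a prescribed nonzero first column form a coset of the
  stabiliser of the first basis vector.\<close>

lemma card_GLd_Suc:
  "card (GLd (Suc k) :: 'a::{field,finite} mat set)
   = (CARD('a) ^ Suc k - 1) * CARD('a) ^ k * card (GLd k :: 'a mat set)"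
proof -
  let ?e = "col_e1 (Suc k) :: 'a mat"
  let ?V = "carrier_mat (Suc k) 1 - {0\<^sub>m (Suc k) 1} :: 'a mat set"
  have V: "A * ?e \<in> ?V" if A: "A \<in> GLd (Suc k)" for A
  proof -
    have "A * ?e \<noteq> 0\<^sub>m (Suc k) 1"
    proof
      assume "A * ?e = 0\<^sub>m (Suc k) 1"
      then have "?e = minv A * 0\<^sub>m (Suc k) 1" using GLd_left_cancel(1)[OF A col_e1_carrier] by simp
      then have "?e = 0\<^sub>m (Suc k) 1" using minv(1)[OF A] by simp
      then have "?e $$ (0, 0) = 0" by simp
      then show False by (simp add: col_e1_def)
    qed
    then show ?thesis using mult_carrier_mat[OF GLd_carrier[OF A], of ?e 1] by simp
  qed
  have "card (GLd (Suc k) :: 'a mat set) = (\<Sum>v\<in>?V. card {A \<in> GLd (Suc k). A * ?e = v})"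
    using sum.group[of "GLd (Suc k)" ?V "\<lambda>A. A * ?e" "\<lambda>_. 1::nat"] V
    by (simp add: image_subset_iff)
  also have "\<dots> = (\<Sum>v\<in>?V. card {A \<in> GLd (Suc k) :: 'a mat set. A * ?e = ?e})"
  proof (rule sum.cong[OF refl])
    fix v assume v: "v \<in> ?V"
    then obtain P where P: "P \<in> GLd (Suc k)" "P * ?e = v" using ex_GLd_col by blast
    have as: "(X * Y) * ?e = X * (Y * ?e)" if "X \<in> GLd (Suc k)" "Y \<in> GLd (Suc k)" for X Y
      using GLd_carrier[OF that(1)] GLd_carrier[OF that(2)] by (intro assoc_mult_mat) auto
    have "bij_betw ((*) P) {A \<in> GLd (Suc k). A * ?e = ?e} {A \<in> GLd (Suc k). A * ?e = v}"
    proof (rule bij_betwI[where g = "(*) (minv P)"])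
      show "(*) P \<in> {A \<in> GLd (Suc k). A * ?e = ?e} \<rightarrow> {A \<in> GLd (Suc k). A * ?e = v}"
        using P by (auto intro: GLd_mult simp: as)
      show "(*) (minv P) \<in> {A \<in> GLd (Suc k). A * ?e = v} \<rightarrow> {A \<in> GLd (Suc k). A * ?e = ?e}"
        using P minv_GLd[OF P(1)] GLd_left_cancel(1)[OF P(1) col_e1_carrier]
        by (auto intro: GLd_mult simp: as)
    qed (auto intro!: GLd_left_cancel[OF P(1), where c = "Suc k"] GLd_carrier)
    then show "card {A \<in> GLd (Suc k). A * ?e = v} = card {A \<in> GLd (Suc k). A * ?e = ?e}"
      by (simp add: bij_betw_same_card)
  qed
  also have "\<dots> = (CARD('a) ^ Suc k - 1) * (CARD('a) ^ k * card (GLd k :: 'a mat set))"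
    by (simp add: card_GLd_col_e1 card_carrier_mat card_Diff_subset One_nat_def)
  finally show ?thesis by simp
qed

lemma card_GLd_0: "card (GLd 0 :: 'a::field mat set) = 1"
proof -
  have "GLd 0 = {1\<^sub>m 0 :: 'a mat}" by (auto simp: GLd_def)
  then show ?thesis by simp
qed

section \<open>Invertible symmetric matrices\<close>

lemma atLeastLessThan_0_1 [simp]: "{0..<1::nat} = {0}"
  by auto

definition SymI :: "nat \<Rightarrow> 'a::field mat set" where
  "SymI k = {A \<in> GLd k. transpose_mat A = A}"

lemma finite_SymI [simp]: "finite (SymI k :: 'a::{field,finite} mat set)"
  by (simp add: SymI_def)

lemma SymI_D: assumes "A \<in> SymI k" shows "A \<in> GLd k" "A \<in> carrier_mat k k" "transpose_mat A = A"
  using assms by (auto simp: SymI_def GLd_def)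

lemma transpose_mult3:
  assumes "R \<in> carrier_mat k k" "A \<in> carrier_mat k k"
  shows "transpose_mat (R * A * transpose_mat R) = R * transpose_mat A * transpose_mat (R :: 'a::field mat)"
  using assms by (simp add: transpose_mult[of _ k k _ k] assoc_mult_mat[of _ k k _ k _ k])

lemma SymI_congruence:
  assumes "A \<in> SymI k" "R \<in> GLd k"
  shows "R * A * transpose_mat R \<in> SymI k"
  using assms SymI_D[OF assms(1)] transpose_mult3[OF GLd_carrier[OF assms(2)], of A]
  by (auto simp: SymI_def intro!: GLd_mult GLd_transpose)

definition vcons :: "'a \<Rightarrow> 'a mat \<Rightarrow> 'a mat" where
  "vcons a v = mat (Suc (dim_row v)) 1 (\<lambda>(i, j). if i = 0 then a else v $$ (i - 1, 0))"

lemma vcons_carrier [simp]: "v \<in> carrier_mat k 1 \<Longrightarrow> vcons a v \<in> carrier_mat (Suc k) 1"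
  by (auto simp: vcons_def)

lemma vcons_index [simp]:
  assumes "v \<in> carrier_mat k 1"
  shows "vcons a v $$ (0, 0) = a" "i < k \<Longrightarrow> vcons a v $$ (Suc i, 0) = v $$ (i, 0)"
  using assms by (auto simp: vcons_def)

lemma bij_betw_vcons:
  "bij_betw (\<lambda>(a, v). vcons a v) (UNIV \<times> carrier_mat k 1) (carrier_mat (Suc k) 1)"
  by (rule bij_betwI[where g = "\<lambda>w. (w $$ (0, 0), mat k 1 (\<lambda>(i, j). w $$ (Suc i, 0)))"])
     (auto simp: vcons_def intro!: eq_matI)

definition lower1 :: "'a::field mat \<Rightarrow> 'a mat" where
  "lower1 u = four_block_mat (mat_sc 1) (0\<^sub>m 1 (dim_row u)) u (1\<^sub>m (dim_row u))"

lemma lower1_GLd: assumes "u \<in> carrier_mat k 1" shows "lower1 u \<in> GLd (Suc k)"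
proof -
  have "lower1 u \<in> carrier_mat (Suc k) (Suc k)" using assms by (auto simp: lower1_def)
  moreover have "det (lower1 u) = 1" using assms
    by (simp add: lower1_def det_four_block_mat_upper_right_zero[where n = 1 and m = k])
  ultimately show ?thesis by (simp add: GLd_def)
qed

abbreviation diag2 :: "'a::field \<Rightarrow> nat \<Rightarrow> 'a mat \<Rightarrow> 'a mat" where
  "diag2 a k D \<equiv> four_block_mat (mat_sc a) (0\<^sub>m 1 k) (0\<^sub>m k 1) D"

lemma det_diag2: "D \<in> carrier_mat k k \<Longrightarrow> det (diag2 a k D) = a * det D"
  by (simp add: det_four_block_mat_upper_right_zero[where n = 1 and m = k])

lemma diag2_SymI: "a \<noteq> 0 \<Longrightarrow> D \<in> SymI k \<Longrightarrow> diag2 a k D \<in> SymI (Suc k)"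
proof -
  assume a: "a \<noteq> 0" and D: "D \<in> SymI k"
  note DD = SymI_D[OF D]
  have "transpose_mat (mat_sc a) = mat_sc a" by (rule eq_matI) auto
  then have "transpose_mat (diag2 a k D) = diag2 a k D"
    using DD by (subst transpose_four_block_mat[of _ 1 1 _ k _ k]) auto
  moreover have "diag2 a k D \<in> GLd (Suc k)"
    using DD a det_diag2[OF DD(2), of a] by (auto simp: GLd_def)
  ultimately show "diag2 a k D \<in> SymI (Suc k)" by (simp add: SymI_def)
qed

text \<open>One step of symmetric elimination read backwards: pivot a, first column a times (1, u),
  and D the Schur complement left after clearing row and column.\<close>

definition schur :: "nat \<Rightarrow> 'a::field \<Rightarrow> 'a mat \<Rightarrow> 'a mat \<Rightarrow> 'a mat" where
  "schur k a u D = lower1 u * diag2 a k D * transpose_mat (lower1 u)"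

lemma schur_block:
  assumes u: "u \<in> carrier_mat k 1" and D: "D \<in> carrier_mat k k"
  shows "schur k a u D = four_block_mat (mat_sc a) (a \<cdot>\<^sub>m transpose_mat u) (a \<cdot>\<^sub>m u) (a \<cdot>\<^sub>m (u * transpose_mat u) + D)"
proof -
  have tl: "transpose_mat (lower1 u) = four_block_mat (mat_sc 1) (transpose_mat u) (0\<^sub>m k 1) (1\<^sub>m k)"
    using u unfolding lower1_def by (auto intro!: eq_matI)
  have "lower1 u * diag2 a k D = four_block_mat (mat_sc a) (0\<^sub>m 1 k) (a \<cdot>\<^sub>m u) D"
    unfolding lower1_def using u D
    by (subst mult_four_block_mat[of _ 1 1 _ k _ k _ _ 1 _ k])
       (auto intro!: cong_four_block_mat eq_matI simp: scalar_prod_def)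
  then have "schur k a u D = four_block_mat (mat_sc a) (0\<^sub>m 1 k) (a \<cdot>\<^sub>m u) D
      * four_block_mat (mat_sc 1) (transpose_mat u) (0\<^sub>m k 1) (1\<^sub>m k)"
    by (simp only: schur_def tl)
  also have "\<dots> = four_block_mat (mat_sc a) (a \<cdot>\<^sub>m transpose_mat u) (a \<cdot>\<^sub>m u) (a \<cdot>\<^sub>m (u * transpose_mat u) + D)"
    using u D
    by (subst mult_four_block_mat[of _ 1 1 _ k _ k _ _ 1 _ k])
       (auto intro!: cong_four_block_mat eq_matI simp: scalar_prod_def mult.assoc)
  finally show ?thesis .
qed

lemma schur_SymI:
  assumes "u \<in> carrier_mat k 1" "D \<in> SymI k" "a \<noteq> 0"
  shows "schur k a u D \<in> SymI (Suc k)"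
  unfolding schur_def by (intro SymI_congruence diag2_SymI lower1_GLd assms)

text \<open>A nonzero pivot clears its row and column by a congruence. The remaining block is
  invertible because its determinant is a factor of the determinant of M.\<close>

lemma SymI_schur:
  assumes M: "M \<in> SymI (Suc k)" and a: "M $$ (0, 0) \<noteq> 0"
  obtains u D where "u \<in> carrier_mat k 1" "D \<in> SymI k" "M = schur k (M $$ (0, 0)) u D"
proof -
  define a where "a = M $$ (0, 0)"
  have a0: "a \<noteq> 0" using a by (simp add: a_def)
  have Mc: "M \<in> carrier_mat (1 + k) (1 + k)" using SymI_D[OF M] by simp
  then obtain A B C E where blk: "A \<in> carrier_mat 1 1" "B \<in> carrier_mat 1 k"
      "C \<in> carrier_mat k 1" "E \<in> carrier_mat k k" "M = four_block_mat A B C E"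
    by (rule four_block_cases)
  have "four_block_mat (transpose_mat A) (transpose_mat C) (transpose_mat B) (transpose_mat E) = M"
    using SymI_D(3)[OF M] transpose_four_block_mat[OF blk(1-4)] blk(5) by simp
  then have tr: "transpose_mat C = B" "transpose_mat E = E"
    using blk by (simp_all add: four_block_eq_iff[of _ 1 1 _ k _ k])
  \<comment> \<open>Forced by comparison with \<open>schur_block\<close>: u is the rest of the first
    column divided by the pivot, D the Schur complement.\<close>
  define u where "u = (1 / a) \<cdot>\<^sub>m C"
  define D where "D = E - a \<cdot>\<^sub>m (u * transpose_mat u)"
  have u: "u \<in> carrier_mat k 1" and D: "D \<in> carrier_mat k k" using blk by (auto simp: u_def D_def)
  have "mat_sc a = A" using blk by (intro eq_matI) (auto simp: a_def)
  moreover have "a \<cdot>\<^sub>m transpose_mat u = B" "a \<cdot>\<^sub>m u = C"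
    using blk tr(1) a0 by (auto simp: u_def intro!: eq_matI)
  moreover have "a \<cdot>\<^sub>m (u * transpose_mat u) + D = E"
    using blk u by (auto simp: D_def intro!: eq_matI)
  ultimately have eq: "M = schur k a u D" unfolding schur_block[OF u D] blk(5) by simp
  have d: "diag2 a k D \<in> carrier_mat (Suc k) (Suc k)" using D by auto
  have L: "lower1 u \<in> carrier_mat (Suc k) (Suc k)" using GLd_carrier[OF lower1_GLd[OF u]] .
  have "det (schur k a u D) = det (lower1 u) * det (diag2 a k D) * det (transpose_mat (lower1 u))"
    using det_mult[OF mult_carrier_mat[OF L d], of "transpose_mat (lower1 u)"] det_mult[OF L d] L
    by (simp add: schur_def)
  then have "det M = det (lower1 u) * det (diag2 a k D) * det (transpose_mat (lower1 u))"
    using eq by simp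
  then have "det D \<noteq> 0" using M D by (auto simp: det_diag2 SymI_def GLd_def)
  moreover have "transpose_mat D = D"
  proof (rule eq_matI)
    fix i j assume "i < dim_row D" "j < dim_col D"
    moreover from this have "E $$ (j, i) = E $$ (i, j)"
      using arg_cong[OF tr(2), of "\<lambda>X. X $$ (i, j)"] blk D by simp
    ultimately show "transpose_mat D $$ (i, j) = D $$ (i, j)"
      using blk u D by (simp add: D_def scalar_prod_def mult.commute)
  qed (use D in auto)
  ultimately have "D \<in> SymI k" using D by (simp add: SymI_def GLd_def)
  with u eq that show ?thesis by (simp add: a_def)
qed

definition qf :: "'a::field mat \<Rightarrow> 'a mat \<Rightarrow> 'a" where
  "qf A x = (transpose_mat x * (A * x)) $$ (0, 0)"

lemma qf_congruence:
  assumes "R \<in> carrier_mat k k" "A \<in> carrier_mat k k" "x \<in> carrier_mat k 1"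
  shows "qf (R * A * transpose_mat R) x = qf A (transpose_mat R * x)"
proof -
  have "transpose_mat x * (R * A * transpose_mat R * x) = transpose_mat x * (R * (A * (transpose_mat R * x)))"
    using assms by (simp add: assoc_mult_mat[of _ k k _ k _ k] assoc_mult_mat[of _ k k _ k _ 1])
  also have "\<dots> = (transpose_mat x * R) * (A * (transpose_mat R * x))"
    using assms by (intro assoc_mult_mat[symmetric, of _ 1 k _ k _ 1]) auto
  also have "transpose_mat x * R = transpose_mat (transpose_mat R * x)"
    using assms by (simp add: transpose_mult[of _ k k _ 1])
  finally show ?thesis by (simp add: qf_def)
qed

lemma qf_sum:
  assumes "A \<in> carrier_mat k k" "x \<in> carrier_mat k 1"
  shows "qf A x = (\<Sum>i<k. \<Sum>j<k. A $$ (i, j) * x $$ (i, 0) * x $$ (j, 0))"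
proof -
  have "qf A x = (\<Sum>i<k. x $$ (i, 0) * (\<Sum>j<k. A $$ (i, j) * x $$ (j, 0)))"
    using assms by (simp add: qf_def scalar_prod_def lessThan_atLeast0)
  then show ?thesis by (simp add: sum_distrib_left mult_ac)
qed

lemma qf_diag2:
  assumes "D \<in> carrier_mat k k" "v \<in> carrier_mat k 1"
  shows "qf (diag2 a k D) (vcons x v) = a * (x * x) + qf D v"
proof -
  have "qf (diag2 a k D) (vcons x v) = (\<Sum>i<Suc k. \<Sum>j<Suc k. diag2 a k D $$ (i, j) * vcons x v $$ (i, 0) * vcons x v $$ (j, 0))"
    using assms by (intro qf_sum) auto
  then show ?thesis using assms
    by (simp add: sum.lessThan_Suc_shift qf_sum mult.assoc del: sum.lessThan_Suc)
qed

text \<open>Polarisation: were the form zero on all sums of two basis vectors, every entry of A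
  would vanish as 2 is invertible, contradicting invertibility. The size \<open>Suc k\<close> rules
  out the empty matrix.\<close>

lemma ex_anisotropic:
  fixes A :: "'a::field mat"
  assumes two: "(2::'a) \<noteq> 0" and A: "A \<in> SymI (Suc k)"
  shows "\<exists>x\<in>carrier_mat (Suc k) 1. qf A x \<noteq> 0"
proof (rule ccontr)
  assume contra: "\<not> ?thesis"
  let ?n = "Suc k"
  have Ac: "A \<in> carrier_mat ?n ?n" and At: "transpose_mat A = A" using SymI_D[OF A] by auto
  have sym: "A $$ (i, j) = A $$ (j, i)" if "i < ?n" "j < ?n" for i j
    using arg_cong[OF At, of "\<lambda>X. X $$ (i, j)"] that Ac by simp
  \<comment> \<open>For p = q this is twice a basis vector, so the same formula covers the diagonal
    entries, with value 4 times the entry.\<close>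
  define e where "e = (\<lambda>p q. mat ?n 1 (\<lambda>(i, j). (if i = p then 1 else 0) + (if i = q then 1 else (0::'a))))"
  have zero: "A $$ (p, q) = 0" if pq: "p < ?n" "q < ?n" for p q
  proof -
    have inner: "(\<Sum>j<?n. A $$ (i, j) * e r s $$ (j, 0)) = A $$ (i, r) + A $$ (i, s)"
      if "r < ?n" "s < ?n" for i r s
    proof -
      have "(\<Sum>j<?n. A $$ (i, j) * e r s $$ (j, 0))
          = (\<Sum>j<?n. (if j = r then A $$ (i, j) else 0) + (if j = s then A $$ (i, j) else 0))"
        by (intro sum.cong refl) (auto simp: e_def)
      then show ?thesis using that by (simp only: sum.distrib) simp
    qed
    have q: "qf A (e r s) = (A $$ (r, r) + A $$ (r, s)) + (A $$ (s, r) + A $$ (s, s))"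
      if rs: "r < ?n" "s < ?n" for r s
    proof -
      have "qf A (e r s) = (\<Sum>i<?n. e r s $$ (i, 0) * (\<Sum>j<?n. A $$ (i, j) * e r s $$ (j, 0)))"
        by (subst qf_sum[OF Ac]) (simp_all add: e_def sum_distrib_left mult_ac del: sum.lessThan_Suc)
      also have "\<dots> = (\<Sum>i<?n. (if i = r then A $$ (i, r) + A $$ (i, s) else 0)
          + (if i = s then A $$ (i, r) + A $$ (i, s) else 0))"
        unfolding inner[OF rs] by (intro sum.cong refl) (auto simp: e_def)
      finally show ?thesis using rs by (simp only: sum.distrib) simp
    qed
    have e: "e r s \<in> carrier_mat ?n 1" for r s by (simp add: e_def)
    have z: "qf A (e r s) = 0" for r s using contra e by blast
    have d: "A $$ (r, r) = 0" if "r < ?n" for r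
    proof -
      have "2 * (2 * A $$ (r, r)) = 0" using z[of r r] q[OF that that] by simp
      then show ?thesis using two by (metis mult_eq_0_iff)
    qed
    have "2 * A $$ (p, q) = 0" using z[of p q] q[OF pq] d pq sym[OF pq] by simp
    then show ?thesis using two by simp
  qed
  have "A = 0\<^sub>m ?n ?n" using Ac zero by (intro eq_matI) auto
  moreover have "A * minv A = 1\<^sub>m ?n" "minv A \<in> carrier_mat ?n ?n" using minv SymI_D(1)[OF A] by auto
  ultimately have "(1\<^sub>m ?n :: 'a mat) = 0\<^sub>m ?n ?n" by simp
  then have "(1\<^sub>m ?n :: 'a mat) $$ (0, 0) = 0\<^sub>m ?n ?n $$ (0, 0)" by simp
  then show False by simp
qed

text \<open>A vector with nonzero value is moved to the first basis vector; its value then sits in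
  the top left corner and serves as pivot. Iterated, this diagonalises the form.\<close>

lemma SymI_diagonal_step:
  fixes A :: "'a::field mat"
  assumes two: "(2::'a) \<noteq> 0" and A: "A \<in> SymI (Suc k)"
  obtains R a D where "R \<in> GLd (Suc k)" "a \<noteq> 0" "D \<in> SymI k" "A = R * diag2 a k D * transpose_mat R"
proof -
  let ?n = "Suc k"
  note Ac = SymI_D(2)[OF A]
  obtain x where x: "x \<in> carrier_mat ?n 1" "qf A x \<noteq> 0" using ex_anisotropic[OF two A] by auto
  have "x \<noteq> 0\<^sub>m ?n 1"
  proof
    assume "x = 0\<^sub>m ?n 1"
    then have "qf A x = 0" using Ac by (simp add: qf_sum)
    with x show False by simp
  qed
  then obtain P where P: "P \<in> GLd ?n" "P * col_e1 ?n = x" using ex_GLd_col x by blast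
  note Pc = GLd_carrier[OF P(1)]
  let ?Q = "transpose_mat P"
  \<comment> \<open>Congruence by the transpose of P makes the value at \<open>col_e1\<close> equal
    to that of A at x.\<close>
  define A1 where "A1 = ?Q * A * transpose_mat ?Q"
  have A1: "A1 \<in> SymI ?n" unfolding A1_def by (intro SymI_congruence A GLd_transpose P)
  have "qf A1 (col_e1 ?n) = qf A x"
    unfolding A1_def using qf_congruence[of ?Q ?n A "col_e1 ?n"] Pc Ac P by simp
  moreover have "qf A1 (col_e1 ?n) = A1 $$ (0, 0)"
  proof -
    have "qf A1 (col_e1 ?n) = (\<Sum>i<?n. \<Sum>j<?n. if i = 0 then if j = 0 then A1 $$ (i, j) else 0 else 0)"
      by (subst qf_sum[OF SymI_D(2)[OF A1]])
        (auto simp: col_e1_def simp del: sum.lessThan_Suc intro!: sum.cong)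
    then show ?thesis by (simp add: sum.lessThan_Suc_shift del: sum.lessThan_Suc)
  qed
  ultimately have a: "A1 $$ (0, 0) \<noteq> 0" using x by simp
  from SymI_schur[OF A1 a] obtain u D where uD: "u \<in> carrier_mat k 1" "D \<in> SymI k"
      "A1 = schur k (A1 $$ (0, 0)) u D" .
  let ?a = "A1 $$ (0, 0)" and ?L = "lower1 u"
  have Qt: "?Q \<in> GLd ?n" by (intro GLd_transpose P)
  note Qc = GLd_carrier[OF Qt] and Qi = minv[OF Qt]
  have L: "?L \<in> GLd ?n" by (rule lower1_GLd[OF uD(1)])
  note Lc = GLd_carrier[OF L]
  define R where "R = minv ?Q * ?L"
  have R: "R \<in> GLd ?n" unfolding R_def by (intro GLd_mult minv_GLd Qt L)
  have Dc: "diag2 ?a k D \<in> carrier_mat ?n ?n" using SymI_D(2)[OF uD(2)] by auto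
  have "R * diag2 ?a k D * transpose_mat R
      = minv ?Q * (?L * diag2 ?a k D * transpose_mat ?L) * transpose_mat (minv ?Q)"
    unfolding R_def using Qi Lc Dc
    by (simp add: transpose_mult[of _ ?n ?n _ ?n] assoc_mult_mat[of _ ?n ?n _ ?n _ ?n])
  also have "\<dots> = minv ?Q * A1 * transpose_mat (minv ?Q)"
    using uD(3) by (simp add: schur_def)
  also have "\<dots> = A * (transpose_mat ?Q * transpose_mat (minv ?Q))"
    unfolding A1_def using Qi Qc Ac
    by (simp add: assoc_mult_mat[of _ ?n ?n _ ?n _ ?n] GLd_left_cancel[OF Qt, of _ ?n])
  also have "transpose_mat ?Q * transpose_mat (minv ?Q) = transpose_mat (minv ?Q * ?Q)"
    using Qi(1) Qc by (intro transpose_mult[symmetric])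
  also have "A * \<dots> = A" using Qi Ac by simp
  finally show ?thesis using that[OF R a uD(2)] by simp
qed

text \<open>With z = x + y sqrt e the argument is the Hermitian form of A at z. One congruence acts
  on x and y alike, so A may be split diagonally, and each diagonal entry contributes one norm form,
  hence one factor -q.\<close>

lemma sum_hermitian_form:
  fixes f :: "'a::{field,finite} \<Rightarrow> rat"
  assumes two: "(2::'a) \<noteq> 0" and e: "\<not> is_sq e" and f: "mean_zero f" and A: "A \<in> SymI r"
  shows "(\<Sum>x\<in>carrier_mat r 1. \<Sum>y\<in>carrier_mat r 1. f (c + (qf A x - e * qf A y)))
       = (- of_nat CARD('a)) ^ r * f c"
  using A
proof (induction r arbitrary: A c)
  case 0
  have "carrier_mat 0 1 = {0\<^sub>m 0 1 :: 'a mat}" by auto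
  then show ?case using SymI_D(2)[OF 0] by (simp add: qf_sum)
next
  case (Suc k)
  from SymI_diagonal_step[OF two Suc.prems] obtain R a D where
    R: "R \<in> GLd (Suc k)" and a: "a \<noteq> 0" and D: "D \<in> SymI k" and AR: "A = R * diag2 a k D * transpose_mat R" .
  note Dc = SymI_D(2)[OF D]
  have d2: "diag2 a k D \<in> carrier_mat (Suc k) (Suc k)" using Dc by auto
  let ?S = "\<lambda>g. \<Sum>x\<in>carrier_mat (Suc k) 1. g x :: rat"
  have cong: "?S (\<lambda>x. g (qf A x)) = ?S (\<lambda>x. g (qf (diag2 a k D) x))" for g :: "'a \<Rightarrow> rat"
  proof -
    have "?S (\<lambda>x. g (qf A x)) = ?S (\<lambda>x. g (qf (diag2 a k D) (transpose_mat R * x)))"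
      unfolding AR by (intro sum.cong refl) (simp add: qf_congruence[OF GLd_carrier[OF R] d2])
    also have "\<dots> = ?S (\<lambda>x. g (qf (diag2 a k D) x))"
      by (rule sum.reindex_bij_betw[OF bij_betw_GLd_left[OF GLd_transpose[OF R]], where g = "\<lambda>x. g (qf (diag2 a k D) x)"])
    finally show ?thesis .
  qed
  have split: "?S (\<lambda>x. g (qf (diag2 a k D) x))
      = (\<Sum>s\<in>UNIV. \<Sum>v\<in>carrier_mat k 1. g (a * (s * s) + qf D v))" for g :: "'a \<Rightarrow> rat"
  proof -
    have "?S (\<lambda>x. g (qf (diag2 a k D) x))
        = (\<Sum>(s, v)\<in>UNIV \<times> carrier_mat k 1. g (qf (diag2 a k D) (vcons s v)))"
      using sum.reindex_bij_betw[OF bij_betw_vcons[of k], where g = "\<lambda>x. g (qf (diag2 a k D) x)"]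
      by (simp add: case_prod_beta)
    also have "\<dots> = (\<Sum>(s, v)\<in>UNIV \<times> carrier_mat k 1. g (a * (s * s) + qf D v))"
      using Dc by (intro sum.cong refl) (auto simp: qf_diag2)
    finally show ?thesis by (simp add: sum.cartesian_product)
  qed
  have "?S (\<lambda>x. ?S (\<lambda>y. f (c + (qf A x - e * qf A y))))
      = ?S (\<lambda>x. ?S (\<lambda>y. f (c + (qf A x - e * qf (diag2 a k D) y))))"
    by (intro sum.cong refl cong)
  also have "\<dots> = ?S (\<lambda>x. ?S (\<lambda>y. f (c + (qf (diag2 a k D) x - e * qf (diag2 a k D) y))))"
    by (rule cong)
  also have "\<dots> = (\<Sum>s\<in>UNIV. \<Sum>v\<in>carrier_mat k 1. \<Sum>s'\<in>UNIV. \<Sum>w\<in>carrier_mat k 1.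
      f (c + ((a * (s * s) + qf D v) - e * (a * (s' * s') + qf D w))))"
    by (subst split) (intro sum.cong refl split)
  \<comment> \<open>Pulling out the first coordinates s and s' isolates a norm form in them; the
    inner sum is the induction hypothesis for D with a shifted constant.\<close>
  also have "\<dots> = (\<Sum>s\<in>UNIV. \<Sum>s'\<in>UNIV. \<Sum>v\<in>carrier_mat k 1. \<Sum>w\<in>carrier_mat k 1.
      f ((c + a * (s * s - e * (s' * s'))) + (qf D v - e * qf D w)))"
    by (subst sum.swap[of _ UNIV "carrier_mat k 1"]) (simp add: algebra_simps)
  also have "\<dots> = (\<Sum>s\<in>UNIV. \<Sum>s'\<in>UNIV. (- of_nat CARD('a)) ^ k * f (c + a * (s * s - e * (s' * s'))))"
    by (simp only: Suc.IH[OF D])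
  also have "\<dots> = (- of_nat CARD('a)) ^ Suc k * f c"
    by (simp add: sum_norm_form[OF two e f a] flip: sum_distrib_left)
  finally show ?case .
qed

lemma mult_col_e1_index:
  assumes "M \<in> carrier_mat (Suc r) (Suc k)"
  shows "M * col_e1 (Suc k) = vcons a v \<longleftrightarrow> dim_row v = r \<and> M $$ (0, 0) = a \<and> (\<forall>i<r. M $$ (Suc i, 0) = v $$ (i, 0))"
proof
  assume eq: "M * col_e1 (Suc k) = vcons a v"
  have d: "dim_row v = r" using arg_cong[OF eq, of dim_row] assms by (simp add: vcons_def)
  have "M $$ (i, 0) = vcons a v $$ (i, 0)" if "i < Suc r" for i
    using arg_cong[OF eq, of "\<lambda>X. X $$ (i, 0)"] that unfolding mult_col_e1[OF assms] by simp
  from this[of 0] this[of "Suc _"] d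
  show "dim_row v = r \<and> M $$ (0, 0) = a \<and> (\<forall>i<r. M $$ (Suc i, 0) = v $$ (i, 0))"
    by (auto simp: vcons_def)
next
  assume "dim_row v = r \<and> M $$ (0, 0) = a \<and> (\<forall>i<r. M $$ (Suc i, 0) = v $$ (i, 0))"
  then show "M * col_e1 (Suc k) = vcons a v"
    unfolding mult_col_e1[OF assms] by (intro eq_matI) (auto simp: vcons_def gr0_conv_Suc less_Suc_eq_0_disj)
qed

text \<open>A nonzero pivot and the column below it determine u in \<open>schur\<close>; only the
  Schur complement remains free.\<close>

lemma card_SymI_pivot:
  fixes a :: "'a::{field,finite}"
  assumes a: "a \<noteq> 0" and v: "v \<in> carrier_mat k 1"
  shows "card {M \<in> SymI (Suc k). M * col_e1 (Suc k) = vcons a v} = card (SymI k :: 'a mat set)"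
proof -
  define u where "u = (1 / a) \<cdot>\<^sub>m v"
  have u: "u \<in> carrier_mat k 1" using v by (simp add: u_def)
  have au: "a \<cdot>\<^sub>m u = v" using v a by (auto simp: u_def intro!: eq_matI)
  have "bij_betw (schur k a u) (SymI k) {M \<in> SymI (Suc k). M * col_e1 (Suc k) = vcons a v}"
  proof (rule bij_betwI')
    fix D E :: "'a mat" assume "D \<in> SymI k" "E \<in> SymI k"
    then have D: "D \<in> carrier_mat k k" and E: "E \<in> carrier_mat k k" by (auto dest: SymI_D)
    show "(schur k a u D = schur k a u E) = (D = E)"
    proof
      assume "schur k a u D = schur k a u E"
      then have "a \<cdot>\<^sub>m (u * transpose_mat u) + D = a \<cdot>\<^sub>m (u * transpose_mat u) + E"
        unfolding schur_block[OF u D] schur_block[OF u E]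
        using u D E by (simp add: four_block_eq_iff[of _ 1 1 _ k _ k])
      then have eq: "(a \<cdot>\<^sub>m (u * transpose_mat u) + D) $$ (i, j) = (a \<cdot>\<^sub>m (u * transpose_mat u) + E) $$ (i, j)" for i j
        by simp
      show "D = E"
      proof (rule eq_matI)
        fix i j assume "i < dim_row E" "j < dim_col E"
        then show "D $$ (i, j) = E $$ (i, j)" using eq[of i j] u D E by simp
      qed (use D E in auto)
    qed simp
  next
    fix D :: "'a mat" assume D: "D \<in> SymI k"
    note Dc = SymI_D(2)[OF D]
    have S: "schur k a u D \<in> SymI (Suc k)" by (rule schur_SymI[OF u D a])
    moreover have "schur k a u D * col_e1 (Suc k) = vcons a v"
      unfolding mult_col_e1_index[OF SymI_D(2)[OF S]] unfolding schur_block[OF u Dc] au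
      using u Dc v by auto
    ultimately show "schur k a u D \<in> {M \<in> SymI (Suc k). M * col_e1 (Suc k) = vcons a v}" by simp
  next
    fix M assume "M \<in> {M \<in> SymI (Suc k). M * col_e1 (Suc k) = vcons a v}"
    then have M: "M \<in> SymI (Suc k)" "M * col_e1 (Suc k) = vcons a v" by auto
    then have e: "M $$ (0, 0) = a" "\<And>i. i < k \<Longrightarrow> M $$ (Suc i, 0) = v $$ (i, 0)"
      unfolding mult_col_e1_index[OF SymI_D(2)[OF M(1)]] by auto
    then obtain w D where w: "w \<in> carrier_mat k 1" and D: "D \<in> SymI k" and eq: "M = schur k a w D"
      using SymI_schur[OF M(1)] a by metis
    have "w = u"
    proof (rule eq_matI)
      fix i j assume ij: "i < dim_row u" "j < dim_col u"
      then have "a * w $$ (i, 0) = v $$ (i, 0)"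
        using e(2)[of i] u w SymI_D(2)[OF D] unfolding eq schur_block[OF w SymI_D(2)[OF D]] by simp
      then show "w $$ (i, j) = u $$ (i, j)" using ij a u v by (auto simp: u_def field_simps)
    qed (use u w in auto)
    with D eq show "\<exists>D\<in>SymI k. M = schur k a u D" by auto
  qed
  then show ?thesis by (simp add: bij_betw_same_card)
qed

lemma mult_vcons_diag2:
  assumes "P \<in> carrier_mat k k" "x \<in> carrier_mat k 1"
  shows "diag2 1 k P * vcons 0 x = vcons 0 (P * x)"
proof (rule eq_matI)
  fix i j assume ij: "i < dim_row (vcons 0 (P * x))" "j < dim_col (vcons 0 (P * x))"
  have "(diag2 1 k P * vcons 0 x) $$ (i, 0) = (\<Sum>l<Suc k. diag2 1 k P $$ (i, l) * vcons 0 x $$ (l, 0))"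
    using ij assms by (simp add: scalar_prod_def lessThan_atLeast0 vcons_def del: sum.op_ivl_Suc)
  also have "\<dots> = vcons 0 (P * x) $$ (i, 0)"
    using ij assms
    by (auto simp: sum.lessThan_Suc_shift vcons_def scalar_prod_def atLeast0LessThan simp del: sum.lessThan_Suc)
  finally show "(diag2 1 k P * vcons 0 x) $$ (i, j) = vcons 0 (P * x) $$ (i, j)"
    using ij by (simp add: vcons_def)
qed (use assms in \<open>auto simp: vcons_def\<close>)

text \<open>If the transpose of R fixes e, then (R M R^T) e = R (M e), so congruence by R carries
  matrices with column w to matrices with column R w.\<close>

lemma SymI_col_congruence_card:
  fixes R e w :: "'a::{field,finite} mat"
  assumes R: "R \<in> GLd n" and e: "e \<in> carrier_mat n 1" "transpose_mat R * e = e" and w: "w \<in> carrier_mat n 1"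
  shows "card {M \<in> SymI n. M * e = R * w} = card {M \<in> SymI n. M * e = w}"
proof -
  let ?R' = "minv R"
  note Rc = GLd_carrier[OF R] and Ri = minv[OF R]
  have R': "?R' \<in> GLd n" by (rule minv_GLd[OF R])
  have e': "transpose_mat ?R' * e = e"
  proof -
    have "transpose_mat ?R' * e = transpose_mat ?R' * (transpose_mat R * e)" using e by simp
    also have "\<dots> = (transpose_mat ?R' * transpose_mat R) * e"
      using Rc Ri e by (intro assoc_mult_mat[symmetric, of _ n n _ n _ 1]) auto
    also have "transpose_mat ?R' * transpose_mat R = transpose_mat (R * ?R')"
      by (rule transpose_mult[symmetric, OF Rc Ri(1)])
    finally show ?thesis using Ri e by simp
  qed
  have act: "(S * M * transpose_mat S) * e = S * (M * e)"
    if "S \<in> carrier_mat n n" "M \<in> carrier_mat n n" "transpose_mat S * e = e" for S M :: "'a mat"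
    using that e by (simp add: assoc_mult_mat[of _ n n _ n _ 1])
  have inv: "S * (T * M * transpose_mat T) * transpose_mat S = M"
    if "S \<in> carrier_mat n n" "T \<in> carrier_mat n n" "M \<in> carrier_mat n n" "S * T = 1\<^sub>m n" for S T M :: "'a mat"
  proof -
    have "transpose_mat T * transpose_mat S = transpose_mat (S * T)"
      by (rule transpose_mult[symmetric, OF that(1,2)])
    then have 1: "transpose_mat T * transpose_mat S = 1\<^sub>m n" using that by simp
    have 2: "S * (T * M) = M"
      using that assoc_mult_mat[OF that(1,2,3)] by simp
    have "S * (T * M * transpose_mat T) * transpose_mat S = S * (T * (M * (transpose_mat T * transpose_mat S)))"
      using that by (simp add: assoc_mult_mat[of _ n n _ n _ n])
    also have "\<dots> = M" unfolding 1 using that 2 by simp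
    finally show ?thesis .
  qed
  have "bij_betw (\<lambda>M :: 'a mat. R * M * transpose_mat R) {M \<in> SymI n. M * e = w} {M \<in> SymI n. M * e = R * w}"
  proof (rule bij_betwI[where g = "\<lambda>M. ?R' * M * transpose_mat ?R'"])
    show "(\<lambda>M :: 'a mat. R * M * transpose_mat R) \<in> {M \<in> SymI n. M * e = w} \<rightarrow> {M \<in> SymI n. M * e = R * w}"
    proof clarsimp
      fix M :: "'a mat" assume M: "M \<in> SymI n"
      show "R * M * transpose_mat R \<in> SymI n \<and> R * M * transpose_mat R * e = R * (M * e)"
        using SymI_congruence[OF M R] act[OF Rc SymI_D(2)[OF M] e(2)] by simp
    qed
    show "(\<lambda>M. ?R' * M * transpose_mat ?R') \<in> {M \<in> SymI n. M * e = R * w} \<rightarrow> {M \<in> SymI n. M * e = w}"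
    proof clarsimp
      fix M :: "'a mat" assume M: "M \<in> SymI n" "M * e = R * w"
      show "?R' * M * transpose_mat ?R' \<in> SymI n \<and> ?R' * M * transpose_mat ?R' * e = w"
        using SymI_congruence[OF M(1) R'] act[OF Ri(1) SymI_D(2)[OF M(1)] e'] M(2)
          GLd_left_cancel(1)[OF R w] by simp
    qed
  qed (use inv Rc Ri in \<open>auto dest: SymI_D\<close>)
  then show ?thesis by (simp add: bij_betw_same_card)
qed

text \<open>Congruence by diag(1, P) keeps the zero pivot and moves the rest of the first column
  transitively among nonzero columns, so one representative suffices.\<close>

lemma card_SymI_zero_pivot:
  assumes v: "v \<in> carrier_mat (Suc l) 1" "v \<noteq> 0\<^sub>m (Suc l) 1"
  shows "card {M \<in> SymI (Suc (Suc l)). M * col_e1 (Suc (Suc l)) = vcons (0::'a::{field,finite}) v}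
      = card {M \<in> SymI (Suc (Suc l)). M * col_e1 (Suc (Suc l)) = vcons (0::'a) (col_e1 (Suc l))}"
proof -
  let ?k = "Suc l"
  obtain P where P: "P \<in> GLd ?k" "P * col_e1 ?k = v" using ex_GLd_col[OF v] by auto
  note Pc = GLd_carrier[OF P(1)]
  have R: "diag2 1 ?k P \<in> GLd (Suc ?k)" using P Pc det_diag2[OF Pc, of 1] by (auto simp: GLd_def)
  have "transpose_mat (diag2 1 ?k P) * col_e1 (Suc ?k) = col_e1 (Suc ?k)"
    using GLd_carrier[OF R] Pc by (subst mult_col_e1) (auto simp: col_e1_def intro!: eq_matI)
  from SymI_col_congruence_card[OF R col_e1_carrier this, of "vcons 0 (col_e1 ?k)"]
  show ?thesis using P by (simp add: mult_vcons_diag2[OF Pc])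
qed

lemma block_congruence:
  fixes K :: "'a::field mat"
  assumes X: "X \<in> carrier_mat l p" and K: "K \<in> carrier_mat p p" and D: "D \<in> carrier_mat l l"
  shows "four_block_mat (1\<^sub>m p) (0\<^sub>m p l) X (1\<^sub>m l) * four_block_mat K (0\<^sub>m p l) (0\<^sub>m l p) D
      * transpose_mat (four_block_mat (1\<^sub>m p) (0\<^sub>m p l) X (1\<^sub>m l))
    = four_block_mat K (K * transpose_mat X) (X * K) (X * K * transpose_mat X + D)"
proof -
  have t: "transpose_mat (four_block_mat (1\<^sub>m p) (0\<^sub>m p l) X (1\<^sub>m l))
      = four_block_mat (1\<^sub>m p) (transpose_mat X) (0\<^sub>m l p) (1\<^sub>m l)"
    using X by (subst transpose_four_block_mat[of _ p p _ l _ l]) auto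
  have "four_block_mat (1\<^sub>m p) (0\<^sub>m p l) X (1\<^sub>m l) * four_block_mat K (0\<^sub>m p l) (0\<^sub>m l p) D
      = four_block_mat K (0\<^sub>m p l) (X * K) D"
    using assms by (subst mult_four_block_mat[of _ p p _ l _ l _ _ p _ l]) auto
  moreover have "four_block_mat K (0\<^sub>m p l) (X * K) D * four_block_mat (1\<^sub>m p) (transpose_mat X) (0\<^sub>m l p) (1\<^sub>m l)
      = four_block_mat K (K * transpose_mat X) (X * K) (X * K * transpose_mat X + D)"
    using assms by (subst mult_four_block_mat[of _ p p _ l _ l _ _ p _ l]) auto
  ultimately show ?thesis unfolding t by simp
qed

text \<open>The pivot vanishes, but the leading block [0 1; 1 c] is invertible and serves as a 2 x 2
  pivot, a hyperbolic plane. Free are c, the l further entries of the second row, and the invertible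
  symmetric complement.\<close>

lemma card_SymI_hyperbolic:
  "card {M \<in> SymI (Suc (Suc l)). M * col_e1 (Suc (Suc l)) = vcons (0::'a::{field,finite}) (col_e1 (Suc l))}
   = CARD('a) ^ Suc l * card (SymI l :: 'a mat set)"
proof -
  let ?n = "Suc (Suc l)"
  let ?T = "{M \<in> SymI ?n. M * col_e1 ?n = vcons (0::'a) (col_e1 (Suc l))}"
  let ?S = "(UNIV :: 'a set) \<times> (carrier_mat l 1 :: 'a mat set) \<times> (SymI l :: 'a mat set)"
  define K where "K = (\<lambda>c::'a. mat 2 2 (\<lambda>(i, j). if i = 1 \<and> j = 1 then c else if i = j then 0 else 1))"
  define X where "X = (\<lambda>d::'a mat. mat l 2 (\<lambda>(i, j). if j = 0 then d $$ (i, 0) else 0))"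
  define G where "G = (\<lambda>d::'a mat. mat 2 l (\<lambda>(i, j). if i = 1 then d $$ (j, 0) else 0))"
  let ?F = "\<lambda>(c, d, E). four_block_mat (K c) (G d) (transpose_mat (G d)) (E :: 'a mat)"
  let ?U = "\<lambda>d. four_block_mat (1\<^sub>m 2) (0\<^sub>m 2 l) (X d) (1\<^sub>m l)"
  let ?B = "\<lambda>c E. four_block_mat (K c) (0\<^sub>m 2 l) (0\<^sub>m l 2) (E :: 'a mat)"
  have c: "K c \<in> carrier_mat 2 2" "X d \<in> carrier_mat l 2" "G d \<in> carrier_mat 2 l" for c d
    by (auto simp: K_def X_def G_def)
  have s2: "{0..<2::nat} = {0, 1}" by auto
  have eqF: "?F (c, d, E) = ?U d * ?B c E * transpose_mat (?U d)" if E: "E \<in> carrier_mat l l" for c d E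
  proof -
    have 1: "K c * transpose_mat (X d) = G d"
      by (auto simp: K_def X_def G_def scalar_prod_def s2 intro!: eq_matI)
    have 2: "X d * K c = transpose_mat (G d)"
      by (auto simp: K_def X_def G_def scalar_prod_def s2 intro!: eq_matI)
    \<comment> \<open>Only the first column of X is nonzero and the corner of K is 0, so the
      correction vanishes and the complement E is itself the lower right block.\<close>
    have "X d * K c * transpose_mat (X d) = 0\<^sub>m l l"
      unfolding 2 by (auto simp: K_def X_def G_def scalar_prod_def s2 intro!: eq_matI)
    then have 3: "X d * K c * transpose_mat (X d) + E = E" using E by simp
    show ?thesis unfolding block_congruence[OF c(2) c(1) E] 1 3 unfolding 2 by simp
  qed
  have K: "K c \<in> GLd 2" for c
  proof (rule GLdI[OF c(1)])
    show "mat 2 2 (\<lambda>(i, j). if i = 0 \<and> j = 0 then - c else if i = j then 0 else 1) \<in> carrier_mat 2 2" by simp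
    show "K c * mat 2 2 (\<lambda>(i, j). if i = 0 \<and> j = 0 then - c else if i = j then 0 else 1) = 1\<^sub>m 2"
      by (rule eq_matI) (auto simp: K_def scalar_prod_def s2 less_2_cases_iff)
  qed
  have Kt: "transpose_mat (K c) = K c" for c by (rule eq_matI) (auto simp: K_def)
  have U: "?U d \<in> GLd (2 + l)" for d
  proof -
    have "?U d \<in> carrier_mat (2 + l) (2 + l)" by (intro four_block_carrier_mat) auto
    moreover have "det (?U d) = 1"
      using c(2) by (subst det_four_block_mat_upper_right_zero[where n = 2 and m = l]) auto
    ultimately show ?thesis by (simp add: GLd_def)
  qed
  have B: "?B c E \<in> SymI (2 + l) \<longleftrightarrow> E \<in> SymI l" if E: "E \<in> carrier_mat l l" for c E
  proof -
    have "?B c E \<in> carrier_mat (2 + l) (2 + l)" using E c(1) by (intro four_block_carrier_mat) auto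
    moreover have "det (?B c E) = det (K c) * det E"
      using E c(1) by (subst det_four_block_mat_upper_right_zero[where n = 2 and m = l]) auto
    moreover have "det (K c) \<noteq> 0" using K[of c] by (simp add: GLd_def)
    moreover have "transpose_mat (?B c E) = ?B c E \<longleftrightarrow> transpose_mat E = E"
      using E c(1) by (subst transpose_four_block_mat[of _ 2 2 _ l _ l])
        (auto simp: Kt four_block_eq_iff[of _ 2 2 _ l _ l])
    ultimately show ?thesis using E by (auto simp: SymI_def GLd_def)
  qed
  have "bij_betw ?F ?S ?T"
  proof (rule bij_betwI')
    fix x y assume xy: "x \<in> ?S" "y \<in> ?S"
    obtain c1 d1 E1 c2 d2 E2 where [simp]: "x = (c1, d1, E1)" "y = (c2, d2, E2)" by (metis prod_cases3)
    have E: "E1 \<in> carrier_mat l l" "E2 \<in> carrier_mat l l" "d1 \<in> carrier_mat l 1" "d2 \<in> carrier_mat l 1"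
      using xy by (auto dest: SymI_D)
    show "(?F x = ?F y) = (x = y)"
    proof
      assume "?F x = ?F y"
      then have eq: "K c1 = K c2" "G d1 = G d2" "E1 = E2"
        using E c by (auto simp: four_block_eq_iff[of _ 2 2 _ l _ l])
      have "c1 = c2" using arg_cong[OF eq(1), of "\<lambda>X. X $$ (1, 1)"] by (simp add: K_def)
      moreover have "d1 = d2"
      proof (rule eq_matI)
        fix i j assume "i < dim_row d2" "j < dim_col d2"
        then show "d1 $$ (i, j) = d2 $$ (i, j)"
          using arg_cong[OF eq(2), of "\<lambda>X. X $$ (1, i)"] E by (simp add: G_def)
      qed (use E in auto)
      ultimately show "x = y" using eq by simp
    qed simp
  next
    fix x assume x: "x \<in> ?S"
    obtain c1 d1 E1 where [simp]: "x = (c1, d1, E1)" by (metis prod_cases3)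
    have E: "E1 \<in> SymI l" "E1 \<in> carrier_mat l l" "d1 \<in> carrier_mat l 1" using x by (auto dest: SymI_D)
    have S: "?F x \<in> SymI ?n"
      using SymI_congruence[of "?B c1 E1" "2 + l" "?U d1"] U[of d1] B[OF E(2), of c1] E(1) eqF[OF E(2), of c1 d1]
      by simp
    moreover have "?F x * col_e1 ?n = vcons 0 (col_e1 (Suc l))"
      unfolding mult_col_e1_index[OF SymI_D(2)[OF S]]
      using c E by (auto simp: K_def G_def col_e1_def)
    ultimately show "?F x \<in> ?T" by simp
  next
    fix M assume "M \<in> ?T"
    then have M: "M \<in> SymI ?n" "M * col_e1 ?n = vcons 0 (col_e1 (Suc l))" by auto
    note Mc = SymI_D(2)[OF M(1)]
    have e: "M $$ (0, 0) = 0" "\<And>i. i < Suc l \<Longrightarrow> M $$ (Suc i, 0) = (if i = 0 then 1 else 0)"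
      using M(2) unfolding mult_col_e1_index[OF Mc] by (auto simp: col_e1_def)
    have sym: "M $$ (i, j) = M $$ (j, i)" if "i < ?n" "j < ?n" for i j
      using arg_cong[OF SymI_D(3)[OF M(1)], of "\<lambda>X. X $$ (i, j)"] that Mc by simp
    define c1 d1 E1 where "c1 = M $$ (1, 1)" and "d1 = mat l 1 (\<lambda>(i, j). M $$ (i + 2, 1))"
      and "E1 = mat l l (\<lambda>(i, j). M $$ (i + 2, j + 2))"
    have Ec: "E1 \<in> carrier_mat l l" "d1 \<in> carrier_mat l 1" by (auto simp: E1_def d1_def)
    have "M = ?F (c1, d1, E1)"
    proof (rule eq_matI)
      fix i j assume ij: "i < dim_row (?F (c1, d1, E1))" "j < dim_col (?F (c1, d1, E1))"
      then have ij: "i < ?n" "j < ?n" using c Ec by (auto simp: K_def)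
      have z: "M $$ (i, 0) = (if i = 1 then 1 else 0)" if "i < ?n" for i
        using that e by (cases i) (auto simp: One_nat_def)
      have z': "M $$ (0, j) = (if j = 1 then 1 else 0)" if "j < ?n" for j
        using that sym[of 0 j] z[of j] by simp
      show "M $$ (i, j) = ?F (c1, d1, E1) $$ (i, j)"
      proof (cases "i < 2")
        case True
        then have i: "i = 0 \<or> i = 1" by auto
        show ?thesis
        proof (cases "j < 2")
          case True
          then have "j = 0 \<or> j = 1" by auto
          with i show ?thesis using c Ec z z' ij by (auto simp: K_def c1_def)
        next
          case False
          then obtain j' where "j = j' + 2" using nat_le_iff_add[of 2 j] by (auto simp: add.commute not_less)
          then show ?thesis using i c Ec z' ij sym[of 1 j] by (auto simp: K_def G_def d1_def)
        qed
      next
        case False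
        then obtain i' where i': "i = i' + 2" using nat_le_iff_add[of 2 i] by (auto simp: add.commute not_less)
        show ?thesis
        proof (cases "j < 2")
          case True
          then have "j = 0 \<or> j = 1" by auto
          then show ?thesis using c Ec z ij i' by (auto simp: K_def G_def d1_def)
        next
          case False
          then obtain j' where "j = j' + 2" using nat_le_iff_add[of 2 j] by (auto simp: add.commute not_less)
          then show ?thesis using c Ec ij i' by (auto simp: K_def E1_def)
        qed
      qed
    qed (use Mc c Ec in \<open>auto simp: K_def\<close>)
    moreover have "E1 \<in> SymI l"
    proof -
      have "?U d1 * ?B c1 E1 * transpose_mat (?U d1) \<in> SymI (2 + l)"
        using M(1) calculation eqF[OF Ec(1)] by simp
      then have dm: "det (?U d1 * ?B c1 E1 * transpose_mat (?U d1)) \<noteq> 0" by (simp add: SymI_def GLd_def)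
      have Bc: "?B c1 E1 \<in> carrier_mat (2 + l) (2 + l)" using Ec c(1) by (intro four_block_carrier_mat) auto
      have Uc: "?U d1 \<in> carrier_mat (2 + l) (2 + l)" using GLd_carrier[OF U] .
      have "det (?B c1 E1) \<noteq> 0"
        using dm det_mult[OF mult_carrier_mat[OF Uc Bc], of "transpose_mat (?U d1)"] det_mult[OF Uc Bc] Uc by auto
      moreover have "det (?B c1 E1) = det (K c1) * det E1"
        using Ec c(1) by (subst det_four_block_mat_upper_right_zero[where n = 2 and m = l]) auto
      moreover have "transpose_mat E1 = E1" using sym by (intro eq_matI) (auto simp: E1_def)
      ultimately show ?thesis using Ec by (simp add: SymI_def GLd_def)
    qed
    ultimately show "\<exists>x\<in>?S. M = ?F x" using Ec by (intro bexI[of _ "(c1, d1, E1)"]) auto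
  qed
  then have "card ?T = card ?S" by (simp add: bij_betw_same_card)
  then show ?thesis by (simp add: card_cartesian_product card_carrier_mat)
qed

lemma card_SymI_0: "card (SymI 0 :: 'a::field mat set) = 1"
proof -
  have "SymI 0 = {1\<^sub>m 0 :: 'a mat}" by (auto simp: SymI_def GLd_def)
  then show ?thesis by simp
qed

text \<open>Sorting by the first column: q - 1 nonzero pivots with q^k columns below each, and the
  zero pivot, for which invertibility forbids a vanishing column.\<close>

lemma card_SymI_split:
  "card (SymI (Suc k) :: 'a::{field,finite} mat set) = (CARD('a) - 1) * CARD('a) ^ k * card (SymI k :: 'a mat set)
    + (\<Sum>v\<in>carrier_mat k 1 - {0\<^sub>m k 1}. card {M \<in> SymI (Suc k). M * col_e1 (Suc k) = vcons (0::'a) v})"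
proof -
  let ?N = "\<lambda>w. card {M \<in> SymI (Suc k) :: 'a mat set. M * col_e1 (Suc k) = w}"
  have "\<forall>M\<in>SymI (Suc k) :: 'a mat set. M * col_e1 (Suc k) \<in> carrier_mat (Suc k) 1"
    by (auto intro!: mult_carrier_mat[where n = "Suc k"] dest: SymI_D)
  then have "card (SymI (Suc k) :: 'a mat set) = (\<Sum>w\<in>carrier_mat (Suc k) 1. ?N w)"
    using sum.group[of "SymI (Suc k) :: 'a mat set" "carrier_mat (Suc k) 1" "\<lambda>M. M * col_e1 (Suc k)" "\<lambda>_. 1::nat"]
    by (simp add: image_subset_iff)
  also have "\<dots> = (\<Sum>(a, v)\<in>UNIV \<times> carrier_mat k 1. ?N (vcons a v))"
    using sum.reindex_bij_betw[OF bij_betw_vcons[of k], where g = ?N] by (simp add: case_prod_beta)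
  also have "\<dots> = (\<Sum>a\<in>UNIV. \<Sum>v\<in>carrier_mat k 1. ?N (vcons a v))"
    by (simp add: sum.cartesian_product)
  also have "\<dots> = (\<Sum>a\<in>UNIV - {0}. \<Sum>v\<in>carrier_mat k 1. ?N (vcons a v))
      + (\<Sum>v\<in>carrier_mat k 1. ?N (vcons 0 v))"
    by (subst sum.remove[of _ 0]) auto
  also have "(\<Sum>a\<in>UNIV - {0}. \<Sum>v\<in>carrier_mat k 1. ?N (vcons a v))
      = (\<Sum>a\<in>UNIV - {0::'a}. \<Sum>v\<in>(carrier_mat k 1 :: 'a mat set). card (SymI k :: 'a mat set))"
    by (intro sum.cong refl) (simp add: card_SymI_pivot)
  also have "\<dots> = (CARD('a) - 1) * CARD('a) ^ k * card (SymI k :: 'a mat set)"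
    by (simp add: card_carrier_mat card_Diff_subset One_nat_def)
  also have "(\<Sum>v\<in>carrier_mat k 1. ?N (vcons 0 v)) = (\<Sum>v\<in>carrier_mat k 1 - {0\<^sub>m k 1}. ?N (vcons 0 v))"
  proof (rule sum.mono_neutral_right)
    have "False" if M: "M \<in> SymI (Suc k)" "M * col_e1 (Suc k) = vcons (0::'a) (0\<^sub>m k 1)" for M
    proof -
      have "vcons (0::'a) (0\<^sub>m k 1) = 0\<^sub>m (Suc k) 1" by (rule eq_matI) (auto simp: vcons_def)
      then have "col_e1 (Suc k) = minv M * 0\<^sub>m (Suc k) 1"
        using GLd_left_cancel(1)[OF SymI_D(1)[OF M(1)] col_e1_carrier] M(2) by simp
      also have "\<dots> = 0\<^sub>m (Suc k) 1" using minv(1)[OF SymI_D(1)[OF M(1)]] by simp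
      finally have "(col_e1 (Suc k) :: 'a mat) $$ (0, 0) = 0" by simp
      then show False by (simp add: col_e1_def)
    qed
    then have "{M \<in> SymI (Suc k). M * col_e1 (Suc k) = vcons (0::'a) (0\<^sub>m k 1)} = {}" by blast
    then show "\<forall>v\<in>carrier_mat k 1 - (carrier_mat k 1 - {0\<^sub>m k 1}). ?N (vcons 0 v) = 0" by auto
  qed auto
  finally show ?thesis .
qed

lemma card_SymI_1: "card (SymI 1 :: 'a::{field,finite} mat set) = CARD('a) - 1"
proof -
  have *: "carrier_mat 0 1 - {0\<^sub>m 0 1} = ({} :: 'a mat set)" by auto
  show ?thesis using card_SymI_split[of 0, where 'a = 'a] unfolding * by (simp add: card_SymI_0 One_nat_def)
qed

lemma card_SymI_Suc_Suc:
  "card (SymI (Suc (Suc l)) :: 'a::{field,finite} mat set)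
   = (CARD('a) - 1) * CARD('a) ^ Suc l * card (SymI (Suc l) :: 'a mat set)
     + (CARD('a) ^ Suc l - 1) * CARD('a) ^ Suc l * card (SymI l :: 'a mat set)"
  unfolding card_SymI_split[of "Suc l"]
  by (simp add: card_SymI_zero_pivot card_SymI_hyperbolic card_carrier_mat card_Diff_subset One_nat_def del: power_Suc)

section \<open>Alternating matrices\<close>

lemma eq_minus_self_imp_0:
  fixes x :: "'a::field"
  assumes "(2::'a) \<noteq> 0" "x = - x"
  shows "x = 0"
proof -
  have "2 * x = 0" using assms(2) by (metis add.right_inverse mult_2)
  with assms(1) show ?thesis by simp
qed

text \<open>The diagonal needs no separate clause: at i = j the condition reads x = -x, which forces
  0 once 2 is nonzero.\<close>

definition Alt :: "nat \<Rightarrow> 'a::comm_ring_1 mat set" where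
  "Alt m = {S \<in> carrier_mat m m. \<forall>i<m. \<forall>j<m. S $$ (j, i) = - S $$ (i, j)}"

lemma Alt_carrier: "S \<in> Alt m \<Longrightarrow> S \<in> carrier_mat m m"
  and Alt_swap: "S \<in> Alt m \<Longrightarrow> i < m \<Longrightarrow> j < m \<Longrightarrow> S $$ (j, i) = - S $$ (i, j)"
  unfolding Alt_def by blast+

lemma AltI:
  "S \<in> carrier_mat m m \<Longrightarrow> (\<And>i j. i < m \<Longrightarrow> j < m \<Longrightarrow> S $$ (j, i) = - S $$ (i, j)) \<Longrightarrow> S \<in> Alt m"
  unfolding Alt_def by blast

definition tri :: "nat \<Rightarrow> (nat \<times> nat) set" where
  "tri m = {(i, j). i < j \<and> j < m}"

lemma finite_tri [simp]: "finite (tri m)"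
  by (rule finite_subset[of _ "{..<m} \<times> {..<m}"]) (auto simp: tri_def)

lemma card_tri: "card (tri m) = m * (m - 1) div 2"
proof (induction m)
  case (Suc m)
  have "tri (Suc m) = tri m \<union> (\<lambda>i. (i, m)) ` {..<m}" by (auto simp: tri_def)
  moreover have "card ((\<lambda>i. (i, m)) ` {..<m}) = m" by (subst card_image) (auto simp: inj_on_def)
  moreover have "tri m \<inter> (\<lambda>i. (i, m)) ` {..<m} = {}" by (auto simp: tri_def)
  ultimately have "card (tri (Suc m)) = card (tri m) + m"
    by (simp add: card_Un_disjoint)
  also have "\<dots> = Suc m * (Suc m - 1) div 2" using Suc by (cases m) (auto simp: algebra_simps)
  finally show ?case .
qed (simp add: tri_def)

lemma finite_Alt [simp]: "finite (Alt m :: 'a::{field,finite} mat set)"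
  by (rule finite_subset[of _ "carrier_mat m m"]) (auto dest: Alt_carrier)

text \<open>The entries on K, above the diagonal, are free and determine the rest. A general K
  serves both the full count and the count with vanishing corner.\<close>

lemma card_Alt_supported:
  assumes two: "(2::'a::{field,finite}) \<noteq> 0" and K: "K \<subseteq> tri m"
  shows "card {S \<in> Alt m :: 'a mat set. \<forall>(i, j)\<in>tri m - K. S $$ (i, j) = 0} = CARD('a) ^ card K"
proof -
  let ?T = "{S \<in> Alt m :: 'a mat set. \<forall>(i, j)\<in>tri m - K. S $$ (i, j) = 0}"
  let ?g = "\<lambda>f. mat m m (\<lambda>(i, j). if (i, j) \<in> K then f (i, j) else if (j, i) \<in> K then - f (j, i) else (0::'a))"
  have Kd: "i < j \<and> j < m" if "(i, j) \<in> K" for i j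
    using subsetD[OF K that] by (simp add: tri_def)
  have "bij_betw (\<lambda>S. restrict (\<lambda>ij. S $$ ij) K) ?T (K \<rightarrow>\<^sub>E UNIV)"
  proof (rule bij_betwI[where g = ?g])
    have nK: "(j, i) \<notin> K" if "(i, j) \<in> K" for i j using Kd[OF that] Kd[of j i] by auto
    have "?g f \<in> Alt m" for f by (rule AltI) (auto simp: nK)
    moreover have "?g f $$ (i, j) = 0" if "(i, j) \<in> tri m" "(i, j) \<notin> K" for f i j
    proof -
      have ij: "i < j" "j < m" using that by (auto simp: tri_def)
      then have "(j, i) \<notin> K" using Kd[of j i] by auto
      with ij that show ?thesis by simp
    qed
    ultimately show "?g \<in> (K \<rightarrow>\<^sub>E UNIV) \<rightarrow> ?T" by blast
    show "restrict (\<lambda>ij. ?g f $$ ij) K = f" if "f \<in> K \<rightarrow>\<^sub>E UNIV" for f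
    proof
      fix ij show "restrict (\<lambda>ij. ?g f $$ ij) K ij = f ij"
      proof (cases "ij \<in> K")
        case True
        then show ?thesis using Kd[of "fst ij" "snd ij"] by (cases ij) auto
      next
        case False
        then show ?thesis using PiE_arb[OF that] by simp
      qed
    qed
    show "?g (restrict (\<lambda>ij. S $$ ij) K) = S" if S: "S \<in> ?T" for S
    proof (rule eq_matI)
      fix i j assume ij: "i < dim_row S" "j < dim_col S"
      then have ij': "i < m" "j < m" using S by (auto dest: Alt_carrier)
      have alt: "S $$ (j, i) = - S $$ (i, j)" using S ij' by (blast intro: Alt_swap)
      have z: "S $$ (a, b) = 0" if "(a, b) \<in> tri m" "(a, b) \<notin> K" for a b using S that by blast
      have diag: "S $$ (i, j) = 0" if "i = j"
        by (rule eq_minus_self_imp_0[OF two]) (use alt that in metis)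
      consider "i < j" | "i = j" | "j < i" by linarith
      then show "?g (restrict (\<lambda>ij. S $$ ij) K) $$ (i, j) = S $$ (i, j)"
      proof cases
        case 1
        then show ?thesis using ij' z[of i j] Kd[of j i] by (auto simp: tri_def)
      next
        case 2
        then show ?thesis using ij' diag Kd[of j i] by auto
      next
        case 3
        then show ?thesis using ij' z[of j i] Kd[of i j] alt by (auto simp: tri_def)
      qed
    qed (use S in \<open>auto dest: Alt_carrier\<close>)
  qed auto
  then have "card ?T = card (K \<rightarrow>\<^sub>E (UNIV :: 'a set))" by (rule bij_betw_same_card)
  also have "\<dots> = CARD('a) ^ card K"
    using finite_subset[OF K finite_tri] by (simp add: card_PiE)
  finally show ?thesis .
qed

lemma card_Alt:
  assumes "(2::'a::{field,finite}) \<noteq> 0"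
  shows "card (Alt m :: 'a mat set) = CARD('a) ^ (m * (m - 1) div 2)"
  using card_Alt_supported[OF assms, of "tri m" m] by (simp add: card_tri)

text \<open>Vanishing on the corner removes \<open>card (tri r)\<close> free entries; the product
  form avoids a difference of exponents.\<close>

lemma card_Alt_corner:
  assumes two: "(2::'a::{field,finite}) \<noteq> 0" and r: "r \<le> m"
  shows "card {S \<in> Alt m :: 'a mat set. \<forall>i<r. \<forall>j<r. S $$ (i, j) = 0} * CARD('a) ^ (r * (r - 1) div 2)
    = CARD('a) ^ (m * (m - 1) div 2)"
proof -
  have sub: "tri r \<subseteq> tri m" using r by (auto simp: tri_def)
  have "{S \<in> Alt m :: 'a mat set. \<forall>i<r. \<forall>j<r. S $$ (i, j) = 0}
      = {S \<in> Alt m. \<forall>(i, j)\<in>tri m - (tri m - tri r). S $$ (i, j) = 0}"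
  proof (intro Collect_cong conj_cong refl iffI)
    fix S :: "'a mat" assume z: "\<forall>i<r. \<forall>j<r. S $$ (i, j) = 0"
    have "S $$ (i, j) = 0" if "(i, j) \<in> tri r" for i j
      using that z by (simp add: tri_def)
    then show "\<forall>(i, j)\<in>tri m - (tri m - tri r). S $$ (i, j) = 0" by blast
  next
    fix S :: "'a mat" assume S: "S \<in> Alt m" and "\<forall>(i, j)\<in>tri m - (tri m - tri r). S $$ (i, j) = 0"
    then have z: "\<forall>(i, j)\<in>tri r. S $$ (i, j) = 0" using sub by blast
    have alt: "S $$ (j, i) = - S $$ (i, j)" if "i < r" "j < r" for i j 
      by (rule Alt_swap[OF S]) (use that r in auto)
    have less: "S $$ (i, j) = 0" if "i < j" "j < r" for i j
      using bspec[OF z, of "(i, j)"] that by (simp add: tri_def)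
    show "\<forall>i<r. \<forall>j<r. S $$ (i, j) = 0"
    proof (intro allI impI)
      fix i j assume ij: "i < r" "j < r"
      consider "i < j" | "i = j" | "j < i" by linarith
      then show "S $$ (i, j) = 0"
      proof cases
        case 2
        show ?thesis by (rule eq_minus_self_imp_0[OF two]) (use alt[OF ij] 2 in metis)
      next
        case 3
        then show ?thesis using less[of j i] alt[of j i] ij by simp
      qed (use less ij in simp)
    qed
  qed
  then have "card {S \<in> Alt m :: 'a mat set. \<forall>i<r. \<forall>j<r. S $$ (i, j) = 0} = CARD('a) ^ card (tri m - tri r)"
    using card_Alt_supported[OF two, of "tri m - tri r" m] by simp
  moreover have "card (tri m - tri r) + card (tri r) = card (tri m)"
    using sub by (simp add: card_Diff_subset card_mono)
  ultimately show ?thesis by (metis card_tri power_add)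
qed

text \<open>For r \<le> m the trace of the leading r x r corner of A * S; this is how the block A *
  B enters the trace after multiplication by \<open>sigma_mat\<close>.\<close>

definition corner_pairing :: "nat \<Rightarrow> nat \<Rightarrow> 'a::field mat \<Rightarrow> 'a mat \<Rightarrow> 'a" where
  "corner_pairing m r A S = (\<Sum>k<r. \<Sum>l<m. A $$ (k, l) * S $$ (l, k))"

lemma corner_pairing_add:
  assumes "S \<in> carrier_mat m m" "T \<in> carrier_mat m m" "r \<le> m"
  shows "corner_pairing m r A (S + T) = corner_pairing m r A S + corner_pairing m r A T"
  using assms unfolding corner_pairing_def
  by (simp add: sum.distrib[symmetric] distrib_left)

text \<open>The pairing is linear in S. If it is not identically 0, its values are equidistributed
  and the sum vanishes; it is identically 0 exactly when the first r rows of A form a symmetric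
  block followed by zeros.\<close>

lemma sum_alternating:
  fixes f :: "'a::{field,finite} \<Rightarrow> rat" and A :: "'a mat"
  assumes two: "(2::'a) \<noteq> 0" and f: "mean_zero f" and r: "r \<le> m"
  shows "(\<Sum>S\<in>Alt m. f (c + corner_pairing m r A S))
    = (if (\<forall>k<r. \<forall>l<m. r \<le> l \<longrightarrow> A $$ (k, l) = 0) \<and> (\<forall>k<r. \<forall>l<r. A $$ (k, l) = A $$ (l, k))
       then of_nat (card (Alt m :: 'a mat set)) * f c else 0)"
proof -
  let ?L = "corner_pairing m r A"
  have zero: "(\<Sum>S\<in>Alt m. f (c + ?L S)) = 0" if S0: "S0 \<in> Alt m" "?L S0 \<noteq> 0" for S0
  proof -
    have shift: "(\<Sum>S\<in>Alt m. f (c + ?L S)) = (\<Sum>S\<in>Alt m. f ((c + ?L S) + ?L S0 * y))" for y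
    proof -
      have "bij_betw (\<lambda>S. S + y \<cdot>\<^sub>m S0) (Alt m) (Alt m)"
      proof (rule bij_betwI[where g = "\<lambda>S. S - y \<cdot>\<^sub>m S0"])
        have *: "S + t \<cdot>\<^sub>m S0 \<in> Alt m" if S: "S \<in> Alt m" for S t
        proof (rule AltI)
          fix i j assume "i < m" "j < m"
          then show "(S + t \<cdot>\<^sub>m S0) $$ (j, i) = - (S + t \<cdot>\<^sub>m S0) $$ (i, j)"
            using Alt_carrier[OF S] Alt_carrier[OF S0(1)] Alt_swap[OF S, of i j] Alt_swap[OF S0(1), of i j] by simp
        qed (use Alt_carrier[OF S] Alt_carrier[OF S0(1)] in simp)
        then show "(\<lambda>S. S + y \<cdot>\<^sub>m S0) \<in> Alt m \<rightarrow> Alt m" by blast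
        have "S - y \<cdot>\<^sub>m S0 = S + (- y) \<cdot>\<^sub>m S0" if "S \<in> Alt m" for S
          using Alt_carrier[OF that] Alt_carrier[OF S0(1)] by (intro eq_matI) auto
        then show "(\<lambda>S. S - y \<cdot>\<^sub>m S0) \<in> Alt m \<rightarrow> Alt m" using * by simp
        fix S :: "'a mat" assume "S \<in> Alt m"
        then show "S + y \<cdot>\<^sub>m S0 - y \<cdot>\<^sub>m S0 = S" "S - y \<cdot>\<^sub>m S0 + y \<cdot>\<^sub>m S0 = S"
          using Alt_carrier[of S m] Alt_carrier[OF S0(1)] by (auto intro!: eq_matI)
      qed
      from sum.reindex_bij_betw[OF this, of "\<lambda>S. f (c + ?L S)"]
      have "(\<Sum>S\<in>Alt m. f (c + ?L S)) = (\<Sum>S\<in>Alt m. f (c + ?L (S + y \<cdot>\<^sub>m S0)))" by simp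
      also have "\<dots> = (\<Sum>S\<in>Alt m. f ((c + ?L S) + ?L S0 * y))"
      proof (rule sum.cong[OF refl])
        fix S :: "'a mat" assume "S \<in> Alt m"
        then have "?L (S + y \<cdot>\<^sub>m S0) = ?L S + ?L (y \<cdot>\<^sub>m S0)"
          using S0 r by (intro corner_pairing_add) (auto dest: Alt_carrier)
        also have "?L (y \<cdot>\<^sub>m S0) = ?L S0 * y"
          using Alt_carrier[OF S0(1)] r by (simp add: corner_pairing_def sum_distrib_right sum_distrib_left mult_ac)
        finally show "f (c + ?L (S + y \<cdot>\<^sub>m S0)) = f ((c + ?L S) + ?L S0 * y)" by (simp add: add.assoc)
      qed
      finally show ?thesis .
    qed
    \<comment> \<open>Averaging over the translates by all multiples of S0 makes the inner argument
      run through the whole field.\<close>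
    have "of_nat CARD('a) * (\<Sum>S\<in>Alt m. f (c + ?L S)) = (\<Sum>y\<in>(UNIV :: 'a set). \<Sum>S\<in>Alt m. f (c + ?L S))" by simp
    also have "\<dots> = (\<Sum>y\<in>UNIV. \<Sum>S\<in>Alt m. f ((c + ?L S) + ?L S0 * y))" by (intro sum.cong refl shift)
    also have "\<dots> = (\<Sum>S\<in>Alt m. \<Sum>y\<in>UNIV. f ((c + ?L S) + ?L S0 * y))" by (rule sum.swap)
    also have "\<dots> = 0" using f S0(2) by (simp add: sum_affine mean_zero_def)
    finally show ?thesis by simp
  qed
  have elem: "(\<Sum>S\<in>Alt m. f (c + ?L S)) = 0"
    if kl: "k < r" "l < m" "k \<noteq> l" and ne: "A $$ (k, l) \<noteq> (if l < r then A $$ (l, k) else 0)" for k l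
  proof -
    \<comment> \<open>The elementary alternating matrix at (l, k), on which the pairing is A(k,l) -
      A(l,k), the second term being absent when l lies outside the corner.\<close>
    define S0 where "S0 = mat m m (\<lambda>(i, j). if i = l \<and> j = k then 1 else if i = k \<and> j = l then - 1 else (0::'a))"
    have "?L S0 = (\<Sum>i<r. \<Sum>j<m. (if i = k then (if j = l then A $$ (k, l) else 0) else 0)
        - (if i = l then (if j = k then A $$ (l, k) else 0) else 0))"
      unfolding corner_pairing_def using kl r by (intro sum.cong refl) (auto simp: S0_def)
    also have "\<dots> = (\<Sum>i<r. (if i = k then A $$ (k, l) else 0) - (if i = l then A $$ (l, k) else 0))"
      using kl r by (intro sum.cong refl) (simp add: sum_subtractf)
    also have "\<dots> = A $$ (k, l) - (if l < r then A $$ (l, k) else 0)"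
      using kl by (simp add: sum_subtractf)
    finally have "?L S0 \<noteq> 0" using ne by auto
    moreover have "S0 \<in> Alt m" using kl by (intro AltI) (auto simp: S0_def)
    ultimately show ?thesis using zero by blast
  qed
  show ?thesis
  proof (cases "(\<forall>k<r. \<forall>l<m. r \<le> l \<longrightarrow> A $$ (k, l) = 0) \<and> (\<forall>k<r. \<forall>l<r. A $$ (k, l) = A $$ (l, k))")
    case True
    have "?L S = 0" if S: "S \<in> Alt m" for S
    proof -
      have "?L S = (\<Sum>k<r. \<Sum>l<r. A $$ (k, l) * S $$ (l, k))"
        unfolding corner_pairing_def using r True
        by (intro sum.cong refl sum.mono_neutral_right) auto
      \<comment> \<open>Symmetric against alternating: exchanging the indices shows that the value
        equals its negative.\<close>
      also have "\<dots> = (\<Sum>k<r. \<Sum>l<r. - (A $$ (l, k) * S $$ (k, l)))"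
      proof (intro sum.cong refl)
        fix k l assume "k \<in> {..<r}" "l \<in> {..<r}"
        moreover from this have "S $$ (l, k) = - S $$ (k, l)" using r by (intro Alt_swap[OF S]) auto
        moreover have "A $$ (k, l) = A $$ (l, k)" using True calculation by auto
        ultimately show "A $$ (k, l) * S $$ (l, k) = - (A $$ (l, k) * S $$ (k, l))" by simp
      qed
      also have "\<dots> = - (\<Sum>l<r. \<Sum>k<r. A $$ (l, k) * S $$ (k, l))"
        by (subst sum.swap) (simp add: sum_negf)
      also have "(\<Sum>l<r. \<Sum>k<r. A $$ (l, k) * S $$ (k, l)) = ?L S"
        unfolding corner_pairing_def using r True
        by (intro sum.cong refl sum.mono_neutral_left) auto
      finally show ?thesis by (rule eq_minus_self_imp_0[OF two])
    qed
    then show ?thesis using True by simp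
  next
    case False
    then consider k l where "k < r" "l < m" "r \<le> l" "A $$ (k, l) \<noteq> 0"
      | k l where "k < r" "l < r" "A $$ (k, l) \<noteq> A $$ (l, k)" by blast
    then have "(\<Sum>S\<in>Alt m. f (c + ?L S)) = 0"
    proof cases
      case 1 then show ?thesis by (intro elem[of k l]) auto
    next
      case 2 then show ?thesis using r by (intro elem[of k l]) auto
    qed
    then show ?thesis unfolding if_not_P[OF False] .
  qed
qed

section \<open>Trace sums over general linear groups\<close>

lemma sum_lessThan_add:
  "(\<Sum>i<r + t. g i) = (\<Sum>i<r. g i) + (\<Sum>i<t::nat. g (r + i))" for g :: "nat \<Rightarrow> 'b::comm_monoid_add"
  by (induction t) (simp_all add: add.assoc)

lemma mat_tr_four_block:
  assumes "X \<in> carrier_mat r r" "D \<in> carrier_mat t t"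
  shows "mat_tr (four_block_mat X Y Z D) = mat_tr X + mat_tr D"
proof -
  have "mat_tr (four_block_mat X Y Z D) = (\<Sum>i<r + t. four_block_mat X Y Z D $$ (i, i))"
    using assms by (simp add: mat_tr_def)
  also have "\<dots> = (\<Sum>i<r. four_block_mat X Y Z D $$ (i, i)) + (\<Sum>i<t. four_block_mat X Y Z D $$ (r + i, r + i))"
    by (rule sum_lessThan_add)
  finally show ?thesis using assms by (simp add: mat_tr_def)
qed

lemma det_block_lower:
  assumes "X \<in> carrier_mat r r" "Y \<in> carrier_mat t r" "D \<in> carrier_mat t t"
  shows "det (four_block_mat X (0\<^sub>m r t) Y D) = det X * det (D :: 'a::field mat)"
  using assms by (intro det_four_block_mat_upper_right_zero) auto

text \<open>The set V of admissible corners is kept general: the trace sum needs the symmetric ones,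
  the stabiliser count all invertible ones.\<close>

lemma bij_betw_block_lower:
  assumes V: "V \<subseteq> GLd r"
  shows "bij_betw (\<lambda>(X, Y, D). four_block_mat X (0\<^sub>m r t) Y D)
    (V \<times> carrier_mat t r \<times> GLd t)
    {A \<in> GLd (r + t). (\<forall>i<r. \<forall>j<r + t. r \<le> j \<longrightarrow> A $$ (i, j) = 0) \<and> mat r r (\<lambda>ij. A $$ ij) \<in> (V :: 'a::field mat set)}"
    (is "bij_betw ?F ?S ?T")
proof (rule bij_betwI')
  fix x y assume "x \<in> ?S" "y \<in> ?S"
  then show "(?F x = ?F y) = (x = y)"
    using V by (auto simp: GLd_def four_block_eq_iff[of _ r r _ t _ t] subset_iff)
next
  fix x assume x: "x \<in> ?S"
  obtain X Y D where [simp]: "x = (X, Y, D)" by (metis prod_cases3)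
  have c: "X \<in> V" "X \<in> carrier_mat r r" "Y \<in> carrier_mat t r" "D \<in> carrier_mat t t" "det X \<noteq> 0" "det D \<noteq> 0"
    using x V by (auto simp: GLd_def)
  have "mat r r (\<lambda>ij. ?F x $$ ij) = X" using c by (intro eq_matI) auto
  moreover have "?F x \<in> GLd (r + t)" using c det_block_lower[OF c(2-4)] by (auto simp: GLd_def)
  moreover have "\<forall>i<r. \<forall>j<r + t. r \<le> j \<longrightarrow> ?F x $$ (i, j) = 0" using c by auto
  ultimately show "?F x \<in> ?T" using c by simp
next
  fix A assume "A \<in> ?T"
  then have A: "A \<in> carrier_mat (r + t) (r + t)" "det A \<noteq> 0"
    and z: "\<And>i j. i < r \<Longrightarrow> j < r + t \<Longrightarrow> r \<le> j \<Longrightarrow> A $$ (i, j) = 0"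
    and XV: "mat r r (\<lambda>ij. A $$ ij) \<in> V" by (auto simp: GLd_def)
  from A(1) obtain X Z Y D where blk: "X \<in> carrier_mat r r" "Z \<in> carrier_mat r t"
      "Y \<in> carrier_mat t r" "D \<in> carrier_mat t t" "A = four_block_mat X Z Y D" by (rule four_block_cases)
  have "Z = 0\<^sub>m r t"
  proof (rule eq_matI)
    fix i j assume "i < dim_row (0\<^sub>m r t)" "j < dim_col (0\<^sub>m r t)"
    then show "Z $$ (i, j) = 0\<^sub>m r t $$ (i, j)" using z[of i "r + j"] blk by simp
  qed (use blk in auto)
  then have AF: "A = ?F (X, Y, D)" using blk(5) by simp
  have "mat r r (\<lambda>ij. A $$ ij) = X" using blk by (intro eq_matI) auto
  then have "X \<in> V" using XV by simp
  moreover have "det D \<noteq> 0" using A(2) det_block_lower[OF blk(1,3,4)] unfolding AF by auto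
  ultimately have "(X, Y, D) \<in> ?S" using blk(3,4) by (simp add: GLd_def)
  with AF show "\<exists>x\<in>?S. A = ?F x" by blast
qed

lemma minv_block_lower:
  assumes X: "X \<in> GLd r" and Y: "Y \<in> carrier_mat t r" and D: "D \<in> GLd t"
  shows "minv (four_block_mat X (0\<^sub>m r t) Y D)
       = four_block_mat (minv X) (0\<^sub>m r t) (- (minv D * (Y * minv X))) (minv D)"
proof (rule minv_unique)
  note Xc = GLd_carrier[OF X] and Dc = GLd_carrier[OF D] and Xi = minv[OF X] and Di = minv[OF D]
  let ?M = "four_block_mat X (0\<^sub>m r t) Y D"
  let ?N = "four_block_mat (minv X) (0\<^sub>m r t) (- (minv D * (Y * minv X))) (minv D)"
  show "?M \<in> carrier_mat (r + t) (r + t)" "?N \<in> carrier_mat (r + t) (r + t)" using Xc Dc Xi Di by auto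
  have W: "Y * minv X \<in> carrier_mat t r" using Y Xi by simp
  have "D * (- (minv D * (Y * minv X))) = - (Y * minv X)"
    using GLd_left_cancel(2)[OF D W] Dc Di W by simp
  moreover have "W + - W = 0\<^sub>m t r" if "W \<in> carrier_mat t r" for W :: "'a mat"
    using that by (intro eq_matI) auto
  ultimately have "Y * minv X + D * (- (minv D * (Y * minv X))) = 0\<^sub>m t r"
    using W by simp
  moreover have "X * 0\<^sub>m r t + 0\<^sub>m r t * minv D = 0\<^sub>m r t" "X * minv X + 0\<^sub>m r t * (- (minv D * (Y * minv X))) = 1\<^sub>m r"
    "Y * 0\<^sub>m r t + D * minv D = 1\<^sub>m t"
    using Xc Xi Di Dc Y W by auto
  ultimately have "?M * ?N = four_block_mat (1\<^sub>m r) (0\<^sub>m r t) (0\<^sub>m t r) (1\<^sub>m t)"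
    using Xc Xi Di Dc Y W by (subst mult_four_block_mat[of _ r r _ t _ t _ _ r _ t]) auto
  then show "?M * ?N = 1\<^sub>m (r + t)" by simp
qed

text \<open>The block Y is free and affects neither the corner X nor the last diagonal entries of A
  and its inverse, so it contributes only the factor q^(rt).\<close>

lemma sum_block_lower:
  fixes H :: "'a::{field,finite} mat \<Rightarrow> 'a \<Rightarrow> rat"
  assumes V: "V \<subseteq> GLd r"
  shows "(\<Sum>A\<in>{A \<in> GLd (r + t). (\<forall>i<r. \<forall>j<r + t. r \<le> j \<longrightarrow> A $$ (i, j) = 0) \<and> mat r r (\<lambda>ij. A $$ ij) \<in> V}.
      H (mat r r (\<lambda>ij. A $$ ij)) (\<Sum>i<t. A $$ (r + i, r + i) + minv A $$ (r + i, r + i)))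
    = of_nat CARD('a) ^ (r * t) * (\<Sum>X\<in>V. \<Sum>D\<in>GLd t. H X (mat_tr D + mat_tr (minv D)))"
proof -
  let ?T = "{A \<in> GLd (r + t). (\<forall>i<r. \<forall>j<r + t. r \<le> j \<longrightarrow> A $$ (i, j) = 0) \<and> mat r r (\<lambda>ij. A $$ ij) \<in> V}"
  let ?G = "\<lambda>A. H (mat r r (\<lambda>ij. A $$ ij)) (\<Sum>i<t. A $$ (r + i, r + i) + minv A $$ (r + i, r + i))"
  have "(\<Sum>A\<in>?T. ?G A) = (\<Sum>x\<in>V \<times> carrier_mat t r \<times> GLd t. ?G (case x of (X, Y, D) \<Rightarrow> four_block_mat X (0\<^sub>m r t) Y D))"
    by (rule sum.reindex_bij_betw[OF bij_betw_block_lower[OF V, of t], of ?G, symmetric])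
  also have "\<dots> = (\<Sum>(X, Y, D)\<in>V \<times> (carrier_mat t r :: 'a mat set) \<times> GLd t. H X (mat_tr D + mat_tr (minv D)))"
  proof (rule sum.cong[OF refl])
    fix x assume x: "x \<in> V \<times> (carrier_mat t r :: 'a mat set) \<times> (GLd t :: 'a mat set)"
    obtain X Y D where [simp]: "x = (X, Y, D)" by (metis prod_cases3)
    have XV: "X \<in> GLd r" and Y: "Y \<in> carrier_mat t r" and D: "D \<in> GLd t" using x V by auto
    note c = GLd_carrier[OF XV] Y GLd_carrier[OF D] minv(1)[OF XV] minv(1)[OF D]
    have "mat r r (\<lambda>ij. four_block_mat X (0\<^sub>m r t) Y D $$ ij) = X" using c by (intro eq_matI) auto
    moreover have "(\<Sum>i<t. four_block_mat X (0\<^sub>m r t) Y D $$ (r + i, r + i)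
        + minv (four_block_mat X (0\<^sub>m r t) Y D) $$ (r + i, r + i)) = mat_tr D + mat_tr (minv D)"
      unfolding minv_block_lower[OF XV Y D] using c by (simp add: mat_tr_def sum.distrib)
    ultimately show "H (mat r r (\<lambda>ij. (case x of (X, Y, D) \<Rightarrow> four_block_mat X (0\<^sub>m r t) Y D) $$ ij))
        (\<Sum>i<t. (case x of (X, Y, D) \<Rightarrow> four_block_mat X (0\<^sub>m r t) Y D) $$ (r + i, r + i)
          + minv (case x of (X, Y, D) \<Rightarrow> four_block_mat X (0\<^sub>m r t) Y D) $$ (r + i, r + i))
      = (case x of (X, Y, D) \<Rightarrow> H X (mat_tr D + mat_tr (minv D)))" by simp
  qed
  also have "\<dots> = (\<Sum>X\<in>V. \<Sum>Y\<in>(carrier_mat t r :: 'a mat set). \<Sum>D\<in>GLd t. H X (mat_tr D + mat_tr (minv D)))"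
    by (simp add: sum.cartesian_product del: sum_constant)
  also have "\<dots> = of_nat CARD('a) ^ (r * t) * (\<Sum>X\<in>V. \<Sum>D\<in>GLd t. H X (mat_tr D + mat_tr (minv D)))"
    by (simp add: card_carrier_mat sum_distrib_left mult.commute)
  finally show ?thesis .
qed

lemma sum_GLd_0:
  fixes H :: "'a::field \<Rightarrow> rat"
  shows "(\<Sum>D\<in>GLd 0. H (mat_tr D + mat_tr (minv D))) = H 0"
proof -
  have "GLd 0 = {1\<^sub>m 0 :: 'a mat}" by (auto simp: GLd_def)
  moreover have "minv (1\<^sub>m 0 :: 'a mat) = 1\<^sub>m 0" by (rule minv_unique[of _ 0]) auto
  ultimately show ?thesis by (simp add: mat_tr_def)
qed

lemma sum_GLd_1:
  fixes H :: "'a::field \<Rightarrow> rat"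
  shows "(\<Sum>D\<in>GLd 1. H (mat_tr D + mat_tr (minv D))) = (\<Sum>a\<in>UNIV - {0}. H (a + inverse a))"
proof -
  have bij: "bij_betw mat_sc (UNIV - {0::'a}) (GLd 1)"
    by (rule bij_betwI[where g = "\<lambda>A. A $$ (0, 0)"])
       (auto simp: GLd_def carrier_mat_1_1E[symmetric] det_single)
  have "mat_tr (mat_sc a) + mat_tr (minv (mat_sc a)) = a + inverse a" if "a \<noteq> 0" for a :: 'a
  proof -
    have "minv (mat_sc a) = mat_sc (inverse a)"
      by (rule minv_unique[of _ 1]) (use that in \<open>auto simp: scalar_prod_def intro!: eq_matI\<close>)
    then show ?thesis by (simp add: mat_tr_def lessThan_Suc One_nat_def mat_sc_def)
  qed
  then show ?thesis
    using sum.reindex_bij_betw[OF bij, of "\<lambda>D. H (mat_tr D + mat_tr (minv D))"] by simp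
qed

abbreviation mat22 :: "'a \<Rightarrow> 'a \<Rightarrow> 'a \<Rightarrow> 'a \<Rightarrow> 'a mat" where
  "mat22 a b c d \<equiv> four_block_mat (mat_sc a) (mat_sc b) (mat_sc c) (mat_sc d)"

lemma det_mat22: "det (mat22 a b c d) = a * d - b * (c :: 'a::field)"
proof -
  have "mat_sc x * mat_sc y = mat_sc (x * y)" for x y :: 'a
    by (rule eq_matI) (auto simp: scalar_prod_def)
  moreover have "mat_sc x - mat_sc y = mat_sc (x - y)" for x y :: 'a by (rule eq_matI) auto
  ultimately show ?thesis by (subst det_four_block_mat[of _ 1]) (auto simp: mult.commute)
qed

lemma mat_tr_mat22: "mat_tr (mat22 a b c d) = a + (d :: 'a::field)"
proof -
  have "mat_tr (mat_sc x) = x" for x :: 'a by (simp add: mat_tr_def lessThan_Suc One_nat_def mat_sc_def)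
  then show ?thesis by (simp add: mat_tr_four_block[of _ 1 _ 1])
qed

lemma mat_tr_minv_mat22:
  assumes "a * d - b * c \<noteq> (0 :: 'a::field)"
  shows "mat_tr (minv (mat22 a b c d)) = (a + d) / (a * d - b * c)"
proof -
  let ?D = "a * d - b * c"
  have m: "mat_sc x * mat_sc y + mat_sc z * mat_sc w = mat_sc (x * y + z * w)" for x y z w :: 'a
    by (rule eq_matI) (auto simp: scalar_prod_def)
  have s: "mat_sc 1 = 1\<^sub>m 1" "mat_sc 0 = 0\<^sub>m 1 1" by (auto intro!: eq_matI simp: mat_sc_def)
  have "minv (mat22 a b c d) = mat22 (d / ?D) (- b / ?D) (- c / ?D) (a / ?D)"
  proof (rule minv_unique[of _ 2])
    have e: "a * (d / ?D) + b * (- c / ?D) = 1" "a * (- b / ?D) + b * (a / ?D) = 0"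
      "c * (d / ?D) + d * (- c / ?D) = 0" "c * (- b / ?D) + d * (a / ?D) = 1"
    proof -
      have "a * (d / ?D) + b * (- c / ?D) = ?D / ?D" "c * (- b / ?D) + d * (a / ?D) = ?D / ?D"
        unfolding diff_divide_distrib by (simp_all add: mult.commute)
      then show "a * (d / ?D) + b * (- c / ?D) = 1" "c * (- b / ?D) + d * (a / ?D) = 1"
        using assms by simp_all
    qed simp_all
    have "mat22 a b c d * mat22 (d / ?D) (- b / ?D) (- c / ?D) (a / ?D) = mat22 1 0 0 1"
      by (subst mult_four_block_mat[of _ 1 1 _ 1 _ 1 _ _ 1 _ 1]) (simp_all only: m e, auto)
    also have "\<dots> = 1\<^sub>m (1 + 1)" unfolding s by (rule four_block_one_mat)
    finally show "mat22 a b c d * mat22 (d / ?D) (- b / ?D) (- c / ?D) (a / ?D) = 1\<^sub>m 2"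
      by (simp add: numeral_2_eq_2 One_nat_def)
  qed (auto simp: numeral_2_eq_2 One_nat_def)
  then show ?thesis by (simp add: mat_tr_mat22 add_divide_distrib add.commute)
qed

lemma bij_betw_mat22:
  "bij_betw (\<lambda>(a, b, c, d). mat22 a b c (d :: 'a::field))
     {(a, b, c, d). a * d - b * c \<noteq> 0} (GLd 2)"
proof (rule bij_betwI')
  fix x y :: "'a \<times> 'a \<times> 'a \<times> 'a"
  have "mat_sc p = mat_sc q \<longleftrightarrow> p = q" for p q :: 'a by (metis mat_sc_index)
  then show "((case x of (a, b, c, d) \<Rightarrow> mat22 a b c d) = (case y of (a, b, c, d) \<Rightarrow> mat22 a b c d)) = (x = y)"
    by (auto simp: four_block_eq_iff[of _ 1 1 _ 1 _ 1] split: prod.splits)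
next
  fix x :: "'a \<times> 'a \<times> 'a \<times> 'a" assume "x \<in> {(a, b, c, d). a * d - b * c \<noteq> 0}"
  then show "(case x of (a, b, c, d) \<Rightarrow> mat22 a b c d) \<in> GLd 2"
    by (auto simp: GLd_def det_mat22 numeral_2_eq_2 One_nat_def)
next
  fix M :: "'a mat" assume M: "M \<in> GLd 2"
  then have "M \<in> carrier_mat (1 + 1) (1 + 1)" by (simp add: GLd_def numeral_2_eq_2 One_nat_def)
  then obtain A B C D where blk: "A \<in> carrier_mat 1 1" "B \<in> carrier_mat 1 1" "C \<in> carrier_mat 1 1"
    "D \<in> carrier_mat 1 1" "M = four_block_mat A B C D" by (rule four_block_cases)
  then obtain a b c d where "M = mat22 a b c d" using carrier_mat_1_1E by metis
  with M show "\<exists>x\<in>{(a, b, c, d). a * d - b * c \<noteq> 0}. M = (case x of (a, b, c, d) \<Rightarrow> mat22 a b c d)"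
    by (intro bexI[of _ "(a, b, c, d)"]) (auto simp: GLd_def det_mat22)
qed

text \<open>Split into a constant and a defect at 0, so that in \<open>sum_GLd_2\<close> the
  constant part can be summed by equidistribution.\<close>

lemma card_mult_eq:
  fixes u :: "'a::{field,finite}"
  shows "(of_nat (card {(b, c). b * c = u}) :: rat)
    = (of_nat CARD('a) - 1) + (if u = 0 then of_nat CARD('a) else 0)"
proof -
  have "{(b, c). b * c = u} = Sigma UNIV (\<lambda>b. {c. b * c = u})" by auto
  then have "card {(b, c). b * c = u} = (\<Sum>b\<in>UNIV. card {c. b * c = u})" by (simp add: card_SigmaI)
  also have "\<dots> = (\<Sum>b\<in>UNIV - {0}. card {c. b * c = u}) + card {c. 0 * c = u}"
    by (subst sum.remove[of _ 0]) auto
  also have "(\<Sum>b\<in>UNIV - {0}. card {c. b * c = u}) = (\<Sum>b\<in>UNIV - {0::'a}. 1)"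
  proof (rule sum.cong[OF refl])
    fix b :: 'a assume "b \<in> UNIV - {0}"
    then have "{c. b * c = u} = {u / b}" by (auto simp: field_simps)
    then show "card {c. b * c = u} = 1" by simp
  qed
  also have "\<dots> = CARD('a) - 1" by (simp add: One_nat_def)
  finally have *: "card {(b, c). b * c = u} = (CARD('a) - 1) + (if u = 0 then CARD('a) else 0)"
    by auto
  have "1 \<le> CARD('a)" by (simp add: One_nat_def Suc_leI)
  then show ?thesis unfolding * by (simp add: of_nat_diff)
qed

text \<open>The argument depends only on trace t and determinant D, as t + t / D. Matrices with
  given D, t and first entry a correspond to pairs with b c = a (t - a) - D; the constant part of
  their number yields the term with f x, the defect part the product of two Kloosterman
  sums.\<close>

lemma sum_GLd_2:
  fixes f :: "'a::{field,finite} \<Rightarrow> rat"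
  assumes f: "mean_zero f"
  shows "(\<Sum>D\<in>GLd 2. f (x + (mat_tr D + mat_tr (minv D))))
    = of_nat CARD('a) * (\<Sum>a\<in>UNIV - {0}. \<Sum>b\<in>UNIV - {0}. f (x + ((a + inverse a) + (b + inverse b))))
      + of_nat CARD('a) ^ 2 * (of_nat CARD('a) - 1) * f x"
proof -
  let ?q = "of_nat CARD('a) :: rat"
  let ?g = "\<lambda>D t. f (x + (t + t / D))"
  have "(\<Sum>D\<in>GLd 2. f (x + (mat_tr D + mat_tr (minv D))))
      = (\<Sum>(a, b, c, d)\<in>{(a, b, c, d). a * d - b * c \<noteq> 0}. ?g (a * d - b * c) (a + d))"
    by (subst sum.reindex_bij_betw[OF bij_betw_mat22, symmetric])
       (auto intro!: sum.cong simp: mat_tr_mat22 mat_tr_minv_mat22)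
  also have "\<dots> = (\<Sum>(D, t, a, b, c)\<in>Sigma (UNIV - {0}) (\<lambda>D. Sigma UNIV (\<lambda>t. Sigma UNIV (\<lambda>a. {(b, c). b * c = a * (t - a) - D}))). ?g D t)"
    by (rule sum.reindex_bij_witness[where i = "\<lambda>(D, t, a, b, c). (a, b, c, t - a)"
          and j = "\<lambda>(a, b, c, d). (a * d - b * c, a + d, a, b, c)"]) auto
  also have "\<dots> = (\<Sum>D\<in>UNIV - {0}. \<Sum>t\<in>UNIV. \<Sum>a\<in>UNIV. of_nat (card {(b, c). b * c = a * (t - a) - D}) * ?g D t)"
  proof -
    have "(\<Sum>(D, t, a, b, c)\<in>Sigma (UNIV - {0}) (\<lambda>D. Sigma UNIV (\<lambda>t. Sigma UNIV (\<lambda>a. {(b, c). b * c = a * (t - a) - D}))). ?g D t)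
        = (\<Sum>D\<in>UNIV - {0}. \<Sum>t\<in>UNIV. \<Sum>a\<in>UNIV. \<Sum>(b, c)\<in>{(b, c). b * c = a * (t - a) - D}. ?g D t)"
      by (simp add: sum.Sigma case_prod_beta del: sum_constant)
    then show ?thesis by simp
  qed
  also have "\<dots> = (\<Sum>D\<in>UNIV - {0}. \<Sum>t\<in>UNIV. \<Sum>a\<in>UNIV. (?q - 1) * ?g D t
      + (if a * (t - a) = D then ?q * ?g D t else 0))"
    by (intro sum.cong refl) (simp add: card_mult_eq distrib_right)
  also have "\<dots> = (\<Sum>D\<in>UNIV - {0}. \<Sum>t\<in>UNIV. ?q * (?q - 1) * ?g D t)
      + (\<Sum>D\<in>UNIV - {0}. \<Sum>t\<in>UNIV. \<Sum>a\<in>UNIV. if a * (t - a) = D then ?q * ?g D t else 0)"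
    by (simp add: sum.distrib mult.assoc)
  also have "(\<Sum>D\<in>UNIV - {0}. \<Sum>t\<in>UNIV. ?q * (?q - 1) * ?g D t) = ?q ^ 2 * (?q - 1) * f x"
  proof -
    \<comment> \<open>t + t / D = (1 + 1 / D) t runs through the field unless D = -1, where it is
      constantly 0.\<close>
    have "(\<Sum>t\<in>UNIV. ?g D t) = (if D = - 1 then ?q * f x else 0)" if "D \<noteq> 0" for D
    proof (cases "D = - 1")
      case False
      have nz: "1 + inverse D \<noteq> 0"
      proof
        assume "1 + inverse D = 0"
        then have "D * (1 + inverse D) = 0" by simp
        then have "D + 1 = 0" using that by (simp add: distrib_left)
        with False show False by (simp add: eq_neg_iff_add_eq_0)
      qed
      have "(\<Sum>t\<in>UNIV. ?g D t) = (\<Sum>t\<in>UNIV. f (x + (1 + inverse D) * t))"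
        by (simp add: field_simps)
      then show ?thesis using f False nz by (simp add: sum_affine mean_zero_def)
    qed simp
    then have "(\<Sum>D\<in>UNIV - {0}. \<Sum>t\<in>UNIV. ?q * (?q - 1) * ?g D t)
        = (\<Sum>D\<in>UNIV - {0::'a}. if D = - 1 then ?q * (?q - 1) * (?q * f x) else 0)"
      by (intro sum.cong refl) (simp flip: sum_distrib_left)
    also have "\<dots> = ?q * (?q - 1) * (?q * f x)" by simp
    finally show ?thesis by (simp add: power2_eq_square)
  qed
  also have "(\<Sum>D\<in>UNIV - {0}. \<Sum>t\<in>UNIV. \<Sum>a\<in>UNIV. if a * (t - a) = D then ?q * ?g D t else 0)
      = (\<Sum>a\<in>UNIV. \<Sum>t\<in>UNIV. \<Sum>D\<in>UNIV - {0}. if a * (t - a) = D then ?q * ?g D t else 0)"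
    by (subst sum.swap, subst sum.swap[of _ "UNIV - {0}" UNIV], subst sum.swap) simp
  \<comment> \<open>In the defect part D is determined as a (t - a), and its being nonzero means
    that a and t - a are; these two become the Kloosterman variables.\<close>
  also have "\<dots> = (\<Sum>a\<in>UNIV. \<Sum>t\<in>UNIV. if a \<noteq> 0 \<and> t - a \<noteq> 0 then ?q * ?g (a * (t - a)) t else 0)"
    by (intro sum.cong refl) auto
  also have "\<dots> = (\<Sum>a\<in>UNIV. \<Sum>b\<in>UNIV. if a \<noteq> 0 \<and> b \<noteq> 0 then ?q * ?g (a * b) (a + b) else 0)"
  proof (rule sum.cong[OF refl])
    fix a :: 'a
    have "bij_betw (\<lambda>b. a + b) UNIV UNIV" by (rule bij_betwI[where g = "\<lambda>t. t - a"]) auto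
    from sum.reindex_bij_betw[OF this, of "\<lambda>t. if a \<noteq> 0 \<and> t - a \<noteq> 0 then ?q * ?g (a * (t - a)) t else 0"]
    show "(\<Sum>t\<in>UNIV. if a \<noteq> 0 \<and> t - a \<noteq> 0 then ?q * ?g (a * (t - a)) t else 0)
        = (\<Sum>b\<in>UNIV. if a \<noteq> 0 \<and> b \<noteq> 0 then ?q * ?g (a * b) (a + b) else 0)" by (simp cong: if_cong)
  qed
  also have "\<dots> = (\<Sum>a\<in>UNIV - {0}. \<Sum>b\<in>UNIV - {0}. ?q * f (x + ((a + inverse a) + (b + inverse b))))"
  proof -
    have g: "?g (a * b) (a + b) = f (x + ((a + inverse a) + (b + inverse b)))" if "a \<noteq> 0" "b \<noteq> 0" for a b
    proof -
      have "(a + b) / (a * b) = inverse a + inverse b" using that by (simp add: field_simps)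
      then show ?thesis by (simp add: algebra_simps)
    qed
    have "(\<Sum>a\<in>UNIV. \<Sum>b\<in>UNIV. if a \<noteq> 0 \<and> b \<noteq> 0 then ?q * ?g (a * b) (a + b) else 0)
        = (\<Sum>a\<in>UNIV - {0}. \<Sum>b\<in>UNIV. if a \<noteq> 0 \<and> b \<noteq> 0 then ?q * ?g (a * b) (a + b) else 0)"
      by (rule sum.mono_neutral_right) auto
    also have "\<dots> = (\<Sum>a\<in>UNIV - {0}. \<Sum>b\<in>UNIV - {0}. if a \<noteq> 0 \<and> b \<noteq> 0 then ?q * ?g (a * b) (a + b) else 0)"
      by (intro sum.cong[OF refl] sum.mono_neutral_right) auto
    also have "\<dots> = (\<Sum>a\<in>UNIV - {0}. \<Sum>b\<in>UNIV - {0}. ?q * f (x + ((a + inverse a) + (b + inverse b))))"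
      by (intro sum.cong refl) (simp add: g)
    finally show ?thesis .
  qed
  finally show ?thesis by (simp add: sum_distrib_left)
qed

lemma corner_GLd:
  fixes A :: "'a::field mat"
  assumes A: "A \<in> GLd (r + t)" and z: "\<forall>i<r. \<forall>j<r + t. r \<le> j \<longrightarrow> A $$ (i, j) = 0"
  shows "mat r r (\<lambda>ij. A $$ ij) \<in> GLd r"
proof -
  from GLd_carrier[OF A] obtain X Z Y D where blk: "X \<in> carrier_mat r r" "Z \<in> carrier_mat r t"
      "Y \<in> carrier_mat t r" "D \<in> carrier_mat t t" "A = four_block_mat X Z Y D" by (rule four_block_cases)
  have "Z = 0\<^sub>m r t"
  proof (rule eq_matI)
    fix i j assume "i < dim_row (0\<^sub>m r t)" "j < dim_col (0\<^sub>m r t)"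
    then show "Z $$ (i, j) = 0\<^sub>m r t $$ (i, j)" using z[rule_format, of i "r + j"] blk by simp
  qed (use blk in auto)
  then have "det A = det X * det D" using det_block_lower[OF blk(1,3,4)] blk(5) by simp
  moreover have "mat r r (\<lambda>ij. A $$ ij) = X" using blk by (intro eq_matI) auto
  ultimately show ?thesis using A blk(1) by (simp add: GLd_def)
qed

section \<open>The trace sum in the free coordinates of the parabolic subgroup\<close>

definition gram :: "'a::field \<Rightarrow> 'a mat \<Rightarrow> 'a mat" where
  "gram e h = transpose_mat h * delta_eps e * h"

lemma gram_carrier [simp]: "h \<in> carrier_mat 2 m \<Longrightarrow> gram e h \<in> carrier_mat m m"
  by (auto simp: gram_def delta_eps_def intro!: mult_carrier_mat)

lemma gram_index:
  assumes "h \<in> carrier_mat 2 m" "k < m" "l < m"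
  shows "gram e h $$ (l, k) = h $$ (0, l) * h $$ (0, k) - e * (h $$ (1, l) * h $$ (1, k))"
proof -
  have s2: "{0..<2::nat} = {0, 1}" by auto
  show ?thesis using assms
    by (simp add: gram_def delta_eps_def scalar_prod_def s2)
qed

text \<open>Only the first r entries of each row enter; the other 2 t entries account for the power
  of q.\<close>

lemma sum_two_rows:
  fixes G :: "'a::finite mat \<Rightarrow> 'a mat \<Rightarrow> rat"
  shows "(\<Sum>h\<in>carrier_mat 2 (r + t). G (mat r 1 (\<lambda>(i, j). h $$ (0, i))) (mat r 1 (\<lambda>(i, j). h $$ (1, i))))
    = of_nat CARD('a) ^ (2 * t) * (\<Sum>x\<in>carrier_mat r 1. \<Sum>y\<in>carrier_mat r 1. G x y)"
proof -
  let ?r = "\<lambda>p h. mat r 1 (\<lambda>(i, j). h $$ (p, i)) :: 'a mat"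
  let ?S = "(carrier_mat 1 r :: 'a mat set) \<times> (carrier_mat 1 t :: 'a mat set)
      \<times> (carrier_mat 1 r :: 'a mat set) \<times> (carrier_mat 1 t :: 'a mat set)"
  let ?F = "\<lambda>(a, b, c, d). four_block_mat a b c (d :: 'a mat)"
  have two: "carrier_mat 2 (r + t) = (carrier_mat (1 + 1) (r + t) :: 'a mat set)"
    by (simp add: numeral_2_eq_2 One_nat_def)
  have bt: "bij_betw transpose_mat (carrier_mat 1 r) (carrier_mat r 1 :: 'a mat set)"
    by (rule bij_betwI[where g = transpose_mat]) auto
  have "(\<Sum>h\<in>carrier_mat 2 (r + t). G (?r 0 h) (?r 1 h)) = (\<Sum>x\<in>?S. G (?r 0 (?F x)) (?r 1 (?F x)))"
    unfolding two by (rule sum.reindex_bij_betw[OF bij_betw_four_block, of "\<lambda>h. G (?r 0 h) (?r 1 h)", symmetric])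
  also have "\<dots> = (\<Sum>(a, b, c, d)\<in>?S. G (transpose_mat a) (transpose_mat c))"
  proof (rule sum.cong[OF refl])
    fix x assume x: "x \<in> ?S"
    obtain a b c d where [simp]: "x = (a, b, c, d)" by (metis prod_cases4)
    have "?r 0 (?F x) = transpose_mat a" "?r 1 (?F x) = transpose_mat c"
      using x by (auto intro!: eq_matI)
    then show "G (?r 0 (?F x)) (?r 1 (?F x)) = (case x of (a, b, c, d) \<Rightarrow> G (transpose_mat a) (transpose_mat c))"
      by simp
  qed
  also have "\<dots> = (\<Sum>a\<in>carrier_mat 1 r. \<Sum>b\<in>(carrier_mat 1 t :: 'a mat set). \<Sum>c\<in>carrier_mat 1 r.
      \<Sum>d\<in>(carrier_mat 1 t :: 'a mat set). G (transpose_mat a) (transpose_mat c))"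
    by (simp add: sum.cartesian_product case_prod_beta del: sum_constant)
  also have "\<dots> = of_nat CARD('a) ^ (2 * t) * (\<Sum>a\<in>carrier_mat 1 r. \<Sum>c\<in>carrier_mat 1 r. G (transpose_mat a) (transpose_mat c))"
    by (simp add: card_carrier_mat mult_2 power_add mult.assoc flip: sum_distrib_left)
  also have "(\<Sum>a\<in>carrier_mat 1 r. \<Sum>c\<in>carrier_mat 1 r. G (transpose_mat a) (transpose_mat c))
      = (\<Sum>a\<in>carrier_mat 1 r. \<Sum>y\<in>carrier_mat r 1. G (transpose_mat a) y)"
    by (intro sum.cong refl sum.reindex_bij_betw[OF bt])
  also have "\<dots> = (\<Sum>x\<in>carrier_mat r 1. \<Sum>y\<in>carrier_mat r 1. G x y)"
    by (rule sum.reindex_bij_betw[OF bt, of "\<lambda>x. \<Sum>y\<in>carrier_mat r 1. G x y"])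
  finally show ?thesis .
qed

lemma sum_if_const: "(\<Sum>h\<in>X. if P then g h else 0) = (if P then sum g X else (0::'b::comm_monoid_add))"
  by (cases P) simp_all

text \<open>Origin of the factors: S gives \<open>card (Alt (r + t))\<close>, the 2 t entries of h
  outside the corner q^(2t), the corner entries of h (-q)^r, the lower left block of A q^(rt), and
  its symmetric corner \<open>card (SymI r)\<close>.\<close>

lemma sum_parabolic:
  fixes f :: "'a::{field,finite} \<Rightarrow> rat"
  assumes two: "(2::'a) \<noteq> 0" and e: "\<not> is_sq e" and f: "mean_zero f"
  shows "(\<Sum>A\<in>GLd (r + t). \<Sum>h\<in>carrier_mat 2 (r + t). \<Sum>S\<in>Alt (r + t).
      f (c + (\<Sum>i<t. A $$ (r + i, r + i) + minv A $$ (r + i, r + i)) + corner_pairing (r + t) r A (gram e h + S)))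
    = of_nat (card (Alt (r + t) :: 'a mat set)) * of_nat CARD('a) ^ (2 * t) * of_nat CARD('a) ^ (r * t)
      * (- of_nat CARD('a)) ^ r * of_nat (card (SymI r :: 'a mat set))
      * (\<Sum>D\<in>GLd t. f (c + (mat_tr D + mat_tr (minv D))))"
proof -
  let ?m = "r + t" and ?q = "of_nat CARD('a) :: rat" and ?N = "of_nat (card (Alt (r + t) :: 'a mat set)) :: rat"
  let ?d = "\<lambda>A. \<Sum>i<t. A $$ (r + i, r + i) + minv A $$ (r + i, r + i)"
  let ?X = "\<lambda>A. mat r r (\<lambda>ij. A $$ ij)"
  let ?cond = "\<lambda>A :: 'a mat. (\<forall>k<r. \<forall>l<?m. r \<le> l \<longrightarrow> A $$ (k, l) = 0) \<and> (\<forall>k<r. \<forall>l<r. A $$ (k, l) = A $$ (l, k))"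
  let ?T = "{A \<in> GLd ?m. (\<forall>i<r. \<forall>j<?m. r \<le> j \<longrightarrow> A $$ (i, j) = 0) \<and> ?X A \<in> SymI r}"
  \<comment> \<open>These are the A that survive the sum over S. Given the zero block, invertibility
    of A passes to the corner, so symmetry alone puts the corner into \<open>SymI r\<close>.\<close>
  have T: "?T = {A \<in> GLd ?m. ?cond A}"
  proof (intro Collect_cong conj_cong refl)
    fix A :: "'a mat"
    assume A: "A \<in> GLd ?m" and z: "\<forall>i<r. \<forall>j<?m. r \<le> j \<longrightarrow> A $$ (i, j) = 0"
    have "transpose_mat (?X A) = ?X A \<longleftrightarrow> (\<forall>k<r. \<forall>l<r. A $$ (k, l) = A $$ (l, k))"
    proof
      assume eq: "transpose_mat (?X A) = ?X A"
      show "\<forall>k<r. \<forall>l<r. A $$ (k, l) = A $$ (l, k)"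
      proof (intro allI impI)
        fix k l assume "k < r" "l < r"
        then show "A $$ (k, l) = A $$ (l, k)" using arg_cong[OF eq, of "\<lambda>X. X $$ (l, k)"] by simp
      qed
    qed (auto intro!: eq_matI)
    then show "?X A \<in> SymI r \<longleftrightarrow> (\<forall>k<r. \<forall>l<r. A $$ (k, l) = A $$ (l, k))"
      using corner_GLd[OF A z] by (simp add: SymI_def)
  qed
  have inner: "(\<Sum>S\<in>Alt ?m. f (c + ?d A + corner_pairing ?m r A (gram e h + S)))
      = (if ?cond A then ?N * f ((c + ?d A) + corner_pairing ?m r A (gram e h)) else 0)"
    if h: "h \<in> carrier_mat 2 ?m" for A h
  proof -
    have "(\<Sum>S\<in>Alt ?m. f (c + ?d A + corner_pairing ?m r A (gram e h + S)))
        = (\<Sum>S\<in>Alt ?m. f ((c + ?d A + corner_pairing ?m r A (gram e h)) + corner_pairing ?m r A S))"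
    proof (rule sum.cong[OF refl])
      fix S :: "'a mat" assume "S \<in> Alt ?m"
      then show "f (c + ?d A + corner_pairing ?m r A (gram e h + S))
          = f ((c + ?d A + corner_pairing ?m r A (gram e h)) + corner_pairing ?m r A S)"
        by (simp add: corner_pairing_add[OF gram_carrier[OF h] Alt_carrier] add.assoc)
    qed
    also have "\<dots> = (if ?cond A then ?N * f ((c + ?d A) + corner_pairing ?m r A (gram e h)) else 0)"
      by (rule sum_alternating[OF two f]) simp
    finally show ?thesis .
  qed
  \<comment> \<open>For a surviving A the pairing sees only its corner, as a quadratic form
    evaluated on the two rows of h.\<close>
  have pairing: "corner_pairing ?m r A (gram e h)
      = qf (?X A) (mat r 1 (\<lambda>(i, j). h $$ (0, i))) - e * qf (?X A) (mat r 1 (\<lambda>(i, j). h $$ (1, i)))"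
    if A: "A \<in> ?T" and h: "h \<in> carrier_mat 2 ?m" for A h
  proof -
    have "corner_pairing ?m r A (gram e h) = (\<Sum>k<r. \<Sum>l<r. A $$ (k, l) * gram e h $$ (l, k))"
      unfolding corner_pairing_def using A
      by (intro sum.cong refl sum.mono_neutral_right) auto
    also have "\<dots> = (\<Sum>k<r. \<Sum>l<r. A $$ (k, l) * h $$ (0, k) * h $$ (0, l)
        - e * (A $$ (k, l) * h $$ (1, k) * h $$ (1, l)))"
      by (intro sum.cong refl) (simp add: gram_index[OF h] algebra_simps)
    finally show ?thesis
      by (simp add: qf_sum[of _ r] sum_subtractf sum_distrib_left)
  qed
  have "(\<Sum>A\<in>GLd ?m. \<Sum>h\<in>carrier_mat 2 ?m. \<Sum>S\<in>Alt ?m. f (c + ?d A + corner_pairing ?m r A (gram e h + S)))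
      = (\<Sum>A\<in>GLd ?m. \<Sum>h\<in>carrier_mat 2 ?m. if ?cond A then ?N * f ((c + ?d A) + corner_pairing ?m r A (gram e h)) else 0)"
    by (intro sum.cong refl inner)
  also have "\<dots> = (\<Sum>A\<in>GLd ?m. if ?cond A then \<Sum>h\<in>carrier_mat 2 ?m. ?N * f ((c + ?d A) + corner_pairing ?m r A (gram e h)) else 0)"
    by (intro sum.cong refl sum_if_const)
  also have "\<dots> = (\<Sum>A\<in>?T. \<Sum>h\<in>carrier_mat 2 ?m. ?N * f ((c + ?d A) + corner_pairing ?m r A (gram e h)))"
    unfolding T by (rule sum.inter_filter[symmetric]) simp
  also have "\<dots> = (\<Sum>A\<in>?T. ?N * ?q ^ (2 * t) * ((- ?q) ^ r * f (c + ?d A)))"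
  proof (rule sum.cong[OF refl])
    fix A :: "'a mat" assume A: "A \<in> ?T"
    then have X: "?X A \<in> SymI r" by simp
    have "(\<Sum>h\<in>carrier_mat 2 ?m. ?N * f ((c + ?d A) + corner_pairing ?m r A (gram e h)))
        = ?N * (\<Sum>h\<in>carrier_mat 2 ?m. f ((c + ?d A) + (qf (?X A) (mat r 1 (\<lambda>(i, j). h $$ (0, i)))
            - e * qf (?X A) (mat r 1 (\<lambda>(i, j). h $$ (1, i))))))"
      unfolding sum_distrib_left by (intro sum.cong refl) (simp only: pairing[OF A])
    also have "\<dots> = ?N * (?q ^ (2 * t) * ((- ?q) ^ r * f (c + ?d A)))"
      unfolding sum_two_rows[of "\<lambda>x y. f ((c + ?d A) + (qf (?X A) x - e * qf (?X A) y))" r t]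
      by (simp only: sum_hermitian_form[OF two e f X])
    finally show "(\<Sum>h\<in>carrier_mat 2 ?m. ?N * f ((c + ?d A) + corner_pairing ?m r A (gram e h)))
        = ?N * ?q ^ (2 * t) * ((- ?q) ^ r * f (c + ?d A))" by (simp add: mult.assoc)
  qed
  also have "\<dots> = ?N * ?q ^ (2 * t) * (- ?q) ^ r * (\<Sum>A\<in>?T. f (c + ?d A))"
    by (simp add: sum_distrib_left mult.assoc)
  also have "(\<Sum>A\<in>?T. f (c + ?d A)) = ?q ^ (r * t) * (\<Sum>X\<in>(SymI r :: 'a mat set). \<Sum>D\<in>GLd t. f (c + (mat_tr D + mat_tr (minv D))))"
    by (rule sum_block_lower) (auto simp: SymI_def)
  finally show ?thesis by (simp add: mult_ac)
qed

section \<open>Trace sums over double cosets\<close>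

lemma mat_tr_comm:
  assumes "A \<in> carrier_mat n k" "B \<in> carrier_mat k n"
  shows "mat_tr (A * B) = mat_tr (B * A)"
proof -
  have "mat_tr (A * B) = (\<Sum>i<n. \<Sum>j<k. A $$ (i, j) * B $$ (j, i))"
    using assms by (simp add: mat_tr_def scalar_prod_def atLeast0LessThan)
  also have "\<dots> = (\<Sum>j<k. \<Sum>i<n. B $$ (j, i) * A $$ (i, j))"
    by (subst sum.swap) (simp add: mult.commute)
  also have "\<dots> = mat_tr (B * A)"
    using assms by (simp add: mat_tr_def scalar_prod_def atLeast0LessThan)
  finally show ?thesis .
qed

locale matrix_group =
  fixes Q :: "'a::{field,finite} mat set" and N :: nat
  assumes sub_GLd: "Q \<subseteq> GLd N" and one: "1\<^sub>m N \<in> Q"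
    and mult: "x \<in> Q \<Longrightarrow> y \<in> Q \<Longrightarrow> x * y \<in> Q"
begin

lemma GL: "x \<in> Q \<Longrightarrow> x \<in> GLd N" using sub_GLd by auto
lemma car: "x \<in> Q \<Longrightarrow> x \<in> carrier_mat N N" using GL GLd_carrier by auto

lemma finite_Q [simp]: "finite Q"
  by (rule finite_subset[OF sub_GLd]) simp

lemma bij_left: assumes "x \<in> Q" shows "bij_betw ((*) x) Q Q"
proof -
  have "inj_on ((*) x) Q"
    by (rule inj_onI) (metis GLd_left_cancel(1) GL car assms)
  moreover have "(*) x ` Q \<subseteq> Q" using mult assms by auto
  ultimately show ?thesis
    by (simp add: bij_betw_def endo_inj_surj)
qed

text \<open>Left multiplication by x is an injective self-map of a finite set, hence surjective; the
  preimage of the identity is the inverse.\<close>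

lemma minv_mem: assumes "x \<in> Q" shows "minv x \<in> Q"
proof -
  have "1\<^sub>m N \<in> (*) x ` Q" using bij_left[OF assms] one by (simp add: bij_betw_def)
  then obtain y where y: "y \<in> Q" "x * y = 1\<^sub>m N" by auto
  then have "minv x = y" using assms by (intro minv_unique[of _ N]) (auto simp: car)
  with y show ?thesis by simp
qed

text \<open>x s y = x0 s y0 holds exactly when p = x0^-1 x satisfies s p s = y0 y^-1. So all fibres
  of the product map are copies of Q \<inter> s Q s, whatever g is.\<close>

lemma double_coset_fibre:
  assumes s: "s \<in> carrier_mat N N" "s * s = 1\<^sub>m N" and g: "g \<in> dcoset Q s"
  shows "card {(x, y). x \<in> Q \<and> y \<in> Q \<and> x * s * y = g} = card {p \<in> Q. s * p * s \<in> Q}"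
proof -
  note as = assoc_mult_mat[of _ N N _ N _ N]
  obtain x0 y0 where xy0: "x0 \<in> Q" "y0 \<in> Q" "g = x0 * s * y0" using g by (auto simp: dcoset_def)
  note c0 = car[OF xy0(1)] car[OF xy0(2)]
  have ss: "s * (s * z) = z" if "z \<in> carrier_mat N N" for z
    using s that by (simp flip: as)
  let ?P = "{p \<in> Q. s * p * s \<in> Q}" and ?T = "{(x, y). x \<in> Q \<and> y \<in> Q \<and> x * s * y = g}"
  have "bij_betw (\<lambda>p. (x0 * p, minv (s * p * s) * y0)) ?P ?T"
  proof (rule bij_betwI[where g = "\<lambda>(x, y). minv x0 * x"])
    show "(\<lambda>p. (x0 * p, minv (s * p * s) * y0)) \<in> ?P \<rightarrow> ?T"
    proof
      fix p assume "p \<in> ?P"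
      then have p: "p \<in> Q" "s * p * s \<in> Q" by auto
      note pc = car[OF p(1)] car[OF p(2)] car[OF minv_mem[OF p(2)]]
      have "x0 * p * s * (minv (s * p * s) * y0) = x0 * (s * ((s * p * s) * (minv (s * p * s) * y0)))"
        using pc c0 s ss by (simp add: as)
      also have "\<dots> = g" using GLd_left_cancel(2)[OF GL[OF p(2)] c0(2)] c0 s xy0(3) by (simp add: as)
      finally show "(x0 * p, minv (s * p * s) * y0) \<in> ?T"
        using p xy0 by (simp add: mult minv_mem)
    qed
    have key: "minv x0 * x \<in> Q" "s * (minv x0 * x) * s = y0 * minv y"
      if "x \<in> Q" "y \<in> Q" "x * s * y = g" for x y
    proof -
      note c = car[OF that(1)] car[OF that(2)] car[OF minv_mem[OF that(2)]] car[OF minv_mem[OF xy0(1)]]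
      show "minv x0 * x \<in> Q" using that xy0 by (simp add: mult minv_mem)
      have "x * s * y = x0 * (s * y0)" using that xy0 c0 s by (simp add: as)
      then have "minv x0 * (x * s * y) = s * y0"
        using GLd_left_cancel(1)[OF GL[OF xy0(1)], of "s * y0" N] c0 s by simp
      then have "s * (minv x0 * (x * s * y)) = y0" using ss c0 by simp
      then have "s * (minv x0 * (x * s * y)) * minv y = y0 * minv y" by simp
      moreover have "s * (minv x0 * (x * s * y)) * minv y = (s * (minv x0 * x) * s) * y * minv y"
        using c s by (simp add: as)
      moreover have "\<dots> = s * (minv x0 * x) * s"
        using c s by (intro GLd_right_cancel(1)[OF GL[OF that(2)], of _ N] mult_carrier_mat)
      ultimately show "s * (minv x0 * x) * s = y0 * minv y" by simp
    qed
    show "(\<lambda>(x, y). minv x0 * x) \<in> ?T \<rightarrow> ?P"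
      using key xy0 by (auto simp: mult minv_mem)
    show "(\<lambda>(x, y). minv x0 * x) ((\<lambda>p. (x0 * p, minv (s * p * s) * y0)) p) = p" if "p \<in> ?P" for p
      using that GLd_left_cancel(1)[OF GL[OF xy0(1)] car] by auto
    show "(\<lambda>p. (x0 * p, minv (s * p * s) * y0)) ((\<lambda>(x, y). minv x0 * x) z) = z" if "z \<in> ?T" for z
    proof -
      obtain x y where [simp]: "z = (x, y)" by (cases z)
      have xy: "x \<in> Q" "y \<in> Q" "x * s * y = g" using that by auto
      have m: "minv (y0 * minv y) = y * minv y0"
      proof (rule minv_unique[of _ N])
        note c = car[OF xy(2)] car[OF minv_mem[OF xy(2)]] car[OF minv_mem[OF xy0(2)]] c0
        show "y0 * minv y \<in> carrier_mat N N" "y * minv y0 \<in> carrier_mat N N" using c by auto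
        have "y0 * minv y * (y * minv y0) = y0 * (minv y * (y * minv y0))" using c by (simp add: as)
        also have "\<dots> = 1\<^sub>m N" using GLd_left_cancel(1)[OF GL[OF xy(2)] c(3)] minv(2)[OF GL[OF xy0(2)]] by simp
        finally show "y0 * minv y * (y * minv y0) = 1\<^sub>m N" .
      qed
      have "x0 * (minv x0 * x) = x" using GLd_left_cancel(2)[OF GL[OF xy0(1)] car[OF xy(1)]] .
      moreover have "minv (s * (minv x0 * x) * s) * y0 = y"
        unfolding key(2)[OF xy] m using GLd_right_cancel(2)[OF GL[OF xy0(2)] car[OF xy(2)]] .
      ultimately show ?thesis by simp
    qed
  qed
  then show ?thesis by (simp add: bij_betw_same_card)
qed

text \<open>Cyclicity of the trace turns the sum over \<open>Q s Q\<close> into a sum over \<open>Q s\<close>.\<close>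

lemma double_coset_sum:
  fixes F :: "'a \<Rightarrow> rat"
  assumes s: "s \<in> carrier_mat N N" "s * s = 1\<^sub>m N"
    and t: "t \<in> carrier_mat N N" "t * t = 1\<^sub>m N" "\<And>w. w \<in> Q \<Longrightarrow> t * w * t \<in> Q"
  shows "of_nat (card {p \<in> Q. s * p * s \<in> Q}) * (\<Sum>g\<in>dcoset Q s. F (mat_tr (t * g)))
    = of_nat (card Q) * (\<Sum>w\<in>Q. F (mat_tr (t * w * s)))"
proof -
  note as = assoc_mult_mat[of _ N N _ N _ N]
  let ?G = "\<lambda>z. F (mat_tr (t * (fst z * s * snd z)))"
  have D: "dcoset Q s = (\<lambda>z. fst z * s * snd z) ` (Q \<times> Q)" by (force simp: dcoset_def)
  have "(\<Sum>z\<in>Q \<times> Q. ?G z) = (\<Sum>g\<in>dcoset Q s. \<Sum>z\<in>{z \<in> Q \<times> Q. fst z * s * snd z = g}. ?G z)"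
    by (rule sum.group[symmetric]) (auto simp: D)
  also have "\<dots> = (\<Sum>g\<in>dcoset Q s. of_nat (card {p \<in> Q. s * p * s \<in> Q}) * F (mat_tr (t * g)))"
  proof (rule sum.cong[OF refl])
    fix g assume g: "g \<in> dcoset Q s"
    have "{z \<in> Q \<times> Q. fst z * s * snd z = g} = {(x, y). x \<in> Q \<and> y \<in> Q \<and> x * s * y = g}" by auto
    then have "card {z \<in> Q \<times> Q. fst z * s * snd z = g} = card {p \<in> Q. s * p * s \<in> Q}"
      using double_coset_fibre[OF s g] by simp
    then show "(\<Sum>z\<in>{z \<in> Q \<times> Q. fst z * s * snd z = g}. ?G z)
        = of_nat (card {p \<in> Q. s * p * s \<in> Q}) * F (mat_tr (t * g))" by simp
  qed
  also have "\<dots> = of_nat (card {p \<in> Q. s * p * s \<in> Q}) * (\<Sum>g\<in>dcoset Q s. F (mat_tr (t * g)))"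
    by (simp add: sum_distrib_left)
  finally have 1: "(\<Sum>z\<in>Q \<times> Q. ?G z) = \<dots>" .
  have "(\<Sum>z\<in>Q \<times> Q. ?G z) = (\<Sum>x\<in>Q. \<Sum>y\<in>Q. F (mat_tr (t * (x * s * y))))"
    by (simp add: sum.cartesian_product case_prod_beta)
  also have "\<dots> = (\<Sum>y\<in>Q. \<Sum>x\<in>Q. F (mat_tr (t * (x * s * y))))" by (rule sum.swap)
  also have "\<dots> = (\<Sum>y\<in>Q. \<Sum>w\<in>Q. F (mat_tr (t * w * s)))"
  proof (rule sum.cong[OF refl])
    fix y assume y: "y \<in> Q"
    note yc = car[OF y]
    have tt: "t * (t * z) = z" if "z \<in> carrier_mat N N" for z using t that by (simp flip: as)
    \<comment> \<open>Cyclicity moves y to the front, and y t = t (t y t); the factor t y t lies in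
      Q and is absorbed by translating x.\<close>
    have "mat_tr (t * (x * s * y)) = mat_tr (t * ((t * y * t) * x) * s)" if x: "x \<in> Q" for x
    proof -
      note xc = car[OF x]
      have "mat_tr (t * (x * s * y)) = mat_tr ((t * (x * s)) * y)" using t s xc yc by (simp add: as)
      also have "\<dots> = mat_tr (y * (t * (x * s)))" using t s xc yc by (intro mat_tr_comm) auto
      also have "y * (t * (x * s)) = t * ((t * y * t) * x) * s" using t s xc yc tt by (simp add: as)
      finally show ?thesis .
    qed
    then have "(\<Sum>x\<in>Q. F (mat_tr (t * (x * s * y)))) = (\<Sum>x\<in>Q. F (mat_tr (t * ((t * y * t) * x) * s)))" by simp
    also have "\<dots> = (\<Sum>w\<in>Q. F (mat_tr (t * w * s)))"
      by (rule sum.reindex_bij_betw[OF bij_left[OF t(3)[OF y]], of "\<lambda>w. F (mat_tr (t * w * s))"])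
    finally show "(\<Sum>x\<in>Q. F (mat_tr (t * (x * s * y)))) = (\<Sum>w\<in>Q. F (mat_tr (t * w * s)))" .
  qed
  also have "\<dots> = of_nat (card Q) * (\<Sum>w\<in>Q. F (mat_tr (t * w * s)))" by simp
  finally show ?thesis using 1 by simp
qed

end

section \<open>The parabolic subgroup\<close>

definition blk_off :: "nat \<Rightarrow> nat \<Rightarrow> nat" where
  "blk_off m a = (if a = 0 then 0 else if a = 1 then m else 2 * m)"

definition blk :: "nat \<Rightarrow> 'a mat \<Rightarrow> nat \<Rightarrow> nat \<Rightarrow> 'a mat" where
  "blk m M a b = mat (blk_dim m a) (blk_dim m b) (\<lambda>(i, j). M $$ (blk_off m a + i, blk_off m b + j))"

lemma blk_carrier [simp]: "blk m M a b \<in> carrier_mat (blk_dim m a) (blk_dim m b)"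
  by (simp add: blk_def)

lemma blk_idx_off:
  "a < 3 \<Longrightarrow> i < blk_dim m a \<Longrightarrow> blk_idx m (blk_off m a + i) = (a, i)"
  "a < 3 \<Longrightarrow> i < blk_dim m a \<Longrightarrow> blk_off m a + i < 2 * m + 2"
  by (auto simp: blk_idx_def blk_off_def blk_dim_def split: if_splits)

lemma blk_cases:
  assumes "i < 2 * m + 2"
  obtains a k where "a < 3" "k < blk_dim m a" "i = blk_off m a + k"
proof -
  consider "i < m" | "m \<le> i" "i < 2 * m" | "2 * m \<le> i" by linarith
  then show ?thesis
  proof cases
    case 1 then show ?thesis by (intro that[of 0 i]) (auto simp: blk_dim_def blk_off_def)
  next
    case 2 then show ?thesis by (intro that[of 1 "i - m"]) (auto simp: blk_dim_def blk_off_def)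
  next
    case 3 then show ?thesis using assms by (intro that[of 2 "i - 2 * m"]) (auto simp: blk_dim_def blk_off_def)
  qed
qed

lemma blk_block3:
  assumes "a < 3" "b < 3" "F a b \<in> carrier_mat (blk_dim m a) (blk_dim m b)"
  shows "blk m (block3 m F) a b = F a b"
proof (rule eq_matI)
  fix i j assume "i < dim_row (F a b)" "j < dim_col (F a b)"
  then have ij: "i < blk_dim m a" "j < blk_dim m b" using assms by auto
  then show "blk m (block3 m F) a b $$ (i, j) = F a b $$ (i, j)"
    using blk_idx_off[OF assms(1) ij(1)] blk_idx_off[OF assms(2) ij(2)]
    by (simp add: blk_def block3_def del: add_2_eq_Suc' add_2_eq_Suc)
qed (use assms in \<open>auto simp: blk_def\<close>)

lemma block3_carrier [simp]: "block3 m F \<in> carrier_mat (2 * m + 2) (2 * m + 2)"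
  by (simp add: block3_def)

lemma less_3_cases: "a < 3 \<Longrightarrow> a = 0 \<or> a = 1 \<or> a = (2::nat)"
  by auto

lemma eq_blkI:
  assumes M: "M \<in> carrier_mat (2 * m + 2) (2 * m + 2)" "M' \<in> carrier_mat (2 * m + 2) (2 * m + 2)"
    and eq: "\<And>a b. a < 3 \<Longrightarrow> b < 3 \<Longrightarrow> blk m M a b = blk m M' a b"
  shows "M = M'"
proof (rule eq_matI)
  fix i j assume "i < dim_row M'" "j < dim_col M'"
  then have i: "i < 2 * m + 2" and j: "j < 2 * m + 2" using M by auto
  obtain a k where a: "a < 3" "k < blk_dim m a" "i = blk_off m a + k" using i by (rule blk_cases)
  obtain b l where b: "b < 3" "l < blk_dim m b" "j = blk_off m b + l" using j by (rule blk_cases)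
  show "M $$ (i, j) = M' $$ (i, j)"
    using arg_cong[OF eq[OF a(1) b(1)], of "\<lambda>X. X $$ (k, l)"] a b by (simp add: blk_def)
qed (use M in auto)

lemma blk_transpose:
  assumes "M \<in> carrier_mat (2 * m + 2) (2 * m + 2)" "a < 3" "b < 3"
  shows "blk m (transpose_mat M) a b = transpose_mat (blk m M b a)"
  using assms blk_idx_off(2)[of _ _ m] by (intro eq_matI) (auto simp: blk_def)

lemma sum_blocks:
  "(\<Sum>i<2 * m + 2. g i) = (\<Sum>a\<in>{0, 1, 2}. \<Sum>k<blk_dim m a. g (blk_off m a + k))"
  for g :: "nat \<Rightarrow> 'b::comm_monoid_add"
proof -
  have "(\<Sum>i<m + m + 2. g i) = (\<Sum>i<m. g i) + (\<Sum>i<m. g (m + i)) + (\<Sum>i<2. g (m + m + i))"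
    by (simp only: sum_lessThan_add)
  then show ?thesis by (simp add: blk_dim_def blk_off_def mult_2 add.assoc)
qed

lemma blk_mult:
  assumes M: "M \<in> carrier_mat (2 * m + 2) (2 * m + 2)" "M' \<in> carrier_mat (2 * m + 2) (2 * m + 2)"
    and ab: "a < 3" "b < 3"
  shows "blk m (M * M') a b = blk m M a 0 * blk m M' 0 b + blk m M a 1 * blk m M' 1 b + blk m M a 2 * blk m M' 2 b"
proof (rule eq_matI)
  let ?R = "blk m M a 0 * blk m M' 0 b + blk m M a 1 * blk m M' 1 b + blk m M a 2 * blk m M' 2 b"
  fix i j assume "i < dim_row ?R" "j < dim_col ?R"
  then have ij: "i < blk_dim m a" "j < blk_dim m b" by (simp_all add: blk_def)
  let ?i = "blk_off m a + i" and ?j = "blk_off m b + j"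
  have ij': "?i < 2 * m + 2" "?j < 2 * m + 2" using ij ab blk_idx_off(2) by auto
  have prod: "(blk m M a c * blk m M' c b) $$ (i, j)
      = (\<Sum>k<blk_dim m c. M $$ (?i, blk_off m c + k) * M' $$ (blk_off m c + k, ?j))" for c
    using ij by (simp add: blk_def scalar_prod_def atLeast0LessThan)
  have "blk m (M * M') a b $$ (i, j) = (M * M') $$ (?i, ?j)" using ij by (simp add: blk_def)
  also have "\<dots> = (\<Sum>k<2 * m + 2. M $$ (?i, k) * M' $$ (k, ?j))"
    using M ij' by (simp add: scalar_prod_def atLeast0LessThan)
  also have "\<dots> = (\<Sum>c\<in>{0, 1, 2}. (blk m M a c * blk m M' c b) $$ (i, j))"
    unfolding sum_blocks prod ..
  also have "\<dots> = ?R $$ (i, j)" using ij by (simp add: add.assoc carrier_matD[OF blk_carrier] del: index_mult_mat(1))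
  finally show "blk m (M * M') a b $$ (i, j) = ?R $$ (i, j)" .
qed (auto simp: blk_def)

lemma blk_dim_simps [simp]: "blk_dim m 0 = m" "blk_dim m 1 = m" "blk_dim m 2 = 2"
  by (auto simp: blk_dim_def)

lemma blk_carriers [simp]:
  "blk m M 0 0 \<in> carrier_mat m m" "blk m M 0 1 \<in> carrier_mat m m" "blk m M 0 2 \<in> carrier_mat m 2"
  "blk m M 1 0 \<in> carrier_mat m m" "blk m M 1 1 \<in> carrier_mat m m" "blk m M 1 2 \<in> carrier_mat m 2"
  "blk m M 2 0 \<in> carrier_mat 2 m" "blk m M 2 1 \<in> carrier_mat 2 m" "blk m M 2 2 \<in> carrier_mat 2 2"
  using blk_carrier[of m M 0 0] blk_carrier[of m M 0 1] blk_carrier[of m M 0 2]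
    blk_carrier[of m M 1 0] blk_carrier[of m M 1 1] blk_carrier[of m M 1 2]
    blk_carrier[of m M 2 0] blk_carrier[of m M 2 1] blk_carrier[of m M 2 2] by simp_all

lemma eq_blk9I:
  assumes "M \<in> carrier_mat (2 * m + 2) (2 * m + 2)" "M' \<in> carrier_mat (2 * m + 2) (2 * m + 2)"
    and "blk m M 0 0 = blk m M' 0 0" "blk m M 0 1 = blk m M' 0 1" "blk m M 0 2 = blk m M' 0 2"
    and "blk m M 1 0 = blk m M' 1 0" "blk m M 1 1 = blk m M' 1 1" "blk m M 1 2 = blk m M' 1 2"
    and "blk m M 2 0 = blk m M' 2 0" "blk m M 2 1 = blk m M' 2 1" "blk m M 2 2 = blk m M' 2 2"
  shows "M = M'"
  by (rule eq_blkI[OF assms(1,2)]) (use assms(3-) in \<open>auto dest!: less_3_cases\<close>)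

lemma GL_eq_GLd: "(GL m :: 'a::field mat set) = GLd m"
proof (intro equalityI subsetI)
  fix A :: "'a mat" assume "A \<in> GL m"
  then obtain B where A: "A \<in> carrier_mat m m" and B: "A * B = 1\<^sub>m m" "B * A = 1\<^sub>m (dim_row B)"
    by (auto simp: GL_def invertible_mat_def inverts_mat_def)
  \<comment> \<open>\<open>invertible_mat\<close> leaves the shape of the inverse open; it follows
    by comparing dimensions in the two products.\<close>
  have "dim_col B = m" using arg_cong[OF B(1), of dim_col] by simp
  moreover have "dim_row B = m" using arg_cong[OF B(2), of dim_col] A by simp
  ultimately have "B \<in> carrier_mat m m" by auto
  then show "A \<in> GLd m" using A B by (intro GLdI)
next
  fix A :: "'a mat" assume A: "A \<in> GLd m"
  show "A \<in> GL m" using GLd_carrier[OF A] minv[OF A]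
    by (auto simp: GL_def invertible_mat_def inverts_mat_def intro!: exI[of _ "minv A"])
qed

lemma delta_eps_carrier [simp]: "delta_eps e \<in> carrier_mat 2 2"
  by (simp add: delta_eps_def)

lemma dim_delta_eps [simp]: "dim_row (delta_eps e) = 2" "dim_col (delta_eps e) = 2"
  using delta_eps_carrier[of e] by (auto simp del: delta_eps_carrier)

lemma uminus_0_mat [simp]: "- 0\<^sub>m k l = (0\<^sub>m k l :: 'a::ring_1 mat)"
  by (rule eq_matI) auto

lemma delta_eps_sym [simp]: "transpose_mat (delta_eps e) = delta_eps e"
  by (rule eq_matI) (auto simp: delta_eps_def)

text \<open>For n = 1 the hyperbolic blocks are empty, so \<open>SOminus 1 e\<close> is the rotation
  group of the binary form \<open>delta_eps e\<close>.\<close>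

lemma Jmat_1: "Jmat 1 e = delta_eps e"
  by (rule eq_matI) (auto simp: Jmat_def block3_def blk_idx_def delta_eps_def)

lemma SOminus_iff: "i \<in> SOminus 1 e \<longleftrightarrow> i \<in> carrier_mat 2 2 \<and> transpose_mat i * delta_eps e * i = delta_eps e \<and> det i = 1"
  by (auto simp: SOminus_def Ominus_def GL_eq_GLd GLd_def Jmat_1)

lemma Jmat_carrier [simp]: "Jmat (Suc m) e \<in> carrier_mat (2 * m + 2) (2 * m + 2)"
  unfolding Jmat_def using block3_carrier[of m] by simp

lemma blk_Jmat:
  "blk m (Jmat (Suc m) e) 0 0 = 0\<^sub>m m m" "blk m (Jmat (Suc m) e) 0 1 = 1\<^sub>m m" "blk m (Jmat (Suc m) e) 0 2 = 0\<^sub>m m 2"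
  "blk m (Jmat (Suc m) e) 1 0 = 1\<^sub>m m" "blk m (Jmat (Suc m) e) 1 1 = 0\<^sub>m m m" "blk m (Jmat (Suc m) e) 1 2 = 0\<^sub>m m 2"
  "blk m (Jmat (Suc m) e) 2 0 = 0\<^sub>m 2 m" "blk m (Jmat (Suc m) e) 2 1 = 0\<^sub>m 2 m" "blk m (Jmat (Suc m) e) 2 2 = delta_eps e"
  by (simp_all add: Jmat_def blk_block3)

text \<open>The Levi and the unipotent factor multiplied out, so that an element of
  \<open>Qpar\<close> is a single block matrix in A, i, h, B.\<close>

definition qmat :: "nat \<Rightarrow> 'a::field \<Rightarrow> 'a mat \<Rightarrow> 'a mat \<Rightarrow> 'a mat \<Rightarrow> 'a mat \<Rightarrow> 'a mat" where
  "qmat m e A i h B = block3 m (\<lambda>a b.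
      if (a, b) = (0, 0) then A
      else if (a, b) = (0, 1) then A * B
      else if (a, b) = (0, 2) then - (A * (transpose_mat h * delta_eps e))
      else if (a, b) = (1, 1) then transpose_mat (minv A)
      else if (a, b) = (2, 1) then i * h
      else if (a, b) = (2, 2) then i
      else 0\<^sub>m (blk_dim m a) (blk_dim m b))"

lemma qmat_carrier [simp]: "qmat m e A i h B \<in> carrier_mat (2 * m + 2) (2 * m + 2)"
  by (simp add: qmat_def del: add_2_eq_Suc')

lemma blk_qmat:
  assumes A: "A \<in> GLd m" and i: "i \<in> carrier_mat 2 2" and h: "h \<in> carrier_mat 2 m" and B: "B \<in> carrier_mat m m"
  shows "blk m (qmat m e A i h B) 0 0 = A" "blk m (qmat m e A i h B) 0 1 = A * B"
    "blk m (qmat m e A i h B) 0 2 = - (A * (transpose_mat h * delta_eps e))"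
    "blk m (qmat m e A i h B) 1 0 = 0\<^sub>m m m" "blk m (qmat m e A i h B) 1 1 = transpose_mat (minv A)"
    "blk m (qmat m e A i h B) 1 2 = 0\<^sub>m m 2"
    "blk m (qmat m e A i h B) 2 0 = 0\<^sub>m 2 m" "blk m (qmat m e A i h B) 2 1 = i * h" "blk m (qmat m e A i h B) 2 2 = i"
proof -
  note c = GLd_carrier[OF A] minv(1)[OF A] i h B
  have "A * (transpose_mat h * delta_eps e) \<in> carrier_mat m 2"
    using c by (intro mult_carrier_mat) auto
  then show "blk m (qmat m e A i h B) 0 0 = A" "blk m (qmat m e A i h B) 0 1 = A * B"
    "blk m (qmat m e A i h B) 0 2 = - (A * (transpose_mat h * delta_eps e))"
    "blk m (qmat m e A i h B) 1 0 = 0\<^sub>m m m" "blk m (qmat m e A i h B) 1 1 = transpose_mat (minv A)"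
    "blk m (qmat m e A i h B) 1 2 = 0\<^sub>m m 2"
    "blk m (qmat m e A i h B) 2 0 = 0\<^sub>m 2 m" "blk m (qmat m e A i h B) 2 1 = i * h" "blk m (qmat m e A i h B) 2 2 = i"
    unfolding qmat_def using c by (simp_all add: blk_block3)
qed

definition Qdata :: "nat \<Rightarrow> 'a::field \<Rightarrow> ('a mat \<times> 'a mat \<times> 'a mat \<times> 'a mat) set" where
  "Qdata m e = {(A, i, h, B). A \<in> GLd m \<and> i \<in> SOminus 1 e \<and> h \<in> carrier_mat 2 m \<and> B \<in> carrier_mat m m
      \<and> transpose_mat B + B + gram e h = 0\<^sub>m m m}"

lemma Qpar_product:
  assumes A: "A \<in> GLd m" and i: "i \<in> carrier_mat 2 2" and h: "h \<in> carrier_mat 2 m" and B: "B \<in> carrier_mat m m"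
  shows "block3 m (\<lambda>a b. if (a,b) = (0,0) then A else if (a,b) = (1,1) then transpose_mat (minv A)
                  else if (a,b) = (2,2) then i else 0\<^sub>m (blk_dim m a) (blk_dim m b))
       * block3 m (\<lambda>a b. if a = b then 1\<^sub>m (blk_dim m a) else if (a,b) = (0,1) then B
                  else if (a,b) = (0,2) then - (transpose_mat h * delta_eps e)
                  else if (a,b) = (2,1) then h else 0\<^sub>m (blk_dim m a) (blk_dim m b))
       = qmat m e A i h B"
    (is "block3 m ?F * block3 m ?G = _")
proof -
  note c = GLd_carrier[OF A] minv(1)[OF A] i h B
  have hd: "transpose_mat h * delta_eps e \<in> carrier_mat m 2" using h by (intro mult_carrier_mat) auto
  define P R where "P = block3 m ?F" and "R = block3 m ?G"
  have F: "blk m P 0 0 = A" "blk m P 0 1 = 0\<^sub>m m m" "blk m P 0 2 = 0\<^sub>m m 2"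
    "blk m P 1 0 = 0\<^sub>m m m" "blk m P 1 1 = transpose_mat (minv A)" "blk m P 1 2 = 0\<^sub>m m 2"
    "blk m P 2 0 = 0\<^sub>m 2 m" "blk m P 2 1 = 0\<^sub>m 2 m" "blk m P 2 2 = i"
    unfolding P_def using c by (simp_all add: blk_block3)
  have G: "blk m R 0 0 = 1\<^sub>m m" "blk m R 0 1 = B" "blk m R 0 2 = - (transpose_mat h * delta_eps e)"
    "blk m R 1 0 = 0\<^sub>m m m" "blk m R 1 1 = 1\<^sub>m m" "blk m R 1 2 = 0\<^sub>m m 2"
    "blk m R 2 0 = 0\<^sub>m 2 m" "blk m R 2 1 = h" "blk m R 2 2 = 1\<^sub>m 2"
    unfolding R_def using c hd by (simp_all add: blk_block3)
  have PR: "P \<in> carrier_mat (2 * m + 2) (2 * m + 2)" "R \<in> carrier_mat (2 * m + 2) (2 * m + 2)"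
    unfolding P_def R_def by (rule block3_carrier)+
  have "P * R = qmat m e A i h B"
    by (rule eq_blk9I[OF mult_carrier_mat[OF PR] qmat_carrier])
       (use c hd in \<open>simp_all add: blk_mult[OF PR] F G blk_qmat[OF A i h B]\<close>)
  then show ?thesis unfolding P_def R_def .
qed

lemma Qpar_eq: "Qpar (Suc m) e = (\<lambda>(A, i, h, B). qmat m e A i h B) ` Qdata m e"
proof (intro equalityI subsetI)
  fix w assume "w \<in> Qpar (Suc m) e"
  then obtain A A' i B h where d: "A \<in> GLd m" "A' \<in> carrier_mat m m" "A * A' = 1\<^sub>m m" "i \<in> SOminus 1 e"
      "B \<in> carrier_mat m m" "h \<in> carrier_mat 2 m" "transpose_mat B + B + gram e h = 0\<^sub>m m m"
    and w: "w = block3 m (\<lambda>a b. if (a,b) = (0,0) then A else if (a,b) = (1,1) then transpose_mat A'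
                  else if (a,b) = (2,2) then i else 0\<^sub>m (blk_dim m a) (blk_dim m b))
       * block3 m (\<lambda>a b. if a = b then 1\<^sub>m (blk_dim m a) else if (a,b) = (0,1) then B
                  else if (a,b) = (0,2) then - (transpose_mat h * delta_eps e)
                  else if (a,b) = (2,1) then h else 0\<^sub>m (blk_dim m a) (blk_dim m b))"
    unfolding Qpar_def mem_Collect_eq diff_Suc_1 GL_eq_GLd gram_def by blast
  have "minv A = A'" by (rule minv_unique[OF GLd_carrier[OF d(1)] d(2,3)])
  moreover have "i \<in> carrier_mat 2 2" using d(4) by (simp add: SOminus_iff)
  ultimately have "w = qmat m e A i h B"
    unfolding w using Qpar_product[OF d(1) _ d(6,5), of i e] by (simp only:)
  moreover have "(A, i, h, B) \<in> Qdata m e" using d by (simp add: Qdata_def)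
  ultimately show "w \<in> (\<lambda>(A, i, h, B). qmat m e A i h B) ` Qdata m e" by force
next
  fix w assume "w \<in> (\<lambda>(A, i, h, B). qmat m e A i h B) ` Qdata m e"
  then obtain A i h B where d: "A \<in> GLd m" "i \<in> SOminus 1 e" "h \<in> carrier_mat 2 m" "B \<in> carrier_mat m m"
      "transpose_mat B + B + gram e h = 0\<^sub>m m m" and w: "w = qmat m e A i h B"
    by (auto simp: Qdata_def)
  have "i \<in> carrier_mat 2 2" using d(2) by (simp add: SOminus_iff)
  note p = Qpar_product[OF d(1) this d(3,4), of e, symmetric]
  show "w \<in> Qpar (Suc m) e"
    unfolding w p Qpar_def mem_Collect_eq diff_Suc_1
    by (intro exI[of _ A] exI[of _ "minv A"] exI[of _ i] exI[of _ B] exI[of _ h])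
       (use d minv[OF d(1)] in \<open>simp add: GL_eq_GLd gram_def\<close>)
qed

text \<open>Multiplication by \<open>Jmat\<close> exchanges the two hyperbolic row blocks and
  applies \<open>delta_eps\<close> to the third, which produces the three terms.\<close>

lemma blk_form:
  assumes w: "w \<in> carrier_mat (2 * m + 2) (2 * m + 2)" and ab: "a < 3" "b < 3"
  shows "blk m (transpose_mat w * Jmat (Suc m) e * w) a b
    = transpose_mat (blk m w 0 a) * blk m w 1 b + transpose_mat (blk m w 1 a) * blk m w 0 b
      + transpose_mat (blk m w 2 a) * (delta_eps e * blk m w 2 b)"
proof -
  have J: "Jmat (Suc m) e \<in> carrier_mat (2 * m + 2) (2 * m + 2)" by (rule Jmat_carrier)
  have c: "blk m w 0 b \<in> carrier_mat m (blk_dim m b)" "blk m w 1 b \<in> carrier_mat m (blk_dim m b)"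
    "blk m w 2 b \<in> carrier_mat 2 (blk_dim m b)" using blk_carrier[of m w _ b] by (metis blk_dim_simps)+
  have Jw: "blk m (Jmat (Suc m) e * w) 0 b = blk m w 1 b" "blk m (Jmat (Suc m) e * w) 1 b = blk m w 0 b"
    "blk m (Jmat (Suc m) e * w) 2 b = delta_eps e * blk m w 2 b"
    using c ab mult_carrier_mat[OF delta_eps_carrier c(3), of e] by (simp_all add: blk_mult[OF J w] blk_Jmat)
  have "transpose_mat w * Jmat (Suc m) e * w = transpose_mat w * (Jmat (Suc m) e * w)"
    using w J by (intro assoc_mult_mat) auto
  then show ?thesis
    using ab w J blk_mult[of "transpose_mat w" m "Jmat (Suc m) e * w" a b]
    by (simp add: Jw blk_transpose[OF w] mult_carrier_mat[OF J w])
qed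

text \<open>Coordinate-free description: isometries preserving the totally isotropic span of the
  first m basis vectors, with determinant 1 on the binary part. Stability under products and under
  conjugation is visible here but not in the coordinates A, i, h, B.\<close>

definition Qchar :: "nat \<Rightarrow> 'a::field \<Rightarrow> 'a mat \<Rightarrow> bool" where
  "Qchar m e w \<longleftrightarrow> w \<in> carrier_mat (2 * m + 2) (2 * m + 2)
     \<and> transpose_mat w * Jmat (Suc m) e * w = Jmat (Suc m) e
     \<and> blk m w 1 0 = 0\<^sub>m m m \<and> blk m w 2 0 = 0\<^sub>m 2 m \<and> det (blk m w 2 2) = 1"

lemma transpose_minv_mult:
  assumes "A \<in> GLd m"
  shows "transpose_mat A * transpose_mat (minv A) = 1\<^sub>m m" "transpose_mat (minv A) * transpose_mat A = 1\<^sub>m m"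
  by (simp_all add: transpose_mult[OF minv(1)[OF assms] GLd_carrier[OF assms], symmetric]
    transpose_mult[OF GLd_carrier[OF assms] minv(1)[OF assms], symmetric] minv[OF assms])

lemma minus_add_self_mat:
  assumes "M \<in> carrier_mat k l"
  shows "- M + M = 0\<^sub>m k (l :: nat)" "M + - M = (0\<^sub>m k l :: 'a::ring_1 mat)"
  using assms by (auto intro!: eq_matI)

lemma add_eq_0_matD:
  assumes "X \<in> carrier_mat k l" "Y \<in> carrier_mat k l" "X + Y = (0\<^sub>m k l :: 'a::ring_1 mat)"
  shows "X = - Y"
proof (rule eq_matI)
  fix i j assume "i < dim_row (- Y)" "j < dim_col (- Y)"
  then show "X $$ (i, j) = (- Y) $$ (i, j)"
    using arg_cong[OF assms(3), of "\<lambda>M. M $$ (i, j)"] assms(1,2) by (simp add: eq_neg_iff_add_eq_0)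
qed (use assms in auto)

text \<open>Block (1,1) of the form equation is exactly the condition on B, and the entry -A h^T
  \<open>delta_eps\<close> is the one that makes blocks (1,2) and (2,1) cancel against i *
  h.\<close>

lemma Qchar_qmat:
  assumes d: "(A, i, h, B) \<in> Qdata m e"
  shows "Qchar m e (qmat m e A i h B)"
proof -
  let ?w = "qmat m e A i h B" and ?d = "delta_eps e"
  have A: "A \<in> GLd m" and h: "h \<in> carrier_mat 2 m" and B: "B \<in> carrier_mat m m"
    and BB: "transpose_mat B + B + gram e h = 0\<^sub>m m m"
    and i: "i \<in> carrier_mat 2 2" "transpose_mat i * ?d * i = ?d" "det i = 1"
    using d by (auto simp: Qdata_def SOminus_iff)
  note Ac = GLd_carrier[OF A] and Ai = minv[OF A]
  note bq = blk_qmat[OF A i(1) h B, of e] and form = blk_form[OF qmat_carrier[of m e A i h B], of _ _ e]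
  note as = assoc_mult_mat
  have hd: "transpose_mat h * ?d \<in> carrier_mat m 2" using h by (intro mult_carrier_mat) auto
  have Ah: "A * (transpose_mat h * ?d) \<in> carrier_mat m 2" by (rule mult_carrier_mat[OF Ac hd])
  have ih: "i * h \<in> carrier_mat 2 m" using i h by (intro mult_carrier_mat)
  have idi: "transpose_mat i * (?d * i) = ?d" using i as[of "transpose_mat i" 2 2 ?d 2 i 2] by simp
  have ihdi: "transpose_mat (i * h) * (?d * i) = transpose_mat h * ?d"
  proof -
    have "transpose_mat (i * h) * (?d * i) = transpose_mat h * (transpose_mat i * (?d * i))"
      using i h mult_carrier_mat[OF delta_eps_carrier i(1), of e]
      by (simp add: transpose_mult[OF i(1) h] as[of _ m 2 _ 2 _ 2])
    then show ?thesis unfolding idi .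
  qed
  have idih: "transpose_mat i * (?d * (i * h)) = ?d * h"
  proof -
    have di: "?d * i \<in> carrier_mat 2 2" by (rule mult_carrier_mat[OF delta_eps_carrier i(1)])
    have "transpose_mat i * (?d * (i * h)) = transpose_mat i * ((?d * i) * h)"
      unfolding as[OF delta_eps_carrier i(1) h] ..
    also have "\<dots> = (transpose_mat i * (?d * i)) * h"
      by (rule as[OF _ di h, symmetric]) (use i in simp)
    finally show ?thesis unfolding idi .
  qed
  have e11: "transpose_mat (A * B) * transpose_mat (minv A) = transpose_mat B"
  proof -
    have "transpose_mat (A * B) * transpose_mat (minv A) = transpose_mat B * (transpose_mat A * transpose_mat (minv A))"
      using Ac B Ai by (simp add: transpose_mult[OF Ac B] as[of _ m m _ m _ m])
    then show ?thesis using B by (simp add: transpose_minv_mult[OF A])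
  qed
  have g: "transpose_mat (i * h) * (?d * (i * h)) = gram e h"
  proof -
    have "transpose_mat (i * h) * (?d * (i * h)) = transpose_mat h * (transpose_mat i * (?d * (i * h)))"
      using i h ih mult_carrier_mat[OF delta_eps_carrier ih, of e]
      by (simp add: transpose_mult[OF i(1) h] as[of _ m 2 _ 2 _ m])
    then show ?thesis unfolding idih gram_def using h by (simp add: as[of _ m 2 _ 2 _ m])
  qed
  have e21: "transpose_mat (- (A * (transpose_mat h * ?d))) * transpose_mat (minv A) = - (?d * h)"
  proof -
    have "transpose_mat (A * (transpose_mat h * ?d)) = (?d * h) * transpose_mat A"
      using h by (simp add: transpose_mult[OF Ac hd] transpose_mult[of "transpose_mat h" m 2 ?d 2])
    then have "transpose_mat (A * (transpose_mat h * ?d)) * transpose_mat (minv A)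
        = (?d * h) * (transpose_mat A * transpose_mat (minv A))"
      using Ac Ai mult_carrier_mat[OF delta_eps_carrier h] by (simp add: as[of _ 2 m _ m _ m])
    then have "transpose_mat (A * (transpose_mat h * ?d)) * transpose_mat (minv A) = ?d * h"
      using right_mult_one_mat[OF mult_carrier_mat[OF delta_eps_carrier h]] by (simp add: transpose_minv_mult[OF A])
    then show ?thesis using Ac Ai by (simp add: transpose_uminus)
  qed
  have e12: "minv A * (A * (transpose_mat h * ?d)) = transpose_mat h * ?d" by (rule GLd_left_cancel(1)[OF A hd])
  have eB: "minv A * (A * B) = B" by (rule GLd_left_cancel(1)[OF A B])
  have c: "transpose_mat w * Jmat (Suc m) e * w \<in> carrier_mat (2 * m + 2) (2 * m + 2)"
    if "w \<in> carrier_mat (2 * m + 2) (2 * m + 2)" for w :: "'a mat"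
    using that Jmat_carrier[of m e] by (intro mult_carrier_mat) auto
  have dh: "?d * h \<in> carrier_mat 2 m" by (rule mult_carrier_mat[OF delta_eps_carrier h])
  have AB: "A * B \<in> carrier_mat m m" using Ac B by simp
  have "transpose_mat ?w * Jmat (Suc m) e * ?w = Jmat (Suc m) e"
  proof (rule eq_blk9I[OF c[OF qmat_carrier] Jmat_carrier])
    show "blk m (transpose_mat ?w * Jmat (Suc m) e * ?w) 0 0 = blk m (Jmat (Suc m) e) 0 0"
      using Ac Ai AB Ah hd dh ih h i(1) BB B by (simp add: form bq blk_Jmat)
    show "blk m (transpose_mat ?w * Jmat (Suc m) e * ?w) 0 1 = blk m (Jmat (Suc m) e) 0 1"
      using Ac Ai AB Ah hd dh ih h i(1) BB B by (simp add: form bq blk_Jmat transpose_minv_mult[OF A] mult_carrier_mat[OF delta_eps_carrier ih])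
    show "blk m (transpose_mat ?w * Jmat (Suc m) e * ?w) 0 2 = blk m (Jmat (Suc m) e) 0 2"
      using Ac Ai AB Ah hd dh ih h i(1) BB B by (simp add: form bq blk_Jmat mult_carrier_mat[OF delta_eps_carrier i(1)])
    show "blk m (transpose_mat ?w * Jmat (Suc m) e * ?w) 1 0 = blk m (Jmat (Suc m) e) 1 0"
      using Ac Ai AB Ah hd dh ih h i(1) BB B by (simp add: form bq blk_Jmat)
    show "blk m (transpose_mat ?w * Jmat (Suc m) e * ?w) 1 1 = blk m (Jmat (Suc m) e) 1 1"
      using Ac Ai AB Ah hd dh ih h i(1) BB B by (simp add: form bq blk_Jmat e11 g eB)
    show "blk m (transpose_mat ?w * Jmat (Suc m) e * ?w) 1 2 = blk m (Jmat (Suc m) e) 1 2"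
      using Ac Ai AB Ah hd dh ih h i(1) BB B by (simp add: form bq blk_Jmat e12 ihdi minus_add_self_mat)
    show "blk m (transpose_mat ?w * Jmat (Suc m) e * ?w) 2 0 = blk m (Jmat (Suc m) e) 2 0"
      using Ac Ai AB Ah hd dh ih h i(1) BB B by (simp add: form bq blk_Jmat)
    show "blk m (transpose_mat ?w * Jmat (Suc m) e * ?w) 2 1 = blk m (Jmat (Suc m) e) 2 1"
      using Ac Ai AB Ah hd dh ih h i(1) BB B by (simp add: form bq blk_Jmat e21 idih minus_add_self_mat)
    show "blk m (transpose_mat ?w * Jmat (Suc m) e * ?w) 2 2 = blk m (Jmat (Suc m) e) 2 2"
      using Ac Ai AB Ah hd dh ih h i(1) BB B by (simp add: form bq blk_Jmat idi)
  qed
  then show ?thesis unfolding Qchar_def using bq i qmat_carrier[of m e A i h B] by simp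
qed

text \<open>The form equation is solved block by block: (0,1) makes A invertible and gives the
  second diagonal block, (0,2) kills block (1,2) of w, (2,2) makes i a rotation, (1,2) yields block
  (0,2) of w, and (1,1) the condition on B.\<close>

lemma Qchar_imp_qmat:
  assumes w: "Qchar m e w"
  shows "\<exists>A i h B. (A, i, h, B) \<in> Qdata m e \<and> w = qmat m e A i h B"
proof -
  let ?d = "delta_eps e"
  have wc: "w \<in> carrier_mat (2 * m + 2) (2 * m + 2)" and J: "transpose_mat w * Jmat (Suc m) e * w = Jmat (Suc m) e"
    and z: "blk m w 1 0 = 0\<^sub>m m m" "blk m w 2 0 = 0\<^sub>m 2 m" and di: "det (blk m w 2 2) = 1"
    using w by (auto simp: Qchar_def)
  define A E F D G H i where "A = blk m w 0 0" and "E = blk m w 0 1" and "F = blk m w 0 2"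
    and "D = blk m w 1 1" and "G = blk m w 1 2" and "H = blk m w 2 1" and "i = blk m w 2 2"
  note defs = this
  have c: "A \<in> carrier_mat m m" "E \<in> carrier_mat m m" "F \<in> carrier_mat m 2" "D \<in> carrier_mat m m"
    "G \<in> carrier_mat m 2" "H \<in> carrier_mat 2 m" "i \<in> carrier_mat 2 2" by (simp_all add: defs)
  note form = blk_form[OF wc, of _ _ e, unfolded J]
  note as = assoc_mult_mat
  have d2: "?d * X \<in> carrier_mat 2 k" if "X \<in> carrier_mat 2 k" for X k
    by (rule mult_carrier_mat[OF delta_eps_carrier that])
  have f01: "transpose_mat A * D = 1\<^sub>m m"
    using form[of 0 1] c d2[OF c(6)] by (simp add: blk_Jmat z flip: defs)
  have f02: "transpose_mat A * G = 0\<^sub>m m 2"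
    using form[of 0 2] c d2[OF c(7)] by (simp add: blk_Jmat z flip: defs)
  have At: "transpose_mat A \<in> GLd m" using c f01 by (intro GLdI[of _ _ D]) auto
  then have A: "A \<in> GLd m" using GLd_transpose[OF At] by simp
  have D: "D = transpose_mat (minv A)"
    using GLd_left_cancel(1)[OF At c(4)] f01 minv_unique[of "transpose_mat A" m "transpose_mat (minv A)"]
      transpose_minv_mult[OF A] minv(1)[OF A] minv(1)[OF At] c by simp
  have "G = minv (transpose_mat A) * (transpose_mat A * G)" using GLd_left_cancel(1)[OF At c(5)] by simp
  then have G: "G = 0\<^sub>m m 2" using f02 minv(1)[OF At] by simp
  have f11: "transpose_mat E * D + transpose_mat D * E + transpose_mat H * (?d * H) = 0\<^sub>m m m"
    using form[of 1 1] by (simp add: blk_Jmat flip: defs)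
  have f12: "transpose_mat D * F + transpose_mat H * (?d * i) = 0\<^sub>m m 2"
    using form[of 1 2] c mult_carrier_mat[of "transpose_mat D" m m F 2] by (simp add: blk_Jmat G flip: defs)
  have f22: "transpose_mat i * (?d * i) = ?d"
    using form[of 2 2] c mult_carrier_mat[of "transpose_mat i" 2 2 "?d * i" 2] d2[OF c(7)]
    by (simp add: blk_Jmat G flip: defs)
  have iS: "i \<in> SOminus 1 e"
    using f22 c di as[of "transpose_mat i" 2 2 ?d 2 i 2] by (simp add: SOminus_iff flip: defs)
  have iG: "i \<in> GLd 2" using c di by (simp add: GLd_def flip: defs)
  \<comment> \<open>A and i are known to be invertible by now, so h and B can be read off from the
    blocks i * h and A * B.\<close>
  define h where "h = minv i * H"
  define B where "B = minv A * E"
  have h: "h \<in> carrier_mat 2 m" unfolding h_def using minv(1)[OF iG] c by (intro mult_carrier_mat)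
  have B: "B \<in> carrier_mat m m" unfolding B_def using minv(1)[OF A] c by simp
  have Hi: "H = i * h" unfolding h_def using GLd_left_cancel(2)[OF iG c(6)] by simp
  have EB: "E = A * B" unfolding B_def using GLd_left_cancel(2)[OF A c(2)] by simp
  have hd: "transpose_mat h * ?d \<in> carrier_mat m 2" using h by (intro mult_carrier_mat) auto
  have hdi: "transpose_mat H * (?d * i) = transpose_mat h * ?d"
  proof -
    have "transpose_mat H * (?d * i) = transpose_mat h * (transpose_mat i * (?d * i))"
      unfolding Hi using c h d2[OF c(7)] by (simp add: transpose_mult[OF c(7) h] as[of _ m 2 _ 2 _ 2])
    then show ?thesis unfolding f22 .
  qed
  have F: "F = - (A * (transpose_mat h * ?d))"
  proof -
    have mF: "minv A * F \<in> carrier_mat m 2" using minv(1)[OF A] c by (intro mult_carrier_mat)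
    have "minv A * F + transpose_mat h * ?d = 0\<^sub>m m 2" using f12 unfolding hdi D by simp
    then have "minv A * F = - (transpose_mat h * ?d)" by (rule add_eq_0_matD[OF mF hd])
    then have "A * (minv A * F) = - (A * (transpose_mat h * ?d))" using c hd h by simp
    then show ?thesis using GLd_left_cancel(2)[OF A c(3)] by simp
  qed
  have g: "transpose_mat H * (?d * H) = gram e h"
  proof -
    have "transpose_mat H * (?d * H) = transpose_mat H * ((?d * i) * h)"
      unfolding as[OF delta_eps_carrier c(7) h] Hi ..
    also have "\<dots> = (transpose_mat H * (?d * i)) * h"
      by (rule as[OF _ d2[OF c(7)] h, symmetric]) (use c in simp)
    finally show ?thesis unfolding hdi gram_def .
  qed
  have e11: "transpose_mat E * D = transpose_mat B"
  proof -
    have "transpose_mat E * D = transpose_mat B * (transpose_mat A * transpose_mat (minv A))"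
      unfolding EB D using c B minv(1)[OF A] by (simp add: transpose_mult[OF c(1) B] as[of _ m m _ m _ m])
    then show ?thesis using B by (simp add: transpose_minv_mult[OF A])
  qed
  have "transpose_mat D * E = B" by (simp add: D B_def)
  then have "transpose_mat B + B + gram e h = 0\<^sub>m m m" using f11 e11 g by simp
  then have Qd: "(A, i, h, B) \<in> Qdata m e" using A iS h B by (simp add: Qdata_def)
  have "w = qmat m e A i h B"
    by (rule eq_blk9I[OF wc qmat_carrier])
       (simp_all add: blk_qmat[OF A c(7) h B] z EB F Hi D G flip: defs)
  with Qd show ?thesis by blast
qed

lemma Qpar_iff: "w \<in> Qpar (Suc m) e \<longleftrightarrow> Qchar m e w"
  unfolding Qpar_eq using Qchar_qmat[of _ _ _ _ m e] Qchar_imp_qmat[of m e w] by (force simp: image_iff)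

lemma matrix_group_Qpar:
  fixes e :: "'a::{field,finite}"
  assumes e: "e \<noteq> 0"
  shows "matrix_group (Qpar (Suc m) e) (2 * m + 2)"
proof
  let ?N = "2 * m + 2" and ?J = "Jmat (Suc m) e"
  note J = Jmat_carrier[of m e]
  show "Qpar (Suc m) e \<subseteq> GLd ?N"
  proof (rule subsetI)
    fix w assume "w \<in> Qpar (Suc m) e"
    then have w: "w \<in> carrier_mat ?N ?N" "transpose_mat w * ?J * w = ?J" by (auto simp: Qpar_iff Qchar_def)
    \<comment> \<open>The inverse of \<open>Jmat\<close>: its hyperbolic part is an involution, and
      diag(1, -e) is inverted by replacing e with 1 / e. Hence K w^T J inverts w.\<close>
    define K where "K = Jmat (Suc m) (1 / e)"
    have K: "K \<in> carrier_mat ?N ?N" unfolding K_def by (rule Jmat_carrier)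
    have dd: "delta_eps (1 / e) * delta_eps e = 1\<^sub>m 2"
    proof -
      have s2: "{0..<2::nat} = {0, 1}" by auto
      show ?thesis using e by (intro eq_matI) (auto simp: delta_eps_def scalar_prod_def s2)
    qed
    have one: "blk m (1\<^sub>m ?N :: 'a mat) a b = (if a = b then 1\<^sub>m (blk_dim m a) else 0\<^sub>m (blk_dim m a) (blk_dim m b))"
      if "a < 3" "b < 3" for a b
    proof (rule eq_matI)
      fix k l assume "k < dim_row (if a = b then 1\<^sub>m (blk_dim m a) else 0\<^sub>m (blk_dim m a) (blk_dim m b) :: 'a mat)"
        "l < dim_col (if a = b then 1\<^sub>m (blk_dim m a) else 0\<^sub>m (blk_dim m a) (blk_dim m b) :: 'a mat)"
      then have kl: "k < blk_dim m a" "l < blk_dim m b" by (auto split: if_splits)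
      have "blk_off m a + k = blk_off m b + l \<longleftrightarrow> a = b \<and> k = l"
        using blk_idx_off(1)[OF that(1) kl(1)] blk_idx_off(1)[OF that(2) kl(2)] by (metis prod.inject)
      then show "blk m (1\<^sub>m ?N) a b $$ (k, l)
          = (if a = b then 1\<^sub>m (blk_dim m a) else 0\<^sub>m (blk_dim m a) (blk_dim m b)) $$ (k, l)"
        using blk_idx_off(2)[OF that(1) kl(1)] blk_idx_off(2)[OF that(2) kl(2)] kl by (auto simp: blk_def)
    qed (auto simp: blk_def)
    have KJ: "K * ?J = 1\<^sub>m ?N"
      by (rule eq_blk9I[OF mult_carrier_mat[OF K J] one_carrier_mat])
         (simp_all add: blk_mult[OF K J] one del: add_2_eq_Suc', simp_all add: K_def blk_Jmat dd)
    have "(K * (transpose_mat w * ?J)) * w = K * (transpose_mat w * ?J * w)"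
      using K J w by (intro assoc_mult_mat) auto
    also have "\<dots> = 1\<^sub>m ?N" using w KJ by simp
    finally have *: "(K * (transpose_mat w * ?J)) * w = 1\<^sub>m ?N" .
    have X: "K * (transpose_mat w * ?J) \<in> carrier_mat ?N ?N" using K J w by (intro mult_carrier_mat) auto
    show "w \<in> GLd ?N" by (rule GLdI[OF w(1) X mat_mult_left_right_inverse[OF X w(1) *]])
  qed
  have "(1\<^sub>m m, 1\<^sub>m 2, 0\<^sub>m 2 m, 0\<^sub>m m m) \<in> Qdata m e"
    by (auto simp: Qdata_def SOminus_iff GLd_def gram_def)
  then have "qmat m e (1\<^sub>m m) (1\<^sub>m 2) (0\<^sub>m 2 m) (0\<^sub>m m m) \<in> Qpar (Suc m) e" unfolding Qpar_eq by force
  moreover have "qmat m e (1\<^sub>m m) (1\<^sub>m 2) (0\<^sub>m 2 m) (0\<^sub>m m m) = 1\<^sub>m ?N"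
  proof -
    have "minv (1\<^sub>m m) = (1\<^sub>m m :: 'a mat)" by (rule minv_unique[of _ m]) auto
    then show ?thesis
      by (intro eq_matI) (auto simp: qmat_def block3_def blk_idx_def)
  qed
  ultimately show "1\<^sub>m ?N \<in> Qpar (Suc m) e" by simp
  fix x y assume "x \<in> Qpar (Suc m) e" "y \<in> Qpar (Suc m) e"
  then have x: "Qchar m e x" and y: "Qchar m e y" by (auto simp: Qpar_iff)
  have xc: "x \<in> carrier_mat ?N ?N" and yc: "y \<in> carrier_mat ?N ?N" using x y by (auto simp: Qchar_def)
  obtain A i h B where "(A, i, h, B) \<in> Qdata m e" "y = qmat m e A i h B" using Qchar_imp_qmat[OF y] by blast
  \<comment> \<open>This zero block is a consequence of the form equation. Together with the zero
    block (2,0) of x it makes the lower right block of x * y the product of those of x and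
    y.\<close>
  then have y12: "blk m y 1 2 = 0\<^sub>m m 2" by (auto simp: Qdata_def SOminus_iff blk_qmat)
  have "transpose_mat (x * y) * ?J * (x * y) = transpose_mat y * (transpose_mat x * ?J * x) * y"
    using xc yc J by (simp add: transpose_mult[OF xc yc] assoc_mult_mat[of _ ?N ?N _ ?N _ ?N])
  also have "\<dots> = ?J" using x y by (simp add: Qchar_def)
  finally have "transpose_mat (x * y) * ?J * (x * y) = ?J" .
  moreover have "x * y \<in> carrier_mat ?N ?N" using xc yc by (rule mult_carrier_mat)
  ultimately have "Qchar m e (x * y)"
    using x y y12 blk_carriers[of m x] blk_carriers[of m y] by (simp add: Qchar_def blk_mult[OF xc yc] det_mult[OF blk_carriers(9) blk_carriers(9)] del: blk_carriers)
  then show "x * y \<in> Qpar (Suc m) e" by (simp add: Qpar_iff)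
qed

section \<open>The anisotropic rotation group\<close>

text \<open>The matrix of multiplication by a + b sqrt e in the basis 1, sqrt e of the quadratic
  extension.\<close>

definition rot :: "'a::field \<Rightarrow> 'a \<Rightarrow> 'a \<Rightarrow> 'a mat" where
  "rot e a b = mat 2 2 (\<lambda>(i, j). if i = j then a else if i = 0 then e * b else b)"

lemma rot_carrier [simp]: "rot e a b \<in> carrier_mat 2 2"
  by (simp add: rot_def)

lemma lt_2_iff: "i < 2 \<longleftrightarrow> i = 0 \<or> i = (1::nat)"
  by auto

lemma det_2x2:
  fixes M :: "'a::field mat"
  assumes "M \<in> carrier_mat 2 2"
  shows "det M = M $$ (0, 0) * M $$ (1, 1) - M $$ (0, 1) * M $$ (1, 0)"
proof -
  have "M = mat22 (M $$ (0, 0)) (M $$ (0, 1)) (M $$ (1, 0)) (M $$ (1, 1))"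
    using assms by (intro eq_matI) (auto simp: mat_sc_def lt_2_iff)
  then show ?thesis by (metis det_mat22)
qed

lemma set_2: "{0..<2::nat} = {0, 1}" by auto

lemma rot_SOminus:
  assumes "(a, b) \<in> norm_one e"
  shows "rot e a b \<in> SOminus 1 e"
proof -
  have n: "a * a - e * (b * b) = 1" using assms by (simp add: norm_one_def)
  have "transpose_mat (rot e a b) * delta_eps e * rot e a b = delta_eps e"
  proof (rule eq_matI)
    fix i j assume "i < dim_row (delta_eps e)" "j < dim_col (delta_eps e)"
    then have "i = 0 \<or> i = 1" "j = 0 \<or> j = 1" by auto
    moreover have "e * b * (e * b) - e * (a * a) = - e"
    proof -
      have "e * b * (e * b) - e * (a * a) = - e * (a * a - e * (b * b))" by (simp add: algebra_simps)
      then show ?thesis using n by simp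
    qed
    ultimately show "(transpose_mat (rot e a b) * delta_eps e * rot e a b) $$ (i, j) = delta_eps e $$ (i, j)"
      using n by (auto simp: rot_def delta_eps_def scalar_prod_def set_2 algebra_simps)
  qed (auto simp: rot_def)
  moreover have "det (rot e a b) = 1"
    using n by (subst det_2x2) (auto simp: rot_def algebra_simps)
  ultimately show ?thesis by (simp add: SOminus_iff)
qed

lemma SOminus_rot:
  assumes "i \<in> SOminus 1 e"
  shows "\<exists>a b. (a, b) \<in> norm_one e \<and> i = rot e a b"
proof -
  have i: "i \<in> carrier_mat 2 2" and form: "transpose_mat i * delta_eps e * i = delta_eps e" and d: "det i = 1"
    using assms by (auto simp: SOminus_iff)
  define p q r s where "p = i $$ (0, 0)" and "q = i $$ (0, 1)" and "r = i $$ (1, 0)" and "s = i $$ (1, 1)"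
  have det: "p * s - q * r = 1" using d det_2x2[OF i] by (simp add: p_def q_def r_def s_def)
  have ent: "(transpose_mat i * delta_eps e * i) $$ (k, l) = i $$ (0, k) * i $$ (0, l) - e * (i $$ (1, k) * i $$ (1, l))"
    if "k < 2" "l < 2" for k l
    using that i by (simp add: delta_eps_def scalar_prod_def set_2)
  have f00: "p * p - e * (r * r) = 1" using ent[of 0 0] form by (simp add: delta_eps_def p_def r_def)
  have f01: "p * q - e * (r * s) = 0" using ent[of 0 1] form by (simp add: delta_eps_def p_def q_def r_def s_def)
  \<comment> \<open>Multiplying s, and then q, by the norm equation p^2 - e r^2 = 1 expresses them
    through the determinant and the mixed equation, with no case distinction on p or r.\<close>
  have "s = s * (p * p - e * (r * r))" using f00 by simp
  also have "\<dots> = p * (p * s - q * r) + r * (p * q - e * (r * s))" by (simp add: algebra_simps)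
  finally have s: "s = p" using det f01 by simp
  have "q = q * (p * p - e * (r * r))" using f00 by simp
  also have "\<dots> = e * r * (p * s - q * r) + p * (p * q - e * (r * s))" by (simp add: algebra_simps)
  finally have q: "q = e * r" using det f01 by simp
  have "i = rot e p r"
    using i s q by (intro eq_matI) (auto simp: rot_def p_def q_def r_def s_def lt_2_iff)
  moreover have "(p, r) \<in> norm_one e" using f00 by (simp add: norm_one_def)
  ultimately show ?thesis by blast
qed

lemma bij_betw_rot: "bij_betw (\<lambda>(a, b). rot e a b) (norm_one e) (SOminus 1 e)"
proof (rule bij_betwI')
  fix x y :: "'a \<times> 'a"
  have "rot e a b = rot e a' b' \<Longrightarrow> a = a' \<and> b = b'" for a b a' b' :: 'a
  proof
    assume eq: "rot e a b = rot e a' b'"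
    show "a = a'" using arg_cong[OF eq, of "\<lambda>M. M $$ (0, 0)"] by (simp add: rot_def)
    show "b = b'" using arg_cong[OF eq, of "\<lambda>M. M $$ (1, 0)"] by (simp add: rot_def)
  qed
  then show "((case x of (a, b) \<Rightarrow> rot e a b) = (case y of (a, b) \<Rightarrow> rot e a b)) = (x = y)"
    by (auto split: prod.splits)
qed (use rot_SOminus SOminus_rot in \<open>auto split: prod.splits, force?\<close>)

lemma gram_sym:
  assumes h: "h \<in> carrier_mat 2 m"
  shows "transpose_mat (gram e h) = gram e h"
proof (rule eq_matI)
  fix i j assume "i < dim_row (gram e h)" "j < dim_col (gram e h)"
  then have "i < m" "j < m" using gram_carrier[OF h, of e] by auto
  then show "transpose_mat (gram e h) $$ (i, j) = gram e h $$ (i, j)"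
    using gram_carrier[OF h, of e] by (simp add: gram_index[OF h] mult.commute)
qed (use gram_carrier[OF h, of e] in auto)

text \<open>\<open>gram e h\<close> is symmetric, so the left side is 3 \<open>gram e h\<close> +
  S^T + S, and the first term vanishes in characteristic 3. The shift thus removes h from the
  condition.\<close>

lemma Qdata_B_iff:
  assumes three: "(3::'a::field) = 0" and h: "h \<in> carrier_mat 2 m" and S: "S \<in> carrier_mat m m"
  shows "transpose_mat (gram e h + S) + (gram e h + S) + gram e h = 0\<^sub>m m m \<longleftrightarrow> (S :: 'a mat) \<in> Alt m"
proof -
  note g = gram_carrier[OF h, of e]
  have ent: "(transpose_mat (gram e h + S) + (gram e h + S) + gram e h) $$ (i, j) = S $$ (j, i) + S $$ (i, j)"
    if ij: "i < m" "j < m" for i j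
  proof -
    have "gram e h $$ (j, i) = gram e h $$ (i, j)"
      using arg_cong[OF gram_sym[OF h, of e], of "\<lambda>M. M $$ (i, j)"] ij g by simp
    then have "(transpose_mat (gram e h + S) + (gram e h + S) + gram e h) $$ (i, j)
        = 3 * gram e h $$ (i, j) + (S $$ (j, i) + S $$ (i, j))"
      using ij g S by (simp add: algebra_simps)
    then show ?thesis using three by simp
  qed
  show ?thesis
  proof
    assume eq: "transpose_mat (gram e h + S) + (gram e h + S) + gram e h = 0\<^sub>m m m"
    show "S \<in> Alt m"
    proof (rule AltI[OF S])
      fix i j assume ij: "i < m" "j < m"
      then have "S $$ (j, i) + S $$ (i, j) = 0" using ent[OF ij] unfolding eq by simp
      then show "S $$ (j, i) = - S $$ (i, j)" by (simp add: eq_neg_iff_add_eq_0)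
    qed
  next
    assume A: "S \<in> Alt m"
    show "transpose_mat (gram e h + S) + (gram e h + S) + gram e h = 0\<^sub>m m m"
    proof (rule eq_matI)
      fix i j assume "i < dim_row (0\<^sub>m m m)" "j < dim_col (0\<^sub>m m m)"
      then have ij: "i < m" "j < m" by auto
      have "S $$ (j, i) = - S $$ (i, j)" by (rule Alt_swap[OF A ij])
      then show "(transpose_mat (gram e h + S) + (gram e h + S) + gram e h) $$ (i, j) = 0\<^sub>m m m $$ (i, j)"
        unfolding ent[OF ij] using ij by simp
    qed (use g S in auto)
  qed
qed

abbreviation qpar :: "nat \<Rightarrow> 'a::field \<Rightarrow> 'a mat \<Rightarrow> 'a \<times> 'a \<Rightarrow> 'a mat \<Rightarrow> 'a mat \<Rightarrow> 'a mat" where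
  "qpar m e A ab h S \<equiv> qmat m e A (rot e (fst ab) (snd ab)) h (gram e h + S)"

text \<open>Subtracting \<open>gram e h\<close> from B leaves an arbitrary alternating matrix, so
  all four coordinates range independently.\<close>

lemma bij_betw_qpar:
  fixes e :: "'a::{field,finite}"
  assumes three: "(3::'a) = 0"
  shows "bij_betw (\<lambda>(A, ab, h, S). qpar m e A ab h S)
    (GLd m \<times> norm_one e \<times> carrier_mat 2 m \<times> Alt m) (Qpar (Suc m) e)"
    (is "bij_betw ?F ?S _")
proof (rule bij_betwI')
  fix x y assume xy: "x \<in> ?S" "y \<in> ?S"
  obtain A ab h S A' ab' h' S' where [simp]: "x = (A, ab, h, S)" "y = (A', ab', h', S')" by (metis prod_cases4)
  have A: "A \<in> GLd m" "A' \<in> GLd m" and ab: "ab \<in> norm_one e" "ab' \<in> norm_one e"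
    and h: "h \<in> carrier_mat 2 m" "h' \<in> carrier_mat 2 m" and S: "S \<in> carrier_mat m m" "S' \<in> carrier_mat m m"
    using xy by (auto dest: Alt_carrier)
  have gS: "gram e h + S \<in> carrier_mat m m" "gram e h' + S' \<in> carrier_mat m m"
    using h S by (auto intro: add_carrier_mat)
  note b1 = blk_qmat[OF A(1) rot_carrier[of e "fst ab" "snd ab"] h(1) gS(1), of e]
    and b2 = blk_qmat[OF A(2) rot_carrier[of e "fst ab'" "snd ab'"] h(2) gS(2), of e]
  show "(?F x = ?F y) = (x = y)"
  proof
    assume "?F x = ?F y"
    then have eq: "qpar m e A ab h S = qpar m e A' ab' h' S'" by simp
    have AA: "A = A'" using arg_cong[OF eq, of "\<lambda>w. blk m w 0 0"] unfolding b1 b2 .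
    have "rot e (fst ab) (snd ab) = rot e (fst ab') (snd ab')"
      using arg_cong[OF eq, of "\<lambda>w. blk m w 2 2"] unfolding b1 b2 .
    then have abab: "ab = ab'"
      using bij_betw_imp_inj_on[OF bij_betw_rot[of e]] ab by (auto simp: inj_on_def case_prod_beta)
    have iG: "rot e (fst ab) (snd ab) \<in> GLd 2"
      using rot_SOminus[of "fst ab" "snd ab" e] ab by (auto simp: SOminus_iff GLd_def)
    have "rot e (fst ab) (snd ab) * h = rot e (fst ab') (snd ab') * h'"
      using arg_cong[OF eq, of "\<lambda>w. blk m w 2 1"] unfolding b1 b2 .
    then have "rot e (fst ab) (snd ab) * h = rot e (fst ab) (snd ab) * h'" using abab by simp
    then have hh: "h = h'" using GLd_left_cancel(1)[OF iG h(1)] GLd_left_cancel(1)[OF iG h(2)] by metis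
    have "A * (gram e h + S) = A' * (gram e h' + S')"
      using arg_cong[OF eq, of "\<lambda>w. blk m w 0 1"] unfolding b1 b2 .
    then have "A * (gram e h + S) = A * (gram e h' + S')" using AA by simp
    then have "gram e h + S = gram e h' + S'"
      using GLd_left_cancel(1)[OF A(1) gS(1)] GLd_left_cancel(1)[OF A(1) gS(2)] by metis
    then have "gram e h + S = gram e h + S'" using hh by simp
    then have e: "(gram e h + S) $$ (i, j) = (gram e h + S') $$ (i, j)" for i j by simp
    have "S = S'"
    proof (rule eq_matI)
      fix i j assume "i < dim_row S'" "j < dim_col S'"
      then show "S $$ (i, j) = S' $$ (i, j)" using e[of i j] S gram_carrier[OF h(1), of e] by simp
    qed (use S in auto)
    with AA abab hh show "x = y" by simp
  qed simp
next
  fix x assume x: "x \<in> ?S"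
  obtain A ab h S where [simp]: "x = (A, ab, h, S)" by (metis prod_cases4)
  have d: "A \<in> GLd m" "ab \<in> norm_one e" "h \<in> carrier_mat 2 m" "S \<in> Alt m" using x by auto
  have "rot e (fst ab) (snd ab) \<in> SOminus 1 e" using d(2) by (intro rot_SOminus) simp
  moreover have "gram e h + S \<in> carrier_mat m m" using d by (auto dest: Alt_carrier)
  ultimately have "(A, rot e (fst ab) (snd ab), h, gram e h + S) \<in> Qdata m e"
    using d Qdata_B_iff[OF three d(3) Alt_carrier[OF d(4)], of e] by (simp add: Qdata_def)
  then show "?F x \<in> Qpar (Suc m) e" unfolding Qpar_eq by force
next
  fix w assume "w \<in> Qpar (Suc m) e"
  then obtain A i h B where d: "A \<in> GLd m" "i \<in> SOminus 1 e" "h \<in> carrier_mat 2 m" "B \<in> carrier_mat m m"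
      "transpose_mat B + B + gram e h = 0\<^sub>m m m" and w: "w = qmat m e A i h B"
    unfolding Qpar_eq by (auto simp: Qdata_def)
  obtain a b where ab: "(a, b) \<in> norm_one e" "i = rot e a b" using SOminus_rot[OF d(2)] by blast
  note g = gram_carrier[OF d(3), of e]
  have BS: "B = gram e h + (B - gram e h)" using g d(4) by (intro eq_matI) auto
  have "B - gram e h \<in> Alt m"
    using d(5) Qdata_B_iff[OF three d(3), of "B - gram e h" e] minus_carrier_mat[OF g] g d(4) BS[symmetric] by simp
  then have "(A, (a, b), h, B - gram e h) \<in> ?S" using d ab by simp
  moreover have "w = ?F (A, (a, b), h, B - gram e h)" using w ab BS by simp
  ultimately show "\<exists>x\<in>?S. w = ?F x" by blast
qed

section \<open>Weyl elements and their stabilisers\<close>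

lemma Jmat_index:
  assumes "i < 2 * m + 2" "j < 2 * m + 2"
  shows "Jmat (Suc m) e $$ (i, j) = (if i < m then if j = i + m then 1 else 0
    else if i < 2 * m then if i = j + m then 1 else 0
    else if i = j then if i = 2 * m then 1 else - e else 0)"
proof -
  obtain a k where a: "a < 3" "k < blk_dim m a" "i = blk_off m a + k" using assms(1) by (rule blk_cases)
  obtain b l where b: "b < 3" "l < blk_dim m b" "j = blk_off m b + l" using assms(2) by (rule blk_cases)
  have "Jmat (Suc m) e $$ (i, j) = blk m (Jmat (Suc m) e) a b $$ (k, l)"
    using a b by (simp add: blk_def)
  moreover have "a = 0 \<or> a = 1 \<or> a = 2" "b = 0 \<or> b = 1 \<or> b = 2" using a(1) b(1) by auto
  ultimately show ?thesis using a(2,3) b(2,3)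
    by (elim disjE) (simp_all add: blk_Jmat blk_off_def delta_eps_def)
qed

abbreviation swp :: "nat \<Rightarrow> nat \<Rightarrow> nat \<Rightarrow> nat" where
  "swp m r \<equiv> sigma_perm (Suc m) r"

lemma swp_simps:
  "swp m r i = (if i < r then i + m else if m \<le> i \<and> i < m + r then i - m else i)"
  by (simp add: sigma_perm_def)

lemma swp_less: "r \<le> m \<Longrightarrow> i < 2 * m + 2 \<Longrightarrow> swp m r i < 2 * m + 2"
  and swp_swp: "r \<le> m \<Longrightarrow> swp m r (swp m r i) = i"
  by (auto simp: swp_simps)

lemma sigma_mat_carrier [simp]: "sigma_mat (Suc m) r \<in> carrier_mat (2 * m + 2) (2 * m + 2)"
  by (simp add: sigma_mat_def)

lemma sigma_mat_index:
  "i < 2 * m + 2 \<Longrightarrow> j < 2 * m + 2 \<Longrightarrow> sigma_mat (Suc m) r $$ (i, j) = (if j = swp m r i then 1 else 0)"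
  by (simp add: sigma_mat_def)

lemma sigma_mat_mult_left:
  assumes w: "w \<in> carrier_mat (2 * m + 2) n" and r: "r \<le> m" and ij: "i < 2 * m + 2" "j < n"
  shows "(sigma_mat (Suc m) r * w) $$ (i, j) = (w :: 'a::field mat) $$ (swp m r i, j)"
proof -
  have "(sigma_mat (Suc m) r * w) $$ (i, j) = (\<Sum>k<2 * m + 2. sigma_mat (Suc m) r $$ (i, k) * w $$ (k, j))"
    using carrier_matD[OF w] carrier_matD[OF sigma_mat_carrier[of m r, where 'a = 'a]] ij
    by (simp add: scalar_prod_def atLeast0LessThan del: add_2_eq_Suc')
  also have "\<dots> = (\<Sum>k<2 * m + 2. if k = swp m r i then w $$ (k, j) else 0)"
    using ij by (intro sum.cong refl) (simp add: sigma_mat_index del: add_2_eq_Suc')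
  also have "\<dots> = w $$ (swp m r i, j)" using swp_less[OF r ij(1)] by (simp del: add_2_eq_Suc')
  finally show ?thesis .
qed

lemma sigma_mat_mult_right:
  assumes w: "w \<in> carrier_mat n (2 * m + 2)" and r: "r \<le> m" and ij: "i < n" "j < 2 * m + 2"
  shows "(w * sigma_mat (Suc m) r) $$ (i, j) = (w :: 'a::field mat) $$ (i, swp m r j)"
proof -
  have "(w * sigma_mat (Suc m) r) $$ (i, j) = (\<Sum>k<2 * m + 2. w $$ (i, k) * sigma_mat (Suc m) r $$ (k, j))"
    using carrier_matD[OF w] carrier_matD[OF sigma_mat_carrier[of m r, where 'a = 'a]] ij
    by (simp add: scalar_prod_def atLeast0LessThan del: add_2_eq_Suc')
  also have "\<dots> = (\<Sum>k<2 * m + 2. if k = swp m r j then w $$ (i, k) else 0)"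
    using ij swp_swp[OF r] by (intro sum.cong refl) (auto simp: sigma_mat_index simp del: add_2_eq_Suc')
  also have "\<dots> = w $$ (i, swp m r j)" using swp_less[OF r ij(2)] by (simp del: add_2_eq_Suc')
  finally show ?thesis .
qed

lemma sigma_mat_conj:
  assumes w: "w \<in> carrier_mat (2 * m + 2) (2 * m + 2)" and r: "r \<le> m" and ij: "i < 2 * m + 2" "j < 2 * m + 2"
  shows "(sigma_mat (Suc m) r * w * sigma_mat (Suc m) r) $$ (i, j) = (w :: 'a::field mat) $$ (swp m r i, swp m r j)"
  using sigma_mat_mult_right[OF mult_carrier_mat[OF sigma_mat_carrier w] r ij]
    sigma_mat_mult_left[OF w r ij(1) swp_less[OF r ij(2)]] by simp

lemma sigma_mat_sq: "r \<le> m \<Longrightarrow> sigma_mat (Suc m) r * sigma_mat (Suc m) r = (1\<^sub>m (2 * m + 2) :: 'a::field mat)"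
proof (rule eq_matI)
  fix i j assume r: "r \<le> m" and "i < dim_row (1\<^sub>m (2 * m + 2) :: 'a mat)" "j < dim_col (1\<^sub>m (2 * m + 2) :: 'a mat)"
  then have ij: "i < 2 * m + 2" "j < 2 * m + 2" by auto
  show "(sigma_mat (Suc m) r * sigma_mat (Suc m) r) $$ (i, j) = (1\<^sub>m (2 * m + 2) :: 'a mat) $$ (i, j)"
    unfolding sigma_mat_mult_left[OF sigma_mat_carrier r ij] sigma_mat_index[OF swp_less[OF r ij(1)] ij(2)]
    using ij swp_swp[OF r] by (auto simp del: add_2_eq_Suc')
qed (auto simp: sigma_mat_def)

lemma sigma_mat_sym: "r \<le> m \<Longrightarrow> transpose_mat (sigma_mat (Suc m) r) = (sigma_mat (Suc m) r :: 'a::field mat)"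
proof (rule eq_matI)
  fix i j assume r: "r \<le> m" and "i < dim_row (sigma_mat (Suc m) r :: 'a mat)" "j < dim_col (sigma_mat (Suc m) r :: 'a mat)"
  then have ij: "i < 2 * m + 2" "j < 2 * m + 2" by (auto simp: sigma_mat_def)
  have "(i = swp m r j) = (j = swp m r i)" using swp_swp[OF r] by metis
  then show "transpose_mat (sigma_mat (Suc m) r) $$ (i, j) = (sigma_mat (Suc m) r :: 'a mat) $$ (i, j)"
    using ij by (simp add: sigma_mat_def)
qed (auto simp: sigma_mat_def)

lemma sigma_mat_Jmat:
  assumes r: "r \<le> m"
  shows "sigma_mat (Suc m) r * Jmat (Suc m) e * sigma_mat (Suc m) r = (Jmat (Suc m) e :: 'a::field mat)"
proof (rule eq_matI)
  fix i j assume "i < dim_row (Jmat (Suc m) e)" "j < dim_col (Jmat (Suc m) e)"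
  then have ij: "i < 2 * m + 2" "j < 2 * m + 2" using carrier_matD[OF Jmat_carrier[of m e]] by auto
  show "(sigma_mat (Suc m) r * Jmat (Suc m) e * sigma_mat (Suc m) r) $$ (i, j) = Jmat (Suc m) e $$ (i, j)"
    unfolding sigma_mat_conj[OF Jmat_carrier r ij]
  proof (cases "i < 2 * m")
    case True
    \<comment> \<open>The partner of an index under the hyperbolic pairing. \<open>swp\<close> only
      exchanges partners and hence commutes with this map.\<close>
    define fl where "fl = (\<lambda>i. if i < m then i + m else i - m)"
    have J: "Jmat (Suc m) e $$ (k, l) = (if l = fl k then 1 else 0)" if "k < 2 * m" "l < 2 * m + 2" for k l
      using that Jmat_index[of k m l e] by (auto simp: fl_def)
    have p: "swp m r i < 2 * m" using True r by (auto simp: swp_simps)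
    have "fl (swp m r i) = swp m r (fl i)" using True r by (auto simp: swp_simps fl_def)
    moreover have "swp m r j = swp m r (fl i) \<longleftrightarrow> j = fl i" using swp_swp[OF r] by metis
    ultimately show "Jmat (Suc m) e $$ (swp m r i, swp m r j) = Jmat (Suc m) e $$ (i, j)"
      using J[OF p swp_less[OF r ij(2)]] J[OF True ij(2)] by simp
  next
    case False
    then have p: "swp m r i = i" using r by (simp add: swp_simps)
    have J: "Jmat (Suc m) e $$ (i, l) = (if i = l then if i = 2 * m then 1 else - e else 0)" if "l < 2 * m + 2" for l
      using that False Jmat_index[OF ij(1) that, of e] by simp
    have "i = swp m r j \<longleftrightarrow> i = j" using swp_swp[OF r] p by metis
    then show "Jmat (Suc m) e $$ (swp m r i, swp m r j) = Jmat (Suc m) e $$ (i, j)"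
      unfolding p using J[OF ij(2)] J[OF swp_less[OF r ij(2)]] by simp
  qed
qed (use carrier_matD[OF Jmat_carrier[of m e]] carrier_matD[OF sigma_mat_carrier[of m r, where 'a = 'a]] in simp_all)

text \<open>Covers the identity (\<kappa> = 1) and \<rho> (\<kappa> = -1) at once, so that all four
  families share one computation.\<close>

definition tau :: "nat \<Rightarrow> 'a::field \<Rightarrow> 'a mat" where
  "tau m \<kappa> = mat (2 * m + 2) (2 * m + 2) (\<lambda>(i, j). if i = j then if i = 2 * m + 1 then \<kappa> else 1 else 0)"

lemma tau_carrier [simp]: "tau m \<kappa> \<in> carrier_mat (2 * m + 2) (2 * m + 2)"
  by (simp add: tau_def)

lemma rho_mat_tau: "rho_mat (Suc m) = tau m (- 1)"
  by (rule eq_matI) (auto simp: rho_mat_def tau_def)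

lemma one_mat_tau: "1\<^sub>m (2 * m + 2) = tau m 1"
  by (rule eq_matI) (auto simp: tau_def)

abbreviation sgn_last :: "nat \<Rightarrow> 'a::field \<Rightarrow> nat \<Rightarrow> 'a" where
  "sgn_last m \<kappa> i \<equiv> if i = 2 * m + 1 then \<kappa> else 1"

lemma tau_mult_left:
  assumes w: "w \<in> carrier_mat (2 * m + 2) n" and ij: "i < 2 * m + 2" "j < n"
  shows "(tau m \<kappa> * w) $$ (i, j) = sgn_last m \<kappa> i * w $$ (i, j)"
proof -
  have "(tau m \<kappa> * w) $$ (i, j) = (\<Sum>k<2 * m + 2. tau m \<kappa> $$ (i, k) * w $$ (k, j))"
    using carrier_matD[OF w] carrier_matD[OF tau_carrier[of m \<kappa>]] ij
    by (simp add: scalar_prod_def atLeast0LessThan del: add_2_eq_Suc')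
  also have "\<dots> = (\<Sum>k<2 * m + 2. if k = i then sgn_last m \<kappa> i * w $$ (k, j) else 0)"
    using ij by (intro sum.cong refl) (simp add: tau_def del: add_2_eq_Suc')
  also have "\<dots> = sgn_last m \<kappa> i * w $$ (i, j)" using ij by (simp del: add_2_eq_Suc')
  finally show ?thesis .
qed

lemma tau_mult_right:
  assumes w: "w \<in> carrier_mat n (2 * m + 2)" and ij: "i < n" "j < 2 * m + 2"
  shows "(w * tau m \<kappa>) $$ (i, j) = w $$ (i, j) * sgn_last m \<kappa> j"
proof -
  have "(w * tau m \<kappa>) $$ (i, j) = (\<Sum>k<2 * m + 2. w $$ (i, k) * tau m \<kappa> $$ (k, j))"
    using carrier_matD[OF w] carrier_matD[OF tau_carrier[of m \<kappa>]] ij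
    by (simp add: scalar_prod_def atLeast0LessThan del: add_2_eq_Suc')
  also have "\<dots> = (\<Sum>k<2 * m + 2. if k = j then w $$ (i, k) * sgn_last m \<kappa> j else 0)"
    using ij by (intro sum.cong refl) (simp add: tau_def del: add_2_eq_Suc')
  also have "\<dots> = w $$ (i, j) * sgn_last m \<kappa> j" using ij by (simp del: add_2_eq_Suc')
  finally show ?thesis .
qed

lemma tau_conj:
  assumes w: "w \<in> carrier_mat (2 * m + 2) (2 * m + 2)" and ij: "i < 2 * m + 2" "j < 2 * m + 2"
  shows "(tau m \<kappa> * w * tau m \<kappa>) $$ (i, j) = sgn_last m \<kappa> i * w $$ (i, j) * sgn_last m \<kappa> j"
  unfolding tau_mult_right[OF mult_carrier_mat[OF tau_carrier w] ij] tau_mult_left[OF w ij] ..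

lemma tau_sq: "\<kappa> * \<kappa> = 1 \<Longrightarrow> tau m \<kappa> * tau m \<kappa> = 1\<^sub>m (2 * m + 2)"
proof (rule eq_matI)
  fix i j assume k: "\<kappa> * \<kappa> = 1" and "i < dim_row (1\<^sub>m (2 * m + 2) :: 'a mat)" "j < dim_col (1\<^sub>m (2 * m + 2) :: 'a mat)"
  then have ij: "i < 2 * m + 2" "j < 2 * m + 2" by auto
  show "(tau m \<kappa> * tau m \<kappa>) $$ (i, j) = 1\<^sub>m (2 * m + 2) $$ (i, j)"
    unfolding tau_mult_left[OF tau_carrier ij] using ij k by (simp add: tau_def)
qed (auto simp: tau_def)

lemma tau_sym: "transpose_mat (tau m \<kappa>) = tau m \<kappa>"
  by (rule eq_matI) (auto simp: tau_def)

lemma tau_Jmat: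
  assumes k: "\<kappa> * \<kappa> = 1"
  shows "tau m \<kappa> * Jmat (Suc m) e * tau m \<kappa> = Jmat (Suc m) e"
proof (rule eq_matI)
  fix i j assume "i < dim_row (Jmat (Suc m) e)" "j < dim_col (Jmat (Suc m) e)"
  then have ij: "i < 2 * m + 2" "j < 2 * m + 2" using carrier_matD[OF Jmat_carrier[of m e]] by auto
  show "(tau m \<kappa> * Jmat (Suc m) e * tau m \<kappa>) $$ (i, j) = Jmat (Suc m) e $$ (i, j)"
    unfolding tau_conj[OF Jmat_carrier ij] Jmat_index[OF ij]
    using k ij by auto
qed (use carrier_matD[OF Jmat_carrier[of m e]] carrier_matD[OF tau_carrier[of m \<kappa>]] in simp_all)

lemma form_conj:
  assumes u: "u \<in> carrier_mat n n" "transpose_mat u = u" "u * J * u = J"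
    and J: "J \<in> carrier_mat n n" and w: "w \<in> carrier_mat n n" "transpose_mat w * J * w = J"
  shows "transpose_mat (u * w * u) * J * (u * w * u) = (J :: 'a::field mat)"
proof -
  note as = assoc_mult_mat[of _ n n _ n _ n]
  have t: "transpose_mat (u * w * u) = u * (transpose_mat w * u)"
    using u w by (simp add: transpose_mult[of _ n n _ n])
  have "transpose_mat (u * w * u) * J * (u * w * u) = u * (transpose_mat w * (u * J * u) * w) * u"
    unfolding t using u(1) w(1) J by (simp add: as)
  also have "\<dots> = J" using u w by simp
  finally show ?thesis .
qed

lemma blk_entry:
  "k < blk_dim m a \<Longrightarrow> l < blk_dim m b \<Longrightarrow> M $$ (blk_off m a + k, blk_off m b + l) = blk m M a b $$ (k, l)"
  by (simp add: blk_def)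

text \<open>The reflection normalises Q: in the 2 x 2 block the off-diagonal entries pick up
  \<kappa> and the last diagonal entry \<kappa>^2 = 1, so the determinant there is
  unchanged.\<close>

lemma Qpar_tau:
  assumes k: "\<kappa> * \<kappa> = 1" and w: "w \<in> Qpar (Suc m) e"
  shows "tau m \<kappa> * w * tau m \<kappa> \<in> Qpar (Suc m) e"
proof -
  have wc: "w \<in> carrier_mat (2 * m + 2) (2 * m + 2)" and J: "transpose_mat w * Jmat (Suc m) e * w = Jmat (Suc m) e"
    and z: "blk m w 1 0 = 0\<^sub>m m m" "blk m w 2 0 = 0\<^sub>m 2 m" and d: "det (blk m w 2 2) = 1"
    using w by (auto simp: Qpar_iff Qchar_def)
  let ?v = "tau m \<kappa> * w * tau m \<kappa>"
  have vc: "?v \<in> carrier_mat (2 * m + 2) (2 * m + 2)"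
    by (intro mult_carrier_mat[OF mult_carrier_mat[OF tau_carrier wc] tau_carrier])
  have ent: "blk m ?v a b $$ (k, l) = sgn_last m \<kappa> (blk_off m a + k) * blk m w a b $$ (k, l) * sgn_last m \<kappa> (blk_off m b + l)"
    if "a < 3" "b < 3" "k < blk_dim m a" "l < blk_dim m b" for a b k l
    unfolding blk_entry[OF that(3,4), symmetric]
    using tau_conj[OF wc blk_idx_off(2)[OF that(1,3)] blk_idx_off(2)[OF that(2,4)], of \<kappa>] by simp
  have "blk m ?v 1 0 = 0\<^sub>m m m"
    by (rule eq_matI) (simp_all add: ent z carrier_matD[OF blk_carrier])
  moreover have "blk m ?v 2 0 = 0\<^sub>m 2 m"
    by (rule eq_matI) (simp_all add: ent z carrier_matD[OF blk_carrier])
  moreover have "det (blk m ?v 2 2) = 1"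
  proof -
    have kk: "\<kappa> * (\<kappa> * x) = x" for x using k by (simp flip: mult.assoc)
    show ?thesis using d
      by (simp add: det_2x2[OF blk_carriers(9)] ent blk_off_def mult_ac kk)
  qed
  moreover have "transpose_mat ?v * Jmat (Suc m) e * ?v = Jmat (Suc m) e"
    by (rule form_conj[OF tau_carrier tau_sym tau_Jmat[OF k] Jmat_carrier wc J])
  ultimately show ?thesis using vc by (simp add: Qpar_iff Qchar_def)
qed

lemma qmat_entries:
  assumes A: "A \<in> GLd m" and i: "i \<in> carrier_mat 2 2" and h: "h \<in> carrier_mat 2 m" and B: "B \<in> carrier_mat m m"
  shows "k < m \<Longrightarrow> l < m \<Longrightarrow> qmat m e A i h B $$ (k, l) = A $$ (k, l)"
    "k < m \<Longrightarrow> l < m \<Longrightarrow> qmat m e A i h B $$ (k, m + l) = (A * B) $$ (k, l)"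
    "k < m \<Longrightarrow> l < m \<Longrightarrow> qmat m e A i h B $$ (m + k, l) = 0"
    "k < m \<Longrightarrow> l < m \<Longrightarrow> qmat m e A i h B $$ (m + k, m + l) = minv A $$ (l, k)"
    "k < 2 \<Longrightarrow> l < m \<Longrightarrow> qmat m e A i h B $$ (2 * m + k, l) = 0"
    "k < 2 \<Longrightarrow> l < m \<Longrightarrow> qmat m e A i h B $$ (2 * m + k, m + l) = (i * h) $$ (k, l)"
    "k < 2 \<Longrightarrow> l < 2 \<Longrightarrow> qmat m e A i h B $$ (2 * m + k, 2 * m + l) = i $$ (k, l)"
proof -
  note bq = blk_qmat[OF A i h B, of e] and c = minv(1)[OF A]
  let ?q = "qmat m e A i h B"
  show "k < m \<Longrightarrow> l < m \<Longrightarrow> ?q $$ (k, l) = A $$ (k, l)"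
    using blk_entry[of k m 0 l 0 ?q] bq by (simp add: blk_off_def)
  show "k < m \<Longrightarrow> l < m \<Longrightarrow> ?q $$ (k, m + l) = (A * B) $$ (k, l)"
    using blk_entry[of k m 0 l 1 ?q] bq by (simp add: blk_off_def)
  show "k < m \<Longrightarrow> l < m \<Longrightarrow> ?q $$ (m + k, l) = 0"
    using blk_entry[of k m 1 l 0 ?q] bq by (simp add: blk_off_def)
  show "k < m \<Longrightarrow> l < m \<Longrightarrow> ?q $$ (m + k, m + l) = minv A $$ (l, k)"
    using blk_entry[of k m 1 l 1 ?q] bq c by (simp add: blk_off_def)
  show "k < 2 \<Longrightarrow> l < m \<Longrightarrow> ?q $$ (2 * m + k, l) = 0"
    using blk_entry[of k m 2 l 0 ?q] bq by (simp add: blk_off_def)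
  show "k < 2 \<Longrightarrow> l < m \<Longrightarrow> ?q $$ (2 * m + k, m + l) = (i * h) $$ (k, l)"
    using blk_entry[of k m 2 l 1 ?q] bq by (simp add: blk_off_def)
  show "k < 2 \<Longrightarrow> l < 2 \<Longrightarrow> ?q $$ (2 * m + k, 2 * m + l) = i $$ (k, l)"
    using blk_entry[of k m 2 l 2 ?q] bq by (simp add: blk_off_def)
qed

text \<open>\<open>sigma_mat\<close> exchanges the first r columns with their partners. The first r
  diagonal places then meet A * B, their partners the zero block; the other t places of both blocks
  keep A and its inverse transpose, and \<open>tau\<close> weights only the last entry of i.\<close>

lemma mat_tr_qmat:
  fixes A :: "'a::field mat"
  assumes A: "A \<in> GLd m" and i: "i \<in> carrier_mat 2 2" and h: "h \<in> carrier_mat 2 m" and B: "B \<in> carrier_mat m m"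
    and m: "m = r + t"
  shows "mat_tr (tau m \<kappa> * qmat m e A i h B * sigma_mat (Suc m) r)
    = (\<Sum>k<t. A $$ (r + k, r + k) + minv A $$ (r + k, r + k)) + corner_pairing m r A B
      + (i $$ (0, 0) + \<kappa> * i $$ (1, 1))"
proof -
  let ?q = "qmat m e A i h B" and ?N = "2 * m + 2"
  note ent = qmat_entries[OF A i h B, of _ _ e]
  have r: "r \<le> m" using m by simp
  have tq: "tau m \<kappa> * ?q \<in> carrier_mat ?N ?N" by (rule mult_carrier_mat[OF tau_carrier qmat_carrier])
  have "mat_tr (tau m \<kappa> * ?q * sigma_mat (Suc m) r) = (\<Sum>j<?N. (tau m \<kappa> * ?q * sigma_mat (Suc m) r) $$ (j, j))"
    by (simp add: mat_tr_def tau_def)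
  also have "\<dots> = (\<Sum>j<?N. sgn_last m \<kappa> j * ?q $$ (j, swp m r j))"
  proof (rule sum.cong[OF refl])
    fix j assume "j \<in> {..<?N}"
    then have j: "j < ?N" by (simp del: add_2_eq_Suc')
    show "(tau m \<kappa> * ?q * sigma_mat (Suc m) r) $$ (j, j) = sgn_last m \<kappa> j * ?q $$ (j, swp m r j)"
      unfolding sigma_mat_mult_right[OF tq r j j] tau_mult_left[OF qmat_carrier j swp_less[OF r j]] ..
  qed
  also have "\<dots> = (\<Sum>k<m. ?q $$ (k, swp m r k)) + (\<Sum>k<m. ?q $$ (m + k, swp m r (m + k)))
      + (\<Sum>k<2. sgn_last m \<kappa> (2 * m + k) * ?q $$ (2 * m + k, swp m r (2 * m + k)))"
    unfolding sum_blocks by (simp add: blk_off_def add.assoc)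
  also have "(\<Sum>k<m. ?q $$ (k, swp m r k)) = (\<Sum>k<r. (A * B) $$ (k, k)) + (\<Sum>k<t. A $$ (r + k, r + k))"
  proof -
    have "?q $$ (k, swp m r k) = (A * B) $$ (k, k)" if "k < r" for k
      using that r ent(2)[of k k] by (simp add: swp_simps add.commute[of _ m])
    moreover have "?q $$ (r + k, swp m r (r + k)) = A $$ (r + k, r + k)" if "k < t" for k
      using that m ent(1)[of "r + k" "r + k"] by (simp add: swp_simps)
    moreover have "(\<Sum>k<m. ?q $$ (k, swp m r k)) = (\<Sum>k<r. ?q $$ (k, swp m r k)) + (\<Sum>k<t. ?q $$ (r + k, swp m r (r + k)))"
      using sum_lessThan_add[of "\<lambda>k. ?q $$ (k, swp m r k)" r t] m by simp
    ultimately show ?thesis by simp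
  qed
  also have "(\<Sum>k<r. (A * B) $$ (k, k)) = corner_pairing m r A B"
    unfolding corner_pairing_def using r GLd_carrier[OF A] B
    by (intro sum.cong refl) (simp add: scalar_prod_def atLeast0LessThan)
  also have "(\<Sum>k<m. ?q $$ (m + k, swp m r (m + k))) = (\<Sum>k<r. 0) + (\<Sum>k<t. minv A $$ (r + k, r + k))"
  proof -
    have "(\<Sum>k<m. ?q $$ (m + k, swp m r (m + k))) = (\<Sum>k<r + t. if k < r then 0 else minv A $$ (k, k))"
      unfolding m[symmetric]
    proof (intro sum.cong refl)
      fix k assume "k \<in> {..<m}"
      then show "?q $$ (m + k, swp m r (m + k)) = (if k < r then 0 else minv A $$ (k, k))"
        using r ent(3,4)[of k k] by (simp add: swp_simps)
    qed
    then show ?thesis unfolding sum_lessThan_add by simp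
  qed
  also have "(\<Sum>k<2. sgn_last m \<kappa> (2 * m + k) * ?q $$ (2 * m + k, swp m r (2 * m + k)))
      = i $$ (0, 0) + \<kappa> * i $$ (1, 1)"
  proof -
    have s: "{..<2::nat} = {0, 1}" by auto
    have "swp m r (2 * m + k) = 2 * m + k" for k using r by (simp add: swp_simps)
    then show ?thesis unfolding s using ent(7)[of 0 0] ent(7)[of 1 1] by simp
  qed
  finally show ?thesis by (simp add: sum.distrib)
qed

lemma all_if_less_iff:
  assumes "r \<le> (m :: nat)"
  shows "(\<forall>k<r. \<forall>l<m. if l < r then P k l else R k l)
    \<longleftrightarrow> (\<forall>k<r. \<forall>l<r. P k l) \<and> (\<forall>k<r. \<forall>l<m. r \<le> l \<longrightarrow> R k l)"
proof
  assume L: "\<forall>k<r. \<forall>l<m. if l < r then P k l else R k l"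
  have "P k l" if "k < r" "l < r" for k l
    using L[rule_format, of k l] that assms by simp
  moreover have "R k l" if "k < r" "l < m" "r \<le> l" for k l
    using L[rule_format, of k l] that by simp
  ultimately show "(\<forall>k<r. \<forall>l<r. P k l) \<and> (\<forall>k<r. \<forall>l<m. r \<le> l \<longrightarrow> R k l)" by blast
qed simp

text \<open>Conjugation keeps the form and the block i, so only the vanishing of blocks (1,0) and
  (2,0) is at stake. The permutation brings entries of A, A * B, the inverse of A and i * h there;
  the invertible factors i and the corner of A can then be cancelled.\<close>

lemma sigma_conj_Qpar_iff:
  fixes A :: "'a::field mat"
  assumes d: "(A, i, h, B) \<in> Qdata m e" and m: "m = r + t"
  shows "sigma_mat (Suc m) r * qmat m e A i h B * sigma_mat (Suc m) r \<in> Qpar (Suc m) e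
    \<longleftrightarrow> (\<forall>k<r. \<forall>l<m. r \<le> l \<longrightarrow> A $$ (k, l) = 0) \<and> (\<forall>k<2. \<forall>l<r. h $$ (k, l) = 0) \<and> (\<forall>k<r. \<forall>l<r. B $$ (k, l) = 0)"
    (is "?v \<in> _ \<longleftrightarrow> ?A \<and> ?H \<and> ?B")
proof -
  have A: "A \<in> GLd m" and iS: "i \<in> SOminus 1 e" and h: "h \<in> carrier_mat 2 m" and B: "B \<in> carrier_mat m m"
    using d by (auto simp: Qdata_def)
  have i: "i \<in> carrier_mat 2 2" "det i = 1" using iS by (auto simp: SOminus_iff)
  have iG: "i \<in> GLd 2" using i by (simp add: GLd_def)
  note Ac = GLd_carrier[OF A] and Ai = minv[OF A] and Ii = minv[OF iG]
  let ?q = "qmat m e A i h B" and ?s = "sigma_mat (Suc m) r :: 'a mat"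
  note ent = qmat_entries[OF A i(1) h B, of _ _ e]
  have r: "r \<le> m" using m by simp
  have q: "Qchar m e ?q" by (rule Qchar_qmat[OF d])
  have vc: "?v \<in> carrier_mat (2 * m + 2) (2 * m + 2)"
    by (intro mult_carrier_mat[OF mult_carrier_mat[OF sigma_mat_carrier qmat_carrier] sigma_mat_carrier])
  have form: "transpose_mat ?v * Jmat (Suc m) e * ?v = Jmat (Suc m) e"
    by (rule form_conj[OF sigma_mat_carrier sigma_mat_sym[OF r] sigma_mat_Jmat[OF r] Jmat_carrier qmat_carrier])
       (use q in \<open>simp add: Qchar_def\<close>)
  have bent: "blk m ?v a b $$ (k, l) = ?q $$ (swp m r (blk_off m a + k), swp m r (blk_off m b + l))"
    if "a < 3" "b < 3" "k < blk_dim m a" "l < blk_dim m b" for a b k l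
    unfolding blk_entry[OF that(3,4), symmetric]
    by (rule sigma_mat_conj[OF qmat_carrier r blk_idx_off(2)[OF that(1,3)] blk_idx_off(2)[OF that(2,4)]])
  have "blk m ?v 2 2 = i"
  proof (rule eq_matI)
    fix k l assume "k < dim_row i" "l < dim_col i"
    then have kl: "k < 2" "l < 2" using i by auto
    have sw: "swp m r (2 * m + k) = 2 * m + k" for k using r by (simp add: swp_simps)
    show "blk m ?v 2 2 $$ (k, l) = i $$ (k, l)"
      using bent[of 2 2 k l] kl ent(7)[OF kl] by (simp add: blk_off_def sw)
  qed (simp_all add: carrier_matD[OF blk_carriers(9)] carrier_matD[OF i(1)])
  then have "?v \<in> Qpar (Suc m) e \<longleftrightarrow> blk m ?v 1 0 = 0\<^sub>m m m \<and> blk m ?v 2 0 = 0\<^sub>m 2 m"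
    using vc form i by (simp add: Qpar_iff Qchar_def)
  also have "blk m ?v 1 0 = 0\<^sub>m m m \<longleftrightarrow> (\<forall>k<m. \<forall>l<m. ?q $$ (swp m r (m + k), swp m r l) = 0)"
    (is "?b \<longleftrightarrow> ?e")
  proof
    assume b: ?b
    show ?e
    proof (intro allI impI)
      fix k l assume kl: "k < m" "l < m"
      then show "?q $$ (swp m r (m + k), swp m r l) = 0"
        using bent[of 1 0 k l] unfolding b by (simp add: blk_off_def)
    qed
  next
    assume ?e
    then show ?b using bent[of 1 0] carrier_matD[OF blk_carriers(4)[of m ?v]]
      by (intro eq_matI) (simp_all add: blk_off_def)
  qed
  also have "blk m ?v 2 0 = 0\<^sub>m 2 m \<longleftrightarrow> (\<forall>k<2. \<forall>l<m. ?q $$ (swp m r (2 * m + k), swp m r l) = 0)"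
    (is "?b \<longleftrightarrow> ?e")
  proof
    assume b: ?b
    show ?e
    proof (intro allI impI)
      fix k l :: nat assume kl: "k < 2" "l < m"
      then show "?q $$ (swp m r (2 * m + k), swp m r l) = 0"
        using bent[of 2 0 k l] unfolding b by (simp add: blk_off_def)
    qed
  next
    assume ?e
    then show ?b using bent[of 2 0] carrier_matD[OF blk_carriers(7)[of m ?v]]
      by (intro eq_matI) (simp_all add: blk_off_def)
  qed
  also have "(\<forall>k<2. \<forall>l<m. ?q $$ (swp m r (2 * m + k), swp m r l) = 0) \<longleftrightarrow> (\<forall>k<2. \<forall>l<r. (i * h) $$ (k, l) = 0)"
  proof -
    have sw: "swp m r (2 * m + k) = 2 * m + k" for k using r by (simp add: swp_simps)
    have "?q $$ (2 * m + k, swp m r l) = (if l < r then (i * h) $$ (k, l) else 0)" if "k < 2" "l < m" for k l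
      using that r ent(5)[OF that] ent(6)[OF that] by (simp add: swp_simps add.commute[of l m])
    then show ?thesis unfolding sw using r by (auto split: if_splits)
  qed
  also have "(\<forall>k<m. \<forall>l<m. ?q $$ (swp m r (m + k), swp m r l) = 0)
    \<longleftrightarrow> (\<forall>k<r. \<forall>l<m. if l < r then (A * B) $$ (k, l) = 0 else A $$ (k, l) = 0)
      \<and> (\<forall>k<m. \<forall>l<r. r \<le> k \<longrightarrow> minv A $$ (l, k) = 0)"
  proof -
    have 1: "?q $$ (swp m r (m + k), swp m r l) = (if k < r then if l < r then (A * B) $$ (k, l) else A $$ (k, l)
        else if l < r then minv A $$ (l, k) else 0)" if "k < m" "l < m" for k l
      using that r ent(1-4)[OF that] by (simp add: swp_simps add.commute[of l m])
    show ?thesis using r by (auto simp: 1 split: if_splits)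
  qed
  finally have main: "?v \<in> Qpar (Suc m) e \<longleftrightarrow> ((\<forall>k<r. \<forall>l<m. if l < r then (A * B) $$ (k, l) = 0 else A $$ (k, l) = 0)
      \<and> (\<forall>k<m. \<forall>l<r. r \<le> k \<longrightarrow> minv A $$ (l, k) = 0)) \<and> (\<forall>k<2. \<forall>l<r. (i * h) $$ (k, l) = 0)" .
  have row: "(\<forall>k<2. \<forall>l<r. (j * g) $$ (k, l) = 0)"
    if "j \<in> carrier_mat 2 2" "g \<in> carrier_mat 2 m" "\<forall>k<2. \<forall>l<r. g $$ (k, l) = 0" for j g :: "'a mat"
    using that r by (simp add: scalar_prod_def set_2)
  have hh: "(\<forall>k<2. \<forall>l<r. (i * h) $$ (k, l) = 0) \<longleftrightarrow> ?H"
    using row[OF i(1) h] row[OF Ii(1) mult_carrier_mat[OF i(1) h]] GLd_left_cancel(1)[OF iG h] by auto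
  \<comment> \<open>The inverse of a block lower triangular matrix is block lower triangular, so
    this condition follows from the one on A.\<close>
  have inv0: "\<forall>k<m. \<forall>l<r. r \<le> k \<longrightarrow> minv A $$ (l, k) = 0" if z: ?A
  proof -
    have A': "A \<in> GLd (r + t)" using A m by simp
    from GLd_carrier[OF A'] obtain X Z Y D where blk: "X \<in> carrier_mat r r" "Z \<in> carrier_mat r t"
      "Y \<in> carrier_mat t r" "D \<in> carrier_mat t t" "A = four_block_mat X Z Y D" by (rule four_block_cases)
    have Z: "Z = 0\<^sub>m r t"
    proof (rule eq_matI)
      fix k l assume "k < dim_row (0\<^sub>m r t)" "l < dim_col (0\<^sub>m r t)"
      then show "Z $$ (k, l) = 0\<^sub>m r t $$ (k, l)" using z[rule_format, of k "r + l"] blk m by simp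
    qed (use blk in auto)
    then have "det X * det D \<noteq> 0" using A' det_block_lower[OF blk(1,3,4)] blk(5) by (simp add: GLd_def)
    then have XD: "X \<in> GLd r" "D \<in> GLd t" using blk by (auto simp: GLd_def)
    show ?thesis unfolding blk(5) Z minv_block_lower[OF XD(1) blk(3) XD(2)]
      using minv(1)[OF XD(1)] minv(1)[OF XD(2)] m by auto
  qed
  \<comment> \<open>For such A the corner of A * B is the invertible corner of A times the corner of
    B.\<close>
  have BB: "(\<forall>k<r. \<forall>l<r. (A * B) $$ (k, l) = 0) \<longleftrightarrow> ?B" if z: ?A
  proof -
    define X where "X = mat r r (\<lambda>ij. A $$ ij)"
    define C where "C = mat r r (\<lambda>ij. B $$ ij)"
    have X: "X \<in> GLd r" unfolding X_def using A m z by (intro corner_GLd[of _ _ t]) auto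
    have C: "C \<in> carrier_mat r r" by (simp add: C_def)
    have AB: "(A * B) $$ (k, l) = (X * C) $$ (k, l)" if kl: "k < r" "l < r" for k l
    proof -
      have "(A * B) $$ (k, l) = (\<Sum>j<m. A $$ (k, j) * B $$ (j, l))"
        using kl r Ac B by (simp add: scalar_prod_def atLeast0LessThan)
      also have "\<dots> = (\<Sum>j<r. A $$ (k, j) * B $$ (j, l))"
        using z kl r by (intro sum.mono_neutral_right) auto
      also have "\<dots> = (X * C) $$ (k, l)"
        using kl by (simp add: X_def C_def scalar_prod_def atLeast0LessThan)
      finally show ?thesis .
    qed
    show ?thesis
    proof
      assume AB0: "\<forall>k<r. \<forall>l<r. (A * B) $$ (k, l) = 0"
      have "X * C = 0\<^sub>m r r"
        using AB AB0 GLd_carrier[OF X] C by (intro eq_matI) (auto simp del: index_mult_mat(1))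
      then have "C = minv X * 0\<^sub>m r r" using GLd_left_cancel(1)[OF X C] by simp
      then have "C = 0\<^sub>m r r" using minv(1)[OF X] by simp
      then have "C $$ (k, l) = 0" if "k < r" "l < r" for k l using that by simp
      then show ?B by (simp add: C_def)
    next
      assume ?B
      then have "C = 0\<^sub>m r r" by (intro eq_matI) (auto simp: C_def)
      then have "X * C = 0\<^sub>m r r" using GLd_carrier[OF X] by simp
      then show "\<forall>k<r. \<forall>l<r. (A * B) $$ (k, l) = 0" using AB by simp
    qed
  qed
  have "(\<forall>k<r. \<forall>l<m. if l < r then (A * B) $$ (k, l) = 0 else A $$ (k, l) = 0)
    \<longleftrightarrow> (\<forall>k<r. \<forall>l<r. (A * B) $$ (k, l) = 0) \<and> ?A"
    by (rule all_if_less_iff[OF r])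
  then have eq: "?v \<in> Qpar (Suc m) e \<longleftrightarrow> (((\<forall>k<r. \<forall>l<r. (A * B) $$ (k, l) = 0) \<and> ?A)
      \<and> (\<forall>k<m. \<forall>l<r. r \<le> k \<longrightarrow> minv A $$ (l, k) = 0)) \<and> ?H"
    using main hh by (simp only:)
  have bool_iff: "P \<longleftrightarrow> ((X \<and> Y) \<and> Z) \<and> W \<Longrightarrow> (Y \<Longrightarrow> Z) \<Longrightarrow> (Y \<Longrightarrow> X \<longleftrightarrow> V) \<Longrightarrow> P \<longleftrightarrow> Y \<and> W \<and> V"
    for P X Y Z W V by blast
  show ?thesis by (rule bool_iff[OF eq inv0 BB])
qed

section \<open>Sums over Q and orders of Q and of its intersection with a conjugate\<close>

lemma sum_Qpar:
  fixes F :: "'a::{field,finite} \<Rightarrow> rat" and e :: 'a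
  assumes three: "(3::'a) = 0" and m: "m = r + t"
  shows "(\<Sum>w\<in>Qpar (Suc m) e. F (mat_tr (tau m \<kappa> * w * sigma_mat (Suc m) r)))
    = (\<Sum>ab\<in>norm_one e. \<Sum>A\<in>GLd m. \<Sum>h\<in>carrier_mat 2 m. \<Sum>S\<in>Alt m.
        F ((fst ab + \<kappa> * fst ab) + (\<Sum>k<t. A $$ (r + k, r + k) + minv A $$ (r + k, r + k)) + corner_pairing m r A (gram e h + S)))"
proof -
  let ?X = "(GLd m :: 'a mat set) \<times> norm_one e \<times> (carrier_mat 2 m :: 'a mat set) \<times> (Alt m :: 'a mat set)"
  let ?G = "\<lambda>A ab h S. F ((fst ab + \<kappa> * fst ab) + (\<Sum>k<t. A $$ (r + k, r + k) + minv A $$ (r + k, r + k))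
      + corner_pairing m r A (gram e h + S))"
  have "(\<Sum>w\<in>Qpar (Suc m) e. F (mat_tr (tau m \<kappa> * w * sigma_mat (Suc m) r)))
      = (\<Sum>x\<in>?X. F (mat_tr (tau m \<kappa> * (case x of (A, ab, h, S) \<Rightarrow> qpar m e A ab h S) * sigma_mat (Suc m) r)))"
    by (rule sum.reindex_bij_betw[OF bij_betw_qpar[OF three], of "\<lambda>w. F (mat_tr (tau m \<kappa> * w * sigma_mat (Suc m) r))", symmetric])
  also have "\<dots> = (\<Sum>(A, ab, h, S)\<in>?X. ?G A ab h S)"
  proof (rule sum.cong[OF refl])
    fix x assume x: "x \<in> ?X"
    obtain A ab h S where [simp]: "x = (A, ab, h, S)" by (metis prod_cases4)
    have d: "A \<in> GLd m" "ab \<in> norm_one e" "h \<in> carrier_mat 2 m" "S \<in> Alt m" using x by auto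
    have B: "gram e h + S \<in> carrier_mat m m" using d by (auto dest: Alt_carrier)
    show "F (mat_tr (tau m \<kappa> * (case x of (A, ab, h, S) \<Rightarrow> qpar m e A ab h S) * sigma_mat (Suc m) r))
        = (case x of (A, ab, h, S) \<Rightarrow> ?G A ab h S)"
      by (simp add: mat_tr_qmat[OF d(1) rot_carrier d(3) B m]) (simp add: rot_def add_ac)
  qed
  also have "\<dots> = (\<Sum>A\<in>GLd m. \<Sum>ab\<in>norm_one e. \<Sum>h\<in>carrier_mat 2 m. \<Sum>S\<in>Alt m. ?G A ab h S)"
    by (simp add: sum.cartesian_product case_prod_beta)
  also have "\<dots> = (\<Sum>ab\<in>norm_one e. \<Sum>A\<in>GLd m. \<Sum>h\<in>carrier_mat 2 m. \<Sum>S\<in>Alt m. ?G A ab h S)"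
    by (rule sum.swap)
  finally show ?thesis .
qed

lemma sum_Qpar_mean_zero:
  fixes f :: "'a::{field,finite} \<Rightarrow> rat" and e :: 'a
  assumes three: "(3::'a) = 0" and two: "(2::'a) \<noteq> 0" and e: "\<not> is_sq e" and f: "mean_zero f" and m: "m = r + t"
  shows "(\<Sum>w\<in>Qpar (Suc m) e. f (mat_tr (tau m \<kappa> * w * sigma_mat (Suc m) r)))
    = of_nat (card (Alt m :: 'a mat set)) * of_nat CARD('a) ^ (2 * t) * of_nat CARD('a) ^ (r * t)
      * (- of_nat CARD('a)) ^ r * of_nat (card (SymI r :: 'a mat set))
      * (\<Sum>ab\<in>norm_one e. \<Sum>D\<in>GLd t. f ((fst ab + \<kappa> * fst ab) + (mat_tr D + mat_tr (minv D))))"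
  unfolding sum_Qpar[OF three m] unfolding m
  by (simp only: sum_parabolic[OF two e f] sum_distrib_left)

lemma finite_norm_one [simp]: "finite (norm_one e)"
  by (rule finite_subset[OF subset_UNIV]) simp

lemma card_Qpar:
  fixes e :: "'a::{field,finite}"
  assumes three: "(3::'a) = 0" and two: "(2::'a) \<noteq> 0" and e: "\<not> is_sq e"
  shows "card (Qpar (Suc m) e) = card (GLd m :: 'a mat set) * (CARD('a) + 1) * CARD('a) ^ (2 * m) * card (Alt m :: 'a mat set)"
  using bij_betw_same_card[OF bij_betw_qpar[OF three, of m e]]
  by (simp add: card_cartesian_product card_carrier_mat card_norm_one[OF two e])

text \<open>An instance of \<open>sum_two_rows\<close>, with the indicator of the pair of zero
  columns as summand.\<close>

lemma card_two_rows_zero: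
  "card {h \<in> carrier_mat 2 (r + t) :: 'a::{field,finite} mat set. \<forall>k<2. \<forall>l<r. h $$ (k, l) = 0} = CARD('a) ^ (2 * t)"
proof -
  let ?G = "\<lambda>(x :: 'a mat) (y :: 'a mat). if x = 0\<^sub>m r 1 \<and> y = 0\<^sub>m r 1 then 1 else (0::rat)"
  let ?H = "{h \<in> carrier_mat 2 (r + t) :: 'a mat set. \<forall>k<2. \<forall>l<r. h $$ (k, l) = 0}"
  have row: "mat r 1 (\<lambda>(i, j). h $$ (p, i)) = 0\<^sub>m r 1 \<longleftrightarrow> (\<forall>l<r. h $$ (p, l) = 0)" for h :: "'a mat" and p
  proof
    assume eq: "mat r 1 (\<lambda>(i, j). h $$ (p, i)) = 0\<^sub>m r 1"
    show "\<forall>l<r. h $$ (p, l) = 0"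
    proof (intro allI impI)
      fix l assume "l < r"
      then show "h $$ (p, l) = 0" using arg_cong[OF eq, of "\<lambda>X. X $$ (l, 0)"] by simp
    qed
  qed (auto intro!: eq_matI)
  have "(of_nat (card ?H) :: rat) = (\<Sum>h\<in>carrier_mat 2 (r + t). if h \<in> ?H then 1 else 0)"
    by (simp add: sum.If_cases Int_def)
  also have "\<dots> = (\<Sum>h\<in>carrier_mat 2 (r + t). ?G (mat r 1 (\<lambda>(i, j). h $$ (0, i))) (mat r 1 (\<lambda>(i, j). h $$ (1, i))))"
    by (intro sum.cong refl) (auto simp: row lt_2_iff)
  also have "\<dots> = of_nat CARD('a) ^ (2 * t) * (\<Sum>x\<in>carrier_mat r 1. \<Sum>y\<in>carrier_mat r 1. ?G x y)"
    by (rule sum_two_rows[of ?G r t])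
  also have "(\<Sum>x\<in>carrier_mat r 1. \<Sum>y\<in>carrier_mat r 1. ?G x y)
      = (\<Sum>x\<in>(carrier_mat r 1 :: 'a mat set). \<Sum>y\<in>(carrier_mat r 1 :: 'a mat set). if x = 0\<^sub>m r 1 then if y = 0\<^sub>m r 1 then 1 else 0 else 0)"
    by (intro sum.cong refl) simp
  also have "\<dots> = (\<Sum>x\<in>(carrier_mat r 1 :: 'a mat set). if x = 0\<^sub>m r 1 then \<Sum>y\<in>(carrier_mat r 1 :: 'a mat set). if y = 0\<^sub>m r 1 then 1 else 0 else 0)"
    by (intro sum.cong refl sum_if_const)
  also have "\<dots> = 1" by simp
  finally have "(of_nat (card ?H) :: rat) = of_nat (CARD('a) ^ (2 * t))" by simp
  then show ?thesis by (simp only: of_nat_eq_iff)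
qed

lemma card_GLd_block_lower:
  "card {A \<in> GLd (r + t) :: 'a::{field,finite} mat set. \<forall>i<r. \<forall>j<r + t. r \<le> j \<longrightarrow> A $$ (i, j) = 0}
   = card (GLd r :: 'a mat set) * CARD('a) ^ (r * t) * card (GLd t :: 'a mat set)"
proof -
  have "{A \<in> GLd (r + t) :: 'a mat set. \<forall>i<r. \<forall>j<r + t. r \<le> j \<longrightarrow> A $$ (i, j) = 0}
      = {A \<in> GLd (r + t). (\<forall>i<r. \<forall>j<r + t. r \<le> j \<longrightarrow> A $$ (i, j) = 0) \<and> mat r r (\<lambda>ij. A $$ ij) \<in> GLd r}"
    using corner_GLd by blast
  also have "card \<dots> = card ((GLd r :: 'a mat set) \<times> (carrier_mat t r :: 'a mat set) \<times> (GLd t :: 'a mat set))"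
    by (rule bij_betw_same_card[OF bij_betw_block_lower[OF subset_refl, of r t], symmetric])
  finally show ?thesis by (simp add: card_cartesian_product card_carrier_mat mult.commute)
qed

lemma card_Qpar_sigma:
  fixes e :: "'a::{field,finite}"
  assumes three: "(3::'a) = 0" and two: "(2::'a) \<noteq> 0" and e: "\<not> is_sq e" and m: "m = r + t"
  shows "card {p \<in> Qpar (Suc m) e. sigma_mat (Suc m) r * p * sigma_mat (Suc m) r \<in> Qpar (Suc m) e}
    = card (GLd r :: 'a mat set) * CARD('a) ^ (r * t) * card (GLd t :: 'a mat set) * (CARD('a) + 1) * CARD('a) ^ (2 * t)
      * card {S \<in> Alt m :: 'a mat set. \<forall>i<r. \<forall>j<r. S $$ (i, j) = 0}"
proof -
  let ?X = "(GLd m :: 'a mat set) \<times> norm_one e \<times> (carrier_mat 2 m :: 'a mat set) \<times> (Alt m :: 'a mat set)"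
  let ?F = "\<lambda>(A, ab, h, S). qpar m e A ab h S"
  let ?Q = "Qpar (Suc m) e" and ?s = "sigma_mat (Suc m) r :: 'a mat"
  let ?A = "{A \<in> GLd m :: 'a mat set. \<forall>i<r. \<forall>j<m. r \<le> j \<longrightarrow> A $$ (i, j) = 0}"
  let ?H = "{h \<in> carrier_mat 2 m :: 'a mat set. \<forall>k<2. \<forall>l<r. h $$ (k, l) = 0}"
  let ?S = "{S \<in> Alt m :: 'a mat set. \<forall>i<r. \<forall>j<r. S $$ (i, j) = 0}"
  have r: "r \<le> m" using m by simp
  have bij: "bij_betw ?F ?X ?Q" by (rule bij_betw_qpar[OF three])
  have iff: "?s * qpar m e A ab h S * ?s \<in> ?Q \<longleftrightarrow> A \<in> ?A \<and> h \<in> ?H \<and> S \<in> ?S"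
    if d: "A \<in> GLd m" "ab \<in> norm_one e" "h \<in> carrier_mat 2 m" "S \<in> Alt m" for A ab h S
  proof -
    have "rot e (fst ab) (snd ab) \<in> SOminus 1 e" using d(2) by (intro rot_SOminus) simp
    moreover have "gram e h + S \<in> carrier_mat m m" using d by (auto dest: Alt_carrier)
    ultimately have Qd: "(A, rot e (fst ab) (snd ab), h, gram e h + S) \<in> Qdata m e"
      using d Qdata_B_iff[OF three d(3) Alt_carrier[OF d(4)], of e] by (simp add: Qdata_def)
    \<comment> \<open>Once the first r columns of h vanish, so does the corner of the Gram matrix,
      and the condition on B becomes one on S alone; the conditions on A, h and S are then
      independent.\<close>
    have "(gram e h + S) $$ (k, l) = S $$ (k, l)" if z: "\<forall>k<2. \<forall>l<r. h $$ (k, l) = 0" and kl: "k < r" "l < r" for k l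
    proof -
      have "gram e h $$ (k, l) = 0" using z kl r by (simp add: gram_index[OF d(3)])
      then show ?thesis using kl r Alt_carrier[OF d(4)] by simp
    qed
    then have hB: "(\<forall>k<2. \<forall>l<r. h $$ (k, l) = 0) \<and> (\<forall>k<r. \<forall>l<r. (gram e h + S) $$ (k, l) = 0)
        \<longleftrightarrow> (\<forall>k<2. \<forall>l<r. h $$ (k, l) = 0) \<and> (\<forall>k<r. \<forall>l<r. S $$ (k, l) = 0)"
      by (intro conj_cong refl) simp
    show ?thesis unfolding sigma_conj_Qpar_iff[OF Qd m] hB using d by (simp only: mem_Collect_eq simp_thms)
  qed
  have "{p \<in> ?Q. ?s * p * ?s \<in> ?Q} = ?F ` (?A \<times> norm_one e \<times> ?H \<times> ?S)"
  proof (intro equalityI subsetI)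
    fix p assume p: "p \<in> {p \<in> ?Q. ?s * p * ?s \<in> ?Q}"
    then obtain A ab h S where d: "A \<in> GLd m" "ab \<in> norm_one e" "h \<in> carrier_mat 2 m" "S \<in> Alt m"
        and pe: "p = qpar m e A ab h S"
      using bij unfolding bij_betw_def by (force simp: image_iff)
    have "?s * qpar m e A ab h S * ?s \<in> ?Q" using p pe by simp
    then have "(A, ab, h, S) \<in> ?A \<times> norm_one e \<times> ?H \<times> ?S" using iff[OF d] d(2) by blast
    moreover have "p = ?F (A, ab, h, S)" using pe by simp
    ultimately show "p \<in> ?F ` (?A \<times> norm_one e \<times> ?H \<times> ?S)" by blast
  next
    fix p assume "p \<in> ?F ` (?A \<times> norm_one e \<times> ?H \<times> ?S)"
    then obtain x where x: "x \<in> ?A \<times> norm_one e \<times> ?H \<times> ?S" "p = ?F x" by blast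
    obtain A ab h S where xe: "x = (A, ab, h, S)" by (metis prod_cases4)
    have d: "A \<in> GLd m" "ab \<in> norm_one e" "h \<in> carrier_mat 2 m" "S \<in> Alt m"
      and c: "A \<in> ?A \<and> h \<in> ?H \<and> S \<in> ?S" using x unfolding xe by blast+
    have "x \<in> ?X" using d xe by simp
    then have "p \<in> ?Q" using bij x(2) unfolding bij_betw_def by blast
    moreover have "?s * p * ?s \<in> ?Q" using iff[OF d] c x(2) unfolding xe by simp
    ultimately show "p \<in> {p \<in> ?Q. ?s * p * ?s \<in> ?Q}" by simp
  qed
  moreover have "card (?F ` (?A \<times> norm_one e \<times> ?H \<times> ?S)) = card (?A \<times> norm_one e \<times> ?H \<times> ?S)"
  proof (rule card_image)
    show "inj_on ?F (?A \<times> norm_one e \<times> ?H \<times> ?S)"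
      by (rule inj_on_subset[OF bij_betw_imp_inj_on[OF bij]]) auto
  qed
  ultimately show ?thesis
    using card_GLd_block_lower[of r t, where 'a = 'a] card_two_rows_zero[of r t, where 'a = 'a]
    unfolding m by (simp add: card_cartesian_product card_norm_one[OF two e])
qed

lemma dcoset_sigma_sum:
  fixes F :: "'a::{field,finite} \<Rightarrow> rat" and e :: 'a
  assumes e: "e \<noteq> 0" and r: "r \<le> m" and k: "\<kappa> * \<kappa> = 1"
  shows "of_nat (card {p \<in> Qpar (Suc m) e. sigma_mat (Suc m) r * p * sigma_mat (Suc m) r \<in> Qpar (Suc m) e})
      * (\<Sum>g\<in>dcoset (Qpar (Suc m) e) (sigma_mat (Suc m) r). F (mat_tr (tau m \<kappa> * g)))
    = of_nat (card (Qpar (Suc m) e)) * (\<Sum>w\<in>Qpar (Suc m) e. F (mat_tr (tau m \<kappa> * w * sigma_mat (Suc m) r)))"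
  by (rule matrix_group.double_coset_sum[OF matrix_group_Qpar[OF e] sigma_mat_carrier sigma_mat_sq[OF r]
      tau_carrier tau_sq[OF k] Qpar_tau[OF k]])

section \<open>Counting constants\<close>

declare One_nat_def [simp]

text \<open>Dimension of the space of alternating r x r matrices.\<close>

definition tri_pow :: "nat \<Rightarrow> nat" where
  "tri_pow r = r * (r - 1) div 2"

lemma tri_pow_even: "tri_pow (2 * k) + k = 2 * k * k"
  by (cases k) (simp_all add: tri_pow_def algebra_simps)

lemma tri_pow_odd: "tri_pow (2 * k + 1) = k * (2 * k + 1)"
proof -
  have "(2 * k + 1) * (2 * k + 1 - 1) = 2 * (k * (2 * k + 1))" by (simp add: algebra_simps)
  then show ?thesis unfolding tri_pow_def by simp
qed

lemma tri_pow_Suc: "tri_pow (Suc k) = tri_pow k + k"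
proof (cases k)
  case (Suc j)
  have "(Suc k * k) = k * (k - 1) + 2 * k" using Suc by (simp add: algebra_simps)
  then show ?thesis by (simp add: tri_pow_def)
qed (simp add: tri_pow_def)

text \<open>The recursion for the order of GL(k) read over the rationals, where the truncated
  subtraction of natural numbers is gone; \<open>sym_num\<close> does the same for invertible
  symmetric matrices.\<close>

fun gl_num :: "rat \<Rightarrow> nat \<Rightarrow> rat" where
  "gl_num q 0 = 1"
| "gl_num q (Suc k) = (q ^ Suc k - 1) * q ^ k * gl_num q k"

fun sym_num :: "rat \<Rightarrow> nat \<Rightarrow> rat" where
  "sym_num q 0 = 1"
| "sym_num q (Suc 0) = q - 1"
| "sym_num q (Suc (Suc l)) = (q - 1) * q ^ Suc l * sym_num q (Suc l) + (q ^ Suc l - 1) * q ^ Suc l * sym_num q l"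

lemma of_nat_card_minus_1: "(of_nat (CARD('a::finite) ^ k - 1) :: rat) = of_nat CARD('a) ^ k - 1"
proof -
  have "1 \<le> CARD('a) ^ k" by (simp add: One_nat_def Suc_leI)
  then show ?thesis by (simp add: of_nat_diff)
qed

lemma card_GLd_num: "(of_nat (card (GLd k :: 'a::{field,finite} mat set)) :: rat) = gl_num (of_nat CARD('a)) k"
  by (induction k) (simp_all add: card_GLd_0 card_GLd_Suc of_nat_card_minus_1 del: power_Suc)

lemma card_SymI_num: "(of_nat (card (SymI k :: 'a::{field,finite} mat set)) :: rat) = sym_num (of_nat CARD('a)) k"
proof (induction k rule: induct_nat_012)
  case 1
  then show ?case
    using of_nat_card_minus_1[of 1, where 'a = 'a] card_SymI_1[where 'a = 'a] by simp
next
  case (ge2 l)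
  then show ?case
    using of_nat_card_minus_1[of 1, where 'a = 'a]
    by (simp add: card_SymI_Suc_Suc of_nat_card_minus_1 del: power_Suc)
qed (simp add: card_SymI_0)

definition odd_prod :: "rat \<Rightarrow> nat \<Rightarrow> rat" where
  "odd_prod q k = (\<Prod>j\<in>{1..k}. q ^ (2 * j - 1) - 1)"

definition even_prod :: "rat \<Rightarrow> nat \<Rightarrow> rat" where
  "even_prod q k = (\<Prod>j\<in>{1..k}. q ^ (2 * j) - 1)"

lemma odd_prod_Suc: "odd_prod q (Suc k) = odd_prod q k * (q ^ (2 * k + 1) - 1)"
  by (simp add: odd_prod_def)

lemma even_prod_Suc: "even_prod q (Suc k) = even_prod q k * (q ^ (2 * k + 2) - 1)"
  by (simp add: even_prod_def)

text \<open>The recursion reaches back two steps, so even and odd sizes are proved together; in each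
  step the two summands combine into a single product.\<close>

lemma sym_num_closed:
  "sym_num q (2 * k) = q ^ (k * (k + 1)) * odd_prod q k
   \<and> sym_num q (2 * k + 1) = q ^ (k * (k + 1)) * odd_prod q (Suc k)"
proof (induction k)
  case 0
  then show ?case by (simp add: odd_prod_def One_nat_def)
next
  case (Suc k)
  let ?P = "odd_prod q (Suc k)"
  have IH: "sym_num q (2 * k) = q ^ (k * (k + 1)) * odd_prod q k" "sym_num q (Suc (2 * k)) = q ^ (k * (k + 1)) * ?P"
    using Suc by (simp_all add: One_nat_def)
  have P: "?P = odd_prod q k * (q ^ Suc (2 * k) - 1)" by (simp add: odd_prod_Suc)
  have even: "sym_num q (Suc (Suc (2 * k))) = q ^ (Suc k * (Suc k + 1)) * ?P"
  proof -
    have "sym_num q (Suc (Suc (2 * k)))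
        = q ^ Suc (2 * k) * q ^ (k * (k + 1)) * ((q - 1) * ?P + (q ^ Suc (2 * k) - 1) * odd_prod q k)"
      by (simp only: sym_num.simps IH) (simp add: algebra_simps)
    \<comment> \<open>The second summand is again P, so the bracket becomes (q - 1) P + P = q
      P.\<close>
    also have "(q ^ Suc (2 * k) - 1) * odd_prod q k = ?P" by (simp add: P mult.commute)
    also have "(q - 1) * ?P + ?P = q * ?P" by (simp add: algebra_simps)
    also have "q ^ Suc (2 * k) * q ^ (k * (k + 1)) * (q * ?P) = q ^ (Suc (2 * k) + k * (k + 1) + 1) * ?P"
      by (simp only: power_add power_one_right mult_ac)
    also have "Suc (2 * k) + k * (k + 1) + 1 = Suc k * (Suc k + 1)" by simp
    finally show ?thesis .
  qed
  have "sym_num q (Suc (Suc (Suc (2 * k)))) = q ^ (Suc k * (Suc k + 1)) * odd_prod q (Suc (Suc k))"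
  proof -
    have "sym_num q (Suc (Suc (Suc (2 * k)))) = (q - 1) * q ^ (2 * k + 2) * (q ^ (Suc k * (Suc k + 1)) * ?P)
        + (q ^ (2 * k + 2) - 1) * (q ^ (2 * k + 2) * (q ^ (k * (k + 1)) * ?P))"
      unfolding sym_num.simps(3)[of q "Suc (2 * k)"] even IH(2) by (simp add: mult.assoc)
    also have "q ^ (2 * k + 2) * (q ^ (k * (k + 1)) * ?P) = q ^ (Suc k * (Suc k + 1)) * ?P"
    proof -
      have "2 * k + 2 + k * (k + 1) = Suc k * (Suc k + 1)" by simp
      then show ?thesis by (metis mult.assoc power_add)
    qed
    also have "(q - 1) * q ^ (2 * k + 2) * (q ^ (Suc k * (Suc k + 1)) * ?P)
        + (q ^ (2 * k + 2) - 1) * (q ^ (Suc k * (Suc k + 1)) * ?P)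
        = q ^ (Suc k * (Suc k + 1)) * (?P * (q * q ^ (2 * k + 2) - 1))" by (simp only: algebra_simps)
    also have "?P * (q * q ^ (2 * k + 2) - 1) = odd_prod q (Suc (Suc k))"
      unfolding odd_prod_Suc[of q "Suc k"] by simp
    finally show ?thesis .
  qed
  with even show ?case by (simp add: One_nat_def)
qed

lemma gl_num_closed:
  "gl_num q (2 * k) = q ^ tri_pow (2 * k) * odd_prod q k * even_prod q k
   \<and> gl_num q (2 * k + 1) = q ^ tri_pow (2 * k + 1) * odd_prod q (Suc k) * even_prod q k"
proof (induction k)
  case 0
  then show ?case by (simp add: odd_prod_def even_prod_def tri_pow_def One_nat_def)
next
  case (Suc k)
  have even: "gl_num q (2 * Suc k) = q ^ tri_pow (2 * Suc k) * odd_prod q (Suc k) * even_prod q (Suc k)"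
  proof -
    have "gl_num q (2 * Suc k) = (q ^ (2 * k + 2) - 1) * q ^ (2 * k + 1) * gl_num q (2 * k + 1)"
      by (simp add: One_nat_def)
    also have "\<dots> = q ^ (tri_pow (2 * k + 1) + (2 * k + 1)) * odd_prod q (Suc k) * even_prod q (Suc k)"
      unfolding conjunct2[OF Suc] even_prod_Suc power_add by (simp only: mult_ac)
    finally show ?thesis using tri_pow_Suc[of "2 * k + 1"] by simp
  qed
  have "gl_num q (2 * Suc k + 1) = (q ^ (2 * Suc k + 1) - 1) * q ^ (2 * Suc k) * gl_num q (2 * Suc k)" by simp
  also have "\<dots> = q ^ (tri_pow (2 * Suc k) + 2 * Suc k) * odd_prod q (Suc (Suc k)) * even_prod q (Suc k)"
    unfolding even odd_prod_Suc[of q "Suc k"] power_add by (simp only: mult_ac)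
  finally have odd: "gl_num q (2 * Suc k + 1) = \<dots>" .
  have "tri_pow (2 * Suc k + 1) = tri_pow (2 * Suc k) + 2 * Suc k" using tri_pow_Suc[of "2 * Suc k"] by simp
  with even odd show ?case by (simp only: simp_thms)
qed

text \<open>What remains of the factor in \<open>sum_parabolic\<close> after multiplying by the
  order of Q and dividing by the order of Q \<inter> s Q s; the quotient of the GL orders is the
  Gaussian binomial.\<close>

definition main_coeff :: "rat \<Rightarrow> nat \<Rightarrow> nat \<Rightarrow> rat" where
  "main_coeff q r t = qbin (r + t) t q * q ^ (r * t + 2 * (r + t) + r + tri_pow r + tri_pow (r + t)) * (- 1) ^ r * sym_num q r"

text \<open>The quotient |Q|^2 / |Q \<inter> s Q s| in closed form.\<close>

definition coset_size :: "rat \<Rightarrow> nat \<Rightarrow> nat \<Rightarrow> rat" where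
  "coset_size q r t = qbin (r + t) t q * q ^ (4 * r + 2 * t + tri_pow r + tri_pow (r + t)) * gl_num q (r + t) * (q + 1)"

text \<open>The Gaussian binomial is the index of the block triangular subgroup in GL(r + t). Only t
  = 0, 1, 2 occur, and each is a direct computation with nonzero denominators as q > 1.\<close>

lemma gl_num_qbin:
  assumes q: "q > 1" and t: "t \<le> 2"
  shows "gl_num q (r + t) = gl_num q r * gl_num q t * q ^ (r * t) * qbin (r + t) t q"
proof -
  have nz: "q ^ Suc k - 1 \<noteq> 0" for k
    using one_less_power[OF q, of "Suc k"] by simp
  consider "t = 0" | "t = 1" | "t = 2" using t by linarith
  then show ?thesis
  proof cases
    case 1 then show ?thesis by (simp add: qbin_def)
  next
    case 2
    then show ?thesis using nz[of 0] by (simp add: qbin_def One_nat_def)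
  next
    case 3
    define a b c d where "a = q ^ (r + 2) - 1" and "b = q ^ (r + 1) - 1" and "c = q ^ 2 - 1" and "d = q - 1"
    have nz': "c \<noteq> 0" "d \<noteq> 0" using nz[of 1] nz[of 0] by (simp_all add: c_def d_def numeral_2_eq_2)
    have bn: "qbin (r + 2) 2 q = (a / c) * (b / d)"
      by (simp add: qbin_def numeral_2_eq_2 a_def b_def c_def d_def)
    have g2: "gl_num q 2 = c * q * d" by (simp add: numeral_2_eq_2 c_def d_def)
    have gr: "gl_num q (r + 2) = a * q ^ (r + 1) * (b * q ^ r * gl_num q r)"
      by (simp add: a_def b_def)
    have pw: "q ^ (r * 2) * q = q ^ (r + 1) * q ^ r" by (simp add: mult_2_right power_add)
    have "gl_num q r * gl_num q 2 * q ^ (r * 2) * qbin (r + 2) 2 q = gl_num q r * (q ^ (r * 2) * q) * (a * b)"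
      unfolding bn g2 using nz' by simp
    also have "\<dots> = gl_num q (r + 2)" unfolding pw gr by (simp only: mult_ac)
    finally have "gl_num q r * gl_num q 2 * q ^ (r * 2) * qbin (r + 2) 2 q = gl_num q (r + 2)" .
    then show ?thesis unfolding 3 by (rule sym)
  qed
qed

lemma qbin_0: "qbin m 0 q = 1"
  by (simp add: qbin_def)

text \<open>Reduces each comparison of constants to a common cofactor u and an identity between
  exponents.\<close>

lemma monomial_eq: "a = q ^ x * u \<Longrightarrow> b = q ^ y * u \<Longrightarrow> x = y \<Longrightarrow> a = (b :: rat)"
  by simp

lemma tri_pow_values:
  "tri_pow (2 * k) = 2 * k * k - k" "tri_pow (2 * k + 1) = 2 * k * k + k"
  "tri_pow (2 * k + 2) = 2 * k * k + 3 * k + 1" "tri_pow (2 * k + 3) = 2 * k * k + 5 * k + 3"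
proof -
  show "tri_pow (2 * k) = 2 * k * k - k" using tri_pow_even[of k] by simp
  show "tri_pow (2 * k + 1) = 2 * k * k + k" unfolding tri_pow_odd by (simp add: algebra_simps)
  show e: "tri_pow (2 * k + 2) = 2 * k * k + 3 * k + 1"
    using tri_pow_even[of "Suc k"] by (simp add: algebra_simps)
  have "2 * k + 3 = Suc (2 * k + 2)" by simp
  then show "tri_pow (2 * k + 3) = 2 * k * k + 5 * k + 3"
    using e tri_pow_Suc[of "2 * k + 2"] by (simp only:)
qed

lemma le_double_square: "(k::nat) \<le> 2 * k * k"
  by (cases k) simp_all

lemma sym_num_parity:
  "sym_num q (2 * k) = q ^ (k * k + k) * odd_prod q k"
  "sym_num q (2 * k + 1) = q ^ (k * k + k) * odd_prod q (Suc k)"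
proof -
  have e: "k * (k + 1) = k * k + k" by simp
  show "sym_num q (2 * k) = q ^ (k * k + k) * odd_prod q k"
    "sym_num q (2 * k + 1) = q ^ (k * k + k) * odd_prod q (Suc k)"
    using sym_num_closed[of q k] unfolding e by (simp_all only: simp_thms)
qed

lemma gl_num_parity:
  "gl_num q (2 * k) = q ^ tri_pow (2 * k) * odd_prod q k * even_prod q k"
  "gl_num q (2 * k + 1) = q ^ tri_pow (2 * k + 1) * odd_prod q (Suc k) * even_prod q k"
  "gl_num q (2 * k + 2) = q ^ tri_pow (2 * k + 2) * odd_prod q (Suc k) * even_prod q (Suc k)"
  "gl_num q (2 * k + 3) = q ^ tri_pow (2 * k + 3) * odd_prod q (Suc (Suc k)) * even_prod q (Suc k)"
proof -
  have e: "2 * Suc k = 2 * k + 2" and e': "2 * k + 2 + 1 = 2 * k + 3" by simp_all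
  show "gl_num q (2 * k) = q ^ tri_pow (2 * k) * odd_prod q k * even_prod q k"
    "gl_num q (2 * k + 1) = q ^ tri_pow (2 * k + 1) * odd_prod q (Suc k) * even_prod q k"
    using gl_num_closed[of q k] by (simp_all only: simp_thms)
  show "gl_num q (2 * k + 2) = q ^ tri_pow (2 * k + 2) * odd_prod q (Suc k) * even_prod q (Suc k)"
    "gl_num q (2 * k + 3) = q ^ tri_pow (2 * k + 3) * odd_prod q (Suc (Suc k)) * even_prod q (Suc k)"
    using gl_num_closed[of q "Suc k"] unfolding e unfolding e' by (simp_all only: simp_thms)
qed

lemma minus_one_parity: "(- 1 :: rat) ^ (2 * k) = 1" "(- 1 :: rat) ^ (2 * k + 1) = - 1"
  by simp_all

section \<open>Matching the given constants with the computed ones\<close>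

lemma constants_plus_1:
  fixes k :: nat
  defines "n \<equiv> 2 * k + 2"
  shows "Aconst True 1 n q = - main_coeff q (2 * k + 1) 0"
    "Aconst True 1 n q * Bconst True 1 n q = coset_size q (2 * k + 1) 0"
proof -
  have m: "n - 1 = 2 * k + 1" "(n - 2) div 2 = k" by (simp_all add: n_def)
  have mm: "2 * k + 1 + 0 = 2 * k + 1" by simp
  \<comment> \<open>After the substitution the numerators are multiples of 4, so \<open>div\<close>
    is exact. The extra factor q^(n-1) - 1 of A is the next factor of
    \<open>odd_prod\<close>.\<close>
  have "5 * n^2 - 2 * n - 4 = 4 * (5 * k * k + 9 * k + 3)" by (simp add: n_def power2_eq_square algebra_simps)
  then have ex: "(5 * n^2 - 2 * n - 4) div 4 = 5 * k * k + 9 * k + 3" by simp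
  have "n^2 = 4 * (k * k + 2 * k + 1)" by (simp add: n_def power2_eq_square algebra_simps)
  then have ex': "n^2 div 4 = k * k + 2 * k + 1" by simp
  have A: "Aconst True 1 n q = q ^ (5 * k * k + 9 * k + 3) * (qbin (2 * k + 1) 0 q * odd_prod q (Suc k))"
    unfolding Aconst_def ex m odd_prod_def by (simp add: qbin_0)
  have B: "Bconst True 1 n q = q ^ (k * k + 2 * k + 1) * ((q + 1) * even_prod q k)"
    unfolding Bconst_def ex' unfolding m even_prod_def by simp
  show "Aconst True 1 n q = - main_coeff q (2 * k + 1) 0"
  proof (rule monomial_eq[OF A])
    show "- main_coeff q (2 * k + 1) 0 = q ^ ((2 * k + 1) * 0 + 2 * (2 * k + 1) + (2 * k + 1) + tri_pow (2 * k + 1) + tri_pow (2 * k + 1) + (k * k + k)) * (qbin (2 * k + 1) 0 q * odd_prod q (Suc k))"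
      unfolding main_coeff_def mm sym_num_parity minus_one_parity power_add power_one_right
      by (simp only: mult_ac mult_minus_left mult_minus_right minus_minus mult_1_left mult_1_right)
    show "5 * k * k + 9 * k + 3 = (2 * k + 1) * 0 + 2 * (2 * k + 1) + (2 * k + 1) + tri_pow (2 * k + 1) + tri_pow (2 * k + 1) + (k * k + k)"
      using le_double_square[of k] unfolding tri_pow_values by (simp add: algebra_simps)
  qed
  show "Aconst True 1 n q * Bconst True 1 n q = coset_size q (2 * k + 1) 0"
  proof (rule monomial_eq)
    show "Aconst True 1 n q * Bconst True 1 n q = q ^ ((5 * k * k + 9 * k + 3) + (k * k + 2 * k + 1)) * ((q + 1) * qbin (2 * k + 1) 0 q * odd_prod q (Suc k) * even_prod q k)"
      unfolding A B power_add[of q "5 * k * k + 9 * k + 3" "k * k + 2 * k + 1"] odd_prod_Suc even_prod_Suc by (simp add: mult_ac)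
    show "coset_size q (2 * k + 1) 0 = q ^ (4 * (2 * k + 1) + 2 * 0 + tri_pow (2 * k + 1) + tri_pow (2 * k + 1) + tri_pow (2 * k + 1)) * ((q + 1) * qbin (2 * k + 1) 0 q * odd_prod q (Suc k) * even_prod q k)"
      unfolding coset_size_def mm gl_num_parity power_add by (simp only: mult_ac)
    show "(5 * k * k + 9 * k + 3) + (k * k + 2 * k + 1) = 4 * (2 * k + 1) + 2 * 0 + tri_pow (2 * k + 1) + tri_pow (2 * k + 1) + tri_pow (2 * k + 1)"
      using le_double_square[of k] unfolding tri_pow_values by (simp add: algebra_simps)
  qed
qed

text \<open>r = 2 k is even, so no sign appears; here it is B whose factor q^(n-1) - 1 extends
  \<open>odd_prod\<close> to the next index.\<close>

lemma constants_plus_2: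
  fixes k :: nat
  defines "n \<equiv> 2 * k + 2"
  shows "Aconst True 2 n q =  main_coeff q (2 * k) 1"
    "Aconst True 2 n q * Bconst True 2 n q = coset_size q (2 * k) 1"
proof -
  have m: "n - 1 = 2 * k + 1" "n - 2 = 2 * k" "(2 * k) div 2 = k" by (simp_all add: n_def)
  have "5 * n^2 - 2 * n - 8 = 4 * (5 * k * k + 9 * k + 2)" by (simp add: n_def power2_eq_square algebra_simps)
  then have ex: "(5 * n^2 - 2 * n - 8) div 4 = 5 * k * k + 9 * k + 2" by simp
  have "(n - 2)^2 = 4 * (k * k)" by (simp add: n_def power2_eq_square algebra_simps)
  then have ex': "(n - 2)^2 div 4 = k * k" by simp
  have A: "Aconst True 2 n q = q ^ (5 * k * k + 9 * k + 2) * (qbin (2 * k + 1) 1 q * odd_prod q k)"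
    unfolding Aconst_def ex m odd_prod_def by (simp add: qbin_0)
  have B: "Bconst True 2 n q = q ^ (k * k) * ((q + 1) * (q ^ (2 * k + 1) - 1) * even_prod q k)"
    unfolding Bconst_def ex' unfolding m even_prod_def by simp
  show "Aconst True 2 n q =  main_coeff q (2 * k) 1"
  proof (rule monomial_eq[OF A])
    show " main_coeff q (2 * k) 1 = q ^ ((2 * k) * 1 + 2 * (2 * k + 1) + (2 * k) + tri_pow (2 * k) + tri_pow (2 * k + 1) + (k * k + k)) * (qbin (2 * k + 1) 1 q * odd_prod q k)"
      unfolding main_coeff_def sym_num_parity minus_one_parity power_add power_one_right
      by (simp only: mult_ac mult_1_left mult_1_right)
    show "5 * k * k + 9 * k + 2 = (2 * k) * 1 + 2 * (2 * k + 1) + (2 * k) + tri_pow (2 * k) + tri_pow (2 * k + 1) + (k * k + k)"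
      using le_double_square[of k] unfolding tri_pow_values by (simp add: algebra_simps)
  qed
  show "Aconst True 2 n q * Bconst True 2 n q = coset_size q (2 * k) 1"
  proof (rule monomial_eq)
    show "Aconst True 2 n q * Bconst True 2 n q = q ^ ((5 * k * k + 9 * k + 2) + (k * k)) * ((q + 1) * qbin (2 * k + 1) 1 q * odd_prod q (Suc k) * even_prod q k)"
      unfolding A B power_add[of q "5 * k * k + 9 * k + 2" "k * k"] odd_prod_Suc even_prod_Suc by (simp add: mult_ac)
    show "coset_size q (2 * k) 1 = q ^ (4 * (2 * k) + 2 * 1 + tri_pow (2 * k) + tri_pow (2 * k + 1) + tri_pow (2 * k + 1)) * ((q + 1) * qbin (2 * k + 1) 1 q * odd_prod q (Suc k) * even_prod q k)"
      unfolding coset_size_def gl_num_parity power_add by (simp only: mult_ac)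
    show "(5 * k * k + 9 * k + 2) + (k * k) = 4 * (2 * k) + 2 * 1 + tri_pow (2 * k) + tri_pow (2 * k + 1) + tri_pow (2 * k + 1)"
      using le_double_square[of k] unfolding tri_pow_values by (simp add: algebra_simps)
  qed
qed

text \<open>q + 1 is the order of the rotation group, whose trace \<rho> cancels, and q the leading
  factor in \<open>sum_GLd_2\<close>; the sign comes from the odd r.\<close>

lemma constants_plus_4:
  fixes k :: nat
  defines "n \<equiv> 2 * k + 4"
  shows "Aconst True 4 n q = - q * (q + 1) * main_coeff q (2 * k + 1) 2"
    "Aconst True 4 n q * Bconst True 4 n q = coset_size q (2 * k + 1) 2"
proof -
  have m: "n - 1 = 2 * k + 3" "n - 3 = 2 * k + 1" "(n - 2) div 2 = Suc k" by (simp_all add: n_def)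
  have mm: "2 * k + 1 + 2 = 2 * k + 3" by simp
  have "5 * n^2 - 6 * n - 4 = 4 * (5 * k * k + 17 * k + 13)" by (simp add: n_def power2_eq_square algebra_simps)
  then have ex: "(5 * n^2 - 6 * n - 4) div 4 = 5 * k * k + 17 * k + 13" by simp
  have "(n - 2)^2 = 4 * (k * k + 2 * k + 1)" by (simp add: n_def power2_eq_square algebra_simps)
  then have ex': "(n - 2)^2 div 4 = k * k + 2 * k + 1" by simp
  have A: "Aconst True 4 n q = q ^ (5 * k * k + 17 * k + 13) * ((q + 1) * qbin (2 * k + 3) 2 q * odd_prod q (Suc k))"
    unfolding Aconst_def ex m odd_prod_def by (simp add: qbin_0)
  have B: "Bconst True 4 n q = q ^ (k * k + 2 * k + 1) * ((q ^ (2 * k + 3) - 1) * even_prod q (Suc k))"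
    unfolding Bconst_def ex' unfolding m even_prod_def by simp
  show "Aconst True 4 n q = - q * (q + 1) * main_coeff q (2 * k + 1) 2"
  proof (rule monomial_eq[OF A])
    show "- q * (q + 1) * main_coeff q (2 * k + 1) 2 = q ^ (1 + (2 * k + 1) * 2 + 2 * (2 * k + 3) + (2 * k + 1) + tri_pow (2 * k + 1) + tri_pow (2 * k + 3) + (k * k + k)) * ((q + 1) * qbin (2 * k + 3) 2 q * odd_prod q (Suc k))"
      unfolding main_coeff_def mm sym_num_parity minus_one_parity power_add power_one_right
      by (simp only: mult_ac mult_minus_left mult_minus_right minus_minus mult_1_left mult_1_right)
    show "5 * k * k + 17 * k + 13 = 1 + (2 * k + 1) * 2 + 2 * (2 * k + 3) + (2 * k + 1) + tri_pow (2 * k + 1) + tri_pow (2 * k + 3) + (k * k + k)"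
      using le_double_square[of k] unfolding tri_pow_values by (simp add: algebra_simps)
  qed
  show "Aconst True 4 n q * Bconst True 4 n q = coset_size q (2 * k + 1) 2"
  proof (rule monomial_eq)
    show "Aconst True 4 n q * Bconst True 4 n q = q ^ ((5 * k * k + 17 * k + 13) + (k * k + 2 * k + 1)) * ((q + 1) * qbin (2 * k + 3) 2 q * odd_prod q (Suc (Suc k)) * even_prod q (Suc k))"
      unfolding A B power_add[of q "5 * k * k + 17 * k + 13" "k * k + 2 * k + 1"] odd_prod_Suc even_prod_Suc by (simp add: mult_ac numeral_3_eq_3)
    show "coset_size q (2 * k + 1) 2 = q ^ (4 * (2 * k + 1) + 2 * 2 + tri_pow (2 * k + 1) + tri_pow (2 * k + 3) + tri_pow (2 * k + 3)) * ((q + 1) * qbin (2 * k + 3) 2 q * odd_prod q (Suc (Suc k)) * even_prod q (Suc k))"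
      unfolding coset_size_def mm gl_num_parity power_add by (simp only: mult_ac)
    show "(5 * k * k + 17 * k + 13) + (k * k + 2 * k + 1) = 4 * (2 * k + 1) + 2 * 2 + tri_pow (2 * k + 1) + tri_pow (2 * k + 3) + tri_pow (2 * k + 3)"
      using le_double_square[of k] unfolding tri_pow_values by (simp add: algebra_simps)
  qed
qed

lemma constants_minus_1:
  fixes k :: nat
  defines "n \<equiv> 2 * k + 1"
  shows "Aconst False 1 n q =  main_coeff q (2 * k) 0"
    "Aconst False 1 n q * Bconst False 1 n q = coset_size q (2 * k) 0"
proof -
  have m: "n - 1 = 2 * k" "(2 * k) div 2 = k" by (simp_all add: n_def)
  have mm: "2 * k + 0 = 2 * k" by simp
  have "5 * (n^2 - 1) = 4 * (5 * k * k + 5 * k)" by (simp add: n_def power2_eq_square algebra_simps)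
  then have ex: "(5 * (n^2 - 1)) div 4 = 5 * k * k + 5 * k" by simp
  have "(n - 1)^2 = 4 * (k * k)" by (simp add: n_def power2_eq_square algebra_simps)
  then have ex': "(n - 1)^2 div 4 = k * k" by simp
  have A: "Aconst False 1 n q = q ^ (5 * k * k + 5 * k) * (qbin (2 * k) 0 q * odd_prod q k)"
    unfolding Aconst_def ex m odd_prod_def by (simp add: qbin_0)
  have B: "Bconst False 1 n q = q ^ (k * k) * ((q + 1) * even_prod q k)"
    unfolding Bconst_def ex' unfolding m even_prod_def by simp
  show "Aconst False 1 n q =  main_coeff q (2 * k) 0"
  proof (rule monomial_eq[OF A])
    show " main_coeff q (2 * k) 0 = q ^ ((2 * k) * 0 + 2 * (2 * k) + (2 * k) + tri_pow (2 * k) + tri_pow (2 * k) + (k * k + k)) * (qbin (2 * k) 0 q * odd_prod q k)"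
      unfolding main_coeff_def mm sym_num_parity minus_one_parity power_add power_one_right
      by (simp only: mult_ac mult_minus_left mult_minus_right minus_minus mult_1_left mult_1_right)
    show "5 * k * k + 5 * k = (2 * k) * 0 + 2 * (2 * k) + (2 * k) + tri_pow (2 * k) + tri_pow (2 * k) + (k * k + k)"
      using le_double_square[of k] unfolding tri_pow_values by (simp add: algebra_simps)
  qed
  show "Aconst False 1 n q * Bconst False 1 n q = coset_size q (2 * k) 0"
  proof (rule monomial_eq)
    show "Aconst False 1 n q * Bconst False 1 n q = q ^ ((5 * k * k + 5 * k) + (k * k)) * ((q + 1) * qbin (2 * k) 0 q * odd_prod q k * even_prod q k)"
      unfolding A B power_add[of q "5 * k * k + 5 * k" "k * k"] odd_prod_Suc even_prod_Suc by (simp add: mult_ac)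
    show "coset_size q (2 * k) 0 = q ^ (4 * (2 * k) + 2 * 0 + tri_pow (2 * k) + tri_pow (2 * k) + tri_pow (2 * k)) * ((q + 1) * qbin (2 * k) 0 q * odd_prod q k * even_prod q k)"
      unfolding coset_size_def mm gl_num_parity power_add by (simp only: mult_ac)
    show "(5 * k * k + 5 * k) + (k * k) = 4 * (2 * k) + 2 * 0 + tri_pow (2 * k) + tri_pow (2 * k) + tri_pow (2 * k)"
      using le_double_square[of k] unfolding tri_pow_values by (simp add: algebra_simps)
  qed
qed

lemma constants_minus_2:
  fixes k :: nat
  defines "n \<equiv> 2 * k + 3"
  shows "Aconst False 2 n q = - main_coeff q (2 * k + 1) 1"
    "Aconst False 2 n q * Bconst False 2 n q = coset_size q (2 * k + 1) 1"
proof -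
  have m: "n - 1 = 2 * k + 2" "n - 2 = 2 * k + 1" "(2 * k + 2) div 2 = Suc k" by (simp_all add: n_def)
  have mm: "2 * k + 1 + 1 = 2 * k + 2" by simp
  have "5 * n^2 - 4 * n - 5 = 4 * (5 * k * k + 13 * k + 7)" by (simp add: n_def power2_eq_square algebra_simps)
  then have ex: "(5 * n^2 - 4 * n - 5) div 4 = 5 * k * k + 13 * k + 7" by simp
  have "(n - 1)^2 = 4 * (k * k + 2 * k + 1)" by (simp add: n_def power2_eq_square algebra_simps)
  then have ex': "(n - 1)^2 div 4 = k * k + 2 * k + 1" by simp
  have A: "Aconst False 2 n q = q ^ (5 * k * k + 13 * k + 7) * (qbin (2 * k + 2) 1 q * odd_prod q (Suc k))"
    unfolding Aconst_def ex m odd_prod_def by (simp add: qbin_0)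
  have B: "Bconst False 2 n q = q ^ (k * k + 2 * k + 1) * ((q + 1) * even_prod q (Suc k))"
    unfolding Bconst_def ex' unfolding m even_prod_def by simp
  show "Aconst False 2 n q = - main_coeff q (2 * k + 1) 1"
  proof (rule monomial_eq[OF A])
    show "- main_coeff q (2 * k + 1) 1 = q ^ ((2 * k + 1) * 1 + 2 * (2 * k + 2) + (2 * k + 1) + tri_pow (2 * k + 1) + tri_pow (2 * k + 2) + (k * k + k)) * (qbin (2 * k + 2) 1 q * odd_prod q (Suc k))"
      unfolding main_coeff_def mm sym_num_parity minus_one_parity power_add power_one_right
      by (simp only: mult_ac mult_minus_left mult_minus_right minus_minus mult_1_left mult_1_right)
    show "5 * k * k + 13 * k + 7 = (2 * k + 1) * 1 + 2 * (2 * k + 2) + (2 * k + 1) + tri_pow (2 * k + 1) + tri_pow (2 * k + 2) + (k * k + k)"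
      using le_double_square[of k] unfolding tri_pow_values by (simp add: algebra_simps)
  qed
  show "Aconst False 2 n q * Bconst False 2 n q = coset_size q (2 * k + 1) 1"
  proof (rule monomial_eq)
    show "Aconst False 2 n q * Bconst False 2 n q = q ^ ((5 * k * k + 13 * k + 7) + (k * k + 2 * k + 1)) * ((q + 1) * qbin (2 * k + 2) 1 q * odd_prod q (Suc k) * even_prod q (Suc k))"
      unfolding A B power_add[of q "5 * k * k + 13 * k + 7" "k * k + 2 * k + 1"] odd_prod_Suc even_prod_Suc by (simp add: mult_ac)
    show "coset_size q (2 * k + 1) 1 = q ^ (4 * (2 * k + 1) + 2 * 1 + tri_pow (2 * k + 1) + tri_pow (2 * k + 2) + tri_pow (2 * k + 2)) * ((q + 1) * qbin (2 * k + 2) 1 q * odd_prod q (Suc k) * even_prod q (Suc k))"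
      unfolding coset_size_def mm gl_num_parity power_add by (simp only: mult_ac)
    show "(5 * k * k + 13 * k + 7) + (k * k + 2 * k + 1) = 4 * (2 * k + 1) + 2 * 1 + tri_pow (2 * k + 1) + tri_pow (2 * k + 2) + tri_pow (2 * k + 2)"
      using le_double_square[of k] unfolding tri_pow_values by (simp add: algebra_simps)
  qed
qed

text \<open>The factors q^(n-2) - 1 and q^(n-1) - 1 of B extend \<open>odd_prod\<close> and
  \<open>even_prod\<close> by one index each, as the order of GL(n - 1) requires.\<close>

lemma constants_minus_4:
  fixes k :: nat
  defines "n \<equiv> 2 * k + 3"
  shows "Aconst False 4 n q = q * (q + 1) * main_coeff q (2 * k) 2"
    "Aconst False 4 n q * Bconst False 4 n q = coset_size q (2 * k) 2"
proof -
  have m: "n - 1 = 2 * k + 2" "n - 3 = 2 * k" "n - 2 = 2 * k + 1" "(2 * k) div 2 = k" by (simp_all add: n_def)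
  have "5 * n^2 - 4 * n - 9 = 4 * (5 * k * k + 13 * k + 6)" by (simp add: n_def power2_eq_square algebra_simps)
  then have ex: "(5 * n^2 - 4 * n - 9) div 4 = 5 * k * k + 13 * k + 6" by simp
  have "(n - 3)^2 = 4 * (k * k)" by (simp add: n_def power2_eq_square algebra_simps)
  then have ex': "(n - 3)^2 div 4 = k * k" by simp
  have A: "Aconst False 4 n q = q ^ (5 * k * k + 13 * k + 6) * ((q + 1) * qbin (2 * k + 2) 2 q * odd_prod q k)"
    unfolding Aconst_def ex m odd_prod_def by (simp add: qbin_0)
  have B: "Bconst False 4 n q = q ^ (k * k) * ((q ^ (2 * k + 1) - 1) * (q ^ (2 * k + 2) - 1) * even_prod q k)"
    unfolding Bconst_def ex' unfolding m even_prod_def by simp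
  show "Aconst False 4 n q = q * (q + 1) * main_coeff q (2 * k) 2"
  proof (rule monomial_eq[OF A])
    show "q * (q + 1) * main_coeff q (2 * k) 2 = q ^ (1 + (2 * k) * 2 + 2 * (2 * k + 2) + (2 * k) + tri_pow (2 * k) + tri_pow (2 * k + 2) + (k * k + k)) * ((q + 1) * qbin (2 * k + 2) 2 q * odd_prod q k)"
      unfolding main_coeff_def sym_num_parity minus_one_parity power_add power_one_right
      by (simp only: mult_ac mult_1_left mult_1_right)
    show "5 * k * k + 13 * k + 6 = 1 + (2 * k) * 2 + 2 * (2 * k + 2) + (2 * k) + tri_pow (2 * k) + tri_pow (2 * k + 2) + (k * k + k)"
      using le_double_square[of k] unfolding tri_pow_values by (simp add: algebra_simps)
  qed
  show "Aconst False 4 n q * Bconst False 4 n q = coset_size q (2 * k) 2"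
  proof (rule monomial_eq)
    show "Aconst False 4 n q * Bconst False 4 n q = q ^ ((5 * k * k + 13 * k + 6) + (k * k)) * ((q + 1) * qbin (2 * k + 2) 2 q * odd_prod q (Suc k) * even_prod q (Suc k))"
      unfolding A B power_add[of q "5 * k * k + 13 * k + 6" "k * k"] odd_prod_Suc even_prod_Suc by (simp add: mult_ac)
    show "coset_size q (2 * k) 2 = q ^ (4 * (2 * k) + 2 * 2 + tri_pow (2 * k) + tri_pow (2 * k + 2) + tri_pow (2 * k + 2)) * ((q + 1) * qbin (2 * k + 2) 2 q * odd_prod q (Suc k) * even_prod q (Suc k))"
      unfolding coset_size_def gl_num_parity power_add by (simp only: mult_ac)
    show "(5 * k * k + 13 * k + 6) + (k * k) = 4 * (2 * k) + 2 * 2 + tri_pow (2 * k) + tri_pow (2 * k + 2) + tri_pow (2 * k + 2)"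
      using le_double_square[of k] unfolding tri_pow_values by (simp add: algebra_simps)
  qed
qed

section \<open>Trace distribution on a double coset\<close>

text \<open>
  The four families are \<open>\<tau> Q \<sigma>\<^sub>r Q\<close> with \<open>r + t = n - 1\<close>, where \<open>\<tau> = 1\<close> for \<open>\<kappa> = 1\<close> and \<open>\<tau> = \<rho>\<close> for
  \<open>\<kappa> = - 1\<close>.\<close>

locale coset_setup =
  fixes e :: "'a::{field,finite}" and m r t :: nat and \<kappa> :: 'a and q :: rat
  assumes q: "q = of_nat CARD('a)" and three: "(3::'a) = 0" and e: "\<not> is_sq e" and m: "m = r + t" and t2: "t \<le> 2" and k: "\<kappa> * \<kappa> = 1"
begin

abbreviation "Q \<equiv> Qpar (Suc m) e"
abbreviation "D \<equiv> dcoset Q (sigma_mat (Suc m) r)"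

lemma two: "(2::'a) \<noteq> 0"
  by (rule two_neq_0[OF three])

lemma e0: "e \<noteq> 0" using e by (auto simp: is_sq_def)

lemma q1: "q > 1"
proof -
  have "card {0, 1 :: 'a} \<le> CARD('a)" by (rule card_mono) auto
  then show ?thesis unfolding q by simp
qed

lemma r_le: "r \<le> m" using m by simp

lemma D_carrier: "D \<subseteq> carrier_mat (2 * m + 2) (2 * m + 2)"
proof -
  have "Q \<subseteq> carrier_mat (2 * m + 2) (2 * m + 2)" by (auto simp: Qpar_iff Qchar_def)
  then show ?thesis
    unfolding dcoset_def using mult_carrier_mat[OF mult_carrier_mat[OF _ sigma_mat_carrier]] by blast
qed

lemma finite_D: "finite D"
  by (rule finite_subset[OF D_carrier]) simp

abbreviation "cP \<equiv> (of_nat (card {p \<in> Q. sigma_mat (Suc m) r * p * sigma_mat (Suc m) r \<in> Q}) :: rat)"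
abbreviation "cQ \<equiv> (of_nat (card Q) :: rat)"

lemma cQ: "cQ = gl_num q m * (q + 1) * q ^ (2 * m) * q ^ tri_pow m"
  by (simp add: q card_Qpar[OF three two e] card_GLd_num card_Alt[OF two] tri_pow_def algebra_simps)

text \<open>The power of q on the left comes from \<open>card_Alt_corner\<close>; keeping it there
  avoids a negative exponent.\<close>

lemma cP: "cP * q ^ tri_pow r = gl_num q r * q ^ (r * t) * gl_num q t * (q + 1) * q ^ (2 * t) * q ^ tri_pow m"
proof -
  have "of_nat (card {S \<in> Alt m :: 'a mat set. \<forall>i<r. \<forall>j<r. S $$ (i, j) = 0}) * q ^ tri_pow r = q ^ tri_pow m"
    using arg_cong[OF card_Alt_corner[OF two r_le], of "of_nat :: nat \<Rightarrow> rat"] by (simp add: q tri_pow_def)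
  moreover have "cP = gl_num q r * q ^ (r * t) * gl_num q t * (q + 1) * q ^ (2 * t)
      * of_nat (card {S \<in> Alt m :: 'a mat set. \<forall>i<r. \<forall>j<r. S $$ (i, j) = 0})"
    by (simp add: q card_Qpar_sigma[OF three two e m] card_GLd_num algebra_simps)
  ultimately show ?thesis by simp
qed

lemma gl_num_pos: "gl_num q k > 0"
proof (induction k)
  case (Suc k)
  have "q ^ Suc k > 1" using q1 by (rule one_less_power) simp
  then show ?case using Suc q1 by simp
qed simp

lemma cP_pos: "cP > 0"
proof -
  have "cP * q ^ tri_pow r > 0" unfolding cP using gl_num_pos[of r] gl_num_pos[of t] q1 by simp
  moreover have "q ^ tri_pow r > 0" using q1 by simp
  ultimately show ?thesis by (simp add: zero_less_mult_iff)
qed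

text \<open>The double coset identity for the constant function 1 reads |Q \<inter> s Q s| |D| =
  |Q|^2.\<close>

lemma card_D: "of_nat (card D) = coset_size q r t"
proof -
  have "cP * of_nat (card D) = cQ * cQ"
    using dcoset_sigma_sum[OF e0 r_le k, of "\<lambda>_. 1"] by simp
  moreover have "cP * coset_size q r t = cQ * cQ"
  proof -
    have "q ^ tri_pow r * (cP * coset_size q r t) = (cP * q ^ tri_pow r) * coset_size q r t" by simp
    also have "\<dots> = q ^ tri_pow r * ((gl_num q r * gl_num q t * q ^ (r * t) * qbin (r + t) t q) * gl_num q (r + t)
        * (q + 1) * (q + 1) * (q ^ (2 * (r + t)) * q ^ (2 * (r + t))) * (q ^ tri_pow m * q ^ tri_pow m))"
    proof -
      have "q ^ (4 * r + 2 * t) * q ^ (2 * t) = q ^ (2 * (r + t)) * q ^ (2 * (r + t))"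
      proof -
        have "4 * r + 2 * t + 2 * t = 2 * (r + t) + 2 * (r + t)" by simp
        then show ?thesis by (simp only: flip: power_add)
      qed
      moreover have "q ^ (2 * t) * (q ^ (4 * r + 2 * t + tri_pow r + tri_pow (r + t)) * x)
          = (q ^ (4 * r + 2 * t) * q ^ (2 * t)) * q ^ tri_pow r * q ^ tri_pow (r + t) * x" for x
        unfolding power_add[of q "4 * r + 2 * t + tri_pow r"] power_add[of q "4 * r + 2 * t" "tri_pow r"]
        by (simp only: mult_ac)
      ultimately have p: "q ^ (2 * t) * (q ^ (4 * r + 2 * t + tri_pow r + tri_pow (r + t)) * x)
          = (q ^ (2 * (r + t)) * q ^ (2 * (r + t))) * q ^ tri_pow r * q ^ tri_pow (r + t) * x" for x
        by (simp only:)
      have "(cP * q ^ tri_pow r) * coset_size q r t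
          = (q ^ (2 * t) * (q ^ (4 * r + 2 * t + tri_pow r + tri_pow (r + t)) * 1))
            * (gl_num q r * q ^ (r * t) * gl_num q t * (q + 1) * q ^ tri_pow m * qbin (r + t) t q * gl_num q (r + t) * (q + 1))"
        unfolding cP coset_size_def by (simp only: mult_ac mult_1_right)
      also have "\<dots> = q ^ tri_pow r * ((gl_num q r * gl_num q t * q ^ (r * t) * qbin (r + t) t q) * gl_num q (r + t)
        * (q + 1) * (q + 1) * (q ^ (2 * (r + t)) * q ^ (2 * (r + t))) * (q ^ tri_pow m * q ^ tri_pow m))"
        unfolding p m by (simp only: mult_ac mult_1_right)
      finally show ?thesis .
    qed
    also have "\<dots> = q ^ tri_pow r * (cQ * cQ)"
      unfolding gl_num_qbin[OF q1 t2, symmetric] cQ unfolding m by (simp only: mult_ac)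
    finally show ?thesis using q1 by simp
  qed
  ultimately have "cP * of_nat (card D) = cP * coset_size q r t" by (simp only:)
  then show ?thesis by (rule mult_left_cancel[THEN iffD1, OF less_imp_neq[OF cP_pos, symmetric]])
qed

text \<open>Both sides are compared after multiplication by the order of Q \<inter> s Q s, which is
  positive and can be cancelled.\<close>

lemma sum_D:
  assumes f: "mean_zero f"
  shows "(\<Sum>g\<in>D. f (mat_tr (tau m \<kappa> * g)))
    = main_coeff q r t * (\<Sum>ab\<in>norm_one e. \<Sum>A\<in>GLd t. f ((fst ab + \<kappa> * fst ab) + (mat_tr A + mat_tr (minv A))))"
    (is "?L = _ * ?X")
proof -
  define c where "c = q ^ tri_pow m * q ^ (2 * t) * q ^ (r * t) * (- q) ^ r * sym_num q r"
  have "cP * ?L = cQ * (c * ?X)"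
    unfolding dcoset_sigma_sum[OF e0 r_le k] sum_Qpar_mean_zero[OF three two e f m] card_SymI_num
    by (simp add: q card_Alt[OF two] tri_pow_def c_def)
  moreover have "cP * main_coeff q r t = cQ * c"
  proof -
    have neg: "(- q) ^ r = (- 1) ^ r * q ^ r" by (simp add: power_minus[of q])
    have "q ^ tri_pow r * (cP * main_coeff q r t) = (cP * q ^ tri_pow r) * main_coeff q r t" by simp
    also have "\<dots> = q ^ tri_pow r * ((gl_num q r * gl_num q t * q ^ (r * t) * qbin (r + t) t q)
        * (q + 1) * q ^ (2 * (r + t)) * q ^ tri_pow (r + t)
        * (q ^ tri_pow m * q ^ (2 * t) * q ^ (r * t) * ((- 1) ^ r * q ^ r) * sym_num q r))"
      unfolding cP unfolding main_coeff_def m power_add[of q "r * t + 2 * (r + t) + r + tri_pow r"]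
        power_add[of q "r * t + 2 * (r + t) + r"] power_add[of q "r * t + 2 * (r + t)"] power_add[of q "r * t"]
      by (simp only: mult_ac)
    also have "\<dots> = q ^ tri_pow r * (cQ * c)"
      unfolding gl_num_qbin[OF q1 t2, symmetric] cQ unfolding c_def neg m by (simp only: mult_ac)
    finally show ?thesis using q1 by simp
  qed
  ultimately have "cP * ?L = cP * (main_coeff q r t * ?X)" by (simp add: mult.assoc)
  then show ?thesis by (rule mult_left_cancel[THEN iffD1, OF less_imp_neq[OF cP_pos, symmetric]])
qed

definition ind :: "'a \<Rightarrow> 'a \<Rightarrow> rat" where
  "ind \<beta> x = (if x = \<beta> then 1 else 0) - 1 / q"

lemma mean_zero_ind: "mean_zero (ind \<beta>)"
proof -
  have "of_nat CARD('a) / q = 1" using q1 q by simp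
  then show ?thesis unfolding mean_zero_def ind_def sum_subtractf by simp
qed

lemma sum_ind:
  assumes "finite X"
  shows "(\<Sum>x\<in>X. ind \<beta> (h x)) = of_nat (card {x \<in> X. h x = \<beta>}) - of_nat (card X) / q"
proof -
  have "(\<Sum>x\<in>X. if h x = \<beta> then 1 else 0 :: rat) = of_nat (card {x \<in> X. h x = \<beta>})"
    using assms by (simp add: sum.If_cases Int_def)
  then show ?thesis by (simp add: ind_def sum_subtractf)
qed

abbreviation "tD \<equiv> (\<lambda>g. tau m \<kappa> * g) ` D"

lemma inj_tau: "inj_on (\<lambda>g. tau m \<kappa> * g) D"
proof (rule inj_onI)
  fix x y assume xy: "x \<in> D" "y \<in> D" "tau m \<kappa> * x = tau m \<kappa> * y"
  have "tau m \<kappa> * (tau m \<kappa> * g) = g" if "g \<in> D" for g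
  proof -
    have g: "g \<in> carrier_mat (2 * m + 2) (2 * m + 2)" using that D_carrier by blast
    show ?thesis
      unfolding assoc_mult_mat[OF tau_carrier tau_carrier g, symmetric] tau_sq[OF k] using g by (rule left_mult_one_mat)
  qed
  then show "x = y" using xy by metis
qed

text \<open>The centred indicator summed over D is the fibre size minus |D| / q, and
  \<open>sum_D\<close> evaluates it.\<close>

lemma fibre_count:
  "(of_nat (card {g \<in> tD. mat_tr g = \<beta>}) :: rat) = coset_size q r t / q
    + main_coeff q r t * (\<Sum>ab\<in>norm_one e. \<Sum>A\<in>GLd t. ind \<beta> ((fst ab + \<kappa> * fst ab) + (mat_tr A + mat_tr (minv A))))"
proof -
  have "{g \<in> tD. mat_tr g = \<beta>} = (\<lambda>g. tau m \<kappa> * g) ` {g \<in> D. mat_tr (tau m \<kappa> * g) = \<beta>}" by auto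
  then have "card {g \<in> tD. mat_tr g = \<beta>} = card {g \<in> D. mat_tr (tau m \<kappa> * g) = \<beta>}"
    using card_image[OF inj_on_subset[OF inj_tau]] by (metis (no_types, lifting) mem_Collect_eq subsetI)
  then show ?thesis
    using sum_D[OF mean_zero_ind, of \<beta>] sum_ind[OF finite_D, of \<beta> "\<lambda>g. mat_tr (tau m \<kappa> * g)"] card_D by simp
qed

text \<open>By \<open>card_kloosterman_fibre\<close> also the number of nonzero \<alpha> with
  \<alpha> + 1 / \<alpha> = \<beta>.\<close>

definition roots :: "'a \<Rightarrow> rat" where
  "roots \<beta> = of_nat (card {y. y * y = \<beta> * \<beta> - 1})"

lemma card_units: "(of_nat (card (UNIV - {0::'a})) :: rat) = q - 1"
proof -
  have "card (UNIV - {0::'a}) = CARD('a) ^ 1 - 1" by (simp add: card_Diff_subset)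
  then show ?thesis using of_nat_card_minus_1[of 1, where 'a = 'a] q by (simp only: power_one_right)
qed

lemma kloosterman_ind: "(\<Sum>a\<in>UNIV - {0}. ind \<beta> (a + inverse a)) = roots \<beta> - (q - 1) / q"
  unfolding sum_ind[of "UNIV - {0}" \<beta> "\<lambda>a. a + inverse a", OF finite] card_units
    card_kloosterman_fibre[OF three, of \<beta>] roots_def ..

lemma kloosterman_sq_ind:
  "(\<Sum>a\<in>UNIV - {0}. \<Sum>b\<in>UNIV - {0}. ind \<beta> ((a + inverse a) + (b + inverse b))) = of_nat (delta2 \<beta>) - (q - 1)\<^sup>2 / q"
proof -
  let ?U = "UNIV - {0::'a}"
  have "(\<Sum>a\<in>?U. \<Sum>b\<in>?U. ind \<beta> ((a + inverse a) + (b + inverse b)))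
      = (\<Sum>x\<in>?U \<times> ?U. ind \<beta> ((fst x + inverse (fst x)) + (snd x + inverse (snd x))))"
    by (simp add: sum.cartesian_product case_prod_beta)
  also have "\<dots> = of_nat (card {x \<in> ?U \<times> ?U. (fst x + inverse (fst x)) + (snd x + inverse (snd x)) = \<beta>})
      - of_nat (card (?U \<times> ?U)) / q" by (rule sum_ind) simp
  also have "{x \<in> ?U \<times> ?U. (fst x + inverse (fst x)) + (snd x + inverse (snd x)) = \<beta>}
      = {(a1, a2). a1 \<noteq> 0 \<and> a2 \<noteq> 0 \<and> a1 + inverse a1 + a2 + inverse a2 = \<beta>}"
    by (auto simp: add.assoc)
  also have "of_nat (card (?U \<times> ?U)) = (q - 1)\<^sup>2"
    unfolding card_cartesian_product of_nat_mult card_units power2_eq_square ..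
  finally show ?thesis by (simp add: delta2_def)
qed

lemma sum_norm_one_const: "(\<Sum>ab\<in>norm_one e. g) = (q + 1) * (g :: rat)"
proof -
  have "of_nat (card (norm_one e)) = q + 1" unfolding card_norm_one[OF two e] q by simp
  then show ?thesis by simp
qed

text \<open>With t = 0 only the rotation trace 2 a is left, and its sum is minus a Kloosterman
  sum.\<close>

lemma fibre_count_1:
  assumes "t = 0" "\<kappa> = 1"
  shows "(of_nat (card {g \<in> tD. mat_tr g = \<beta>}) :: rat)
    = coset_size q r t / q - main_coeff q r t * (roots \<beta> - (q - 1) / q)"
proof -
  have "(\<Sum>ab\<in>norm_one e. \<Sum>A\<in>GLd t. ind \<beta> ((fst ab + \<kappa> * fst ab) + (mat_tr A + mat_tr (minv A))))
      = (\<Sum>(a, b)\<in>norm_one e. ind \<beta> (0 + 2 * a))"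
  proof (rule sum.cong)
    fix ab assume "ab \<in> norm_one e"
    show "(\<Sum>A\<in>GLd t. ind \<beta> ((fst ab + \<kappa> * fst ab) + (mat_tr A + mat_tr (minv A))))
        = (case ab of (a, b) \<Rightarrow> ind \<beta> (0 + 2 * a))"
      unfolding assms sum_GLd_0[of "\<lambda>z. ind \<beta> ((fst ab + 1 * fst ab) + z)"]
      by (simp only: mult_1_left mult_2[symmetric] add_0_left add_0_right case_prod_beta)
  qed simp
  also have "\<dots> = - (roots \<beta> - (q - 1) / q)"
    unfolding sum_norm_one[OF three e mean_zero_ind] using kloosterman_ind by (simp only: add_0_left)
  finally have s: "(\<Sum>ab\<in>norm_one e. \<Sum>A\<in>GLd t. ind \<beta> ((fst ab + \<kappa> * fst ab) + (mat_tr A + mat_tr (minv A)))) = \<dots>" .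
  show ?thesis unfolding fibre_count s mult_minus_right by (rule add_uminus_conv_diff)
qed

text \<open>One Kloosterman variable comes from GL(1) and a second one, with negative sign, from the
  rotations; together they are counted by \<open>delta2\<close>.\<close>

lemma fibre_count_2:
  assumes "t = 1" "\<kappa> = 1"
  shows "(of_nat (card {g \<in> tD. mat_tr g = \<beta>}) :: rat)
    = coset_size q r t / q - main_coeff q r t * (of_nat (delta2 \<beta>) - (q - 1)\<^sup>2 / q)"
proof -
  have "(\<Sum>ab\<in>norm_one e. \<Sum>A\<in>GLd t. ind \<beta> ((fst ab + \<kappa> * fst ab) + (mat_tr A + mat_tr (minv A))))
      = (\<Sum>ab\<in>norm_one e. \<Sum>d\<in>UNIV - {0}. ind \<beta> ((d + inverse d) + 2 * fst ab))"
  proof (rule sum.cong)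
    fix ab assume "ab \<in> norm_one e"
    show "(\<Sum>A\<in>GLd t. ind \<beta> ((fst ab + \<kappa> * fst ab) + (mat_tr A + mat_tr (minv A))))
        = (\<Sum>d\<in>UNIV - {0}. ind \<beta> ((d + inverse d) + 2 * fst ab))"
      unfolding assms sum_GLd_1[of "\<lambda>z. ind \<beta> ((fst ab + 1 * fst ab) + z)"] unfolding mult_1_left mult_2[of "fst ab"]
      by (simp only: add.commute[of "fst ab + fst ab"])
  qed simp
  also have "\<dots> = (\<Sum>d\<in>UNIV - {0}. \<Sum>(a, b)\<in>norm_one e. ind \<beta> ((d + inverse d) + 2 * a))"
    by (subst sum.swap) (simp add: case_prod_beta)
  also have "\<dots> = - (of_nat (delta2 \<beta>) - (q - 1)\<^sup>2 / q)"
    unfolding sum_norm_one[OF three e mean_zero_ind] sum_negf kloosterman_sq_ind ..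
  finally have s: "(\<Sum>ab\<in>norm_one e. \<Sum>A\<in>GLd t. ind \<beta> ((fst ab + \<kappa> * fst ab) + (mat_tr A + mat_tr (minv A)))) = \<dots>" .
  show ?thesis unfolding fibre_count s mult_minus_right by (rule add_uminus_conv_diff)
qed

text \<open>\<kappa> = -1 cancels the rotation trace, so the rotations contribute the factor q + 1
  and GL(1) a single Kloosterman sum.\<close>

lemma fibre_count_3:
  assumes "t = 1" "\<kappa> = - 1"
  shows "(of_nat (card {g \<in> tD. mat_tr g = \<beta>}) :: rat)
    = coset_size q r t / q + main_coeff q r t * (q + 1) * (roots \<beta> - (q - 1) / q)"
proof -
  have "(\<Sum>ab\<in>norm_one e. \<Sum>A\<in>GLd t. ind \<beta> ((fst ab + \<kappa> * fst ab) + (mat_tr A + mat_tr (minv A))))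
      = (\<Sum>ab\<in>norm_one e. \<Sum>d\<in>UNIV - {0}. ind \<beta> (d + inverse d))"
  proof (rule sum.cong)
    fix ab assume "ab \<in> norm_one e"
    have z: "fst ab + - 1 * fst ab = 0" by simp
    show "(\<Sum>A\<in>GLd t. ind \<beta> ((fst ab + \<kappa> * fst ab) + (mat_tr A + mat_tr (minv A))))
        = (\<Sum>d\<in>UNIV - {0}. ind \<beta> (d + inverse d))"
      unfolding assms z add_0_left sum_GLd_1[of "ind \<beta>"] ..
  qed simp
  also have "\<dots> = (q + 1) * (roots \<beta> - (q - 1) / q)"
    unfolding sum_norm_one_const kloosterman_ind ..
  finally have s: "(\<Sum>ab\<in>norm_one e. \<Sum>A\<in>GLd t. ind \<beta> ((fst ab + \<kappa> * fst ab) + (mat_tr A + mat_tr (minv A)))) = \<dots>" .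
  show ?thesis unfolding fibre_count s by simp
qed

text \<open>The term with f x in \<open>sum_GLd_2\<close> is now evaluated at x = 0, which singles
  out the fibre over \<beta> = 0.\<close>

lemma fibre_count_4:
  assumes "t = 2" "\<kappa> = - 1"
  shows "(of_nat (card {g \<in> tD. mat_tr g = \<beta>}) :: rat)
    = coset_size q r t / q + main_coeff q r t * (q + 1) * (q * (of_nat (delta2 \<beta>) - (q - 1)\<^sup>2 / q)
      + q\<^sup>2 * (q - 1) * ((if \<beta> = 0 then 1 else 0) - 1 / q))"
proof -
  have "(\<Sum>ab\<in>norm_one e. \<Sum>A\<in>GLd t. ind \<beta> ((fst ab + \<kappa> * fst ab) + (mat_tr A + mat_tr (minv A))))
      = (\<Sum>ab\<in>norm_one e. q * (of_nat (delta2 \<beta>) - (q - 1)\<^sup>2 / q) + q\<^sup>2 * (q - 1) * ind \<beta> 0)"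
  proof (rule sum.cong)
    fix ab assume "ab \<in> norm_one e"
    have z: "fst ab + - 1 * fst ab = 0" by simp
    show "(\<Sum>A\<in>GLd t. ind \<beta> ((fst ab + \<kappa> * fst ab) + (mat_tr A + mat_tr (minv A))))
        = q * (of_nat (delta2 \<beta>) - (q - 1)\<^sup>2 / q) + q\<^sup>2 * (q - 1) * ind \<beta> 0"
      unfolding assms z sum_GLd_2[OF mean_zero_ind] q[symmetric] unfolding add_0_left kloosterman_sq_ind ..
  qed simp
  also have "\<dots> = (q + 1) * (q * (of_nat (delta2 \<beta>) - (q - 1)\<^sup>2 / q) + q\<^sup>2 * (q - 1) * ind \<beta> 0)"
    by (rule sum_norm_one_const)
  finally have s: "(\<Sum>ab\<in>norm_one e. \<Sum>A\<in>GLd t. ind \<beta> ((fst ab + \<kappa> * fst ab) + (mat_tr A + mat_tr (minv A)))) = \<dots>" .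
  show ?thesis unfolding fibre_count s by (auto simp: ind_def)
qed

end

lemma (in coset_setup) image_tau_1: "\<kappa> = 1 \<Longrightarrow> tD = D"
proof -
  assume k1: "\<kappa> = 1"
  have "tau m \<kappa> * g = g" if "g \<in> D" for g
  proof -
    have "g \<in> carrier_mat (2 * m + 2) (2 * m + 2)" using that D_carrier by blast
    then show ?thesis unfolding k1 one_mat_tau[symmetric] by (rule left_mult_one_mat)
  qed
  then have "tD = (\<lambda>g. g) ` D" by (rule image_cong[OF refl])
  then show "tD = D" by simp
qed

lemma DC_tau:
  "DC pm 3 (Suc m) e = (\<lambda>g. tau m (- 1) * g) ` dcoset (Qpar (Suc m) e) (sigma_mat (Suc m) (Suc m - 2))"
  "DC pm 4 (Suc m) e = (\<lambda>g. tau m (- 1) * g) ` dcoset (Qpar (Suc m) e) (sigma_mat (Suc m) (Suc m - 3))"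
proof -
  have "DC pm 3 n e = (\<lambda>g. rho_mat n * g) ` dcoset (Qpar n e) (sigma_mat n (n - 2))"
    "DC pm 4 n e = (\<lambda>g. rho_mat n * g) ` dcoset (Qpar n e) (sigma_mat n (n - 3))" for n
    by (simp_all add: DC_def)
  then show "DC pm 3 (Suc m) e = (\<lambda>g. tau m (- 1) * g) ` dcoset (Qpar (Suc m) e) (sigma_mat (Suc m) (Suc m - 2))"
    "DC pm 4 (Suc m) e = (\<lambda>g. tau m (- 1) * g) ` dcoset (Qpar (Suc m) e) (sigma_mat (Suc m) (Suc m - 3))"
    unfolding rho_mat_tau[symmetric] by (simp_all only:)
qed

section \<open>The four families in both parities\<close>

declare One_nat_def [simp del]

text \<open>The value t = n - 1 - r belonging to the Weyl element of family i.\<close>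

definition corank :: "nat \<Rightarrow> nat" where
  "corank i = (if i = 1 then 0 else if i = 4 then 2 else 1)"

definition family_sign :: "bool \<Rightarrow> rat" where
  "family_sign pm = (if pm then 1 else - 1)"

text \<open>The ratio of \<eta> times A to \<open>main_coeff\<close>, which no longer depends on the
  parity of n because the sign (-1)^r is absorbed by \<eta>.\<close>

definition fibre_factor :: "nat \<Rightarrow> rat \<Rightarrow> rat" where
  "fibre_factor i q = (if i = 1 then - 1 else if i = 2 then 1 else if i = 3 then q + 1 else - q * (q + 1))"

lemma corank_values: "corank 1 = 0" "corank 2 = 1" "corank 3 = 1" "corank 4 = 2"
  by (simp_all add: corank_def)

lemma family_sign_values: "family_sign True = 1" "family_sign False = - 1"
  by (simp_all add: family_sign_def)

lemma fibre_factor_values: "fibre_factor 1 q = - 1" "fibre_factor 2 q = 1" "fibre_factor 3 q = q + 1" "fibre_factor 4 q = - q * (q + 1)"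
  by (simp_all add: fibre_factor_def)

lemma Aconst_3: "Aconst pm 3 n q = (q + 1) * Aconst pm 2 n q"
  by (simp add: Aconst_def)

lemma AB_const_3: "Aconst pm 3 n q * Bconst pm 3 n q = Aconst pm 2 n q * Bconst pm 2 n q"
  by (simp add: Aconst_def Bconst_def)

text \<open>Substituting n = 2 k + const, with the parity of the family, turns the exponents and
  product bounds into polynomials in k. Family 3 shares its product A B with family 2: the factor q
  + 1 has only moved from B to A.\<close>

lemma DC_params:
  assumes "DC_valid pm i n"
  obtains m r where "n = Suc m" "m = r + corank i"
    "Aconst pm i n q * Bconst pm i n q = coset_size q r (corank i)"
    "family_sign pm * Aconst pm i n q = fibre_factor i q * main_coeff q r (corank i)"
proof (cases pm)
  case True
  then have pm: "pm = True" by simp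
  consider k where "i = 1" "n = 2 * k + 2" | k where "i = 2" "n = 2 * k + 2" | k where "i = 3" "n = 2 * k + 2"
    | k where "i = 4" "n = 2 * k + 4"
  proof -
    have i: "i \<in> {1, 2, 3, 4}" and n: "even n" "n \<ge> (if i = 4 then 4 else 2)"
      using assms pm by (auto simp: DC_valid_def)
    obtain l where l: "n = 2 * l" using n(1) by (rule evenE)
    have "\<exists>k. n = 2 * k + 2" using n(2) l by (intro exI[of _ "l - 1"]) (auto split: if_splits)
    moreover have "i = 4 \<Longrightarrow> \<exists>k. n = 2 * k + 4" using n(2) l by (intro exI[of _ "l - 2"]) (auto split: if_splits)
    ultimately show ?thesis using i that by auto
  qed
  then show ?thesis
  proof cases
    case (1 k)
    show ?thesis
    proof (rule that)
      show "n = Suc (2 * k + 1)" unfolding 1 by simp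
      show "2 * k + 1 = 2 * k + 1 + corank i" unfolding 1 corank_values by simp
      show "Aconst pm i n q * Bconst pm i n q = coset_size q (2 * k + 1) (corank i)"
        unfolding 1 pm corank_values by (rule constants_plus_1(2))
      show "family_sign pm * Aconst pm i n q = fibre_factor i q * main_coeff q (2 * k + 1) (corank i)"
        unfolding 1 pm corank_values family_sign_values fibre_factor_values constants_plus_1(1) by simp
    qed
  next
    case (2 k)
    show ?thesis
    proof (rule that)
      show "n = Suc (2 * k + 1)" unfolding 2 by simp
      show "2 * k + 1 = 2 * k + corank i" unfolding 2 corank_values by simp
      show "Aconst pm i n q * Bconst pm i n q = coset_size q (2 * k) (corank i)"
        unfolding 2 pm corank_values by (rule constants_plus_2(2))
      show "family_sign pm * Aconst pm i n q = fibre_factor i q * main_coeff q (2 * k) (corank i)"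
        unfolding 2 pm corank_values family_sign_values fibre_factor_values constants_plus_2(1) by simp
    qed
  next
    case (3 k)
    show ?thesis
    proof (rule that)
      show "n = Suc (2 * k + 1)" unfolding 3 by simp
      show "2 * k + 1 = 2 * k + corank i" unfolding 3 corank_values by simp
      show "Aconst pm i n q * Bconst pm i n q = coset_size q (2 * k) (corank i)"
        unfolding 3 pm AB_const_3 corank_values by (rule constants_plus_2(2))
      show "family_sign pm * Aconst pm i n q = fibre_factor i q * main_coeff q (2 * k) (corank i)"
        unfolding 3 pm Aconst_3 corank_values family_sign_values fibre_factor_values constants_plus_2(1) by simp
    qed
  next
    case (4 k)
    show ?thesis
    proof (rule that)
      show "n = Suc (2 * k + 3)" unfolding 4 by simp
      show "2 * k + 3 = 2 * k + 1 + corank i" unfolding 4 corank_values by simp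
      show "Aconst pm i n q * Bconst pm i n q = coset_size q (2 * k + 1) (corank i)"
        unfolding 4 pm corank_values by (rule constants_plus_4(2))
      show "family_sign pm * Aconst pm i n q = fibre_factor i q * main_coeff q (2 * k + 1) (corank i)"
        unfolding 4 pm corank_values family_sign_values fibre_factor_values constants_plus_4(1) by simp
    qed
  qed
next
  case False
  then have pm: "pm = False" by simp
  consider k where "i = 1" "n = 2 * k + 1" | k where "i = 2" "n = 2 * k + 3" | k where "i = 3" "n = 2 * k + 3"
    | k where "i = 4" "n = 2 * k + 3"
  proof -
    have i: "i \<in> {1, 2, 3, 4}" and n: "odd n" "n \<ge> (if i = 1 then 1 else 3)"
      using assms pm by (auto simp: DC_valid_def)
    obtain l where l: "n = 2 * l + 1" using n(1) by (rule oddE)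
    have "i \<noteq> 1 \<Longrightarrow> \<exists>k. n = 2 * k + 3" using n(2) l by (intro exI[of _ "l - 1"]) (auto split: if_splits)
    then show ?thesis using i l that by auto
  qed
  then show ?thesis
  proof cases
    case (1 k)
    show ?thesis
    proof (rule that)
      show "n = Suc (2 * k)" unfolding 1 by simp
      show "2 * k = 2 * k + corank i" unfolding 1 corank_values by simp
      show "Aconst pm i n q * Bconst pm i n q = coset_size q (2 * k) (corank i)"
        unfolding 1 pm corank_values by (rule constants_minus_1(2))
      show "family_sign pm * Aconst pm i n q = fibre_factor i q * main_coeff q (2 * k) (corank i)"
        unfolding 1 pm corank_values family_sign_values fibre_factor_values constants_minus_1(1) by simp
    qed
  next
    case (2 k)
    show ?thesis
    proof (rule that)
      show "n = Suc (2 * k + 2)" unfolding 2 by simp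
      show "2 * k + 2 = 2 * k + 1 + corank i" unfolding 2 corank_values by simp
      show "Aconst pm i n q * Bconst pm i n q = coset_size q (2 * k + 1) (corank i)"
        unfolding 2 pm corank_values by (rule constants_minus_2(2))
      show "family_sign pm * Aconst pm i n q = fibre_factor i q * main_coeff q (2 * k + 1) (corank i)"
        unfolding 2 pm corank_values family_sign_values fibre_factor_values constants_minus_2(1) by simp
    qed
  next
    case (3 k)
    show ?thesis
    proof (rule that)
      show "n = Suc (2 * k + 2)" unfolding 3 by simp
      show "2 * k + 2 = 2 * k + 1 + corank i" unfolding 3 corank_values by simp
      show "Aconst pm i n q * Bconst pm i n q = coset_size q (2 * k + 1) (corank i)"
        unfolding 3 pm AB_const_3 corank_values by (rule constants_minus_2(2))
      show "family_sign pm * Aconst pm i n q = fibre_factor i q * main_coeff q (2 * k + 1) (corank i)"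
        unfolding 3 pm Aconst_3 corank_values family_sign_values fibre_factor_values constants_minus_2(1) by simp
    qed
  next
    case (4 k)
    show ?thesis
    proof (rule that)
      show "n = Suc (2 * k + 2)" unfolding 4 by simp
      show "2 * k + 2 = 2 * k + corank i" unfolding 4 corank_values by simp
      show "Aconst pm i n q * Bconst pm i n q = coset_size q (2 * k) (corank i)"
        unfolding 4 pm corank_values by (rule constants_minus_4(2))
      show "family_sign pm * Aconst pm i n q = fibre_factor i q * main_coeff q (2 * k) (corank i)"
        unfolding 4 pm corank_values family_sign_values fibre_factor_values constants_minus_4(1) by simp
    qed
  qed
qed

text \<open>Brings a mean |D| / q plus a correction into the shape A (B + \<eta> Y) / q; the factor
  q in Y offsets the common denominator.\<close>

lemma fibre_rescale:
  fixes q :: rat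
  assumes "q \<noteq> 0" "A * B = C" "\<eta> * A = M" "Y = q * X"
  shows "C / q + M * X = A * (B + \<eta> * Y) / q"
proof -
  have "A * (B + \<eta> * Y) = C + q * (M * X)" unfolding assms(2,3)[symmetric] assms(4) by (simp add: algebra_simps)
  then show ?thesis using assms(1) by (simp add: add_divide_distrib)
qed

context
  fixes e :: "'a::{field,finite}" and q :: rat
  assumes q: "q = of_nat CARD('a)" and three: "(3::'a) = 0" and e: "\<not> is_sq e"
begin

text \<open>The root count is 1, 2 or 0, so the bracket after the sign is 1, q + 1 or 1 - q: the
  three classes of \<beta> in the weight formula.\<close>

lemma DC_fibre_1:
  assumes v: "DC_valid pm 1 n"
  shows "(of_nat (card {g \<in> DC pm 1 n e. mat_tr g = \<beta>}) :: rat)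
    = Aconst pm 1 n q * (Bconst pm 1 n q + family_sign pm * (q * of_nat (card {y. y * y = \<beta> * \<beta> - 1}) - (q - 1))) / q"
proof -
  obtain m r where n: "n = Suc m" and m: "m = r + 0"
    and AB: "Aconst pm 1 n q * Bconst pm 1 n q = coset_size q r 0"
    and A: "family_sign pm * Aconst pm 1 n q = - 1 * main_coeff q r 0"
    by (rule DC_params[OF v, of q, unfolded corank_values fibre_factor_values])
  interpret coset_setup e m r 0 1 q
    by (rule coset_setup.intro[OF q three e m]) simp_all
  have DC: "DC pm 1 n e = tD"
    unfolding image_tau_1[OF refl] using m by (simp add: n DC_def)
  have "of_nat (card {g \<in> DC pm 1 n e. mat_tr g = \<beta>})
      = coset_size q r 0 / q + - 1 * main_coeff q r 0 * (roots \<beta> - (q - 1) / q)"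
    unfolding DC fibre_count_1[OF refl refl] by simp
  also have "\<dots> = Aconst pm 1 n q * (Bconst pm 1 n q + family_sign pm * (q * roots \<beta> - (q - 1))) / q"
    by (rule fibre_rescale[OF _ AB A]) (use q1 in \<open>simp_all add: right_diff_distrib[of q "roots \<beta>"]\<close>)
  finally show ?thesis unfolding roots_def .
qed

lemma DC_fibre_2:
  assumes v: "DC_valid pm 2 n"
  shows "(of_nat (card {g \<in> DC pm 2 n e. mat_tr g = \<beta>}) :: rat)
    = Aconst pm 2 n q * (Bconst pm 2 n q + family_sign pm * ((q - 1)\<^sup>2 - q * of_nat (delta2 \<beta>))) / q"
proof -
  obtain m r where n: "n = Suc m" and m: "m = r + 1"
    and AB: "Aconst pm 2 n q * Bconst pm 2 n q = coset_size q r 1"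
    and A: "family_sign pm * Aconst pm 2 n q = 1 * main_coeff q r 1"
    by (rule DC_params[OF v, of q, unfolded corank_values fibre_factor_values])
  interpret coset_setup e m r 1 1 q
    by (rule coset_setup.intro[OF q three e m]) simp_all
  have DC: "DC pm 2 n e = tD"
    unfolding image_tau_1[OF refl] using m by (simp add: n DC_def)
  have "of_nat (card {g \<in> DC pm 2 n e. mat_tr g = \<beta>})
      = coset_size q r 1 / q + 1 * main_coeff q r 1 * ((q - 1)\<^sup>2 / q - of_nat (delta2 \<beta>))"
    unfolding DC fibre_count_2[OF refl refl] right_diff_distrib mult_1_left by simp
  also have "\<dots> = Aconst pm 2 n q * (Bconst pm 2 n q + family_sign pm * ((q - 1)\<^sup>2 - q * of_nat (delta2 \<beta>))) / q"
    by (rule fibre_rescale[OF _ AB A]) (use q1 in \<open>simp_all add: right_diff_distrib[of q "(q - 1)\<^sup>2 / q"]\<close>)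
  finally show ?thesis .
qed

lemma DC_fibre_3:
  assumes v: "DC_valid pm 3 n"
  shows "(of_nat (card {g \<in> DC pm 3 n e. mat_tr g = \<beta>}) :: rat)
    = Aconst pm 3 n q * (Bconst pm 3 n q + family_sign pm * (q * of_nat (card {y. y * y = \<beta> * \<beta> - 1}) - (q - 1))) / q"
proof -
  obtain m r where n: "n = Suc m" and m: "m = r + 1"
    and AB: "Aconst pm 3 n q * Bconst pm 3 n q = coset_size q r 1"
    and A: "family_sign pm * Aconst pm 3 n q = (q + 1) * main_coeff q r 1"
    by (rule DC_params[OF v, of q, unfolded corank_values fibre_factor_values])
  interpret coset_setup e m r 1 "- 1" q
    by (rule coset_setup.intro[OF q three e m]) simp_all
  have r: "Suc m - 2 = r" unfolding m by (simp only: One_nat_def numeral_2_eq_2 numeral_3_eq_3 add_Suc_right add_0_right diff_Suc_Suc diff_zero)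
  have DC: "DC pm 3 n e = tD" unfolding n DC_tau r ..
  have "of_nat (card {g \<in> DC pm 3 n e. mat_tr g = \<beta>})
      = coset_size q r 1 / q + (q + 1) * main_coeff q r 1 * (roots \<beta> - (q - 1) / q)"
    unfolding DC fibre_count_3[OF refl refl] mult.commute[of "q + 1" "main_coeff q r 1"] ..
  also have "\<dots> = Aconst pm 3 n q * (Bconst pm 3 n q + family_sign pm * (q * roots \<beta> - (q - 1))) / q"
    by (rule fibre_rescale[OF _ AB A]) (use q1 in \<open>simp_all add: right_diff_distrib[of q "roots \<beta>"]\<close>)
  finally show ?thesis unfolding roots_def .
qed

lemma DC_fibre_4:
  assumes v: "DC_valid pm 4 n"
  shows "(of_nat (card {g \<in> DC pm 4 n e. mat_tr g = \<beta>}) :: rat)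
    = Aconst pm 4 n q * (Bconst pm 4 n q - family_sign pm
        * (q * of_nat (delta2 \<beta>) - 2 * q\<^sup>2 + 3 * q - 1 + (if \<beta> = 0 then q\<^sup>2 * (q - 1) else 0))) / q"
proof -
  obtain m r where n: "n = Suc m" and m: "m = r + 2"
    and AB: "Aconst pm 4 n q * Bconst pm 4 n q = coset_size q r 2"
    and A: "family_sign pm * Aconst pm 4 n q = - q * (q + 1) * main_coeff q r 2"
    by (rule DC_params[OF v, of q, unfolded corank_values fibre_factor_values])
  have neg_sq: "- 1 * - 1 = (1 :: 'a)" by simp
  have S: "coset_setup e m r 2 (- 1) q"
    by (rule coset_setup.intro[OF q three e m order_refl neg_sq])
  have r: "Suc m - 3 = r" unfolding m using diff_add_inverse2[of r 3] by (simp only: numeral_3_eq_3 numeral_2_eq_2 add_Suc_right)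
  have DC: "DC pm 4 n e = (\<lambda>g. tau m (- 1) * g) ` dcoset (Qpar (Suc m) e) (sigma_mat (Suc m) r)" unfolding n DC_tau r ..
  have q0: "q \<noteq> 0" using coset_setup.q1[OF S] by simp
  let ?Y = "q * of_nat (delta2 \<beta>) - 2 * q\<^sup>2 + 3 * q - 1 + (if \<beta> = 0 then q\<^sup>2 * (q - 1) else 0)"
  \<comment> \<open>The polynomial -2 q^2 + 3 q - 1 collects -(q - 1)^2 from the Kloosterman product
    and -q (q - 1) from the centred indicator at 0.\<close>
  have "q * (of_nat (delta2 \<beta>) - (q - 1)\<^sup>2 / q) + q\<^sup>2 * (q - 1) * ((if \<beta> = 0 then 1 else 0) - 1 / q) = ?Y"
  proof -
    have "q * (d - (q - 1)\<^sup>2 / q) + q\<^sup>2 * (q - 1) * (c - 1 / q)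
        = q * d - 2 * q\<^sup>2 + 3 * q - 1 + q\<^sup>2 * (q - 1) * c" for d c
    proof -
      have a: "q * (d - (q - 1)\<^sup>2 / q) = q * d - (q - 1)\<^sup>2" using q0 by (simp add: right_diff_distrib[of q d])
      have b: "q\<^sup>2 * (q - 1) * (c - 1 / q) = q\<^sup>2 * (q - 1) * c - q * (q - 1)"
      proof -
        have "q\<^sup>2 * x * (1 / q) = q * x" for x using q0 by (simp add: power2_eq_square)
        then show ?thesis unfolding right_diff_distrib[of "q\<^sup>2 * (q - 1)" c] by (simp only:)
      qed
      show ?thesis unfolding a b by (simp add: power2_eq_square algebra_simps)
    qed
    then show ?thesis by simp
  qed
  then have "of_nat (card {g \<in> DC pm 4 n e. mat_tr g = \<beta>}) = coset_size q r 2 / q + main_coeff q r 2 * (q + 1) * ?Y"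
    unfolding DC coset_setup.fibre_count_4[OF S refl refl] by (simp only:)
  also have "\<dots> = coset_size q r 2 / q + - q * (q + 1) * main_coeff q r 2 * (- ?Y / q)"
  proof -
    have "main_coeff q r 2 * (q + 1) * y = - q * (q + 1) * main_coeff q r 2 * (- y / q)" for y
      using q0 by simp
    then show ?thesis by (simp only:)
  qed
  also have "\<dots> = Aconst pm 4 n q * (Bconst pm 4 n q + family_sign pm * (- ?Y)) / q"
    by (rule fibre_rescale[OF q0 AB A]) (use q0 in simp)
  finally show ?thesis by (simp only: mult_minus_right add_uminus_conv_diff)
qed

end

lemma finite_DC:
  fixes e :: "'a::{field,finite}"
  assumes v: "DC_valid pm i n"
  shows "finite (DC pm i n e)"
proof -
  have fin: "finite (dcoset (Qpar n e) (sigma_mat n r))" for r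
  proof -
    obtain m where n: "n = Suc m" using DC_params[OF v, of 1] by metis
    have "finite (carrier_mat (2 * m + 2) (2 * m + 2) :: 'a mat set)" by simp
    moreover have "Qpar n e \<subseteq> carrier_mat (2 * m + 2) (2 * m + 2)" unfolding n by (auto simp: Qpar_iff Qchar_def)
    ultimately have "finite (Qpar n e)" by (rule rev_finite_subset)
    moreover have "dcoset (Qpar n e) (sigma_mat n r) = (\<lambda>(x, y). x * sigma_mat n r * y) ` (Qpar n e \<times> Qpar n e)"
      by (auto simp: dcoset_def)
    ultimately show ?thesis by simp
  qed
  then show ?thesis by (simp add: DC_def)
qed

text \<open>\<beta>^2 - 1 vanishes exactly at 1 and -1, which differ because 2 is nonzero; as 0 is
  itself a square, the nonsquare class avoids both.\<close>

lemma prod_split_square_class: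
  fixes g :: "'a::{field,finite} \<Rightarrow> 'b::comm_monoid_mult"
  assumes two: "(2::'a) \<noteq> 0"
  shows "(\<Prod>\<beta>\<in>UNIV. g \<beta>) = g 1 * g (- 1) * (\<Prod>\<beta>\<in>{\<beta>. \<beta>\<^sup>2 - 1 \<noteq> 0 \<and> is_sq (\<beta>\<^sup>2 - 1)}. g \<beta>)
    * (\<Prod>\<beta>\<in>{\<beta>. \<not> is_sq (\<beta>\<^sup>2 - 1)}. g \<beta>)"
proof -
  let ?S = "{\<beta>::'a. \<beta>\<^sup>2 - 1 \<noteq> 0 \<and> is_sq (\<beta>\<^sup>2 - 1)}" and ?T = "{\<beta>::'a. \<not> is_sq (\<beta>\<^sup>2 - 1)}"
  have ne: "(1::'a) \<noteq> - 1"
  proof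
    assume "(1::'a) = - 1"
    then have "(1::'a) + 1 = 0" by (simp only: eq_neg_iff_add_eq_0)
    then show False using two by simp
  qed
  have sq0: "is_sq (0::'a)" by (auto simp: is_sq_def)
  have "UNIV = {1, - 1} \<union> ?S \<union> ?T" by (auto simp: power2_eq_1_iff)
  moreover have "(\<Prod>\<beta>\<in>{1, - 1} \<union> ?S \<union> ?T. g \<beta>) = (\<Prod>\<beta>\<in>{1, - 1} \<union> ?S. g \<beta>) * (\<Prod>\<beta>\<in>?T. g \<beta>)"
    by (rule prod.union_disjoint) (use sq0 in auto)
  moreover have "(\<Prod>\<beta>\<in>{1, - 1} \<union> ?S. g \<beta>) = (\<Prod>\<beta>\<in>{1, - 1}. g \<beta>) * (\<Prod>\<beta>\<in>?S. g \<beta>)"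
    by (rule prod.union_disjoint) auto
  moreover have "(\<Prod>\<beta>\<in>{1, - 1}. g \<beta>) = g 1 * g (- 1)" using ne by simp
  ultimately show ?thesis by (simp only:)
qed

lemma prod_split_zero:
  fixes g :: "'a::{zero,finite} \<Rightarrow> 'b::comm_monoid_mult"
  shows "(\<Prod>\<beta>\<in>UNIV. g \<beta>) = g 0 * (\<Prod>\<beta>\<in>UNIV - {0}. g \<beta>)"
  by (rule prod.remove) simp_all

theorem theorem18:
  fixes \<epsilon> :: "'a::{field,finite}" and s :: nat and pm :: bool and i n j :: nat
  assumes q: "CARD('a) = 3 ^ s"
    and eps: "\<epsilon> \<noteq> 0" "\<not> is_sq \<epsilon>"
    and valid: "DC_valid pm i n"
    and j: "of_nat j \<le> Aconst pm i n (of_nat CARD('a)) * Bconst pm i n (of_nat CARD('a))"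
  shows
   "let q = (of_nat CARD('a) :: rat);
        \<eta> = (if pm then 1 else -1 :: rat);
        A = Aconst pm i n q; B = Bconst pm i n q;
        C = (of_nat (weight_count (DC pm i n \<epsilon>) j) :: rat)
    in (i \<in> {1,3} \<longrightarrow>
          C = (\<Sum>(\<nu>,\<mu>)\<in>(fams j :: (('a \<Rightarrow> nat) \<times> ('a \<Rightarrow> nat)) set).
                 multinom (A * (B + \<eta>) / q) (\<nu> 1) (\<mu> 1)
               * multinom (A * (B + \<eta>) / q) (\<nu> (-1)) (\<mu> (-1))
               * (\<Prod>\<beta>\<in>{\<beta>. \<beta>^2 - 1 \<noteq> 0 \<and> is_sq (\<beta>^2 - 1)}.
                    multinom (A * (B + \<eta> * (q + 1)) / q) (\<nu> \<beta>) (\<mu> \<beta>))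
               * (\<Prod>\<beta>\<in>{\<beta>. \<not> is_sq (\<beta>^2 - 1)}.
                    multinom (A * (B + \<eta> * (1 - q)) / q) (\<nu> \<beta>) (\<mu> \<beta>))))
     \<and> (i = 2 \<longrightarrow>
          C = (\<Sum>(\<nu>,\<mu>)\<in>(fams j :: (('a \<Rightarrow> nat) \<times> ('a \<Rightarrow> nat)) set). \<Prod>\<beta>\<in>UNIV.
                 multinom (A * (B + \<eta> * ((q - 1)^2 - q * of_nat (delta2 \<beta>))) / q) (\<nu> \<beta>) (\<mu> \<beta>)))
     \<and> (i = 4 \<longrightarrow>
          C = (\<Sum>(\<nu>,\<mu>)\<in>(fams j :: (('a \<Rightarrow> nat) \<times> ('a \<Rightarrow> nat)) set).
                 multinom (A * (B - \<eta> * (q * of_nat (delta2 (0::'a)) + (q - 1)^3)) / q) (\<nu> 0) (\<mu> 0)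
               * (\<Prod>\<beta>\<in>UNIV - {0}.
                    multinom (A * (B - \<eta> * (q * of_nat (delta2 \<beta>) - 2 * q^2 + 3 * q - 1)) / q)
                      (\<nu> \<beta>) (\<mu> \<beta>))))"
proof -
  define Q where "Q = (of_nat CARD('a) :: rat)"
  define \<eta> where "\<eta> = (if pm then 1 else - 1 :: rat)"
  define A where "A = Aconst pm i n Q"
  define B where "B = Bconst pm i n Q"
  define C where "C = (of_nat (weight_count (DC pm i n \<epsilon>) j) :: rat)"
  define N where "N \<beta> = (of_nat (card {g \<in> DC pm i n \<epsilon>. mat_tr g = \<beta>}) :: rat)" for \<beta>
  have three: "(3::'a) = 0" by (rule three_eq_0[OF q])
  have two: "(2::'a) \<noteq> 0" by (rule two_neq_0[OF three])
  have sgn: "family_sign pm = \<eta>" by (simp only: family_sign_def \<eta>_def)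
  have fin: "finite (DC pm i n \<epsilon>)" by (rule finite_DC[OF valid])
  have C: "C = (\<Sum>(\<nu>,\<mu>)\<in>fams j. \<Prod>\<beta>\<in>UNIV. multinom (N \<beta>) (\<nu> \<beta>) (\<mu> \<beta>))"
    unfolding C_def N_def by (rule weight_count_eq[OF three fin])
  have "C = (\<Sum>(\<nu>,\<mu>)\<in>(fams j :: (('a \<Rightarrow> nat) \<times> ('a \<Rightarrow> nat)) set). multinom (A * (B + \<eta>) / Q) (\<nu> 1) (\<mu> 1)
               * multinom (A * (B + \<eta>) / Q) (\<nu> (-1)) (\<mu> (-1))
               * (\<Prod>\<beta>\<in>{\<beta>. \<beta>^2 - 1 \<noteq> 0 \<and> is_sq (\<beta>^2 - 1)}.
                    multinom (A * (B + \<eta> * (Q + 1)) / Q) (\<nu> \<beta>) (\<mu> \<beta>))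
               * (\<Prod>\<beta>\<in>{\<beta>. \<not> is_sq (\<beta>^2 - 1)}.
                    multinom (A * (B + \<eta> * (1 - Q)) / Q) (\<nu> \<beta>) (\<mu> \<beta>)))" if i: "i \<in> {1, 3}"
  proof -
    have N: "N \<beta> = A * (B + \<eta> * (Q * of_nat (card {y. y * y = \<beta>\<^sup>2 - 1}) - (Q - 1))) / Q" for \<beta>
    proof -
      consider "i = 1" | "i = 3" using i by blast
      then show ?thesis
      proof cases
        case 1
        show ?thesis
          using DC_fibre_1[OF Q_def three eps(2) valid[unfolded 1], of \<beta>]
          unfolding N_def A_def B_def sgn 1 power2_eq_square .
      next
        case 2
        show ?thesis
          using DC_fibre_3[OF Q_def three eps(2) valid[unfolded 2], of \<beta>]
          unfolding N_def A_def B_def sgn 2 power2_eq_square .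
      qed
    qed
    have one: "N \<beta> = A * (B + \<eta>) / Q" if "\<beta>\<^sup>2 - 1 = 0" for \<beta>
      unfolding N that card_sq_roots[OF two] by simp
    have sq: "N \<beta> = A * (B + \<eta> * (Q + 1)) / Q" if "\<beta> \<in> {\<beta>. \<beta>\<^sup>2 - 1 \<noteq> 0 \<and> is_sq (\<beta>\<^sup>2 - 1)}" for \<beta>
    proof -
      have "Q * of_nat (card {y. y * y = \<beta>\<^sup>2 - 1}) - (Q - 1) = Q + 1"
        unfolding card_sq_roots[OF two] using that by simp
      then show ?thesis unfolding N by (simp only:)
    qed
    have nsq: "N \<beta> = A * (B + \<eta> * (1 - Q)) / Q" if "\<beta> \<in> {\<beta>. \<not> is_sq (\<beta>\<^sup>2 - 1)}" for \<beta>
    proof -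
      have "\<beta>\<^sup>2 - 1 \<noteq> 0"
      proof
        assume "\<beta>\<^sup>2 - 1 = 0"
        moreover have "is_sq (0::'a)" by (auto simp: is_sq_def)
        ultimately show False using that by simp
      qed
      then have "Q * of_nat (card {y. y * y = \<beta>\<^sup>2 - 1}) - (Q - 1) = 1 - Q"
        unfolding card_sq_roots[OF two] using that by simp
      then show ?thesis unfolding N by (simp only:)
    qed
    have N1: "N 1 = A * (B + \<eta>) / Q" "N (- 1) = A * (B + \<eta>) / Q" by (rule one, simp)+
    show ?thesis
      unfolding C
    proof (rule sum.cong)
      fix x :: "('a \<Rightarrow> nat) \<times> ('a \<Rightarrow> nat)"
      obtain \<nu> \<mu> where x: "x = (\<nu>, \<mu>)" by (cases x)
      show "(case x of (\<nu>, \<mu>) \<Rightarrow> \<Prod>\<beta>\<in>UNIV. multinom (N \<beta>) (\<nu> \<beta>) (\<mu> \<beta>))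
        = (case x of (\<nu>, \<mu>) \<Rightarrow> multinom (A * (B + \<eta>) / Q) (\<nu> 1) (\<mu> 1)
               * multinom (A * (B + \<eta>) / Q) (\<nu> (-1)) (\<mu> (-1))
               * (\<Prod>\<beta>\<in>{\<beta>. \<beta>^2 - 1 \<noteq> 0 \<and> is_sq (\<beta>^2 - 1)}.
                    multinom (A * (B + \<eta> * (Q + 1)) / Q) (\<nu> \<beta>) (\<mu> \<beta>))
               * (\<Prod>\<beta>\<in>{\<beta>. \<not> is_sq (\<beta>^2 - 1)}.
                    multinom (A * (B + \<eta> * (1 - Q)) / Q) (\<nu> \<beta>) (\<mu> \<beta>)))"
        unfolding x prod.case prod_split_square_class[OF two] N1
        by (intro arg_cong2[where f = "(*)"] refl prod.cong) (simp_all only: sq nsq)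
    qed simp
  qed
  moreover have "C = (\<Sum>(\<nu>,\<mu>)\<in>(fams j :: (('a \<Rightarrow> nat) \<times> ('a \<Rightarrow> nat)) set). \<Prod>\<beta>\<in>UNIV.
      multinom (A * (B + \<eta> * ((Q - 1)^2 - Q * of_nat (delta2 \<beta>))) / Q) (\<nu> \<beta>) (\<mu> \<beta>))" if i: "i = 2"
  proof -
    have N: "N \<beta> = A * (B + \<eta> * ((Q - 1)^2 - Q * of_nat (delta2 \<beta>))) / Q" for \<beta>
      using DC_fibre_2[OF Q_def three eps(2) valid[unfolded i], of \<beta>] unfolding N_def A_def B_def sgn i .
    show ?thesis unfolding C N ..
  qed
  moreover have "C = (\<Sum>(\<nu>,\<mu>)\<in>(fams j :: (('a \<Rightarrow> nat) \<times> ('a \<Rightarrow> nat)) set).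
                 multinom (A * (B - \<eta> * (Q * of_nat (delta2 (0::'a)) + (Q - 1)^3)) / Q) (\<nu> 0) (\<mu> 0)
               * (\<Prod>\<beta>\<in>UNIV - {0}.
                    multinom (A * (B - \<eta> * (Q * of_nat (delta2 \<beta>) - 2 * Q^2 + 3 * Q - 1)) / Q)
                      (\<nu> \<beta>) (\<mu> \<beta>)))" if i: "i = 4"
  proof -
    have N: "N \<beta> = A * (B - \<eta> * (Q * of_nat (delta2 \<beta>) - 2 * Q\<^sup>2 + 3 * Q - 1
        + (if \<beta> = 0 then Q\<^sup>2 * (Q - 1) else 0))) / Q" for \<beta>
      using DC_fibre_4[OF Q_def three eps(2) valid[unfolded i], of \<beta>] unfolding N_def A_def B_def sgn i .
    \<comment> \<open>At \<beta> = 0 the extra term Q^2 (Q - 1) completes -2 Q^2 + 3 Q - 1 to the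
      cube (Q - 1)^3.\<close>
    have "d - 2 * Q\<^sup>2 + 3 * Q - 1 + Q\<^sup>2 * (Q - 1) = d + (Q - 1)^3" for d
      by (simp add: power2_eq_square power3_eq_cube algebra_simps)
    then have N0: "N 0 = A * (B - \<eta> * (Q * of_nat (delta2 (0::'a)) + (Q - 1)^3)) / Q"
      unfolding N by simp
    have N1: "N \<beta> = A * (B - \<eta> * (Q * of_nat (delta2 \<beta>) - 2 * Q^2 + 3 * Q - 1)) / Q" if "\<beta> \<in> UNIV - {0}" for \<beta>
      unfolding N using that by simp
    show ?thesis
      unfolding C
    proof (rule sum.cong)
      fix x :: "('a \<Rightarrow> nat) \<times> ('a \<Rightarrow> nat)"
      obtain \<nu> \<mu> where x: "x = (\<nu>, \<mu>)" by (cases x)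
      show "(case x of (\<nu>, \<mu>) \<Rightarrow> \<Prod>\<beta>\<in>UNIV. multinom (N \<beta>) (\<nu> \<beta>) (\<mu> \<beta>))
        = (case x of (\<nu>, \<mu>) \<Rightarrow> multinom (A * (B - \<eta> * (Q * of_nat (delta2 (0::'a)) + (Q - 1)^3)) / Q) (\<nu> 0) (\<mu> 0)
               * (\<Prod>\<beta>\<in>UNIV - {0}.
                    multinom (A * (B - \<eta> * (Q * of_nat (delta2 \<beta>) - 2 * Q^2 + 3 * Q - 1)) / Q)
                      (\<nu> \<beta>) (\<mu> \<beta>)))"
        unfolding x prod.case prod_split_zero N0
        by (intro arg_cong2[where f = "(*)"] refl prod.cong) (simp_all only: N1)
    qed simp
  qed
  ultimately show ?thesis
    unfolding Let_def Q_def[symmetric] \<eta>_def[symmetric] A_def[symmetric] B_def[symmetric] C_def[symmetric]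
    by blast
qed

end
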